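(* Let $p$ be a prime number, let $\Gamma$ be a discrete group and let $\Delta$ be a normal subgroup of $\Gamma$ of finite index. Let $M$ be a $\mathbb Z\Gamma$-module which is $p$-adically expansive of exponent $n_0$, and let $0\to P_d\to\cdots\to P_0\to M\to 0$ be a resolution of $M$ by finitely generated projective $\mathbb Z\Gamma$-modules, of length $d$. Assume also that $\varprojlim_i M_{p^i}=0$. Then the homology groups $H_i(\Delta,M)$ are finite abelian groups whose $p$-primary part is annihilated by $p^{n_0}$ and which vanish for $i>d$. Moreover the sequence $$0\to c_0(\Delta)\otimes_{\mathbb Z\Delta}P_d\to\cdots\to c_0(\Delta)\otimes_{\mathbb Z\Delta}P_0\to 0$$ is exact. If $n_0=0$, i.e. if $p:M\to M$ is surjective, then even the sequence $$0\to\widehat{\mathbb Z\Delta}\otimes_{\mathbb Z\Delta}P_d\to\cdots\to\widehat{\mathbb Z\Delta}\otimes_{\mathbb Z\Delta}P_0\to 0$$ is exact.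
   Context: Modules are left modules. For a discrete group $\Gamma$, $\widehat{\mathbb Z\Gamma}=\varprojlim_n\mathbb Z\Gamma/p^n\mathbb Z\Gamma$ is the $p$-adic completion of the integral group ring; it is the ring of formal sums $\sum_{\gamma\in\Gamma}x_\gamma\gamma$ with $x_\gamma\in\mathbb Z_p$ and $|x_\gamma|\to 0$ as $\gamma\to\infty$ (i.e. for each $\epsilon>0$ only finitely many $\gamma$ satisfy $|x_\gamma|\ge\epsilon$). Put $c_0(\Gamma)=\widehat{\mathbb Z\Gamma}\otimes_{\mathbb Z}\mathbb Q$ (the same sums with $x_\gamma\in\mathbb Q_p$). A $\mathbb Z\Gamma$-module $M$ is of type $FL$ if there is an exact sequence $0\to F_d\to\cdots\to F_0\to M\to 0$ with all $F_\nu$ finitely generated free. A $\mathbb Z\Gamma$-module $M$ of type $FL$ is called $p$-adically expansive if $c_0(\Gamma)\otimes_{\mathbb Z\Gamma}M=0$, equivalently if the flag $(p^iM)_i$ is stationary; it is called $p$-adically expansive of exponent $n_0$ ($n_0\ge 0$ an integer) if $p^iM=p^{n_0}M$ for all $i\ge n_0$. $M_{p^i}=\ker(p^i:M\to M)$, and $\varprojlim_i M_{p^i}$ is taken with respect to the transition maps $p:M_{p^i}\to M_{p^{i-1}}$. $H_i(\Delta,M)=\mathrm{Tor}^{\mathbb Z\Delta}_i(\mathbb Z,M)$ is group homology. *)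

theory Defs
  imports
    Complex_Main
    "HOL-Algebra.Module"
    "HOL-Algebra.IntRing"
    "HOL-Algebra.Free_Abelian_Groups"
begin

section \<open>One-sided modules over rings that need not be commutative\<close>

text \<open>
  The record \<^type>\<open>module\<close> of HOL-Algebra is used both for left and for right modules.
  For a right module, \<open>r \<odot> x\<close> stands for \<open>x \<cdot> r\<close>.  The ring fields \<open>mult\<close> and \<open>one\<close> that the
  record inherits play no role.
\<close>

locale left_module = R?: ring R + M?: abelian_group M
  for R (structure) and M (structure) +
  assumes smult_closed:
      "\<lbrakk>r \<in> carrier R; x \<in> carrier M\<rbrakk> \<Longrightarrow> r \<odot>\<^bsub>M\<^esub> x \<in> carrier M"
    and smult_l_distr:
      "\<lbrakk>r \<in> carrier R; s \<in> carrier R; x \<in> carrier M\<rbrakk>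
        \<Longrightarrow> (r \<oplus> s) \<odot>\<^bsub>M\<^esub> x = r \<odot>\<^bsub>M\<^esub> x \<oplus>\<^bsub>M\<^esub> s \<odot>\<^bsub>M\<^esub> x"
    and smult_r_distr:
      "\<lbrakk>r \<in> carrier R; x \<in> carrier M; y \<in> carrier M\<rbrakk>
        \<Longrightarrow> r \<odot>\<^bsub>M\<^esub> (x \<oplus>\<^bsub>M\<^esub> y) = r \<odot>\<^bsub>M\<^esub> x \<oplus>\<^bsub>M\<^esub> r \<odot>\<^bsub>M\<^esub> y"
    and smult_assoc:
      "\<lbrakk>r \<in> carrier R; s \<in> carrier R; x \<in> carrier M\<rbrakk>
        \<Longrightarrow> (r \<otimes> s) \<odot>\<^bsub>M\<^esub> x = r \<odot>\<^bsub>M\<^esub> (s \<odot>\<^bsub>M\<^esub> x)"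
    and smult_one: "x \<in> carrier M \<Longrightarrow> \<one> \<odot>\<^bsub>M\<^esub> x = x"

definition module_of ::
    "'a set \<Rightarrow> ('a \<Rightarrow> 'a \<Rightarrow> 'a) \<Rightarrow> 'a \<Rightarrow> ('r \<Rightarrow> 'a \<Rightarrow> 'a) \<Rightarrow> ('r, 'a) module"
  where "module_of C pl ze sm =
    \<lparr>carrier = C, monoid.mult = undefined, one = undefined, ring.zero = ze, add = pl, smult = sm\<rparr>"

definition module_homs :: "'r ring \<Rightarrow> ('r, 'a) module \<Rightarrow> ('r, 'b) module \<Rightarrow> ('a \<Rightarrow> 'b) set"
  where "module_homs R M N =
    {f \<in> carrier M \<rightarrow> carrier N.
       (\<forall>x\<in>carrier M. \<forall>y\<in>carrier M. f (x \<oplus>\<^bsub>M\<^esub> y) = f x \<oplus>\<^bsub>N\<^esub> f y) \<and>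
       (\<forall>r\<in>carrier R. \<forall>x\<in>carrier M. f (r \<odot>\<^bsub>M\<^esub> x) = r \<odot>\<^bsub>N\<^esub> f x)}"

definition module_isomorphic :: "'r ring \<Rightarrow> ('r, 'a) module \<Rightarrow> ('r, 'b) module \<Rightarrow> bool"
  where "module_isomorphic R M N \<longleftrightarrow>
    (\<exists>f\<in>module_homs R M N. bij_betw f (carrier M) (carrier N))"

definition direct_sum :: "('r, 'a) module \<Rightarrow> ('r, 'b) module \<Rightarrow> ('r, 'a \<times> 'b) module"
  where "direct_sum M N = module_of (carrier M \<times> carrier N)
    (\<lambda>(x, y) (x', y'). (x \<oplus>\<^bsub>M\<^esub> x', y \<oplus>\<^bsub>N\<^esub> y')) (\<zero>\<^bsub>M\<^esub>, \<zero>\<^bsub>N\<^esub>)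
    (\<lambda>r (x, y). (r \<odot>\<^bsub>M\<^esub> x, r \<odot>\<^bsub>N\<^esub> y))"

definition free_module :: "'r ring \<Rightarrow> 'x set \<Rightarrow> ('r, 'x \<Rightarrow> 'r) module"
  where "free_module R X = module_of
    {f. (\<forall>x. f x \<in> carrier R) \<and> finite {x. f x \<noteq> \<zero>\<^bsub>R\<^esub>} \<and> {x. f x \<noteq> \<zero>\<^bsub>R\<^esub>} \<subseteq> X}
    (\<lambda>f g x. f x \<oplus>\<^bsub>R\<^esub> g x) (\<lambda>x. \<zero>\<^bsub>R\<^esub>) (\<lambda>r f x. r \<otimes>\<^bsub>R\<^esub> f x)"

text \<open>The \<open>R\<close>-linear map \<open>free_module R X \<rightarrow> N\<close> that sends the basis element \<open>x\<close> to \<open>\<phi> x\<close>.\<close>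

definition linear_extension ::
    "'r ring \<Rightarrow> ('r, 'b) module \<Rightarrow> ('x \<Rightarrow> 'b) \<Rightarrow> ('x \<Rightarrow> 'r) \<Rightarrow> 'b"
  where "linear_extension R N \<phi> f = (\<Oplus>\<^bsub>N\<^esub>x\<in>{x. f x \<noteq> \<zero>\<^bsub>R\<^esub>}. f x \<odot>\<^bsub>N\<^esub> \<phi> x)"

definition fg_free :: "'r ring \<Rightarrow> ('r, 'a) module \<Rightarrow> bool"
  where "fg_free R M \<longleftrightarrow> (\<exists>n::nat. module_isomorphic R M (free_module R {..<n}))"

definition finitely_generated :: "'r ring \<Rightarrow> ('r, 'a) module \<Rightarrow> bool"
  where "finitely_generated R M \<longleftrightarrow>
    (\<exists>S. finite S \<and> S \<subseteq> carrier M \<and>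
      (\<forall>x\<in>carrier M. \<exists>c \<in> S \<rightarrow> carrier R. x = (\<Oplus>\<^bsub>M\<^esub>s\<in>S. c s \<odot>\<^bsub>M\<^esub> s)))"

text \<open>
  Projective means: a direct summand of a free module.  Bounding the types of the basis and of the
  complement loses nothing, since a projective module \<open>P\<close> is a direct summand of the free module on
  its own elements, the complement being the kernel of the canonical surjection onto \<open>P\<close>.
\<close>

definition projective :: "'r ring \<Rightarrow> ('r, 'a) module \<Rightarrow> bool"
  where "projective R P \<longleftrightarrow>
    (\<exists>(X :: 'a set) (Q :: ('r, 'a \<Rightarrow> 'r) module).
      left_module R Q \<and> module_isomorphic R (direct_sum P Q) (free_module R X))"

text \<open>
  \<open>finite_resolution R d P \<delta> \<epsilon> M\<close>: the sequence
  \<open>0 \<rightarrow> P\<^sub>d \<rightarrow> \<dots> \<rightarrow> P\<^sub>0 \<rightarrow> M \<rightarrow> 0\<close> of left \<open>R\<close>-modules is exact, where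
  \<open>\<delta> i : P\<^sub>i \<rightarrow> P\<^bsub>i-1\<^esub>\<close> for \<open>1 \<le> i \<le> d\<close> and \<open>\<epsilon> : P\<^sub>0 \<rightarrow> M\<close>.
  Nothing is said about \<open>P i\<close> and \<open>\<delta> i\<close> for \<open>i > d\<close>.
\<close>

definition finite_resolution ::
    "'r ring \<Rightarrow> nat \<Rightarrow> (nat \<Rightarrow> ('r, 'a) module) \<Rightarrow> (nat \<Rightarrow> 'a \<Rightarrow> 'a) \<Rightarrow> ('a \<Rightarrow> 'm)
      \<Rightarrow> ('r, 'm) module \<Rightarrow> bool"
  where "finite_resolution R d P \<delta> \<epsilon> M \<longleftrightarrow>
    left_module R M \<and> (\<forall>i\<le>d. left_module R (P i)) \<and>
    \<epsilon> \<in> module_homs R (P 0) M \<and>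
    (\<forall>i\<in>{1..d}. \<delta> i \<in> module_homs R (P i) (P (i - 1))) \<and>
    \<epsilon> ` carrier (P 0) = carrier M \<and>
    (\<forall>i\<le>d. {x \<in> carrier (P i). if i = 0 then \<epsilon> x = \<zero>\<^bsub>M\<^esub> else \<delta> i x = \<zero>\<^bsub>P (i - 1)\<^esub>}
          = (if i < d then \<delta> (Suc i) ` carrier (P (Suc i)) else {\<zero>\<^bsub>P i\<^esub>}))"

text \<open>
  Every free module of rank \<open>n\<close> is isomorphic to one with carrier in \<open>nat \<Rightarrow> 'r\<close>, so fixing that type in
  the next definition is no restriction.
\<close>

definition type_FL :: "'r ring \<Rightarrow> ('r, 'm) module \<Rightarrow> bool"
  where "type_FL R M \<longleftrightarrow>
    (\<exists>d (F :: nat \<Rightarrow> ('r, nat \<Rightarrow> 'r) module) \<delta> \<epsilon>.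
      finite_resolution R d F \<delta> \<epsilon> M \<and> (\<forall>i\<le>d. fg_free R (F i)))"


section \<open>Tensor products, complexes, Tor\<close>

text \<open>
  \<open>A \<otimes>\<^sub>R B\<close> for a right \<open>R\<close>-module \<open>A\<close> and a left \<open>R\<close>-module \<open>B\<close>; this is an abelian group, written
  multiplicatively as all quotient groups in HOL-Algebra.
\<close>

definition tensor_relations ::
    "'r ring \<Rightarrow> ('r, 'a) module \<Rightarrow> ('r, 'b) module \<Rightarrow> ('a \<times> 'b \<Rightarrow>\<^sub>0 int) set"
  where "tensor_relations R A B = generate (free_Abelian_group (carrier A \<times> carrier B))
    ({frag_of (a \<oplus>\<^bsub>A\<^esub> a', b) - frag_of (a, b) - frag_of (a', b) | a a' b.
        a \<in> carrier A \<and> a' \<in> carrier A \<and> b \<in> carrier B} \<union>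
     {frag_of (a, b \<oplus>\<^bsub>B\<^esub> b') - frag_of (a, b) - frag_of (a, b') | a b b'.
        a \<in> carrier A \<and> b \<in> carrier B \<and> b' \<in> carrier B} \<union>
     {frag_of (r \<odot>\<^bsub>A\<^esub> a, b) - frag_of (a, r \<odot>\<^bsub>B\<^esub> b) | r a b.
        r \<in> carrier R \<and> a \<in> carrier A \<and> b \<in> carrier B})"

definition tensor ::
    "'r ring \<Rightarrow> ('r, 'a) module \<Rightarrow> ('r, 'b) module \<Rightarrow> ('a \<times> 'b \<Rightarrow>\<^sub>0 int) set monoid"
  where "tensor R A B =
    free_Abelian_group (carrier A \<times> carrier B) Mod tensor_relations R A B"

text \<open>
  \<open>tensor_map R A' B' f g : A \<otimes>\<^sub>R B \<rightarrow> A' \<otimes>\<^sub>R B'\<close> is \<open>f \<otimes> g\<close>.  The argument \<open>X\<close> is a coset, and for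
  \<open>R\<close>-linear \<open>f\<close>, \<open>g\<close> all members of \<open>X\<close> contribute the same coset to the union.
\<close>

definition tensor_map ::
    "'r ring \<Rightarrow> ('r, 'c) module \<Rightarrow> ('r, 'd) module \<Rightarrow> ('a \<Rightarrow> 'c) \<Rightarrow> ('b \<Rightarrow> 'd)
      \<Rightarrow> ('a \<times> 'b \<Rightarrow>\<^sub>0 int) set \<Rightarrow> ('c \<times> 'd \<Rightarrow>\<^sub>0 int) set"
  where "tensor_map R A' B' f g X =
    (\<Union>t\<in>X. tensor_relations R A' B' #>\<^bsub>free_Abelian_group (carrier A' \<times> carrier B')\<^esub>
              frag_extend (\<lambda>(a, b). frag_of (f a, g b)) t)"

text \<open>
  Complexes \<open>\<dots> \<rightarrow> C\<^sub>2 \<rightarrow> C\<^sub>1 \<rightarrow> C\<^sub>0 \<rightarrow> 0\<close> of abelian groups with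
  \<open>\<delta> i : C\<^sub>i \<rightarrow> C\<^bsub>i-1\<^esub>\<close> for \<open>i \<ge> 1\<close>; the value \<open>\<delta> 0\<close> is never used.
\<close>

definition cycles :: "(nat \<Rightarrow> 'a monoid) \<Rightarrow> (nat \<Rightarrow> 'a \<Rightarrow> 'a) \<Rightarrow> nat \<Rightarrow> 'a set"
  where "cycles C \<delta> i = (if i = 0 then carrier (C 0) else kernel (C i) (C (i - 1)) (\<delta> i))"

definition homology :: "(nat \<Rightarrow> 'a monoid) \<Rightarrow> (nat \<Rightarrow> 'a \<Rightarrow> 'a) \<Rightarrow> nat \<Rightarrow> 'a set monoid"
  where "homology C \<delta> i = C i\<lparr>carrier := cycles C \<delta> i\<rparr> Mod (\<delta> (Suc i) ` carrier (C (Suc i)))"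

text \<open>Exactness of \<open>0 \<rightarrow> C\<^sub>d \<rightarrow> \<dots> \<rightarrow> C\<^sub>0 \<rightarrow> 0\<close>.\<close>

definition exact_sequence :: "nat \<Rightarrow> (nat \<Rightarrow> 'a monoid) \<Rightarrow> (nat \<Rightarrow> 'a \<Rightarrow> 'a) \<Rightarrow> bool"
  where "exact_sequence d C \<delta> \<longleftrightarrow>
    (\<forall>i\<in>{1..d}. \<delta> i \<in> hom (C i) (C (i - 1))) \<and>
    (\<forall>i\<le>d. cycles C \<delta> i = (if i < d then \<delta> (Suc i) ` carrier (C (Suc i)) else {\<one>\<^bsub>C i\<^esub>}))"

text \<open>
  To define Tor, every left module \<open>M\<close> gets a explicit free resolution
  \<open>\<dots> \<rightarrow> F\<^sub>1 \<rightarrow> F\<^sub>0 \<rightarrow> M\<close>.  The basis of \<open>F\<^sub>0\<close> is the set of elements of \<open>M\<close>; the basis of \<open>F\<^bsub>n+1\<^esub>\<close>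
  consists of the formal linear combinations of basis elements of \<open>F\<^sub>n\<close>, written as lists
  of pairs, whose value in \<open>F\<^sub>n\<close> lies in the kernel of \<open>F\<^sub>n \<rightarrow> F\<^bsub>n-1\<^esub>\<close> (of \<open>F\<^sub>0 \<rightarrow> M\<close> if \<open>n = 0\<close>), and the
  boundary map evaluates them.  The datatype houses all these basis elements in one type.
\<close>

datatype ('r, 'm) syzygy = Gen 'm | Rel "('r \<times> ('r, 'm) syzygy) list"

definition formal_combination :: "'r ring \<Rightarrow> ('r \<times> 'x) list \<Rightarrow> 'x \<Rightarrow> 'r"
  where "formal_combination R l =
    foldr (\<lambda>(r, x) f. f(x := r \<oplus>\<^bsub>R\<^esub> f x)) l (\<lambda>_. \<zero>\<^bsub>R\<^esub>)"

definition syzygy_augmentation ::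
    "'r ring \<Rightarrow> ('r, 'm) module \<Rightarrow> (('r, 'm) syzygy \<Rightarrow> 'r) \<Rightarrow> 'm"
  where "syzygy_augmentation R M =
    linear_extension R M (\<lambda>x. case x of Gen m \<Rightarrow> m | Rel l \<Rightarrow> \<zero>\<^bsub>M\<^esub>)"

definition syzygy_boundary ::
    "'r ring \<Rightarrow> (('r, 'm) syzygy \<Rightarrow> 'r) \<Rightarrow> (('r, 'm) syzygy \<Rightarrow> 'r)"
  where "syzygy_boundary R =
    linear_extension R (free_module R UNIV)
      (\<lambda>x. case x of Gen m \<Rightarrow> (\<lambda>_. \<zero>\<^bsub>R\<^esub>) | Rel l \<Rightarrow> formal_combination R l)"

primrec syzygy_basis :: "'r ring \<Rightarrow> ('r, 'm) module \<Rightarrow> nat \<Rightarrow> ('r, 'm) syzygy set"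
  where
    "syzygy_basis R M 0 = Gen ` carrier M"
  | "syzygy_basis R M (Suc n) =
      {Rel l | l. set l \<subseteq> carrier R \<times> syzygy_basis R M n \<and>
         (if n = 0 then syzygy_augmentation R M (formal_combination R l) = \<zero>\<^bsub>M\<^esub>
          else syzygy_boundary R (formal_combination R l) = (\<lambda>_. \<zero>\<^bsub>R\<^esub>))}"

definition Tor ::
    "'r ring \<Rightarrow> ('r, 'a) module \<Rightarrow> ('r, 'm) module \<Rightarrow> nat
      \<Rightarrow> ('a \<times> (('r, 'm) syzygy \<Rightarrow> 'r) \<Rightarrow>\<^sub>0 int) set set monoid"
  where "Tor R A M =
    homology
      (\<lambda>n. tensor R A (free_module R (syzygy_basis R M n)))
      (\<lambda>n. tensor_map R A (free_module R (syzygy_basis R M (n - 1))) id (syzygy_boundary R))"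


section \<open>Group rings, group homology and \<open>p\<close>-adic completions\<close>

definition group_ring :: "('g, 'x) monoid_scheme \<Rightarrow> ('g \<Rightarrow>\<^sub>0 int) ring"
  where "group_ring G =
    \<lparr>carrier = {a. Poly_Mapping.keys a \<subseteq> carrier G},
     monoid.mult = (\<lambda>a b. frag_extend (\<lambda>g. frag_extend (\<lambda>h. frag_of (g \<otimes>\<^bsub>G\<^esub> h)) b) a),
     one = frag_of \<one>\<^bsub>G\<^esub>, ring.zero = 0, add = (+)\<rparr>"

text \<open>\<open>\<int>\<close> with trivial action, as a right module over any integral group ring.\<close>

definition trivial_module :: "('g \<Rightarrow>\<^sub>0 int, int) module"
  where "trivial_module = module_of UNIV (+) 0
    (\<lambda>a k. k * (\<Sum>g\<in>Poly_Mapping.keys a. Poly_Mapping.lookup a g))"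

definition group_homology ::
    "('g, 'x) monoid_scheme \<Rightarrow> ('g \<Rightarrow>\<^sub>0 int, 'm) module \<Rightarrow> nat
      \<Rightarrow> (int \<times> (('g \<Rightarrow>\<^sub>0 int, 'm) syzygy \<Rightarrow> 'g \<Rightarrow>\<^sub>0 int) \<Rightarrow>\<^sub>0 int) set set monoid"
  where "group_homology G M = Tor (group_ring G) trivial_module M"

definition inverse_limit :: "(nat \<Rightarrow> 'a set) \<Rightarrow> (nat \<Rightarrow> 'a \<Rightarrow> 'a) \<Rightarrow> (nat \<Rightarrow> 'a) set"
  where "inverse_limit A t = {x. (\<forall>n. x n \<in> A n) \<and> (\<forall>n. t n (x (Suc n)) = x n)}"

definition multiples :: "('a, 'x) ring_scheme \<Rightarrow> nat \<Rightarrow> 'a set"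
  where "multiples M k = (\<lambda>x. [k] \<cdot>\<^bsub>M\<^esub> x) ` carrier M"

definition torsion :: "('a, 'x) ring_scheme \<Rightarrow> nat \<Rightarrow> 'a set"
  where "torsion M k = {x \<in> carrier M. [k] \<cdot>\<^bsub>M\<^esub> x = \<zero>\<^bsub>M\<^esub>}"

text \<open>
  The ring \<open>lim R/p\<^sup>nR\<close>.  The projection \<open>R/p\<^bsup>n+1\<^esup>R \<rightarrow> R/p\<^sup>nR\<close> sends a coset \<open>X\<close> to \<open>p\<^sup>nR + X\<close>.
\<close>

definition padic_completion :: "nat \<Rightarrow> 'a ring \<Rightarrow> (nat \<Rightarrow> 'a set) ring"
  where "padic_completion p R =
    (let Q = (\<lambda>n. R Quot multiples R (p ^ n)) in
     \<lparr>carrier = inverse_limit (\<lambda>n. carrier (Q n)) (\<lambda>n X. multiples R (p ^ n) <+>\<^bsub>R\<^esub> X),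
      monoid.mult = (\<lambda>x y n. x n \<otimes>\<^bsub>Q n\<^esub> y n), one = (\<lambda>n. \<one>\<^bsub>Q n\<^esub>),
      ring.zero = (\<lambda>n. \<zero>\<^bsub>Q n\<^esub>), add = (\<lambda>x y n. x n \<oplus>\<^bsub>Q n\<^esub> y n)\<rparr>)"

definition completion_map :: "nat \<Rightarrow> 'a ring \<Rightarrow> 'a \<Rightarrow> (nat \<Rightarrow> 'a set)"
  where "completion_map p R r = (\<lambda>n. multiples R (p ^ n) +>\<^bsub>R\<^esub> r)"

definition completion_module :: "nat \<Rightarrow> 'a ring \<Rightarrow> ('a, nat \<Rightarrow> 'a set) module"
  where "completion_module p R =
    (let S = padic_completion p R in
     module_of (carrier S) (add S) (ring.zero S) (\<lambda>r x. x \<otimes>\<^bsub>S\<^esub> completion_map p R r))"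

definition int_module_of :: "('a, 'x) ring_scheme \<Rightarrow> (int, 'a) module"
  where "int_module_of A = module_of (carrier A) (add A) (ring.zero A) (\<lambda>(k::int) x. [k] \<cdot>\<^bsub>A\<^esub> x)"

definition rat_module :: "(int, rat) module"
  where "rat_module = module_of UNIV (+) 0 (\<lambda>k q. of_int k * q)"

text \<open>
  \<open>c\<^sub>0(G)\<close>, the tensor product over \<open>\<int>\<close> of the \<open>p\<close>-adic completion of \<open>\<int>G\<close> with \<open>\<rat>\<close>, as a right
  \<open>\<int>G\<close>-module via the first factor.
\<close>

definition c0_module ::
    "nat \<Rightarrow> ('g, 'x) monoid_scheme
      \<Rightarrow> ('g \<Rightarrow>\<^sub>0 int, ((nat \<Rightarrow> ('g \<Rightarrow>\<^sub>0 int) set) \<times> rat \<Rightarrow>\<^sub>0 int) set) module"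
  where "c0_module p G =
    (let A = completion_module p (group_ring G);
         T = tensor \<Z> (int_module_of A) rat_module in
     module_of (carrier T) (monoid.mult T) (one T)
       (\<lambda>r. tensor_map \<Z> (int_module_of A) rat_module (\<lambda>x. r \<odot>\<^bsub>A\<^esub> x) id))"

definition padically_expansive_of_exponent ::
    "nat \<Rightarrow> ('g, 'x) monoid_scheme \<Rightarrow> ('g \<Rightarrow>\<^sub>0 int, 'm) module \<Rightarrow> nat \<Rightarrow> bool"
  where "padically_expansive_of_exponent p G M n0 \<longleftrightarrow>
    left_module (group_ring G) M \<and> type_FL (group_ring G) M \<and>
    (\<forall>i\<ge>n0. multiples M (p ^ i) = multiples M (p ^ n0))"

end

theory Submission
  imports Defs "HOL-Algebra.AbelCoset" "HOL-Algebra.QuotRing" "HOL-Algebra.Elementary_Groups"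
begin

text \<open>
  Let \<open>\<Delta>\<close> be the subgroup and \<open>P\<^sub>i\<close> the given resolution.  Finitely generated projective modules are
  handled through finite dual bases: elements \<open>b\<^sub>j\<close> and functionals \<open>\<phi>\<^sub>j\<close> with
  \<open>x = \<Sum> \<phi>\<^sub>j(x) b\<^sub>j\<close>.  Multiplying the \<open>b\<^sub>j\<close> by representatives of the cosets of \<open>\<Delta>\<close> turns a
  dual basis over \<open>\<int>G\<close> into one over \<open>\<int>\<Delta>\<close> (\<open>dual_basis_restrict\<close>), so that the resolution may be read
  over \<open>\<int>\<Delta>\<close>, and everything takes place there.

  Completion.  Let \<open>A\<close> be the completed ring and \<open>T\<^sub>i = A \<otimes> P\<^sub>i\<close>.  Through the coordinates, \<open>T\<^sub>i\<close> inherits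
  from \<open>A\<close> that it is torsion free, \<open>p\<close>-adically complete and separated, and that
  \<open>P\<^sub>i / p\<^sup>k P\<^sub>i \<rightarrow> T\<^sub>i / p\<^sup>k T\<^sub>i\<close> is bijective.  By successive approximation, the completed complex is exact in
  degree \<open>i\<close> as soon as every cycle in \<open>T\<^sub>i\<close> is congruent modulo \<open>p\<close> to the boundary of an element of
  \<open>P\<^bsub>i+1\<^esub>\<close>.  Write a cycle as \<open>x = u + p t\<close> with \<open>u \<in> P\<^sub>i\<close>; then \<open>\<delta> u = p v\<close> with \<open>v \<in> P\<^bsub>i-1\<^esub>\<close>, and if
  \<open>v = \<delta> w\<close>, then \<open>u - p w\<close> is a cycle, hence a boundary, of the original resolution.  For \<open>i \<ge> 2\<close> such a \<open>w\<close>
  exists because \<open>v\<close> is a cycle (\<open>exactT_high\<close>).  For \<open>i = 1\<close> one takes better and better approximations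
  \<open>x = u\<^sub>k + p\<^sup>k t\<^sub>k\<close> with \<open>\<delta> u\<^sub>k = p\<^sup>k v\<^sub>k\<close>.  The images of the \<open>v\<^sub>k\<close> in \<open>M\<close> form an element of
  the inverse limit of the \<open>M\<^bsub>p^k\<^esub>\<close>, so they vanish, and \<open>v\<^sub>1\<close> is a boundary (\<open>exactT_1\<close>).  In degree 0 the
  equation \<open>p\<^bsup>n0\<^esup> M = p\<^bsup>n0+1\<^esup> M\<close> gives \<open>p\<^bsup>n0\<^esup> T\<^sub>0 \<subseteq> \<delta> T\<^sub>1\<close> (\<open>multiple_boundary\<close>).  This settles the
  completed sequence for \<open>n0 = 0\<close>.  The elements of \<open>c\<^sub>0 \<otimes> P\<^sub>i\<close> are the fractions \<open>t/m\<close> with \<open>t \<in> T\<^sub>i\<close>, and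
  \<open>t/m = 0\<close> only for \<open>t = 0\<close>, so the sequence with coefficients \<open>c\<^sub>0\<close> is exact too.

  Homology.  Since the \<open>T\<^sub>i\<close> are projective over \<open>A\<close>, multiplication by \<open>p\<^bsup>n0\<^esup>\<close> on them is null
  homotopic: \<open>p\<^bsup>n0\<^esup> = \<delta> h + h \<delta>\<close> (\<open>homotopy\<close>).  Let \<open>1 \<otimes> u\<close> be a cycle in \<open>\<int> \<otimes> P\<^sub>i\<close>.  Then all coordinates of
  \<open>\<delta> u\<close> have augmentation 0, and so, modulo any power \<open>p\<^sup>N\<close>, the term \<open>h \<delta> u\<close> is represented by an element of
  \<open>P\<^sub>i\<close> that vanishes in \<open>\<int> \<otimes> P\<^sub>i\<close>.  Approximating \<open>h u\<close> modulo \<open>p\<^sup>N\<close> by an element of \<open>P\<^bsub>i+1\<^esub>\<close> one finds that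
  \<open>p\<^bsup>n0\<^esup> H \<subseteq> p\<^sup>N H\<close> for the homology \<open>H\<close> and all \<open>N\<close> (\<open>cycles_divisible\<close>).  A finitely generated abelian
  group with this property is finite, with \<open>p\<close>-primary part killed by \<open>p\<^bsup>n0\<^esup>\<close> (\<open>finite_of_divisible\<close>).
  Finally, lifting the identity of \<open>M\<close> to chain maps embeds the homology computed with the syzygy
  resolution, that is Tor, into the homology computed with \<open>P\<close> (\<open>Tor_injection\<close>).
\<close>

section \<open>Additive maps\<close>

definition additive :: "('a, 'x) ring_scheme \<Rightarrow> ('b, 'y) ring_scheme \<Rightarrow> ('a \<Rightarrow> 'b) \<Rightarrow> bool"
  where "additive M N f \<longleftrightarrow> f \<in> hom (add_monoid M) (add_monoid N)"

lemma additiveI: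
  assumes "\<And>x. x \<in> carrier M \<Longrightarrow> f x \<in> carrier N"
    and "\<And>x y. x \<in> carrier M \<Longrightarrow> y \<in> carrier M \<Longrightarrow> f (x \<oplus>\<^bsub>M\<^esub> y) = f x \<oplus>\<^bsub>N\<^esub> f y"
  shows "additive M N f"
  using assms by (auto simp: additive_def hom_def)

lemma additive_closed: "additive M N f \<Longrightarrow> x \<in> carrier M \<Longrightarrow> f x \<in> carrier N"
  by (auto simp: additive_def hom_def)

lemma additive_add:
  "additive M N f \<Longrightarrow> x \<in> carrier M \<Longrightarrow> y \<in> carrier M \<Longrightarrow> f (x \<oplus>\<^bsub>M\<^esub> y) = f x \<oplus>\<^bsub>N\<^esub> f y"
  by (auto simp: additive_def hom_def)

lemma additive_compose:
  "additive L M f \<Longrightarrow> additive M N g \<Longrightarrow> additive L N (\<lambda>x. g (f x))"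
  by (rule additiveI) (simp_all add: additive_closed additive_add)

lemma additive_id: "additive M M (\<lambda>x. x)"
  by (auto simp: additive_def hom_def)

lemma add_group_hom:
  assumes "abelian_group M" "abelian_group N" "additive M N f"
  shows "group_hom (add_monoid M) (add_monoid N) f"
  using abelian_group.a_group[OF assms(1)] abelian_group.a_group[OF assms(2)] assms(3)
  by (simp add: group_hom_def group_hom_axioms_def additive_def)

lemma additive_zero:
  assumes "abelian_group M" "abelian_group N" "additive M N f"
  shows "f \<zero>\<^bsub>M\<^esub> = \<zero>\<^bsub>N\<^esub>"
  using group_hom.hom_one[OF add_group_hom[OF assms]] by simp

lemma additive_uminus:
  assumes "abelian_group M" "abelian_group N" "additive M N f" "x \<in> carrier M"
  shows "f (\<ominus>\<^bsub>M\<^esub> x) = \<ominus>\<^bsub>N\<^esub> f x"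
  using group_hom.hom_inv[OF add_group_hom[OF assms(1-3)], of x] assms(4) by (simp add: a_inv_def)

lemma additive_diff:
  assumes "abelian_group M" "abelian_group N" "additive M N f" "x \<in> carrier M" "y \<in> carrier M"
  shows "f (x \<ominus>\<^bsub>M\<^esub> y) = f x \<ominus>\<^bsub>N\<^esub> f y"
  using assms by (simp add: a_minus_def additive_add additive_uminus abelian_group.a_inv_closed)

lemma additive_nat_pow:
  assumes "abelian_group M" "abelian_group N" "additive M N f" "x \<in> carrier M"
  shows "f ([(n::nat)] \<cdot>\<^bsub>M\<^esub> x) = [n] \<cdot>\<^bsub>N\<^esub> f x"
  using group_hom.hom_nat_pow[OF add_group_hom[OF assms(1-3)], of x n] assms(4)
  by (simp add: add_pow_def)

lemma additive_int_pow:
  assumes "abelian_group M" "abelian_group N" "additive M N f" "x \<in> carrier M"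
  shows "f ([(n::int)] \<cdot>\<^bsub>M\<^esub> x) = [n] \<cdot>\<^bsub>N\<^esub> f x"
  using group_hom.hom_int_pow[OF add_group_hom[OF assms(1-3)], of x n] assms(4)
  by (simp add: add_pow_def)

lemma additive_finsum:
  assumes M: "abelian_group M" and N: "abelian_group N" and f: "additive M N f"
    and g: "g \<in> J \<rightarrow> carrier M"
  shows "f (\<Oplus>\<^bsub>M\<^esub>j\<in>J. g j) = (\<Oplus>\<^bsub>N\<^esub>j\<in>J. f (g j))"
proof -
  interpret M: abelian_group M by fact
  interpret N: abelian_group N by fact
  show ?thesis
  proof (cases "finite J")
    case True
    then show ?thesis using g
    proof (induction J rule: finite_induct)
      case empty
      show ?case by (simp add: additive_zero[OF M N f])
    next
      case (insert j J)
      then have "g \<in> J \<rightarrow> carrier M" "g j \<in> carrier M" by auto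
      moreover have "(\<lambda>i. f (g i)) \<in> J \<rightarrow> carrier N" "f (g j) \<in> carrier N"
        using insert.prems additive_closed[OF f] by auto
      ultimately show ?case
        using insert by (simp add: M.finsum_insert N.finsum_insert additive_add[OF f] M.finsum_closed)
    qed
  next
    case False
    then show ?thesis by (simp add: M.finsum_infinite N.finsum_infinite additive_zero[OF M N f])
  qed
qed

context abelian_group
begin

lemma additive_nat_multiple: "additive G G (\<lambda>x. [(n::nat)] \<cdot>\<^bsub>G\<^esub> x)"
  by (rule additiveI) (simp_all add: add.nat_pow_distrib)

lemma nat_multiple_mult: "x \<in> carrier G \<Longrightarrow> [(m * n :: nat)] \<cdot>\<^bsub>G\<^esub> x = [m] \<cdot>\<^bsub>G\<^esub> ([n] \<cdot>\<^bsub>G\<^esub> x)"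
  by (simp add: add.nat_pow_pow mult.commute)

lemma nat_multiple_Suc_power:
  "x \<in> carrier G \<Longrightarrow> [(p ^ Suc n :: nat)] \<cdot>\<^bsub>G\<^esub> x = [p] \<cdot>\<^bsub>G\<^esub> ([(p ^ n)] \<cdot>\<^bsub>G\<^esub> x)"
  by (simp add: nat_multiple_mult)

lemma diff_eq_zero:
  assumes "x \<in> carrier G" "y \<in> carrier G"
  shows "x \<ominus> y = \<zero> \<longleftrightarrow> x = y"
proof
  assume "x \<ominus> y = \<zero>"
  then have "\<ominus> (\<ominus> y) = x"
    using assms minus_equality[of x "\<ominus> y"] by (simp add: a_minus_def)
  then show "x = y" using assms by simp
next
  assume "x = y"
  then show "x \<ominus> y = \<zero>" using assms by (simp add: a_minus_def r_neg)
qed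

lemma diff_self: "x \<in> carrier G \<Longrightarrow> x \<ominus> x = \<zero>"
  by (simp add: diff_eq_zero)

lemma add_diff_add:
  assumes "a \<in> carrier G" "b \<in> carrier G" "c \<in> carrier G" "d \<in> carrier G"
  shows "(a \<oplus> b) \<ominus> (c \<oplus> d) = (a \<ominus> c) \<oplus> (b \<ominus> d)"
  using assms by (simp add: a_minus_def minus_add a_ac)

lemma diff_add_cancel: "x \<in> carrier G \<Longrightarrow> y \<in> carrier G \<Longrightarrow> (x \<ominus> y) \<oplus> y = x"
  by (simp add: a_minus_def a_assoc l_neg)

lemma add_diff_cancel: "x \<in> carrier G \<Longrightarrow> y \<in> carrier G \<Longrightarrow> (x \<oplus> y) \<ominus> y = x"
  by (simp add: a_minus_def a_assoc r_neg)

lemma add_diff_cancel_left: "x \<in> carrier G \<Longrightarrow> y \<in> carrier G \<Longrightarrow> (x \<oplus> y) \<ominus> x = y"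
  by (metis a_comm add_diff_cancel)

end

section \<open>Modules\<close>

lemma module_of_simps [simp]:
  "carrier (module_of C pl ze sm) = C" "add (module_of C pl ze sm) = pl"
  "ring.zero (module_of C pl ze sm) = ze" "smult (module_of C pl ze sm) = sm"
  by (simp_all add: module_of_def)

locale right_module = R?: ring R + M?: abelian_group M
  for R (structure) and M (structure) +
  assumes smult_closed: "\<lbrakk>r \<in> carrier R; x \<in> carrier M\<rbrakk> \<Longrightarrow> r \<odot>\<^bsub>M\<^esub> x \<in> carrier M"
    and smult_l_distr:
      "\<lbrakk>r \<in> carrier R; s \<in> carrier R; x \<in> carrier M\<rbrakk>
        \<Longrightarrow> (r \<oplus> s) \<odot>\<^bsub>M\<^esub> x = r \<odot>\<^bsub>M\<^esub> x \<oplus>\<^bsub>M\<^esub> s \<odot>\<^bsub>M\<^esub> x"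
    and smult_r_distr:
      "\<lbrakk>r \<in> carrier R; x \<in> carrier M; y \<in> carrier M\<rbrakk>
        \<Longrightarrow> r \<odot>\<^bsub>M\<^esub> (x \<oplus>\<^bsub>M\<^esub> y) = r \<odot>\<^bsub>M\<^esub> x \<oplus>\<^bsub>M\<^esub> r \<odot>\<^bsub>M\<^esub> y"
    and smult_assoc:
      "\<lbrakk>r \<in> carrier R; s \<in> carrier R; x \<in> carrier M\<rbrakk>
        \<Longrightarrow> (r \<otimes> s) \<odot>\<^bsub>M\<^esub> x = s \<odot>\<^bsub>M\<^esub> (r \<odot>\<^bsub>M\<^esub> x)"
    and smult_one: "x \<in> carrier M \<Longrightarrow> \<one> \<odot>\<^bsub>M\<^esub> x = x"

lemma module_homsD:
  assumes "f \<in> module_homs R M N"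
  shows "additive M N f"
    and "\<And>x. x \<in> carrier M \<Longrightarrow> f x \<in> carrier N"
    and "\<And>r x. r \<in> carrier R \<Longrightarrow> x \<in> carrier M \<Longrightarrow> f (r \<odot>\<^bsub>M\<^esub> x) = r \<odot>\<^bsub>N\<^esub> f x"
  using assms by (auto simp: module_homs_def intro!: additiveI)

lemma module_homsI:
  assumes "additive M N f"
    and "\<And>r x. r \<in> carrier R \<Longrightarrow> x \<in> carrier M \<Longrightarrow> f (r \<odot>\<^bsub>M\<^esub> x) = r \<odot>\<^bsub>N\<^esub> f x"
  shows "f \<in> module_homs R M N"
  using assms by (auto simp: module_homs_def additive_closed additive_add)

lemma module_homs_compose:
  assumes "f \<in> module_homs R L M" "g \<in> module_homs R M N"
  shows "(\<lambda>x. g (f x)) \<in> module_homs R L N"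
  using assms by (auto simp: module_homs_def Pi_def)

context left_module
begin

lemma additive_smult: "r \<in> carrier R \<Longrightarrow> additive M M (\<lambda>x. r \<odot>\<^bsub>M\<^esub> x)"
  by (auto intro: additiveI simp: smult_closed smult_r_distr)

lemma additive_smult_left: "x \<in> carrier M \<Longrightarrow> additive R M (\<lambda>r. r \<odot>\<^bsub>M\<^esub> x)"
  by (auto intro: additiveI simp: smult_closed smult_l_distr)

lemma smult_zero_left: "x \<in> carrier M \<Longrightarrow> \<zero> \<odot>\<^bsub>M\<^esub> x = \<zero>\<^bsub>M\<^esub>"
  using additive_zero[OF _ _ additive_smult_left] R.is_abelian_group M.abelian_group_axioms by blast

lemma smult_zero_right: "r \<in> carrier R \<Longrightarrow> r \<odot>\<^bsub>M\<^esub> \<zero>\<^bsub>M\<^esub> = \<zero>\<^bsub>M\<^esub>"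
  using additive_zero[OF _ _ additive_smult] M.abelian_group_axioms by blast

end

lemma nat_multiple_hom:
  assumes "left_module R M"
  shows "(\<lambda>x. [(n::nat)] \<cdot>\<^bsub>M\<^esub> x) \<in> module_homs R M M"
proof -
  interpret left_module R M by fact
  show ?thesis
  proof (rule module_homsI)
    fix r x assume "r \<in> carrier R" "x \<in> carrier M"
    then show "[n] \<cdot>\<^bsub>M\<^esub> (r \<odot>\<^bsub>M\<^esub> x) = r \<odot>\<^bsub>M\<^esub> ([n] \<cdot>\<^bsub>M\<^esub> x)"
      using additive_nat_pow[OF M.abelian_group_axioms M.abelian_group_axioms additive_smult] by simp
  qed (rule M.additive_nat_multiple)
qed

lemma module_homs_diff:
  assumes "left_module R L" "left_module R M" "f \<in> module_homs R L M" "g \<in> module_homs R L M"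
  shows "(\<lambda>x. f x \<ominus>\<^bsub>M\<^esub> g x) \<in> module_homs R L M"
proof -
  interpret L: left_module R L by fact
  interpret M: left_module R M by fact
  note f = module_homsD[OF assms(3)] and g = module_homsD[OF assms(4)]
  show ?thesis
  proof (rule module_homsI)
    show "additive L M (\<lambda>x. f x \<ominus>\<^bsub>M\<^esub> g x)"
      by (rule additiveI) (simp_all add: f(2) g(2) additive_add[OF f(1)] additive_add[OF g(1)]
          M.add_diff_add)
  next
    fix r x assume "r \<in> carrier R" "x \<in> carrier L"
    then show "f (r \<odot>\<^bsub>L\<^esub> x) \<ominus>\<^bsub>M\<^esub> g (r \<odot>\<^bsub>L\<^esub> x) = r \<odot>\<^bsub>M\<^esub> (f x \<ominus>\<^bsub>M\<^esub> g x)"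
      using f g additive_diff[OF M.M.abelian_group_axioms M.M.abelian_group_axioms M.additive_smult, of r "f x" "g x"]
      by simp
  qed
qed

section \<open>Tensor products\<close>

definition pure_tensor ::
    "'r ring \<Rightarrow> ('r, 'a) module \<Rightarrow> ('r, 'b) module \<Rightarrow> 'a \<Rightarrow> 'b \<Rightarrow> ('a \<times> 'b \<Rightarrow>\<^sub>0 int) set"
  where "pure_tensor R A B a b =
    tensor_relations R A B #>\<^bsub>free_Abelian_group (carrier A \<times> carrier B)\<^esub> frag_of (a, b)"

text \<open>
  The tensor product written additively, so that \<^locale>\<open>abelian_group\<close> and its finite sums apply.  The
  scalar multiplication is a dummy.
\<close>

definition additive_tensor ::
    "'r ring \<Rightarrow> ('r, 'a) module \<Rightarrow> ('r, 'b) module \<Rightarrow> ('r, ('a \<times> 'b \<Rightarrow>\<^sub>0 int) set) module"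
  where "additive_tensor R A B =
    (let T = tensor R A B in module_of (carrier T) (monoid.mult T) (one T) (\<lambda>_ x. x))"

lemma additive_tensor_simps:
  "carrier (additive_tensor R A B) = carrier (tensor R A B)"
  "add (additive_tensor R A B) = monoid.mult (tensor R A B)"
  "ring.zero (additive_tensor R A B) = one (tensor R A B)"
  by (simp_all add: additive_tensor_def Let_def)

locale tensor_pair = A: right_module R A + B: left_module R B
  for R :: "'r ring" and A :: "('r, 'a) module" and B :: "('r, 'b) module"
begin

abbreviation "F \<equiv> free_Abelian_group (carrier A \<times> carrier B)"
abbreviation "K \<equiv> tensor_relations R A B"
abbreviation "T \<equiv> additive_tensor R A B"
abbreviation "tens \<equiv> pure_tensor R A B"

definition "relators = {frag_of (a \<oplus>\<^bsub>A\<^esub> a', b) - frag_of (a, b) - frag_of (a', b) | a a' b.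
        a \<in> carrier A \<and> a' \<in> carrier A \<and> b \<in> carrier B} \<union>
     {frag_of (a, b \<oplus>\<^bsub>B\<^esub> b') - frag_of (a, b) - frag_of (a, b') | a b b'.
        a \<in> carrier A \<and> b \<in> carrier B \<and> b' \<in> carrier B} \<union>
     {frag_of (r \<odot>\<^bsub>A\<^esub> a, b) - frag_of (a, r \<odot>\<^bsub>B\<^esub> b) | r a b.
        r \<in> carrier R \<and> a \<in> carrier A \<and> b \<in> carrier B}"

lemma tensor_relations_eq: "K = generate F relators"
  by (simp add: tensor_relations_def relators_def)

sublocale F: comm_group F
  by (rule abelian_free_Abelian_group)

lemma relators_subset: "relators \<subseteq> carrier F"
proof -
  have "frag_of x - frag_of y - frag_of z \<in> carrier F"
    if "x \<in> carrier A \<times> carrier B" "y \<in> carrier A \<times> carrier B" "z \<in> carrier A \<times> carrier B" for x y z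
    using that keys_diff[of "frag_of x - frag_of y" "frag_of z"] keys_diff[of "frag_of x" "frag_of y"]
    by (auto simp: keys_frag_of)
  moreover have "frag_of x - frag_of y \<in> carrier F"
    if "x \<in> carrier A \<times> carrier B" "y \<in> carrier A \<times> carrier B" for x y
    using that keys_diff[of "frag_of x" "frag_of y"] by (auto simp: keys_frag_of)
  ultimately show ?thesis
    unfolding relators_def
    by (auto simp del: carrier_free_Abelian_group_iff simp: A.smult_closed B.smult_closed)
qed

lemma subgroup_relations: "subgroup K F"
  unfolding tensor_relations_eq by (rule F.generate_is_subgroup[OF relators_subset])

lemma normal_relations: "K \<lhd> F"
  by (rule F.subgroup_imp_normal[OF subgroup_relations])

lemma tensor_comm_group: "comm_group (tensor R A B)"
  unfolding tensor_def by (rule F.abelian_FactGroup[OF subgroup_relations])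

lemma tensor_abelian_group: "abelian_group T"
proof -
  interpret C: comm_group "tensor R A B" by (rule tensor_comm_group)
  have "comm_group (add_monoid T)"
    by (rule comm_groupI) (simp_all add: additive_tensor_simps C.m_assoc C.l_inv_ex, simp add: C.m_comm)
  then show ?thesis
    by (rule comm_group_abelian_groupI)
qed

sublocale T: abelian_group T
  by (rule tensor_abelian_group)

lemma tens_closed [simp]: "a \<in> carrier A \<Longrightarrow> b \<in> carrier B \<Longrightarrow> tens a b \<in> carrier T"
  by (auto simp: additive_tensor_simps pure_tensor_def tensor_def carrier_FactGroup)

lemma coset_add:
  "x \<in> carrier F \<Longrightarrow> y \<in> carrier F \<Longrightarrow> K #>\<^bsub>F\<^esub> (x + y) = (K #>\<^bsub>F\<^esub> x) \<oplus>\<^bsub>T\<^esub> (K #>\<^bsub>F\<^esub> y)"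
  using normal.rcos_sum[OF normal_relations, of x y] by (simp add: additive_tensor_simps tensor_def)

lemma coset_closed: "x \<in> carrier F \<Longrightarrow> K #>\<^bsub>F\<^esub> x \<in> carrier T"
  by (auto simp: additive_tensor_simps tensor_def carrier_FactGroup)

lemma coset_additive: "(\<lambda>x. K #>\<^bsub>F\<^esub> x) \<in> hom F (add_monoid T)"
  by (rule homI) (simp_all add: coset_add coset_closed del: carrier_free_Abelian_group_iff)

lemma coset_eqI:
  assumes "x \<in> carrier F" "y \<in> carrier F" "x - y \<in> K"
  shows "K #>\<^bsub>F\<^esub> x = K #>\<^bsub>F\<^esub> y"
proof -
  have "x \<in> K #>\<^bsub>F\<^esub> y"
    unfolding r_coset_def using assms(3) by (auto intro!: bexI[of _ "x - y"])
  then show ?thesis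
    using F.repr_independence[OF _ assms(2) subgroup_relations] by simp
qed

lemma coset_zero: "K #>\<^bsub>F\<^esub> 0 = \<zero>\<^bsub>T\<^esub>"
  using F.coset_join2[OF _ subgroup_relations, of 0] subgroup.one_closed[OF subgroup_relations]
  by (simp add: additive_tensor_simps tensor_def)

lemma tens_add_left:
  assumes "a \<in> carrier A" "a' \<in> carrier A" "b \<in> carrier B"
  shows "tens (a \<oplus>\<^bsub>A\<^esub> a') b = tens a b \<oplus>\<^bsub>T\<^esub> tens a' b"
proof -
  have "frag_of (a \<oplus>\<^bsub>A\<^esub> a', b) - frag_of (a, b) - frag_of (a', b) \<in> relators"
    unfolding relators_def using assms by blast
  then have "frag_of (a \<oplus>\<^bsub>A\<^esub> a', b) - (frag_of (a, b) + frag_of (a', b)) \<in> relators"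
    by (simp only: diff_diff_eq)
  then have "frag_of (a \<oplus>\<^bsub>A\<^esub> a', b) - (frag_of (a, b) + frag_of (a', b)) \<in> K"
    unfolding tensor_relations_eq by (rule generate.incl)
  moreover have "frag_of (a, b) + frag_of (a', b) \<in> carrier F"
    using assms F.m_closed[of "frag_of (a, b)" "frag_of (a', b)"] by simp
  ultimately have "K #>\<^bsub>F\<^esub> frag_of (a \<oplus>\<^bsub>A\<^esub> a', b) = K #>\<^bsub>F\<^esub> (frag_of (a, b) + frag_of (a', b))"
    using assms by (intro coset_eqI) simp_all
  then show ?thesis
    using assms coset_add[of "frag_of (a, b)" "frag_of (a', b)"] by (simp add: pure_tensor_def)
qed

lemma tens_add_right:
  assumes "a \<in> carrier A" "b \<in> carrier B" "b' \<in> carrier B"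
  shows "tens a (b \<oplus>\<^bsub>B\<^esub> b') = tens a b \<oplus>\<^bsub>T\<^esub> tens a b'"
proof -
  have "frag_of (a, b \<oplus>\<^bsub>B\<^esub> b') - frag_of (a, b) - frag_of (a, b') \<in> relators"
    unfolding relators_def using assms by blast
  then have "frag_of (a, b \<oplus>\<^bsub>B\<^esub> b') - (frag_of (a, b) + frag_of (a, b')) \<in> relators"
    by (simp only: diff_diff_eq)
  then have "frag_of (a, b \<oplus>\<^bsub>B\<^esub> b') - (frag_of (a, b) + frag_of (a, b')) \<in> K"
    unfolding tensor_relations_eq by (rule generate.incl)
  moreover have "frag_of (a, b) + frag_of (a, b') \<in> carrier F"
    using assms F.m_closed[of "frag_of (a, b)" "frag_of (a, b')"] by simp
  ultimately have "K #>\<^bsub>F\<^esub> frag_of (a, b \<oplus>\<^bsub>B\<^esub> b') = K #>\<^bsub>F\<^esub> (frag_of (a, b) + frag_of (a, b'))"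
    using assms by (intro coset_eqI) simp_all
  then show ?thesis
    using assms coset_add[of "frag_of (a, b)" "frag_of (a, b')"] by (simp add: pure_tensor_def)
qed

lemma tens_balanced:
  assumes "r \<in> carrier R" "a \<in> carrier A" "b \<in> carrier B"
  shows "tens (r \<odot>\<^bsub>A\<^esub> a) b = tens a (r \<odot>\<^bsub>B\<^esub> b)"
proof -
  have "frag_of (r \<odot>\<^bsub>A\<^esub> a, b) - frag_of (a, r \<odot>\<^bsub>B\<^esub> b) \<in> relators"
    unfolding relators_def using assms by blast
  then have "frag_of (r \<odot>\<^bsub>A\<^esub> a, b) - frag_of (a, r \<odot>\<^bsub>B\<^esub> b) \<in> K"
    unfolding tensor_relations_eq by (rule generate.incl)
  then show ?thesis
    unfolding pure_tensor_def using assms A.smult_closed B.smult_closed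
    by (intro coset_eqI) simp_all
qed

lemma additive_tens_left: "b \<in> carrier B \<Longrightarrow> additive A T (\<lambda>a. tens a b)"
  by (rule additiveI) (simp_all add: tens_add_left)

lemma additive_tens_right: "a \<in> carrier A \<Longrightarrow> additive B T (\<lambda>b. tens a b)"
  by (rule additiveI) (simp_all add: tens_add_right)

text \<open>
  Since \<open>- (a \<otimes> b) = (- a) \<otimes> b\<close>, the pure tensors generate the tensor product under addition alone.
\<close>

lemma tensor_induct [consumes 1, case_names tens add]:
  assumes t: "t \<in> carrier T"
    and tens: "\<And>a b. a \<in> carrier A \<Longrightarrow> b \<in> carrier B \<Longrightarrow> Q (tens a b)"
    and add: "\<And>s t. \<lbrakk>s \<in> carrier T; t \<in> carrier T; Q s; Q t\<rbrakk> \<Longrightarrow> Q (s \<oplus>\<^bsub>T\<^esub> t)"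
  shows "Q t"
proof -
  let ?c = "\<lambda>x. K #>\<^bsub>F\<^esub> x"
  interpret c: group_hom F "add_monoid T" ?c
    using coset_additive T.a_group F.group_axioms by (simp add: group_hom_def group_hom_axioms_def)
  have neg: "?c (- x) = \<ominus>\<^bsub>T\<^esub> ?c x" if "x \<in> carrier F" for x
    using c.hom_inv[of x] that by (simp add: a_inv_def)
  have main: "Q (?c x) \<and> Q (?c (- x))" if "Poly_Mapping.keys x \<subseteq> carrier A \<times> carrier B" for x
    using that
  proof (rule free_Abelian_group_induct)
    have "Q (tens \<zero>\<^bsub>A\<^esub> \<zero>\<^bsub>B\<^esub>)" by (rule tens) simp_all
    moreover have "tens \<zero>\<^bsub>A\<^esub> \<zero>\<^bsub>B\<^esub> = \<zero>\<^bsub>T\<^esub>"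
      using additive_zero[OF A.abelian_group_axioms T.abelian_group_axioms additive_tens_left, of "\<zero>\<^bsub>B\<^esub>"] by simp
    moreover have "?c 0 = \<zero>\<^bsub>T\<^esub>" using c.hom_one by simp
    ultimately show "Q (?c 0) \<and> Q (?c (- 0))" by simp
  next
    fix x y assume xy: "Q (?c x) \<and> Q (?c (- x))" "Q (?c y) \<and> Q (?c (- y))"
      "Poly_Mapping.keys x \<subseteq> carrier A \<times> carrier B" "Poly_Mapping.keys y \<subseteq> carrier A \<times> carrier B"
    then have x: "x \<in> carrier F" and y: "y \<in> carrier F" by simp_all
    have mx: "- x \<in> carrier F" and my: "- y \<in> carrier F"
      using F.inv_closed[OF x] F.inv_closed[OF y] x y by simp_all
    have "?c (x - y) = ?c x \<oplus>\<^bsub>T\<^esub> ?c (- y)"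
      using coset_add[OF x my] by simp
    moreover have "?c (- (x - y)) = ?c (- x) \<oplus>\<^bsub>T\<^esub> ?c y"
      using coset_add[OF mx y] by simp
    ultimately show "Q (?c (x - y)) \<and> Q (?c (- (x - y)))"
      using xy(1,2) add[OF coset_closed[OF x] coset_closed[OF my]] add[OF coset_closed[OF mx] coset_closed[OF y]]
      by simp
  next
    fix x assume "x \<in> carrier A \<times> carrier B"
    then obtain a b where x: "x = (a, b)" "a \<in> carrier A" "b \<in> carrier B" by auto
    have "?c (- frag_of (a, b)) = tens (\<ominus>\<^bsub>A\<^esub> a) b"
      using neg[of "frag_of (a, b)"] x additive_uminus[OF A.abelian_group_axioms T.abelian_group_axioms additive_tens_left, of b a]
      by (simp add: pure_tensor_def)
    then show "Q (?c (frag_of x)) \<and> Q (?c (- frag_of x))"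
      using x tens[of a b] tens[of "\<ominus>\<^bsub>A\<^esub> a" b] by (simp add: pure_tensor_def)
  qed
  obtain x where "x \<in> carrier F" "t = ?c x"
    using t by (auto simp: additive_tensor_simps tensor_def carrier_FactGroup)
  then show ?thesis using main[of x] by simp
qed

lemma additive_eqI:
  assumes "additive T N f" "additive T N g"
    and "\<And>a b. a \<in> carrier A \<Longrightarrow> b \<in> carrier B \<Longrightarrow> f (tens a b) = g (tens a b)"
    and "t \<in> carrier T"
  shows "f t = g t"
  using assms(4)
  by (induction rule: tensor_induct) (simp_all add: assms(3) additive_add[OF assms(1)] additive_add[OF assms(2)])

lemma tensor_universal:
  assumes N: "abelian_group N"
    and cl: "\<And>a b. a \<in> carrier A \<Longrightarrow> b \<in> carrier B \<Longrightarrow> \<beta> a b \<in> carrier N"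
    and l: "\<And>a a' b. \<lbrakk>a \<in> carrier A; a' \<in> carrier A; b \<in> carrier B\<rbrakk> \<Longrightarrow> \<beta> (a \<oplus>\<^bsub>A\<^esub> a') b = \<beta> a b \<oplus>\<^bsub>N\<^esub> \<beta> a' b"
    and r: "\<And>a b b'. \<lbrakk>a \<in> carrier A; b \<in> carrier B; b' \<in> carrier B\<rbrakk> \<Longrightarrow> \<beta> a (b \<oplus>\<^bsub>B\<^esub> b') = \<beta> a b \<oplus>\<^bsub>N\<^esub> \<beta> a b'"
    and bal: "\<And>r a b. \<lbrakk>r \<in> carrier R; a \<in> carrier A; b \<in> carrier B\<rbrakk> \<Longrightarrow> \<beta> (r \<odot>\<^bsub>A\<^esub> a) b = \<beta> a (r \<odot>\<^bsub>B\<^esub> b)"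
  obtains h where "additive T N h"
    and "\<And>a b. a \<in> carrier A \<Longrightarrow> b \<in> carrier B \<Longrightarrow> h (tens a b) = \<beta> a b"
proof -
  interpret N: abelian_group N by fact
  have "case_prod \<beta> ` (carrier A \<times> carrier B) \<subseteq> carrier (add_monoid N)"
    using cl by auto
  then obtain h where h: "h \<in> hom F (add_monoid N)"
    and hf: "\<And>x. x \<in> carrier A \<times> carrier B \<Longrightarrow> h (frag_of x) = case_prod \<beta> x"
    using N.a_comm_group comm_group.free_Abelian_group_universal by blast
  interpret h: group_hom F "add_monoid N" h
    using h N.a_group F.group_axioms by (simp add: group_hom_def group_hom_axioms_def)
  have hd: "h (x - y) = h x \<ominus>\<^bsub>N\<^esub> h y" if "x \<in> carrier F" "y \<in> carrier F" for x y
    using h.hom_mult[of x "- y"] h.hom_inv[of y] that F.inv_closed[of y]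
    by (simp add: a_minus_def a_inv_def)
  have frag2: "frag_of x - frag_of y \<in> carrier F"
    if "x \<in> carrier A \<times> carrier B" "y \<in> carrier A \<times> carrier B" for x y
    using that keys_diff[of "frag_of x" "frag_of y"] by (auto simp: keys_frag_of)
  have hd2: "h (frag_of x - frag_of y) = case_prod \<beta> x \<ominus>\<^bsub>N\<^esub> case_prod \<beta> y"
    if "x \<in> carrier A \<times> carrier B" "y \<in> carrier A \<times> carrier B" for x y
    using that by (simp add: hd hf)
  have hd3: "h (frag_of x - frag_of y - frag_of z) = case_prod \<beta> x \<ominus>\<^bsub>N\<^esub> case_prod \<beta> y \<ominus>\<^bsub>N\<^esub> case_prod \<beta> z"
    if "x \<in> carrier A \<times> carrier B" "y \<in> carrier A \<times> carrier B" "z \<in> carrier A \<times> carrier B" for x y z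
    using that frag2[OF that(1,2)] hd[OF frag2[OF that(1,2)], of "frag_of z"] by (simp add: hd2 hf)
  have cancel: "u \<oplus>\<^bsub>N\<^esub> v \<ominus>\<^bsub>N\<^esub> u \<ominus>\<^bsub>N\<^esub> v = \<zero>\<^bsub>N\<^esub>" if "u \<in> carrier N" "v \<in> carrier N" for u v
    using that by (simp add: N.add_diff_cancel_left N.diff_self)
  have "relators \<subseteq> kernel F (add_monoid N) h"
  proof
    fix x assume x: "x \<in> relators"
    then have "h x = \<zero>\<^bsub>N\<^esub>"
      unfolding relators_def
      by (auto simp: hd2 hd3 l r bal cancel cl A.smult_closed B.smult_closed N.diff_self)
    then show "x \<in> kernel F (add_monoid N) h"
      using subsetD[OF relators_subset x] by (simp add: kernel_def)
  qed
  then have "K \<subseteq> kernel F (add_monoid N) h"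
    unfolding tensor_relations_eq
    by (rule F.generate_subgroup_incl[OF _ h.subgroup_kernel])
  then obtain g where g: "g \<in> hom (F Mod K) (add_monoid N)" "\<And>x. x \<in> carrier F \<Longrightarrow> g (K #>\<^bsub>F\<^esub> x) = h x"
    using h.FactGroup_universal_kernel[OF normal_relations] by metis
  show thesis
  proof
    show "additive T N g"
      using g(1) by (auto simp: additive_def hom_def tensor_def additive_tensor_simps)
    show "g (tens a b) = \<beta> a b" if "a \<in> carrier A" "b \<in> carrier B" for a b
      using that g(2)[of "frag_of (a, b)"] hf[of "(a, b)"] by (simp add: pure_tensor_def)
  qed
qed

end

text \<open>
  By the universal property \<open>f \<otimes> g\<close> exists as an additive map \<open>h\<close>.  All members of a coset \<open>X\<close> contribute
  \<open>h X\<close> to the union that defines \<^const>\<open>tensor_map\<close>.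
\<close>

lemma tensor_map_additive:
  assumes P: "tensor_pair R A B" and P': "tensor_pair R A' B'"
    and f: "additive A A' f" "\<And>r x. r \<in> carrier R \<Longrightarrow> x \<in> carrier A \<Longrightarrow> f (r \<odot>\<^bsub>A\<^esub> x) = r \<odot>\<^bsub>A'\<^esub> f x"
    and g: "g \<in> module_homs R B B'"
  shows "additive (additive_tensor R A B) (additive_tensor R A' B') (tensor_map R A' B' f g)" (is ?thesis1)
    and "\<And>a b. a \<in> carrier A \<Longrightarrow> b \<in> carrier B \<Longrightarrow>
      tensor_map R A' B' f g (pure_tensor R A B a b) = pure_tensor R A' B' (f a) (g b)" (is "PROP ?thesis2")
proof -
  interpret P: tensor_pair R A B by fact
  interpret P': tensor_pair R A' B' by fact
  note g' = module_homsD[OF g]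
  define \<phi> where "\<phi> = (\<lambda>t. frag_extend (\<lambda>(a, b). frag_of (f a, g b)) t)"
  have fg: "f a \<in> carrier A'" "g b \<in> carrier B'" if "a \<in> carrier A" "b \<in> carrier B" for a b
    using that g'(2) additive_closed[OF f(1)] by auto
  have hom: "\<phi> \<in> hom P.F P'.F"
  proof (rule homI)
    fix x assume "x \<in> carrier P.F"
    then have x: "Poly_Mapping.keys x \<subseteq> carrier A \<times> carrier B" by simp
    have "Poly_Mapping.keys (case z of (a, b) \<Rightarrow> frag_of (f a, g b)) \<subseteq> carrier A' \<times> carrier B'"
      if "z \<in> Poly_Mapping.keys x" for z
      using that x fg by (auto simp: keys_frag_of split_beta)
    then have "Poly_Mapping.keys (\<phi> x) \<subseteq> carrier A' \<times> carrier B'"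
      unfolding \<phi>_def using keys_frag_extend[of "\<lambda>(a, b). frag_of (f a, g b)" x] by blast
    then show "\<phi> x \<in> carrier P'.F" by simp
  qed (simp add: \<phi>_def frag_extend_add)
  interpret \<phi>: group_hom P.F P'.F \<phi>
    using hom P.F.group_axioms P'.F.group_axioms by (simp add: group_hom_def group_hom_axioms_def)
  have "\<exists>h. additive P.T P'.T h \<and>
    (\<forall>a b. a \<in> carrier A \<longrightarrow> b \<in> carrier B \<longrightarrow> h (P.tens a b) = P'.tens (f a) (g b))"
  proof (rule P.tensor_universal[OF P'.tensor_abelian_group, of "\<lambda>a b. P'.tens (f a) (g b)"])
    fix r a b assume "r \<in> carrier R" "a \<in> carrier A" "b \<in> carrier B"
    then show "P'.tens (f (r \<odot>\<^bsub>A\<^esub> a)) (g b) = P'.tens (f a) (g (r \<odot>\<^bsub>B\<^esub> b))"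
      by (simp add: f(2) g'(3) fg P'.tens_balanced)
  qed (auto simp: fg P'.tens_add_left P'.tens_add_right additive_add[OF f(1)] additive_add[OF g'(1)])
  then obtain h where h: "additive P.T P'.T h"
    and hp: "\<And>a b. a \<in> carrier A \<Longrightarrow> b \<in> carrier B \<Longrightarrow> h (P.tens a b) = P'.tens (f a) (g b)"
    by blast
  have key: "h (P.K #>\<^bsub>P.F\<^esub> t) = P'.K #>\<^bsub>P'.F\<^esub> \<phi> t" if "t \<in> carrier P.F" for t
  proof -
    have "Poly_Mapping.keys t \<subseteq> carrier A \<times> carrier B" using that by simp
    then have "Poly_Mapping.keys t \<subseteq> carrier A \<times> carrier B \<and> h (P.K #>\<^bsub>P.F\<^esub> t) = P'.K #>\<^bsub>P'.F\<^esub> \<phi> t"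
    proof (induction rule: frag_induction)
      case zero
      have "h (P.K #>\<^bsub>P.F\<^esub> 0) = h \<zero>\<^bsub>P.T\<^esub>"
        by (simp only: P.coset_zero)
      also have "\<dots> = \<zero>\<^bsub>P'.T\<^esub>"
        by (rule additive_zero[OF P.tensor_abelian_group P'.tensor_abelian_group h])
      also have "\<dots> = P'.K #>\<^bsub>P'.F\<^esub> \<phi> 0"
        using P'.coset_zero by (simp add: \<phi>_def)
      finally show ?case by simp
    next
      case (one x)
      then show ?case
        using hp[of "fst x" "snd x"] by (auto simp: pure_tensor_def \<phi>_def keys_frag_of split_beta)
    next
      case (diff a b)
      have a: "a \<in> carrier P.F" and b: "b \<in> carrier P.F" using diff by simp_all
      have ab: "a - b \<in> carrier P.F" using diff keys_diff[of a b] by auto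
      have "h (P.K #>\<^bsub>P.F\<^esub> (a - b)) \<oplus>\<^bsub>P'.T\<^esub> h (P.K #>\<^bsub>P.F\<^esub> b) = h (P.K #>\<^bsub>P.F\<^esub> a)"
        using additive_add[OF h P.coset_closed[OF ab] P.coset_closed[OF b]] P.coset_add[OF ab b] by simp
      moreover have "(P'.K #>\<^bsub>P'.F\<^esub> \<phi> (a - b)) \<oplus>\<^bsub>P'.T\<^esub> (P'.K #>\<^bsub>P'.F\<^esub> \<phi> b) = P'.K #>\<^bsub>P'.F\<^esub> \<phi> a"
        using P'.coset_add[OF \<phi>.hom_closed[OF ab] \<phi>.hom_closed[OF b]] by (simp add: \<phi>_def frag_extend_diff)
      ultimately have "h (P.K #>\<^bsub>P.F\<^esub> (a - b)) \<oplus>\<^bsub>P'.T\<^esub> h (P.K #>\<^bsub>P.F\<^esub> b)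
          = (P'.K #>\<^bsub>P'.F\<^esub> \<phi> (a - b)) \<oplus>\<^bsub>P'.T\<^esub> h (P.K #>\<^bsub>P.F\<^esub> b)"
        using diff by simp
      then have "h (P.K #>\<^bsub>P.F\<^esub> (a - b)) = P'.K #>\<^bsub>P'.F\<^esub> \<phi> (a - b)"
        using P'.T.add_diff_cancel additive_closed[OF h] P.coset_closed[OF ab] P.coset_closed[OF b]
          P'.coset_closed[OF \<phi>.hom_closed[OF ab]] by metis
      then show ?case using ab by simp
    qed
    then show ?thesis ..
  qed
  have map: "tensor_map R A' B' f g X = h X" if X: "X \<in> carrier P.T" for X
  proof -
    obtain x where x: "x \<in> carrier P.F" "X = P.K #>\<^bsub>P.F\<^esub> x"
      using X by (auto simp: additive_tensor_simps tensor_def carrier_FactGroup)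
    have tX: "t \<in> carrier P.F \<and> P.K #>\<^bsub>P.F\<^esub> t = X" if "t \<in> X" for t
      using P.F.repr_independence[OF _ x(1) P.subgroup_relations, of t] that
        subsetD[OF P.F.r_coset_subset_G[OF subgroup.subset[OF P.subgroup_relations] x(1)], of t]
      unfolding x(2) by metis
    have "x \<in> X" using x P.F.rcos_self[OF x(1) P.subgroup_relations] by simp
    have "tensor_map R A' B' f g X = (\<Union>t\<in>X. P'.K #>\<^bsub>P'.F\<^esub> \<phi> t)"
      by (simp only: tensor_map_def \<phi>_def)
    also have "\<dots> = (\<Union>t\<in>X. h X)"
    proof (rule SUP_cong[OF refl])
      show "P'.K #>\<^bsub>P'.F\<^esub> \<phi> t = h X" if "t \<in> X" for t
        using key[of t] tX[OF that] by simp
    qed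
    finally show ?thesis using \<open>x \<in> X\<close> by blast
  qed
  show ?thesis1
    by (rule additiveI) (simp_all add: map additive_closed[OF h] additive_add[OF h])
  fix a b assume ab: "a \<in> carrier A" "b \<in> carrier B"
  then show "tensor_map R A' B' f g (pure_tensor R A B a b) = pure_tensor R A' B' (f a) (g b)"
    using map[OF P.tens_closed[OF ab]] hp by simp
qed

section \<open>Dual bases and lifting\<close>

text \<open>
  By the dual basis lemma, such data exist exactly on projective modules.  Compared with a complement in a
  free module they pass directly to subgroups of finite index in group rings, to extensions of scalars and to
  tensor products.
\<close>

definition dual_basis ::
    "'r ring \<Rightarrow> ('r, 'a) module \<Rightarrow> 'j set \<Rightarrow> ('j \<Rightarrow> 'a) \<Rightarrow> ('j \<Rightarrow> 'a \<Rightarrow> 'r) \<Rightarrow> bool"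
  where "dual_basis R P J b \<phi> \<longleftrightarrow>
    b \<in> J \<rightarrow> carrier P \<and>
    (\<forall>j\<in>J. additive P R (\<phi> j) \<and>
      (\<forall>r\<in>carrier R. \<forall>x\<in>carrier P. \<phi> j (r \<odot>\<^bsub>P\<^esub> x) = r \<otimes>\<^bsub>R\<^esub> \<phi> j x)) \<and>
    (\<forall>x\<in>carrier P. finite {j \<in> J. \<phi> j x \<noteq> \<zero>\<^bsub>R\<^esub>} \<and>
      x = (\<Oplus>\<^bsub>P\<^esub>j\<in>{j \<in> J. \<phi> j x \<noteq> \<zero>\<^bsub>R\<^esub>}. \<phi> j x \<odot>\<^bsub>P\<^esub> b j))"

lemma dual_basisD:
  assumes "dual_basis R P J b \<phi>"
  shows "\<And>j. j \<in> J \<Longrightarrow> b j \<in> carrier P"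
    and "\<And>j. j \<in> J \<Longrightarrow> additive P R (\<phi> j)"
    and "\<And>j r x. \<lbrakk>j \<in> J; r \<in> carrier R; x \<in> carrier P\<rbrakk> \<Longrightarrow> \<phi> j (r \<odot>\<^bsub>P\<^esub> x) = r \<otimes>\<^bsub>R\<^esub> \<phi> j x"
    and "\<And>x. x \<in> carrier P \<Longrightarrow> finite {j \<in> J. \<phi> j x \<noteq> \<zero>\<^bsub>R\<^esub>}"
    and "\<And>x. x \<in> carrier P \<Longrightarrow> (\<Oplus>\<^bsub>P\<^esub>j\<in>{j \<in> J. \<phi> j x \<noteq> \<zero>\<^bsub>R\<^esub>}. \<phi> j x \<odot>\<^bsub>P\<^esub> b j) = x"
    and "\<And>j x. \<lbrakk>j \<in> J; x \<in> carrier P\<rbrakk> \<Longrightarrow> \<phi> j x \<in> carrier R"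
  using assms unfolding dual_basis_def by (auto simp: additive_closed)

lemma dual_sum_extend:
  assumes N: "left_module R N" and db: "dual_basis R P J b \<phi>" and x: "x \<in> carrier P"
    and y: "y \<in> J \<rightarrow> carrier N"
    and K: "finite K" "K \<subseteq> J" "{j \<in> J. \<phi> j x \<noteq> \<zero>\<^bsub>R\<^esub>} \<subseteq> K"
  shows "(\<Oplus>\<^bsub>N\<^esub>j\<in>{j \<in> J. \<phi> j x \<noteq> \<zero>\<^bsub>R\<^esub>}. \<phi> j x \<odot>\<^bsub>N\<^esub> y j) = (\<Oplus>\<^bsub>N\<^esub>j\<in>K. \<phi> j x \<odot>\<^bsub>N\<^esub> y j)"
proof -
  interpret N: left_module R N by fact
  note db' = dual_basisD[OF db]
  show ?thesis
  proof (rule N.add.finprod_mono_neutral_cong_left[OF K(1) K(3)])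
    show "\<phi> j x \<odot>\<^bsub>N\<^esub> y j = \<zero>\<^bsub>N\<^esub>" if "j \<in> K - {j \<in> J. \<phi> j x \<noteq> \<zero>\<^bsub>R\<^esub>}" for j
    proof -
      have "\<phi> j x = \<zero>\<^bsub>R\<^esub>" "j \<in> J" using that K(2) by auto
      then show ?thesis using y N.smult_zero_left by auto
    qed
    show "(\<lambda>j. \<phi> j x \<odot>\<^bsub>N\<^esub> y j) \<in> K \<rightarrow> carrier N"
      using K(2) y db'(6) x N.smult_closed by blast
  qed simp
qed

lemma dual_basis_expand:
  assumes P: "left_module R P" and db: "dual_basis R P J b \<phi>" and J: "finite J" and x: "x \<in> carrier P"
  shows "(\<Oplus>\<^bsub>P\<^esub>j\<in>J. \<phi> j x \<odot>\<^bsub>P\<^esub> b j) = x"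
proof -
  have "b \<in> J \<rightarrow> carrier P" using dual_basisD(1)[OF db] by blast
  then show ?thesis
    using dual_sum_extend[OF P db x _ J subset_refl, of b] dual_basisD(5)[OF db x] by auto
qed

lemma dual_basis_hom:
  assumes P: "left_module R P" and N: "left_module R N" and db: "dual_basis R P J b \<phi>"
    and y: "y \<in> J \<rightarrow> carrier N"
  shows "(\<lambda>x. \<Oplus>\<^bsub>N\<^esub>j\<in>{j \<in> J. \<phi> j x \<noteq> \<zero>\<^bsub>R\<^esub>}. \<phi> j x \<odot>\<^bsub>N\<^esub> y j) \<in> module_homs R P N"
proof -
  interpret P: left_module R P by fact
  interpret N: left_module R N by fact
  note db' = dual_basisD[OF db]
  let ?S = "\<lambda>x. {j \<in> J. \<phi> j x \<noteq> \<zero>\<^bsub>R\<^esub>}"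
  let ?h = "\<lambda>x. \<Oplus>\<^bsub>N\<^esub>j\<in>?S x. \<phi> j x \<odot>\<^bsub>N\<^esub> y j"
  have cl: "(\<lambda>j. \<phi> j x \<odot>\<^bsub>N\<^esub> y j) \<in> K \<rightarrow> carrier N" if "K \<subseteq> J" "x \<in> carrier P" for K x
    using that y db'(6) N.smult_closed by blast
  show ?thesis
  proof (rule module_homsI)
    show "additive P N ?h"
    proof (rule additiveI)
      fix x assume x: "x \<in> carrier P"
      show "?h x \<in> carrier N" by (rule N.finsum_closed[OF cl]) (use x in auto)
    next
      fix x x' assume x: "x \<in> carrier P" and x': "x' \<in> carrier P"
      define K where "K = ?S x \<union> ?S x'"
      have K: "finite K" "K \<subseteq> J" using db'(4)[OF x] db'(4)[OF x'] by (auto simp: K_def)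
      have "\<phi> j (x \<oplus>\<^bsub>P\<^esub> x') = \<phi> j x \<oplus>\<^bsub>R\<^esub> \<phi> j x'" if "j \<in> J" for j
        using additive_add[OF db'(2)[OF that] x x'] .
      note add = this
      then have sub: "?S (x \<oplus>\<^bsub>P\<^esub> x') \<subseteq> K" by (auto simp: K_def)
      have "?h (x \<oplus>\<^bsub>P\<^esub> x') = (\<Oplus>\<^bsub>N\<^esub>j\<in>K. \<phi> j (x \<oplus>\<^bsub>P\<^esub> x') \<odot>\<^bsub>N\<^esub> y j)"
        using dual_sum_extend[OF N db _ y K sub] x x' by simp
      also have "\<dots> = (\<Oplus>\<^bsub>N\<^esub>j\<in>K. \<phi> j x \<odot>\<^bsub>N\<^esub> y j \<oplus>\<^bsub>N\<^esub> \<phi> j x' \<odot>\<^bsub>N\<^esub> y j)"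
      proof (rule N.add.finprod_cong'[OF refl])
        show "(\<lambda>j. \<phi> j x \<odot>\<^bsub>N\<^esub> y j \<oplus>\<^bsub>N\<^esub> \<phi> j x' \<odot>\<^bsub>N\<^esub> y j) \<in> K \<rightarrow> carrier N"
          using cl[OF K(2) x] cl[OF K(2) x'] by blast
        show "\<phi> j (x \<oplus>\<^bsub>P\<^esub> x') \<odot>\<^bsub>N\<^esub> y j = \<phi> j x \<odot>\<^bsub>N\<^esub> y j \<oplus>\<^bsub>N\<^esub> \<phi> j x' \<odot>\<^bsub>N\<^esub> y j" if "j \<in> K" for j
        proof -
          have j: "j \<in> J" using that K(2) by blast
          then have "y j \<in> carrier N" using y by blast
          then show ?thesis using j by (simp add: add N.smult_l_distr db'(6) x x')
        qed
      qed
      also have "\<dots> = (\<Oplus>\<^bsub>N\<^esub>j\<in>K. \<phi> j x \<odot>\<^bsub>N\<^esub> y j) \<oplus>\<^bsub>N\<^esub> (\<Oplus>\<^bsub>N\<^esub>j\<in>K. \<phi> j x' \<odot>\<^bsub>N\<^esub> y j)"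
        by (rule N.finsum_addf[OF cl[OF K(2) x] cl[OF K(2) x']])
      also have "(\<Oplus>\<^bsub>N\<^esub>j\<in>K. \<phi> j x \<odot>\<^bsub>N\<^esub> y j) = ?h x"
        by (rule dual_sum_extend[OF N db x y K, symmetric]) (auto simp: K_def)
      also have "(\<Oplus>\<^bsub>N\<^esub>j\<in>K. \<phi> j x' \<odot>\<^bsub>N\<^esub> y j) = ?h x'"
        by (rule dual_sum_extend[OF N db x' y K, symmetric]) (auto simp: K_def)
      finally show "?h (x \<oplus>\<^bsub>P\<^esub> x') = ?h x \<oplus>\<^bsub>N\<^esub> ?h x'" .
    qed
  next
    fix r x assume r: "r \<in> carrier R" and x: "x \<in> carrier P"
    let ?K = "?S x"
    have K: "finite ?K" "?K \<subseteq> J" using db'(4)[OF x] by auto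
    have sub: "?S (r \<odot>\<^bsub>P\<^esub> x) \<subseteq> ?K"
      using r by (auto simp: db'(3)[OF _ r x])
    have "?h (r \<odot>\<^bsub>P\<^esub> x) = (\<Oplus>\<^bsub>N\<^esub>j\<in>?K. \<phi> j (r \<odot>\<^bsub>P\<^esub> x) \<odot>\<^bsub>N\<^esub> y j)"
      by (rule dual_sum_extend[OF N db _ y K sub]) (use r x P.smult_closed in blast)
    also have "\<dots> = (\<Oplus>\<^bsub>N\<^esub>j\<in>?K. r \<odot>\<^bsub>N\<^esub> (\<phi> j x \<odot>\<^bsub>N\<^esub> y j))"
    proof (rule N.add.finprod_cong'[OF refl])
      show "(\<lambda>j. r \<odot>\<^bsub>N\<^esub> (\<phi> j x \<odot>\<^bsub>N\<^esub> y j)) \<in> ?K \<rightarrow> carrier N"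
        using cl[OF K(2) x] r N.smult_closed by blast
      show "\<phi> j (r \<odot>\<^bsub>P\<^esub> x) \<odot>\<^bsub>N\<^esub> y j = r \<odot>\<^bsub>N\<^esub> (\<phi> j x \<odot>\<^bsub>N\<^esub> y j)" if "j \<in> ?K" for j
      proof -
        have "j \<in> J" "y j \<in> carrier N" using that y by auto
        then show ?thesis by (simp add: db'(3)[OF _ r x] N.smult_assoc db'(6) r x)
      qed
    qed
    also have "\<dots> = r \<odot>\<^bsub>N\<^esub> ?h x"
      by (rule additive_finsum[OF N.M.abelian_group_axioms N.M.abelian_group_axioms N.additive_smult[OF r] cl[OF K(2) x], symmetric])
    finally show "?h (r \<odot>\<^bsub>P\<^esub> x) = r \<odot>\<^bsub>N\<^esub> ?h x" .
  qed
qed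

lemma hom_dual_sum:
  assumes N: "left_module R N" and N': "left_module R N'" and g: "g \<in> module_homs R N N'"
    and db: "dual_basis R P J b \<phi>" and x: "x \<in> carrier P" and y: "y \<in> J \<rightarrow> carrier N" and K: "K \<subseteq> J"
  shows "g (\<Oplus>\<^bsub>N\<^esub>j\<in>K. \<phi> j x \<odot>\<^bsub>N\<^esub> y j) = (\<Oplus>\<^bsub>N'\<^esub>j\<in>K. \<phi> j x \<odot>\<^bsub>N'\<^esub> g (y j))"
proof -
  interpret N: left_module R N by fact
  interpret N': left_module R N' by fact
  note db' = dual_basisD[OF db] and g' = module_homsD[OF g]
  have "g (\<Oplus>\<^bsub>N\<^esub>j\<in>K. \<phi> j x \<odot>\<^bsub>N\<^esub> y j) = (\<Oplus>\<^bsub>N'\<^esub>j\<in>K. g (\<phi> j x \<odot>\<^bsub>N\<^esub> y j))"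
    by (rule additive_finsum[OF N.M.abelian_group_axioms N'.M.abelian_group_axioms g'(1)])
      (use y K db'(6) x N.smult_closed in blast)
  also have "\<dots> = (\<Oplus>\<^bsub>N'\<^esub>j\<in>K. \<phi> j x \<odot>\<^bsub>N'\<^esub> g (y j))"
  proof (rule N'.add.finprod_cong'[OF refl])
    show "(\<lambda>j. \<phi> j x \<odot>\<^bsub>N'\<^esub> g (y j)) \<in> K \<rightarrow> carrier N'"
      using y K db'(6) x N'.smult_closed g'(2) by blast
    show "g (\<phi> j x \<odot>\<^bsub>N\<^esub> y j) = \<phi> j x \<odot>\<^bsub>N'\<^esub> g (y j)" if "j \<in> K" for j
      using that K y by (intro g'(3) db'(6) x) auto
  qed
  finally show ?thesis .
qed

text \<open>
  Projectivity: preimages of the values \<open>f (b j)\<close> are extended linearly by means of the functionals.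
\<close>

lemma dual_basis_lift:
  assumes P: "left_module R P" and N: "left_module R N" and N': "left_module R N'"
    and db: "dual_basis R P J b \<phi>"
    and f: "f \<in> module_homs R P N'" and g: "g \<in> module_homs R N N'"
    and im: "f ` carrier P \<subseteq> g ` carrier N"
  shows "\<exists>h\<in>module_homs R P N. \<forall>x\<in>carrier P. g (h x) = f x"
proof -
  note db' = dual_basisD[OF db]
  have "\<forall>j\<in>J. \<exists>z\<in>carrier N. g z = f (b j)"
  proof
    fix j assume "j \<in> J"
    then have "f (b j) \<in> g ` carrier N" using im db'(1) by blast
    then show "\<exists>z\<in>carrier N. g z = f (b j)" by auto
  qed
  then obtain y where y: "\<And>j. j \<in> J \<Longrightarrow> y j \<in> carrier N \<and> g (y j) = f (b j)"
    by metis
  then have yJ: "y \<in> J \<rightarrow> carrier N" by blast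
  let ?S = "\<lambda>x. {j \<in> J. \<phi> j x \<noteq> \<zero>\<^bsub>R\<^esub>}"
  let ?h = "\<lambda>x. \<Oplus>\<^bsub>N\<^esub>j\<in>?S x. \<phi> j x \<odot>\<^bsub>N\<^esub> y j"
  interpret N': left_module R N' by fact
  have "g (?h x) = f x" if x: "x \<in> carrier P" for x
  proof -
    have "g (?h x) = (\<Oplus>\<^bsub>N'\<^esub>j\<in>?S x. \<phi> j x \<odot>\<^bsub>N'\<^esub> g (y j))"
      by (rule hom_dual_sum[OF N N' g db x yJ]) blast
    also have "\<dots> = (\<Oplus>\<^bsub>N'\<^esub>j\<in>?S x. \<phi> j x \<odot>\<^bsub>N'\<^esub> f (b j))"
      by (rule N'.add.finprod_cong'[OF refl])
        (auto simp: y db'(1,6) x N'.smult_closed module_homsD(2)[OF f])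
    also have "\<dots> = f (\<Oplus>\<^bsub>P\<^esub>j\<in>?S x. \<phi> j x \<odot>\<^bsub>P\<^esub> b j)"
      by (rule hom_dual_sum[OF P N' f db x, symmetric]) (use db'(1) in blast)+
    also have "\<dots> = f x" by (rule arg_cong[of _ _ f]) (rule db'(5)[OF x])
    finally show ?thesis .
  qed
  then have "\<forall>x\<in>carrier P. g (?h x) = f x" by (rule ballI)
  then show ?thesis by (rule bexI[OF _ dual_basis_hom[OF P N db yJ]])
qed

text \<open>
  The map \<open>e\<^bsub>n+1\<^esub> - h\<^sub>n \<delta>\<close> takes its values in the cycles, hence in the boundaries, and \<open>h\<^bsub>n+1\<^esub>\<close> is
  obtained by lifting it.
\<close>

lemma null_homotopy:
  fixes X :: "nat \<Rightarrow> ('r, 'a) module" and Y :: "nat \<Rightarrow> ('r, 'b) module"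
  assumes X: "\<And>n. left_module R (X n)" and Y: "\<And>n. left_module R (Y n)"
    and DX: "\<And>n. DX n \<in> module_homs R (X (Suc n)) (X n)"
    and DY: "\<And>n. DY n \<in> module_homs R (Y (Suc n)) (Y n)"
    and DDX: "\<And>n x. x \<in> carrier (X (Suc (Suc n))) \<Longrightarrow> DX n (DX (Suc n) x) = \<zero>\<^bsub>X n\<^esub>"
    and db: "\<And>n. dual_basis R (X n) (J n) (b n) (\<phi> n)"
    and e: "\<And>n. e n \<in> module_homs R (X n) (Y n)"
    and comm: "\<And>n x. x \<in> carrier (X (Suc n)) \<Longrightarrow> DY n (e (Suc n) x) = e n (DX n x)"
    and e0: "e 0 ` carrier (X 0) \<subseteq> DY 0 ` carrier (Y (Suc 0))"
    and exact: "\<And>n y. y \<in> carrier (Y (Suc n)) \<Longrightarrow> DY n y = \<zero>\<^bsub>Y n\<^esub> \<Longrightarrow> y \<in> DY (Suc n) ` carrier (Y (Suc (Suc n)))"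
  obtains h where "\<And>n. h n \<in> module_homs R (X n) (Y (Suc n))"
    and "\<And>x. x \<in> carrier (X 0) \<Longrightarrow> DY 0 (h 0 x) = e 0 x"
    and "\<And>n x. x \<in> carrier (X (Suc n)) \<Longrightarrow> DY (Suc n) (h (Suc n) x) \<oplus>\<^bsub>Y (Suc n)\<^esub> h n (DX n x) = e (Suc n) x"
proof -
  define good where "good = (\<lambda>n h. h \<in> module_homs R (X n) (Y (Suc n)) \<and>
     (n = 0 \<longrightarrow> (\<forall>x\<in>carrier (X 0). DY 0 (h x) = e 0 x)) \<and>
     (\<forall>x\<in>carrier (X (Suc n)). DY n (h (DX n x)) = e n (DX n x)))"
  define step where "step = (\<lambda>n h h'. \<forall>x\<in>carrier (X (Suc n)).
     DY (Suc n) (h' x) \<oplus>\<^bsub>Y (Suc n)\<^esub> h (DX n x) = e (Suc n) x)"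
  note DX' = module_homsD[OF DX] and DY' = module_homsD[OF DY] and e' = module_homsD[OF e]
  have "\<exists>h. \<forall>n. good n (h n) \<and> step n (h n) (h (Suc n))"
  proof (rule dependent_nat_choice)
    show "\<exists>h. good 0 h"
      using dual_basis_lift[OF X Y Y db e DY e0] DX'(2) unfolding good_def by metis
  next
    fix h n assume "good n h"
    then have h: "h \<in> module_homs R (X n) (Y (Suc n))"
      and hD: "\<And>x. x \<in> carrier (X (Suc n)) \<Longrightarrow> DY n (h (DX n x)) = e n (DX n x)"
      by (auto simp: good_def)
    note h' = module_homsD[OF h]
    interpret X0: left_module R "X n" by (rule X)
    interpret Y0: left_module R "Y n" by (rule Y)
    interpret Y1: left_module R "Y (Suc n)" by (rule Y)
    have hDX: "(\<lambda>x. h (DX n x)) \<in> module_homs R (X (Suc n)) (Y (Suc n))"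
      by (rule module_homs_compose[OF DX h])
    let ?f = "\<lambda>x. e (Suc n) x \<ominus>\<^bsub>Y (Suc n)\<^esub> h (DX n x)"
    have f: "?f \<in> module_homs R (X (Suc n)) (Y (Suc n))"
      by (rule module_homs_diff[OF X Y e hDX])
    have "?f ` carrier (X (Suc n)) \<subseteq> DY (Suc n) ` carrier (Y (Suc (Suc n)))"
    proof
      fix y assume "y \<in> ?f ` carrier (X (Suc n))"
      then obtain x where x: "x \<in> carrier (X (Suc n))" "y = ?f x" by blast
      have "DY n y = DY n (e (Suc n) x) \<ominus>\<^bsub>Y n\<^esub> DY n (h (DX n x))"
        unfolding x(2)
        by (rule additive_diff[OF Y1.M.abelian_group_axioms Y0.M.abelian_group_axioms DY'(1)])
          (simp_all add: x(1) e'(2) h'(2) DX'(2))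
      also have "\<dots> = \<zero>\<^bsub>Y n\<^esub>"
        using x(1) by (simp add: comm hD Y0.diff_self e'(2) DX'(2))
      finally show "y \<in> DY (Suc n) ` carrier (Y (Suc (Suc n)))"
        using exact[of y n] module_homsD(2)[OF f] x by blast
    qed
    then obtain k where k: "k \<in> module_homs R (X (Suc n)) (Y (Suc (Suc n)))"
      and kf: "\<And>x. x \<in> carrier (X (Suc n)) \<Longrightarrow> DY (Suc n) (k x) = ?f x"
      using dual_basis_lift[OF X Y Y db f DY] by blast
    have "DY (Suc n) (k (DX (Suc n) x)) = e (Suc n) (DX (Suc n) x)"
      if "x \<in> carrier (X (Suc (Suc n)))" for x
    proof -
      have "h (DX n (DX (Suc n) x)) = \<zero>\<^bsub>Y (Suc n)\<^esub>"
        using additive_zero[OF X0.M.abelian_group_axioms Y1.M.abelian_group_axioms h'(1)] that by (simp add: DDX)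
      then show ?thesis
        using that kf[OF DX'(2)] e'(2)[OF DX'(2)] by (simp add: a_minus_def)
    qed
    moreover have "DY (Suc n) (k x) \<oplus>\<^bsub>Y (Suc n)\<^esub> h (DX n x) = e (Suc n) x" if "x \<in> carrier (X (Suc n))" for x
      using that by (simp add: kf Y1.diff_add_cancel e'(2) h'(2) DX'(2))
    ultimately show "\<exists>k. good (Suc n) k \<and> step n h k"
      using k unfolding good_def step_def by blast
  qed
  then show thesis
    using that unfolding good_def step_def by metis
qed

text \<open>
  The comparison theorem for projective resolutions: \<open>f\<^bsub>n+1\<^esub>\<close> lifts \<open>f\<^sub>n \<delta>\<close>, whose values are cycles and therefore
  boundaries.
\<close>

lemma chain_map_lift:
  fixes X :: "nat \<Rightarrow> ('r, 'a) module" and Y :: "nat \<Rightarrow> ('r, 'b) module"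
  assumes X: "\<And>n. left_module R (X n)" and Y: "\<And>n. left_module R (Y n)" and M: "left_module R M"
    and DX: "\<And>n. DX n \<in> module_homs R (X (Suc n)) (X n)"
    and DY: "\<And>n. DY n \<in> module_homs R (Y (Suc n)) (Y n)"
    and a: "\<alpha> \<in> module_homs R (X 0) M" and b: "\<beta> \<in> module_homs R (Y 0) M"
    and DDX: "\<And>n x. x \<in> carrier (X (Suc (Suc n))) \<Longrightarrow> DX n (DX (Suc n) x) = \<zero>\<^bsub>X n\<^esub>"
    and aD: "\<And>x. x \<in> carrier (X (Suc 0)) \<Longrightarrow> \<alpha> (DX 0 x) = \<zero>\<^bsub>M\<^esub>"
    and db: "\<And>n. dual_basis R (X n) (J n) (b n) (\<phi> n)"
    and surj: "\<alpha> ` carrier (X 0) \<subseteq> \<beta> ` carrier (Y 0)"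
    and exact0: "\<And>y. y \<in> carrier (Y 0) \<Longrightarrow> \<beta> y = \<zero>\<^bsub>M\<^esub> \<Longrightarrow> y \<in> DY 0 ` carrier (Y (Suc 0))"
    and exact: "\<And>n y. y \<in> carrier (Y (Suc n)) \<Longrightarrow> DY n y = \<zero>\<^bsub>Y n\<^esub> \<Longrightarrow> y \<in> DY (Suc n) ` carrier (Y (Suc (Suc n)))"
  obtains f where "\<And>n. f n \<in> module_homs R (X n) (Y n)"
    and "\<And>x. x \<in> carrier (X 0) \<Longrightarrow> \<beta> (f 0 x) = \<alpha> x"
    and "\<And>n x. x \<in> carrier (X (Suc n)) \<Longrightarrow> DY n (f (Suc n) x) = f n (DX n x)"
proof -
  define good where "good = (\<lambda>n f. f \<in> module_homs R (X n) (Y n) \<and>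
     (n = 0 \<longrightarrow> (\<forall>x\<in>carrier (X 0). \<beta> (f x) = \<alpha> x)) \<and>
     (\<forall>x\<in>carrier (X (Suc n)). f (DX n x) \<in> DY n ` carrier (Y (Suc n))))"
  define step where "step = (\<lambda>n f f'. \<forall>x\<in>carrier (X (Suc n)). DY n (f' x) = f (DX n x))"
  note DX' = module_homsD[OF DX] and DY' = module_homsD[OF DY]
  have "\<exists>f. \<forall>n. good n (f n) \<and> step n (f n) (f (Suc n))"
  proof (rule dependent_nat_choice)
    obtain f where f: "f \<in> module_homs R (X 0) (Y 0)" "\<forall>x\<in>carrier (X 0). \<beta> (f x) = \<alpha> x"
      using dual_basis_lift[OF X Y M db a b surj] by blast
    moreover have "f (DX 0 x) \<in> DY 0 ` carrier (Y (Suc 0))" if "x \<in> carrier (X (Suc 0))" for x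
      using exact0[OF module_homsD(2)[OF f(1)]] f(2) DX'(2)[OF that] aD[OF that] by simp
    ultimately show "\<exists>f. good 0 f" unfolding good_def by blast
  next
    fix f n assume "good n f"
    then have f: "f \<in> module_homs R (X n) (Y n)"
      and fD: "\<And>x. x \<in> carrier (X (Suc n)) \<Longrightarrow> f (DX n x) \<in> DY n ` carrier (Y (Suc n))"
      by (auto simp: good_def)
    interpret X0: left_module R "X n" by (rule X)
    interpret Y0: left_module R "Y n" by (rule Y)
    obtain k where k: "k \<in> module_homs R (X (Suc n)) (Y (Suc n))"
      and kf: "\<And>x. x \<in> carrier (X (Suc n)) \<Longrightarrow> DY n (k x) = f (DX n x)"
      using dual_basis_lift[OF X Y Y db module_homs_compose[OF DX f] DY] fD by blast
    have "k (DX (Suc n) x) \<in> DY (Suc n) ` carrier (Y (Suc (Suc n)))"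
      if "x \<in> carrier (X (Suc (Suc n)))" for x
    proof (rule exact)
      show "k (DX (Suc n) x) \<in> carrier (Y (Suc n))"
        using module_homsD(2)[OF k] DX'(2) that by blast
      show "DY n (k (DX (Suc n) x)) = \<zero>\<^bsub>Y n\<^esub>"
        using additive_zero[OF X0.M.abelian_group_axioms Y0.M.abelian_group_axioms module_homsD(1)[OF f]]
          that kf[OF DX'(2)] by (simp add: DDX)
    qed
    then show "\<exists>k. good (Suc n) k \<and> step n f k"
      using k kf unfolding good_def step_def by blast
  qed
  then show thesis
    using that unfolding good_def step_def by metis
qed

section \<open>Free modules and finitely generated projective modules\<close>

lemma free_module_simps:
  "carrier (free_module R X) = {f. (\<forall>x. f x \<in> carrier R) \<and> finite {x. f x \<noteq> \<zero>\<^bsub>R\<^esub>} \<and> {x. f x \<noteq> \<zero>\<^bsub>R\<^esub>} \<subseteq> X}"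
  "f \<oplus>\<^bsub>free_module R X\<^esub> g = (\<lambda>x. f x \<oplus>\<^bsub>R\<^esub> g x)"
  "\<zero>\<^bsub>free_module R X\<^esub> = (\<lambda>x. \<zero>\<^bsub>R\<^esub>)"
  "r \<odot>\<^bsub>free_module R X\<^esub> f = (\<lambda>x. r \<otimes>\<^bsub>R\<^esub> f x)"
  by (simp_all add: free_module_def)

lemma left_module_free_module:
  fixes R :: "'r ring"
  assumes "ring R"
  shows "left_module R (free_module R X)"
proof -
  interpret R: ring R by fact
  let ?F = "free_module R X"
  have add: "(\<lambda>x. f x \<oplus>\<^bsub>R\<^esub> g x) \<in> carrier ?F" if "f \<in> carrier ?F" "g \<in> carrier ?F" for f g
  proof -
    have "{x. f x \<oplus>\<^bsub>R\<^esub> g x \<noteq> \<zero>\<^bsub>R\<^esub>} \<subseteq> {x. f x \<noteq> \<zero>\<^bsub>R\<^esub>} \<union> {x. g x \<noteq> \<zero>\<^bsub>R\<^esub>}" by auto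
    then show ?thesis
      using that finite_subset unfolding free_module_simps by blast
  qed
  have sm: "(\<lambda>x. r \<otimes>\<^bsub>R\<^esub> f x) \<in> carrier ?F" if "r \<in> carrier R" "f \<in> carrier ?F" for r f
  proof -
    have "{x. r \<otimes>\<^bsub>R\<^esub> f x \<noteq> \<zero>\<^bsub>R\<^esub>} \<subseteq> {x. f x \<noteq> \<zero>\<^bsub>R\<^esub>}" using that(1) by auto
    then show ?thesis
      using that finite_subset unfolding free_module_simps by blast
  qed
  have cl: "f x \<in> carrier R" if "f \<in> carrier ?F" for f x
    using that by (simp add: free_module_simps)
  have F: "abelian_group ?F"
  proof (rule abelian_groupI)
    fix f assume f: "f \<in> carrier ?F"
    show "\<exists>g\<in>carrier ?F. g \<oplus>\<^bsub>?F\<^esub> f = \<zero>\<^bsub>?F\<^esub>"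
    proof
      show "(\<lambda>x. (\<ominus>\<^bsub>R\<^esub> \<one>\<^bsub>R\<^esub>) \<otimes>\<^bsub>R\<^esub> f x) \<in> carrier ?F" by (rule sm) (use f in auto)
      show "(\<lambda>x. (\<ominus>\<^bsub>R\<^esub> \<one>\<^bsub>R\<^esub>) \<otimes>\<^bsub>R\<^esub> f x) \<oplus>\<^bsub>?F\<^esub> f = \<zero>\<^bsub>?F\<^esub>"
        using cl[OF f] by (simp add: free_module_simps R.l_minus R.l_neg)
    qed
  next
    show "\<zero>\<^bsub>?F\<^esub> \<in> carrier ?F" by (simp add: free_module_simps)
  qed (use add cl in \<open>auto simp: free_module_simps(2,3) R.a_assoc intro!: ext R.a_comm\<close>)
  interpret F: abelian_group ?F by fact
  show ?thesis
    by unfold_locales (use sm cl in \<open>auto simp: free_module_simps(2,4) R.l_distr R.r_distr R.m_assoc\<close>)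
qed

definition unit_vector :: "'r ring \<Rightarrow> 'x \<Rightarrow> 'x \<Rightarrow> 'r"
  where "unit_vector R x = (\<lambda>y. if y = x then \<one>\<^bsub>R\<^esub> else \<zero>\<^bsub>R\<^esub>)"

lemma additive_eval: "additive (free_module R X) R (\<lambda>v. v x)"
  by (rule additiveI) (simp_all add: free_module_simps)

lemma dual_basis_free_module:
  fixes R :: "'r ring"
  assumes "ring R"
  shows "dual_basis R (free_module R X) X (unit_vector R) (\<lambda>x v. v x)"
proof -
  interpret R: ring R by fact
  interpret F: left_module R "free_module R X" by (rule left_module_free_module) fact
  have e: "unit_vector R x \<in> carrier (free_module R X)" if "x \<in> X" for x
    using that by (auto simp: unit_vector_def free_module_simps)
  show ?thesis
    unfolding dual_basis_def
  proof (intro conjI ballI)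
    show "unit_vector R \<in> X \<rightarrow> carrier (free_module R X)" using e by blast
    fix v assume v: "v \<in> carrier (free_module R X)"
    have v': "\<And>x. v x \<in> carrier R" "finite {x. v x \<noteq> \<zero>\<^bsub>R\<^esub>}" "\<And>x. v x \<noteq> \<zero>\<^bsub>R\<^esub> \<Longrightarrow> x \<in> X"
      using v by (auto simp: free_module_simps)
    let ?S = "{x \<in> X. v x \<noteq> \<zero>\<^bsub>R\<^esub>}"
    have S: "?S = {x. v x \<noteq> \<zero>\<^bsub>R\<^esub>}" using v'(3) by auto
    then show fin: "finite ?S" using v'(2) by simp
    have cl: "(\<lambda>x. v x \<odot>\<^bsub>free_module R X\<^esub> unit_vector R x) \<in> ?S \<rightarrow> carrier (free_module R X)"
      using e v'(1) F.smult_closed by blast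
    show "v = (\<Oplus>\<^bsub>free_module R X\<^esub>x\<in>?S. v x \<odot>\<^bsub>free_module R X\<^esub> unit_vector R x)"
    proof
      fix y
      have "(\<Oplus>\<^bsub>free_module R X\<^esub>x\<in>?S. v x \<odot>\<^bsub>free_module R X\<^esub> unit_vector R x) y
          = (\<Oplus>\<^bsub>R\<^esub>x\<in>?S. (v x \<odot>\<^bsub>free_module R X\<^esub> unit_vector R x) y)"
        by (rule additive_finsum[OF F.M.abelian_group_axioms R.is_abelian_group additive_eval cl])
      also have "\<dots> = (\<Oplus>\<^bsub>R\<^esub>x\<in>?S. if y = x then v x else \<zero>\<^bsub>R\<^esub>)"
        by (rule R.finsum_cong') (auto simp: free_module_simps unit_vector_def v')
      also have "\<dots> = v y"
      proof (cases "y \<in> ?S")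
        case True
        then show ?thesis using R.finsum_singleton[OF True fin, of v] v'(1) by auto
      next
        case False
        then have "v y = \<zero>\<^bsub>R\<^esub>" using v'(3) by auto
        moreover have "(\<Oplus>\<^bsub>R\<^esub>x\<in>?S. if y = x then v x else \<zero>\<^bsub>R\<^esub>) = (\<Oplus>\<^bsub>R\<^esub>x\<in>?S. \<zero>\<^bsub>R\<^esub>)"
          using False by (intro R.finsum_cong') auto
        ultimately show ?thesis by (simp add: R.finsum_zero)
      qed
      finally show "v y = (\<Oplus>\<^bsub>free_module R X\<^esub>x\<in>?S. v x \<odot>\<^bsub>free_module R X\<^esub> unit_vector R x) y" by simp
    qed
  qed (auto simp: additive_eval free_module_simps)
qed

lemma dual_basis_retract:
  assumes L: "left_module R L" and P: "left_module R P" and db: "dual_basis R L J b \<phi>"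
    and i: "i \<in> module_homs R P L" and r: "r \<in> module_homs R L P"
    and ri: "\<And>x. x \<in> carrier P \<Longrightarrow> r (i x) = x"
  shows "dual_basis R P J (\<lambda>j. r (b j)) (\<lambda>j x. \<phi> j (i x))"
proof -
  note db' = dual_basisD[OF db] and i' = module_homsD[OF i] and r' = module_homsD[OF r]
  have "x = (\<Oplus>\<^bsub>P\<^esub>j\<in>{j \<in> J. \<phi> j (i x) \<noteq> \<zero>\<^bsub>R\<^esub>}. \<phi> j (i x) \<odot>\<^bsub>P\<^esub> r (b j))" if x: "x \<in> carrier P" for x
    using hom_dual_sum[OF L P r db i'(2)[OF x], of b "{j \<in> J. \<phi> j (i x) \<noteq> \<zero>\<^bsub>R\<^esub>}"] db'(1) db'(5)[OF i'(2)[OF x]]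
    by (auto simp: ri[OF x])
  then show ?thesis
    unfolding dual_basis_def
    by (auto simp: db' i' r' intro!: additive_compose[OF i'(1) db'(2)])
qed

lemma direct_sum_simps:
  "carrier (direct_sum M N) = carrier M \<times> carrier N"
  "(x, y) \<oplus>\<^bsub>direct_sum M N\<^esub> (x', y') = (x \<oplus>\<^bsub>M\<^esub> x', y \<oplus>\<^bsub>N\<^esub> y')"
  "r \<odot>\<^bsub>direct_sum M N\<^esub> (x, y) = (r \<odot>\<^bsub>M\<^esub> x, r \<odot>\<^bsub>N\<^esub> y)"
  by (simp_all add: direct_sum_def)

lemma module_homs_inverse:
  assumes M: "\<And>x y. x \<in> carrier M \<Longrightarrow> y \<in> carrier M \<Longrightarrow> x \<oplus>\<^bsub>M\<^esub> y \<in> carrier M"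
    "\<And>r x. r \<in> carrier R \<Longrightarrow> x \<in> carrier M \<Longrightarrow> r \<odot>\<^bsub>M\<^esub> x \<in> carrier M"
    and f: "f \<in> module_homs R M N" and bij: "bij_betw f (carrier M) (carrier N)"
  shows "inv_into (carrier M) f \<in> module_homs R N M"
proof -
  let ?g = "inv_into (carrier M) f"
  note f' = module_homsD[OF f]
  have g: "?g y \<in> carrier M" "f (?g y) = y" if "y \<in> carrier N" for y
    using that bij by (auto simp: bij_betw_def inv_into_into f_inv_into_f)
  have gf: "?g (f x) = x" if "x \<in> carrier M" for x
    using that bij by (simp add: bij_betw_def)
  show ?thesis
  proof (intro module_homsI additiveI)
    fix x y assume x: "x \<in> carrier N" and y: "y \<in> carrier N"
    have "f (?g x \<oplus>\<^bsub>M\<^esub> ?g y) = x \<oplus>\<^bsub>N\<^esub> y"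
      using additive_add[OF f'(1)] g x y by simp
    then show "?g (x \<oplus>\<^bsub>N\<^esub> y) = ?g x \<oplus>\<^bsub>M\<^esub> ?g y"
      using gf[OF M(1)[OF g(1)[OF x] g(1)[OF y]]] by simp
  next
    fix r x assume r: "r \<in> carrier R" and x: "x \<in> carrier N"
    have "f (r \<odot>\<^bsub>M\<^esub> ?g x) = r \<odot>\<^bsub>N\<^esub> x"
      using f'(3) g r x by simp
    then show "?g (r \<odot>\<^bsub>N\<^esub> x) = r \<odot>\<^bsub>M\<^esub> ?g x"
      using gf[OF M(2)[OF r g(1)[OF x]]] by simp
  qed (rule g)
qed

text \<open>
  A direct summand of a free module inherits a dual basis from the unit vectors.  Only finitely many of its
  functionals are nonzero on a given finite generating set, and the others vanish identically.
\<close>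

lemma fg_projective_dual_basis:
  fixes P :: "('r, 'a) module"
  assumes P: "left_module R P" and fg: "finitely_generated R P" and proj: "projective R P"
  obtains J :: "'a set" and b \<phi> where "finite J" "dual_basis R P J b \<phi>"
proof -
  interpret P: left_module R P by fact
  obtain X :: "'a set" and Q :: "('r, 'a \<Rightarrow> 'r) module"
    where Q: "left_module R Q" and iso: "module_isomorphic R (direct_sum P Q) (free_module R X)"
    using proj unfolding projective_def by blast
  interpret Q: left_module R Q by fact
  let ?D = "direct_sum P Q" and ?F = "free_module R X"
  obtain f where f: "f \<in> module_homs R ?D ?F" and bij: "bij_betw f (carrier ?D) (carrier ?F)"
    using iso unfolding module_isomorphic_def by blast
  let ?g = "inv_into (carrier ?D) f"
  have g: "?g \<in> module_homs R ?F ?D"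
    by (rule module_homs_inverse[OF _ _ f bij])
      (auto simp: direct_sum_simps P.smult_closed Q.smult_closed)
  have i: "(\<lambda>x. f (x, \<zero>\<^bsub>Q\<^esub>)) \<in> module_homs R P ?F"
  proof (rule module_homs_compose[OF _ f])
    show "(\<lambda>x. (x, \<zero>\<^bsub>Q\<^esub>)) \<in> module_homs R P ?D"
      by (auto simp: module_homs_def direct_sum_simps Q.smult_zero_right)
  qed
  have r: "(\<lambda>v. fst (?g v)) \<in> module_homs R ?F P"
  proof (rule module_homs_compose[OF g])
    show "fst \<in> module_homs R ?D P"
      by (auto simp: module_homs_def direct_sum_simps)
  qed
  have ri: "fst (?g (f (x, \<zero>\<^bsub>Q\<^esub>))) = x" if "x \<in> carrier P" for x
    using that bij by (simp add: bij_betw_def direct_sum_simps)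
  obtain b \<phi> where db: "dual_basis R P X b \<phi>"
    using dual_basis_retract[where i = "\<lambda>x. f (x, \<zero>\<^bsub>Q\<^esub>)" and r = "\<lambda>v. fst (?g v)",
        OF left_module_free_module[OF P.R.ring_axioms] P dual_basis_free_module[OF P.R.ring_axioms] i r ri]
    by blast
  note db' = dual_basisD[OF db]
  obtain S where S: "finite S" "S \<subseteq> carrier P"
    and gen: "\<And>x. x \<in> carrier P \<Longrightarrow> \<exists>c \<in> S \<rightarrow> carrier R. x = (\<Oplus>\<^bsub>P\<^esub>s\<in>S. c s \<odot>\<^bsub>P\<^esub> s)"
    using fg unfolding finitely_generated_def by blast
  define J where "J = (\<Union>s\<in>S. {j \<in> X. \<phi> j s \<noteq> \<zero>\<^bsub>R\<^esub>})"
  have J: "finite J" "J \<subseteq> X" using S db'(4) by (auto simp: J_def)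
  have zero: "\<phi> j x = \<zero>\<^bsub>R\<^esub>" if j: "j \<in> X" "j \<notin> J" and x: "x \<in> carrier P" for j x
  proof -
    obtain c where c: "c \<in> S \<rightarrow> carrier R" "x = (\<Oplus>\<^bsub>P\<^esub>s\<in>S. c s \<odot>\<^bsub>P\<^esub> s)"
      using gen[OF x] by blast
    have cl: "(\<lambda>s. c s \<odot>\<^bsub>P\<^esub> s) \<in> S \<rightarrow> carrier P"
      using c(1) S(2) P.smult_closed by blast
    have "\<phi> j x = (\<Oplus>\<^bsub>R\<^esub>s\<in>S. \<phi> j (c s \<odot>\<^bsub>P\<^esub> s))"
      unfolding c(2) by (rule additive_finsum[OF P.M.abelian_group_axioms P.R.is_abelian_group db'(2)[OF j(1)] cl])
    also have "\<dots> = (\<Oplus>\<^bsub>R\<^esub>s\<in>S. \<zero>\<^bsub>R\<^esub>)"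
    proof (rule P.R.finsum_cong'[OF refl])
      fix s assume s: "s \<in> S"
      then have "\<phi> j s = \<zero>\<^bsub>R\<^esub>" using j by (auto simp: J_def)
      moreover have "c s \<in> carrier R" "s \<in> carrier P" using s c(1) S(2) by auto
      ultimately show "\<phi> j (c s \<odot>\<^bsub>P\<^esub> s) = \<zero>\<^bsub>R\<^esub>" using db'(3)[OF j(1)] by simp
    qed simp
    finally show ?thesis by (simp add: P.R.finsum_zero)
  qed
  then have eq: "{j \<in> X. \<phi> j x \<noteq> \<zero>\<^bsub>R\<^esub>} = {j \<in> J. \<phi> j x \<noteq> \<zero>\<^bsub>R\<^esub>}" if "x \<in> carrier P" for x
    using that J(2) by auto
  have "dual_basis R P J b \<phi>"
    unfolding dual_basis_def
  proof (intro conjI ballI)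
    fix x assume x: "x \<in> carrier P"
    show "finite {j \<in> J. \<phi> j x \<noteq> \<zero>\<^bsub>R\<^esub>}" using J(1) by simp
    show "x = (\<Oplus>\<^bsub>P\<^esub>j\<in>{j \<in> J. \<phi> j x \<noteq> \<zero>\<^bsub>R\<^esub>}. \<phi> j x \<odot>\<^bsub>P\<^esub> b j)"
      using db'(5)[OF x] by (simp only: eq[OF x])
  next
    show "b \<in> J \<rightarrow> carrier P" using J(2) db'(1) by blast
  next
    fix j assume "j \<in> J"
    then have j: "j \<in> X" using J(2) by blast
    show "additive P R (\<phi> j)" by (rule db'(2)[OF j])
    show "\<phi> j (r \<odot>\<^bsub>P\<^esub> x) = r \<otimes>\<^bsub>R\<^esub> \<phi> j x" if "r \<in> carrier R" "x \<in> carrier P" for r x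
      by (rule db'(3)[OF j that])
  qed
  then show thesis by (rule that[OF J(1)])
qed

section \<open>Coordinates on a tensor product\<close>

text \<open>
  For an \<open>R\<close>-linear functional \<open>f\<close> on \<open>P\<close>, the map \<open>A \<otimes> P \<rightarrow> A\<close> with \<open>a \<otimes> x \<mapsto> a f(x)\<close>.
\<close>

definition tensor_coordinate ::
    "'r ring \<Rightarrow> ('r, 'a) module \<Rightarrow> ('r, 'b) module \<Rightarrow> ('b \<Rightarrow> 'r) \<Rightarrow> ('a \<times> 'b \<Rightarrow>\<^sub>0 int) set \<Rightarrow> 'a"
  where "tensor_coordinate R A P f = (SOME c. additive (additive_tensor R A P) A c \<and>
    (\<forall>a\<in>carrier A. \<forall>x\<in>carrier P. c (pure_tensor R A P a x) = f x \<odot>\<^bsub>A\<^esub> a))"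

context tensor_pair
begin

lemma tensor_coordinate:
  assumes f: "additive B R f" "\<And>r x. r \<in> carrier R \<Longrightarrow> x \<in> carrier B \<Longrightarrow> f (r \<odot>\<^bsub>B\<^esub> x) = r \<otimes>\<^bsub>R\<^esub> f x"
  shows "additive T A (tensor_coordinate R A B f)"
    and "\<And>a x. a \<in> carrier A \<Longrightarrow> x \<in> carrier B \<Longrightarrow> tensor_coordinate R A B f (tens a x) = f x \<odot>\<^bsub>A\<^esub> a"
proof -
  note fc = additive_closed[OF f(1)]
  have "\<exists>c. additive T A c \<and> (\<forall>a\<in>carrier A. \<forall>x\<in>carrier B. c (tens a x) = f x \<odot>\<^bsub>A\<^esub> a)"
  proof (rule tensor_universal[OF A.M.abelian_group_axioms, of "\<lambda>a x. f x \<odot>\<^bsub>A\<^esub> a"])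
    fix r a b assume "r \<in> carrier R" "a \<in> carrier A" "b \<in> carrier B"
    then show "f b \<odot>\<^bsub>A\<^esub> (r \<odot>\<^bsub>A\<^esub> a) = f (r \<odot>\<^bsub>B\<^esub> b) \<odot>\<^bsub>A\<^esub> a"
      using A.smult_assoc f(2) fc by simp
  qed (auto simp: A.smult_closed A.smult_l_distr A.smult_r_distr fc additive_add[OF f(1)])
  from someI_ex[OF this]
  show "additive T A (tensor_coordinate R A B f)"
    and "\<And>a x. a \<in> carrier A \<Longrightarrow> x \<in> carrier B \<Longrightarrow> tensor_coordinate R A B f (tens a x) = f x \<odot>\<^bsub>A\<^esub> a"
    unfolding tensor_coordinate_def by auto
qed

text \<open>
  On pure tensors, the coefficient \<open>\<phi>\<^sub>j(x)\<close> moves across the tensor sign, and the sum becomes the expansion of \<open>x\<close>.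
\<close>

lemma tensor_expand:
  assumes J: "finite J" and db: "dual_basis R B J b \<phi>" and t: "t \<in> carrier T"
  shows "(\<Oplus>\<^bsub>T\<^esub>j\<in>J. tens (tensor_coordinate R A B (\<phi> j) t) (b j)) = t"
proof -
  note db' = dual_basisD[OF db]
  let ?c = "\<lambda>j. tensor_coordinate R A B (\<phi> j)"
  have c: "additive T A (?c j)" "\<And>a x. a \<in> carrier A \<Longrightarrow> x \<in> carrier B \<Longrightarrow> ?c j (tens a x) = \<phi> j x \<odot>\<^bsub>A\<^esub> a"
    if "j \<in> J" for j
    using tensor_coordinate[of "\<phi> j"] db'(2,3)[OF that] by auto
  have cl: "(\<lambda>j. tens (?c j t) (b j)) \<in> J \<rightarrow> carrier T" if "t \<in> carrier T" for t
    using that by (intro funcsetI tens_closed additive_closed[OF c(1)] db'(1))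
  show ?thesis
    using t
  proof (induction rule: tensor_induct)
    case (tens a x)
    have "(\<Oplus>\<^bsub>T\<^esub>j\<in>J. tens (?c j (tens a x)) (b j)) = (\<Oplus>\<^bsub>T\<^esub>j\<in>J. tens a (\<phi> j x \<odot>\<^bsub>B\<^esub> b j))"
      by (rule T.finsum_cong')
        (auto simp: c(2) tens_balanced B.smult_closed tens db'(1,6))
    also have "\<dots> = tens a (\<Oplus>\<^bsub>B\<^esub>j\<in>J. \<phi> j x \<odot>\<^bsub>B\<^esub> b j)"
      by (rule additive_finsum[OF B.M.abelian_group_axioms T.abelian_group_axioms additive_tens_right[OF tens(1)], symmetric])
        (use tens in \<open>intro funcsetI B.smult_closed db'(1,6)\<close>)
    also have "\<dots> = tens a x"
      by (rule arg_cong[of _ _ "tens a"]) (rule dual_basis_expand[OF B.left_module_axioms db J tens(2)])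
    finally show ?case .
  next
    case (add s t)
    have "(\<Oplus>\<^bsub>T\<^esub>j\<in>J. tens (?c j (s \<oplus>\<^bsub>T\<^esub> t)) (b j)) = (\<Oplus>\<^bsub>T\<^esub>j\<in>J. tens (?c j s) (b j) \<oplus>\<^bsub>T\<^esub> tens (?c j t) (b j))"
      by (rule T.finsum_cong')
        (auto simp: additive_add[OF c(1)] additive_closed[OF c(1)] tens_add_left add(1,2) db'(1))
    also have "\<dots> = (\<Oplus>\<^bsub>T\<^esub>j\<in>J. tens (?c j s) (b j)) \<oplus>\<^bsub>T\<^esub> (\<Oplus>\<^bsub>T\<^esub>j\<in>J. tens (?c j t) (b j))"
      by (rule T.finsum_addf[OF cl cl]) (use add in auto)
    finally show ?case using add by simp
  qed
qed

lemma tensor_coordinates_zero: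
  assumes "finite J" "dual_basis R B J b \<phi>" "t \<in> carrier T"
    and "\<And>j. j \<in> J \<Longrightarrow> tensor_coordinate R A B (\<phi> j) t = \<zero>\<^bsub>A\<^esub>"
  shows "t = \<zero>\<^bsub>T\<^esub>"
proof -
  have "tens \<zero>\<^bsub>A\<^esub> (b j) = \<zero>\<^bsub>T\<^esub>" if "j \<in> J" for j
    using additive_zero[OF A.M.abelian_group_axioms T.abelian_group_axioms additive_tens_left]
      dual_basisD(1)[OF assms(2) that] by blast
  then have "(\<Oplus>\<^bsub>T\<^esub>j\<in>J. tens (tensor_coordinate R A B (\<phi> j) t) (b j)) = (\<Oplus>\<^bsub>T\<^esub>j\<in>J. \<zero>\<^bsub>T\<^esub>)"
    using assms(4) by (intro T.finsum_cong') auto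
  then show ?thesis using tensor_expand[OF assms(1-3)] by (simp add: T.finsum_zero)
qed

end

section \<open>Integral group rings\<close>

lemma group_ring_simps [simp]:
  "carrier (group_ring G) = {a. Poly_Mapping.keys a \<subseteq> carrier G}"
  "ring.zero (group_ring G) = 0" "one (group_ring G) = frag_of \<one>\<^bsub>G\<^esub>"
  "add (group_ring G) = (+)"
  by (simp_all add: group_ring_def)

lemma group_ring_mult:
  "a \<otimes>\<^bsub>group_ring G\<^esub> b = frag_extend (\<lambda>g. frag_extend (\<lambda>h. frag_of (g \<otimes>\<^bsub>G\<^esub> h)) b) a"
  by (simp add: group_ring_def)

lemma frag_extend_fun_diff: "frag_extend (\<lambda>x. f x - g x) a = frag_extend f a - frag_extend g a"
proof -
  have "Poly_Mapping.keys a \<subseteq> UNIV" by simp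
  then show ?thesis
    by (induction rule: frag_induction) (simp_all add: frag_extend_diff)
qed

lemma group_ring_mult_diff:
  "(a - a') \<otimes>\<^bsub>group_ring G\<^esub> b = a \<otimes>\<^bsub>group_ring G\<^esub> b - a' \<otimes>\<^bsub>group_ring G\<^esub> b"
  "a \<otimes>\<^bsub>group_ring G\<^esub> (b - b') = a \<otimes>\<^bsub>group_ring G\<^esub> b - a \<otimes>\<^bsub>group_ring G\<^esub> b'"
  by (simp_all add: group_ring_mult frag_extend_diff frag_extend_fun_diff)

lemma group_ring_mult_zero:
  "0 \<otimes>\<^bsub>group_ring G\<^esub> b = 0" "a \<otimes>\<^bsub>group_ring G\<^esub> 0 = 0"
  by (simp_all add: group_ring_mult frag_extend_eq_0)

lemma group_ring_mult_add:
  "(a + a') \<otimes>\<^bsub>group_ring G\<^esub> b = a \<otimes>\<^bsub>group_ring G\<^esub> b + a' \<otimes>\<^bsub>group_ring G\<^esub> b"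
  "a \<otimes>\<^bsub>group_ring G\<^esub> (b + b') = a \<otimes>\<^bsub>group_ring G\<^esub> b + a \<otimes>\<^bsub>group_ring G\<^esub> b'"
  using group_ring_mult_diff(1)[of G a "0 - a'" b] group_ring_mult_diff(1)[of G 0 a' b]
    group_ring_mult_diff(2)[of G a b "0 - b'"] group_ring_mult_diff(2)[of G a 0 b']
  by (simp_all add: group_ring_mult_zero)

lemma group_ring_mult_of: "frag_of g \<otimes>\<^bsub>group_ring G\<^esub> frag_of h = frag_of (g \<otimes>\<^bsub>G\<^esub> h)"
  by (simp add: group_ring_mult)

lemma group_ring_induct [consumes 1, case_names zero of diff]:
  assumes "a \<in> carrier (group_ring G)"
    and "Q 0" and "\<And>g. g \<in> carrier G \<Longrightarrow> Q (frag_of g)" and "\<And>a b. Q a \<Longrightarrow> Q b \<Longrightarrow> Q (a - b)"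
  shows "Q a"
  using assms(1) by (intro frag_induction[of a "carrier G" Q] assms) simp

lemma ring_group_ring:
  assumes "group G"
  shows "ring (group_ring G)"
proof -
  interpret G: group G by fact
  let ?R = "group_ring G"
  have mc: "a \<otimes>\<^bsub>?R\<^esub> b \<in> carrier ?R" if "a \<in> carrier ?R" "b \<in> carrier ?R" for a b
  proof -
    have "a \<otimes>\<^bsub>?R\<^esub> b \<in> carrier ?R" if g: "g \<in> carrier G" "a = frag_of g" and b: "b \<in> carrier ?R" for a b g
      using b
    proof (induction rule: group_ring_induct)
      case (diff b c)
      then show ?case using keys_diff[of "a \<otimes>\<^bsub>?R\<^esub> b" "a \<otimes>\<^bsub>?R\<^esub> c"] by (auto simp: group_ring_mult_diff)
    qed (auto simp: group_ring_mult_zero group_ring_mult_of keys_frag_of g)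
    note of = this
    show ?thesis using that(1)
    proof (induction rule: group_ring_induct)
      case (diff a c)
      then show ?case using keys_diff[of "a \<otimes>\<^bsub>?R\<^esub> b" "c \<otimes>\<^bsub>?R\<^esub> b"] by (auto simp: group_ring_mult_diff)
    qed (use of that(2) in \<open>auto simp: group_ring_mult_zero\<close>)
  qed
  have assoc: "(a \<otimes>\<^bsub>?R\<^esub> b) \<otimes>\<^bsub>?R\<^esub> c = a \<otimes>\<^bsub>?R\<^esub> (b \<otimes>\<^bsub>?R\<^esub> c)"
    if a: "a \<in> carrier ?R" and b: "b \<in> carrier ?R" and c: "c \<in> carrier ?R" for a b c
    using a
  proof (induction rule: group_ring_induct)
    case (of x)
    note x = of
    show ?case using b
    proof (induction rule: group_ring_induct)
      case (of y)
      note y = of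
      show ?case using c
        by (induction rule: group_ring_induct)
          (use x y in \<open>simp_all add: group_ring_mult_zero group_ring_mult_of group_ring_mult_diff G.m_assoc\<close>)
    qed (simp_all add: group_ring_mult_zero group_ring_mult_diff)
  qed (simp_all add: group_ring_mult_zero group_ring_mult_diff)
  have one: "frag_of \<one>\<^bsub>G\<^esub> \<otimes>\<^bsub>?R\<^esub> a = a \<and> a \<otimes>\<^bsub>?R\<^esub> frag_of \<one>\<^bsub>G\<^esub> = a" if "a \<in> carrier ?R" for a
    using that
    by (induction rule: group_ring_induct)
      (simp_all add: group_ring_mult_zero group_ring_mult_of group_ring_mult_diff)
  show ?thesis
  proof (rule ringI)
    show "abelian_group ?R"
    proof (rule abelian_groupI)
      fix x y assume "x \<in> carrier ?R" "y \<in> carrier ?R"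
      then show "x \<oplus>\<^bsub>?R\<^esub> y \<in> carrier ?R" using keys_add[of x y] by auto
    next
      fix x assume "x \<in> carrier ?R"
      then show "\<exists>y\<in>carrier ?R. y \<oplus>\<^bsub>?R\<^esub> x = \<zero>\<^bsub>?R\<^esub>" by (intro bexI[of _ "- x"]) simp_all
    qed (simp_all add: add_ac)
    show "monoid ?R"
      by (rule monoidI) (use mc assoc one in \<open>auto simp: keys_frag_of\<close>)
  qed (simp_all add: group_ring_mult_add)
qed

lemma group_ring_nat_multiple: "[(n::nat)] \<cdot>\<^bsub>group_ring G\<^esub> a = frag_cmul (int n) a"
proof (induction n)
  case (Suc n)
  then show ?case by (simp add: add_pow_def frag_cmul_distrib)
qed (simp add: add_pow_def)

lemma group_ring_torsion_free:
  assumes "k > 0" "[(k::nat)] \<cdot>\<^bsub>group_ring G\<^esub> a = \<zero>\<^bsub>group_ring G\<^esub>"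
  shows "a = \<zero>\<^bsub>group_ring G\<^esub>"
  using assms by (simp add: group_ring_nat_multiple)

subsection \<open>The augmentation\<close>

definition augmentation :: "('g \<Rightarrow>\<^sub>0 int) \<Rightarrow> int"
  where "augmentation a = (\<Sum>g\<in>Poly_Mapping.keys a. Poly_Mapping.lookup a g)"

text \<open>
  Mapping all group elements to one point makes the additivity of \<^const>\<open>frag_extend\<close> available.
\<close>

lemma augmentation_eq: "augmentation a = Poly_Mapping.lookup (frag_extend (\<lambda>_. frag_of ()) a) ()"
  by (simp add: augmentation_def frag_extend_def lookup_sum)

lemma augmentation_simps [simp]:
  "augmentation 0 = 0" "augmentation (frag_of g) = 1"
  "augmentation (a + b) = augmentation a + augmentation b"
  "augmentation (a - b) = augmentation a - augmentation b"
  by (simp_all add: augmentation_eq frag_extend_add frag_extend_diff lookup_add lookup_minus)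

lemma augmentation_mult:
  "augmentation (a \<otimes>\<^bsub>group_ring G\<^esub> b) = augmentation a * augmentation b"
proof -
  have of: "augmentation (frag_of g \<otimes>\<^bsub>group_ring G\<^esub> b) = augmentation b" for g
  proof -
    have "Poly_Mapping.keys b \<subseteq> UNIV" by simp
    then show ?thesis
      by (induction rule: frag_induction)
        (simp_all add: group_ring_mult_zero group_ring_mult_diff group_ring_mult_of)
  qed
  have "Poly_Mapping.keys a \<subseteq> UNIV" by simp
  then show ?thesis
    by (induction rule: frag_induction)
      (simp_all add: group_ring_mult_zero group_ring_mult_diff of left_diff_distrib)
qed

lemma trivial_module_simps [simp]:
  "carrier trivial_module = UNIV" "add trivial_module = (+)" "ring.zero trivial_module = 0"
  "a \<odot>\<^bsub>trivial_module\<^esub> k = k * augmentation a"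
  by (simp_all add: trivial_module_def augmentation_def)

lemma right_module_trivial_module:
  assumes "group G"
  shows "right_module (group_ring G) trivial_module"
proof -
  interpret R: ring "group_ring G" by (rule ring_group_ring) fact
  interpret M: abelian_group "trivial_module :: ('a \<Rightarrow>\<^sub>0 int, int) module"
  proof (rule abelian_groupI)
    fix x :: int
    show "\<exists>y\<in>carrier trivial_module. y \<oplus>\<^bsub>trivial_module\<^esub> x = \<zero>\<^bsub>trivial_module\<^esub>"
      by (intro bexI[of _ "- x"]) simp_all
  qed auto
  show ?thesis
    by unfold_locales (simp_all add: augmentation_mult distrib_left distrib_right)
qed

lemma trivial_module_nat_multiple:
  "[(n::nat)] \<cdot>\<^bsub>trivial_module\<^esub> k = int n * k"
  by (induction n) (simp_all add: add_pow_def distrib_right)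

subsection \<open>Restriction to a subgroup of finite index\<close>

lemma group_ring_subgroup_simps [simp]:
  "carrier (group_ring (G\<lparr>carrier := D\<rparr>)) = {a. Poly_Mapping.keys a \<subseteq> D}"
  "monoid.mult (group_ring (G\<lparr>carrier := D\<rparr>)) = monoid.mult (group_ring G)"
  by (simp_all add: group_ring_def)

lemma left_module_restrict:
  assumes G: "group G" and D: "subgroup D G" and P: "left_module (group_ring G) P"
  shows "left_module (group_ring (G\<lparr>carrier := D\<rparr>)) P"
proof -
  interpret P: left_module "group_ring G" P by fact
  interpret S: ring "group_ring (G\<lparr>carrier := D\<rparr>)"
    by (rule ring_group_ring) (rule group.subgroup_imp_group[OF G D])
  have sub: "r \<in> carrier (group_ring G)" if "r \<in> carrier (group_ring (G\<lparr>carrier := D\<rparr>))" for r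
    using that subgroup.subset[OF D] by auto
  show ?thesis
  proof unfold_locales
    show "r \<odot>\<^bsub>P\<^esub> x \<in> carrier P" if "r \<in> carrier (group_ring (G\<lparr>carrier := D\<rparr>))" "x \<in> carrier P" for r x
      by (rule P.smult_closed[OF sub[OF that(1)] that(2)])
    show "(r \<oplus>\<^bsub>group_ring (G\<lparr>carrier := D\<rparr>)\<^esub> s) \<odot>\<^bsub>P\<^esub> x = r \<odot>\<^bsub>P\<^esub> x \<oplus>\<^bsub>P\<^esub> s \<odot>\<^bsub>P\<^esub> x"
      if "r \<in> carrier (group_ring (G\<lparr>carrier := D\<rparr>))" "s \<in> carrier (group_ring (G\<lparr>carrier := D\<rparr>))" "x \<in> carrier P" for r s x
      using P.smult_l_distr[OF sub[OF that(1)] sub[OF that(2)] that(3)] by simp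
    show "r \<odot>\<^bsub>P\<^esub> (x \<oplus>\<^bsub>P\<^esub> y) = r \<odot>\<^bsub>P\<^esub> x \<oplus>\<^bsub>P\<^esub> r \<odot>\<^bsub>P\<^esub> y"
      if "r \<in> carrier (group_ring (G\<lparr>carrier := D\<rparr>))" "x \<in> carrier P" "y \<in> carrier P" for r x y
      by (rule P.smult_r_distr[OF sub[OF that(1)] that(2,3)])
    show "(r \<otimes>\<^bsub>group_ring (G\<lparr>carrier := D\<rparr>)\<^esub> s) \<odot>\<^bsub>P\<^esub> x = r \<odot>\<^bsub>P\<^esub> (s \<odot>\<^bsub>P\<^esub> x)"
      if "r \<in> carrier (group_ring (G\<lparr>carrier := D\<rparr>))" "s \<in> carrier (group_ring (G\<lparr>carrier := D\<rparr>))" "x \<in> carrier P" for r s x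
      using P.smult_assoc[OF sub[OF that(1)] sub[OF that(2)] that(3)] by simp
    show "\<one>\<^bsub>group_ring (G\<lparr>carrier := D\<rparr>)\<^esub> \<odot>\<^bsub>P\<^esub> x = x" if "x \<in> carrier P" for x
      using P.smult_one[OF that] by simp
  qed
qed

lemma module_homs_restrict:
  assumes D: "subgroup D G" and f: "f \<in> module_homs (group_ring G) M N"
  shows "f \<in> module_homs (group_ring (G\<lparr>carrier := D\<rparr>)) M N"
  using f subgroup.subset[OF D] by (auto simp: module_homs_def)

text \<open>
  As a left module over the group ring of \<open>D\<close>, the group ring of \<open>G\<close> is free on any set of representatives of the
  right cosets of \<open>D\<close>; this is the coordinate belonging to the representative \<open>c\<close>.
\<close>

definition coset_part :: "('g, 'x) monoid_scheme \<Rightarrow> 'g set \<Rightarrow> 'g \<Rightarrow> ('g \<Rightarrow>\<^sub>0 int) \<Rightarrow> ('g \<Rightarrow>\<^sub>0 int)"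
  where "coset_part G D c =
    frag_extend (\<lambda>h. if h \<in> D #>\<^bsub>G\<^esub> c then frag_of (h \<otimes>\<^bsub>G\<^esub> inv\<^bsub>G\<^esub> c) else 0)"

context
  fixes G :: "('g, 'x) monoid_scheme" and D :: "'g set"
  assumes G: "group G" and D: "subgroup D G"
begin

interpretation G: group G by (rule G)
interpretation R: ring "group_ring G" by (rule ring_group_ring[OF G])

lemma coset_part_simps:
  "coset_part G D c (a + b) = coset_part G D c a + coset_part G D c b"
  "coset_part G D c (a - b) = coset_part G D c a - coset_part G D c b"
  "coset_part G D c 0 = 0"
  "coset_part G D c (frag_of h) = (if h \<in> D #>\<^bsub>G\<^esub> c then frag_of (h \<otimes>\<^bsub>G\<^esub> inv\<^bsub>G\<^esub> c) else 0)"
  by (simp_all add: coset_part_def frag_extend_add frag_extend_diff)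

lemma rcos_iff:
  assumes "c \<in> carrier G" "h \<in> carrier G"
  shows "h \<in> D #>\<^bsub>G\<^esub> c \<longleftrightarrow> h \<otimes>\<^bsub>G\<^esub> inv\<^bsub>G\<^esub> c \<in> D"
  using subgroup.rcos_module[OF D G assms] .

lemma coset_part_closed:
  assumes c: "c \<in> carrier G" and a: "a \<in> carrier (group_ring G)"
  shows "coset_part G D c a \<in> carrier (group_ring (G\<lparr>carrier := D\<rparr>))"
  using a
proof (induction rule: group_ring_induct)
  case (diff a b)
  then show ?case using keys_diff[of "coset_part G D c a" "coset_part G D c b"]
    by (auto simp: coset_part_simps)
qed (use c in \<open>auto simp: coset_part_simps rcos_iff keys_frag_of\<close>)

lemma coset_part_linear:
  assumes c: "c \<in> carrier G" and s: "s \<in> carrier (group_ring (G\<lparr>carrier := D\<rparr>))"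
    and a: "a \<in> carrier (group_ring G)"
  shows "coset_part G D c (s \<otimes>\<^bsub>group_ring G\<^esub> a) = s \<otimes>\<^bsub>group_ring G\<^esub> coset_part G D c a"
proof -
  have of: "coset_part G D c (frag_of d \<otimes>\<^bsub>group_ring G\<^esub> a) = frag_of d \<otimes>\<^bsub>group_ring G\<^esub> coset_part G D c a"
    if d: "d \<in> D" for d
    using a
  proof (induction rule: group_ring_induct)
    case (of h)
    have dG: "d \<in> carrier G" using d subgroup.subset[OF D] by blast
    have *: "(d \<otimes>\<^bsub>G\<^esub> h) \<otimes>\<^bsub>G\<^esub> inv\<^bsub>G\<^esub> c = d \<otimes>\<^bsub>G\<^esub> (h \<otimes>\<^bsub>G\<^esub> inv\<^bsub>G\<^esub> c)"
      using dG of c by (simp add: G.m_assoc)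
    have "d \<otimes>\<^bsub>G\<^esub> x \<in> D \<longleftrightarrow> x \<in> D" if "x \<in> carrier G" for x
    proof
      assume "d \<otimes>\<^bsub>G\<^esub> x \<in> D"
      then have "inv\<^bsub>G\<^esub> d \<otimes>\<^bsub>G\<^esub> (d \<otimes>\<^bsub>G\<^esub> x) \<in> D"
        by (rule subgroup.m_closed[OF D subgroup.m_inv_closed[OF D d]])
      then show "x \<in> D" using dG that by (simp add: G.m_assoc[symmetric])
    qed (rule subgroup.m_closed[OF D d])
    then show ?case
      using dG of c by (simp add: group_ring_mult_of coset_part_simps rcos_iff * group_ring_mult_zero)
  qed (simp_all add: group_ring_mult_zero group_ring_mult_diff coset_part_simps)
  show ?thesis
    using s
    by (induction rule: group_ring_induct)
      (simp_all add: group_ring_mult_zero group_ring_mult_diff coset_part_simps of)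
qed

lemma coset_part_sum:
  assumes C: "finite C" "C \<subseteq> carrier G" "\<And>h. h \<in> carrier G \<Longrightarrow> \<exists>!c. c \<in> C \<and> h \<in> D #>\<^bsub>G\<^esub> c"
    and a: "a \<in> carrier (group_ring G)"
  shows "(\<Sum>c\<in>C. coset_part G D c a \<otimes>\<^bsub>group_ring G\<^esub> frag_of c) = a"
  using a
proof (induction rule: group_ring_induct)
  case (of h)
  obtain c where c: "c \<in> C" "h \<in> D #>\<^bsub>G\<^esub> c" "\<And>c'. c' \<in> C \<Longrightarrow> h \<in> D #>\<^bsub>G\<^esub> c' \<Longrightarrow> c' = c"
    using C(3)[OF of] by blast
  have cG: "c \<in> carrier G" using c(1) C(2) by blast
  have "(\<Sum>c\<in>C. coset_part G D c (frag_of h) \<otimes>\<^bsub>group_ring G\<^esub> frag_of c) =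
      (\<Sum>c'\<in>C. if c' = c then frag_of h else 0)"
  proof (rule sum.cong[OF refl])
    fix c' assume c': "c' \<in> C"
    show "coset_part G D c' (frag_of h) \<otimes>\<^bsub>group_ring G\<^esub> frag_of c' = (if c' = c then frag_of h else 0)"
    proof (cases "c' = c")
      case True
      then show ?thesis using c(2) of cG by (simp add: coset_part_simps group_ring_mult_of G.m_assoc)
    next
      case False
      then have "h \<notin> D #>\<^bsub>G\<^esub> c'" using c(3)[OF c'] by blast
      then show ?thesis using False by (simp add: coset_part_simps group_ring_mult_zero)
    qed
  qed
  then show ?case using C(1) c(1) by simp
qed (simp_all add: coset_part_simps group_ring_mult_zero group_ring_mult_diff sum_subtractf)

lemma coset_representatives:
  assumes "finite (rcosets\<^bsub>G\<^esub> D)"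
  obtains C where "finite C" "C \<subseteq> carrier G" "\<forall>h\<in>carrier G. \<exists>!c. c \<in> C \<and> h \<in> D #>\<^bsub>G\<^esub> c"
proof -
  have "\<exists>c\<in>carrier G. X = D #>\<^bsub>G\<^esub> c" if "X \<in> rcosets\<^bsub>G\<^esub> D" for X
    using that by (auto simp: RCOSETS_def)
  then have "\<forall>X\<in>rcosets\<^bsub>G\<^esub> D. \<exists>c. c \<in> carrier G \<and> X = D #>\<^bsub>G\<^esub> c"
    by blast
  from bchoice[OF this] obtain r where r: "\<And>X. X \<in> rcosets\<^bsub>G\<^esub> D \<Longrightarrow> r X \<in> carrier G \<and> X = D #>\<^bsub>G\<^esub> r X"
    by auto
  show thesis
  proof
    show "finite (r ` (rcosets\<^bsub>G\<^esub> D))" using assms by simp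
    show "r ` (rcosets\<^bsub>G\<^esub> D) \<subseteq> carrier G" using r by auto
    show "\<forall>h\<in>carrier G. \<exists>!c. c \<in> r ` (rcosets\<^bsub>G\<^esub> D) \<and> h \<in> D #>\<^bsub>G\<^esub> c"
    proof
    fix h assume h: "h \<in> carrier G"
    then have X: "D #>\<^bsub>G\<^esub> h \<in> rcosets\<^bsub>G\<^esub> D" by (auto simp: RCOSETS_def)
    show "\<exists>!c. c \<in> r ` (rcosets\<^bsub>G\<^esub> D) \<and> h \<in> D #>\<^bsub>G\<^esub> c"
    proof
      show "r (D #>\<^bsub>G\<^esub> h) \<in> r ` (rcosets\<^bsub>G\<^esub> D) \<and> h \<in> D #>\<^bsub>G\<^esub> r (D #>\<^bsub>G\<^esub> h)"
        using X r[OF X] G.rcos_self[OF h D] by auto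
      fix c assume c: "c \<in> r ` (rcosets\<^bsub>G\<^esub> D) \<and> h \<in> D #>\<^bsub>G\<^esub> c"
      then obtain Y where Y: "Y \<in> rcosets\<^bsub>G\<^esub> D" "c = r Y" by blast
      have "D #>\<^bsub>G\<^esub> c = D #>\<^bsub>G\<^esub> h"
        using G.repr_independence[OF _ _ D, of h c] c r[OF Y(1)] Y(2) by auto
      then show "c = r (D #>\<^bsub>G\<^esub> h)" using r[OF Y(1)] Y(2) by simp
    qed
    qed
  qed
qed

end

lemma (in abelian_monoid) finsum_Times:
  assumes "finite A" "finite B" "\<And>a b. a \<in> A \<Longrightarrow> b \<in> B \<Longrightarrow> f a b \<in> carrier G"
  shows "(\<Oplus>z\<in>A \<times> B. f (fst z) (snd z)) = (\<Oplus>a\<in>A. \<Oplus>b\<in>B. f a b)"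
  using assms(1,3)
proof (induction A rule: finite_induct)
  case (insert x A)
  let ?f = "\<lambda>z. f (fst z) (snd z)"
  have "(\<Oplus>z\<in>insert x A \<times> B. ?f z) = (\<Oplus>z\<in>Pair x ` B \<union> A \<times> B. ?f z)"
    by (rule arg_cong[of _ _ "finsum G ?f"]) auto
  also have "\<dots> = (\<Oplus>z\<in>Pair x ` B. ?f z) \<oplus> (\<Oplus>z\<in>A \<times> B. ?f z)"
    by (rule finsum_Un_disjoint) (use insert assms(2) in auto)
  also have "(\<Oplus>z\<in>Pair x ` B. ?f z) = (\<Oplus>b\<in>B. ?f (x, b))"
    by (rule finsum_reindex) (use insert in \<open>auto simp: inj_on_def\<close>)
  also have "(\<Oplus>z\<in>A \<times> B. ?f z) = (\<Oplus>a\<in>A. \<Oplus>b\<in>B. f a b)"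
    using insert by auto
  finally show ?case
    using insert by (subst finsum_insert) (auto intro!: finsum_closed)
qed simp

lemma dual_basis_finiteI:
  assumes P: "left_module R P" and J: "finite J"
    and b: "b \<in> J \<rightarrow> carrier P"
    and add: "\<And>j. j \<in> J \<Longrightarrow> additive P R (\<phi> j)"
    and lin: "\<And>j r x. \<lbrakk>j \<in> J; r \<in> carrier R; x \<in> carrier P\<rbrakk> \<Longrightarrow> \<phi> j (r \<odot>\<^bsub>P\<^esub> x) = r \<otimes>\<^bsub>R\<^esub> \<phi> j x"
    and sum: "\<And>x. x \<in> carrier P \<Longrightarrow> (\<Oplus>\<^bsub>P\<^esub>j\<in>J. \<phi> j x \<odot>\<^bsub>P\<^esub> b j) = x"
  shows "dual_basis R P J b \<phi>"
proof -
  interpret P: left_module R P by fact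
  have "(\<Oplus>\<^bsub>P\<^esub>j\<in>{j \<in> J. \<phi> j x \<noteq> \<zero>\<^bsub>R\<^esub>}. \<phi> j x \<odot>\<^bsub>P\<^esub> b j) = (\<Oplus>\<^bsub>P\<^esub>j\<in>J. \<phi> j x \<odot>\<^bsub>P\<^esub> b j)"
    if x: "x \<in> carrier P" for x
  proof (rule P.add.finprod_mono_neutral_cong_left[OF J])
    show "\<phi> j x \<odot>\<^bsub>P\<^esub> b j = \<zero>\<^bsub>P\<^esub>" if "j \<in> J - {j \<in> J. \<phi> j x \<noteq> \<zero>\<^bsub>R\<^esub>}" for j
      using that b P.smult_zero_left by auto
    show "(\<lambda>j. \<phi> j x \<odot>\<^bsub>P\<^esub> b j) \<in> J \<rightarrow> carrier P"
      using b x by (intro funcsetI P.smult_closed additive_closed[OF add]) auto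
  qed auto
  then show ?thesis
    unfolding dual_basis_def using b add lin sum J by simp
qed

text \<open>
  If \<open>C\<close> represents the right cosets, the elements \<open>c b\<^sub>j\<close> with \<open>c \<in> C\<close> form a dual basis over the subring, the
  functionals being the \<open>c\<close>-coordinates of the \<open>\<phi>\<^sub>j\<close>.
\<close>

lemma dual_basis_restrict:
  fixes G :: "('g, 'x) monoid_scheme" and P :: "('g \<Rightarrow>\<^sub>0 int, 'a) module" and J :: "'j set"
  assumes G: "group G" and D: "subgroup D G" and fin: "finite (rcosets\<^bsub>G\<^esub> D)"
    and P: "left_module (group_ring G) P" and J: "finite J"
    and db: "dual_basis (group_ring G) P J b \<phi>"
  obtains J' :: "('j \<times> 'g) set" and b' \<phi>'
  where "finite J'" "dual_basis (group_ring (G\<lparr>carrier := D\<rparr>)) P J' b' \<phi>'"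
proof -
  interpret P: left_module "group_ring G" P by fact
  note db' = dual_basisD[OF db]
  obtain C where C: "finite C" "C \<subseteq> carrier G" "\<forall>h\<in>carrier G. \<exists>!c. c \<in> C \<and> h \<in> D #>\<^bsub>G\<^esub> c"
    by (rule coset_representatives[OF G D fin])
  let ?S = "group_ring (G\<lparr>carrier := D\<rparr>)"
  let ?J = "J \<times> C"
  let ?b = "\<lambda>(j, c). frag_of c \<odot>\<^bsub>P\<^esub> b j"
  let ?\<phi> = "\<lambda>(j, c) x. coset_part G D c (\<phi> j x)"
  have S: "s \<in> carrier (group_ring G)" if "s \<in> carrier ?S" for s
    using that subgroup.subset[OF D] by auto
  have CG: "c \<in> carrier G" "frag_of c \<in> carrier (group_ring G)" if "c \<in> C" for c
    using that C(2) by (auto simp: keys_frag_of)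
  have cp: "coset_part G D c a \<in> carrier (group_ring G)" if "c \<in> C" "a \<in> carrier (group_ring G)" for c a
    by (rule S[OF coset_part_closed[OF G D CG(1)[OF that(1)] that(2)]])
  have "dual_basis ?S P ?J ?b ?\<phi>"
  proof (rule dual_basis_finiteI[OF left_module_restrict[OF G D P]])
    show "finite ?J" using J C by simp
    show "?b \<in> ?J \<rightarrow> carrier P"
      using P.smult_closed[OF CG(2) db'(1)] by auto
  next
    fix j assume "j \<in> ?J"
    then obtain i c where j: "j = (i, c)" "i \<in> J" "c \<in> C" by auto
    show "additive P ?S (?\<phi> j)"
      unfolding j by (rule additiveI)
        (use coset_part_closed[OF G D CG(1)[OF j(3)] db'(6)[OF j(2)]] in
          \<open>simp_all add: additive_add[OF db'(2)[OF j(2)]] coset_part_simps[OF G D]\<close>)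
    fix r x assume r: "r \<in> carrier ?S" and x: "x \<in> carrier P"
    show "?\<phi> j (r \<odot>\<^bsub>P\<^esub> x) = r \<otimes>\<^bsub>?S\<^esub> ?\<phi> j x"
      unfolding j using db'(3)[OF j(2) S[OF r] x]
        coset_part_linear[OF G D CG(1)[OF j(3)] r db'(6)[OF j(2) x]] by simp
  next
    fix x assume x: "x \<in> carrier P"
    let ?t = "\<lambda>j c. coset_part G D c (\<phi> j x) \<odot>\<^bsub>P\<^esub> (frag_of c \<odot>\<^bsub>P\<^esub> b j)"
    have cl: "?t j c \<in> carrier P" if "j \<in> J" "c \<in> C" for j c
      by (intro P.smult_closed cp CG(2) db'(1) db'(6) x that)
    have inner: "(\<Oplus>\<^bsub>P\<^esub>c\<in>C. ?t j c) = \<phi> j x \<odot>\<^bsub>P\<^esub> b j" if j: "j \<in> J" for j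
    proof -
      let ?r = "\<lambda>c. coset_part G D c (\<phi> j x) \<otimes>\<^bsub>group_ring G\<^esub> frag_of c"
      have rc: "?r \<in> C \<rightarrow> carrier (group_ring G)"
        by (intro funcsetI P.R.m_closed cp CG(2) db'(6) x j)
      have "finite C'' \<Longrightarrow> C'' \<subseteq> C \<Longrightarrow> (\<Oplus>\<^bsub>group_ring G\<^esub>c\<in>C''. ?r c) = (\<Sum>c\<in>C''. ?r c)" for C''
      proof (induction C'' rule: finite_induct)
        case (insert c C'')
        then have "?r c \<in> carrier (group_ring G)" "?r \<in> C'' \<rightarrow> carrier (group_ring G)"
          using rc by blast+
        then show ?case
          using insert by (simp add: P.R.finsum_insert del: group_ring_simps(1))
      qed simp
      then have "\<phi> j x = (\<Oplus>\<^bsub>group_ring G\<^esub>c\<in>C. ?r c)"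
        using coset_part_sum[OF G D C(1,2) bspec[OF C(3)] db'(6)[OF j x]] C(1) by simp
      then have "\<phi> j x \<odot>\<^bsub>P\<^esub> b j = (\<Oplus>\<^bsub>P\<^esub>c\<in>C. ?r c \<odot>\<^bsub>P\<^esub> b j)"
        using additive_finsum[OF P.R.is_abelian_group P.M.abelian_group_axioms
            P.additive_smult_left[OF db'(1)[OF j]] rc] by simp
      also have "\<dots> = (\<Oplus>\<^bsub>P\<^esub>c\<in>C. ?t j c)"
        by (rule P.M.finsum_cong'[OF refl])
          (simp_all only: cl[OF j] Pi_I P.smult_assoc[OF cp[OF _ db'(6)[OF j x]] CG(2) db'(1)[OF j]])
      finally show ?thesis by simp
    qed
    have "(\<Oplus>\<^bsub>P\<^esub>j\<in>?J. ?\<phi> j x \<odot>\<^bsub>P\<^esub> ?b j) = (\<Oplus>\<^bsub>P\<^esub>z\<in>?J. ?t (fst z) (snd z))"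
      by (rule P.M.finsum_cong') (use cl in auto)
    also have "\<dots> = (\<Oplus>\<^bsub>P\<^esub>j\<in>J. \<Oplus>\<^bsub>P\<^esub>c\<in>C. ?t j c)"
      by (rule P.M.finsum_Times[OF J C(1) cl])
    also have "\<dots> = (\<Oplus>\<^bsub>P\<^esub>j\<in>J. \<phi> j x \<odot>\<^bsub>P\<^esub> b j)"
      by (rule P.M.finsum_cong'[OF refl]) (use inner db'(1,6) x P.smult_closed in auto)
    also have "\<dots> = x"
      by (rule dual_basis_expand[OF P db J x])
    finally show "(\<Oplus>\<^bsub>P\<^esub>j\<in>?J. ?\<phi> j x \<odot>\<^bsub>P\<^esub> ?b j) = x" .
  qed
  then show thesis by (rule that[OF finite_cartesian_product[OF J C(1)]])
qed

section \<open>The p-adic completion of a ring\<close>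

lemma abelian_group_transfer:
  assumes "abelian_group A" "carrier M = carrier A" "add M = add A" "ring.zero M = ring.zero A"
  shows "abelian_group M"
proof -
  interpret A: abelian_group A by fact
  show ?thesis
    by (rule abelian_groupI) (auto simp: assms(2-) A.a_assoc A.add.l_inv_ex intro: A.a_comm)
qed

locale padic_ring = R: ring R for R :: "'r ring" (structure) +
  fixes p :: nat
  assumes prime_p: "Factorial_Ring.prime p"
    and torsion_free: "\<lbrakk>r \<in> carrier R; [p] \<cdot>\<^bsub>R\<^esub> r = \<zero>\<rbrakk> \<Longrightarrow> r = \<zero>"
begin

abbreviation I where "I n \<equiv> multiples R (p ^ n)"
abbreviation Q where "Q n \<equiv> R Quot I n"
abbreviation A where "A \<equiv> padic_completion p R"

definition cls where "cls n r = I n +>\<^bsub>R\<^esub> r"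

lemma p_pos: "p > 0" using prime_p prime_gt_0_nat by blast

lemma I_iff: "x \<in> I n \<longleftrightarrow> (\<exists>y\<in>carrier R. x = [(p ^ n)] \<cdot>\<^bsub>R\<^esub> y)"
  by (auto simp: multiples_def)

lemma ideal_I: "ideal (I n) R"
proof (rule idealI[OF R.ring_axioms])
  show "subgroup (I n) (add_monoid R)"
    using group_hom.img_is_subgroup[OF add_group_hom[OF R.is_abelian_group R.is_abelian_group R.additive_nat_multiple]]
    by (simp add: multiples_def)
next
  fix a x assume a: "a \<in> I n" and x: "x \<in> carrier R"
  then obtain y where y: "y \<in> carrier R" "a = [(p ^ n)] \<cdot>\<^bsub>R\<^esub> y" by (auto simp: I_iff)
  show "x \<otimes> a \<in> I n" unfolding I_iff y(2) using x y(1) R.add_pow_rdistr by auto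
  show "a \<otimes> x \<in> I n" unfolding I_iff y(2) using x y(1) R.add_pow_ldistr by auto
qed

sublocale I: ideal "I n" R for n by (rule ideal_I)

lemma I_add: "x \<in> I n \<Longrightarrow> y \<in> I n \<Longrightarrow> x \<oplus> y \<in> I n" by (rule I.a_closed)
lemma I_minus: "x \<in> I n \<Longrightarrow> \<ominus> x \<in> I n" by (rule I.a_inv_closed)
lemma I_zero: "\<zero> \<in> I n" by (rule I.zero_closed)
lemma I_0: "I 0 = carrier R" by (auto simp: multiples_def)

lemma I_carrier: "x \<in> I n \<Longrightarrow> x \<in> carrier R" by (rule I.Icarr)

lemma I_Suc: "x \<in> I (Suc n) \<longleftrightarrow> (\<exists>y\<in>I n. x = [p] \<cdot>\<^bsub>R\<^esub> y)"
proof -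
  have "[(p ^ Suc n)] \<cdot>\<^bsub>R\<^esub> y = [p] \<cdot>\<^bsub>R\<^esub> ([(p ^ n)] \<cdot>\<^bsub>R\<^esub> y)" if "y \<in> carrier R" for y
    using that by (rule R.nat_multiple_Suc_power)
  then show ?thesis unfolding multiples_def by (auto simp del: power_Suc)
qed

lemma I_p: "y \<in> I n \<Longrightarrow> [p] \<cdot>\<^bsub>R\<^esub> y \<in> I (Suc n)"
  unfolding I_Suc by blast

lemma p_cancel:
  assumes "x \<in> carrier R" "y \<in> carrier R" "[p] \<cdot>\<^bsub>R\<^esub> x = [p] \<cdot>\<^bsub>R\<^esub> y"
  shows "x = y"
proof -
  have "[p] \<cdot>\<^bsub>R\<^esub> (x \<ominus> y) = \<zero>"
    using assms additive_diff[OF R.is_abelian_group R.is_abelian_group R.additive_nat_multiple assms(1,2)]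
    by (simp add: R.diff_self)
  then show ?thesis using torsion_free[of "x \<ominus> y"] assms R.diff_eq_zero by auto
qed

lemma I_p_cancel: "y \<in> carrier R \<Longrightarrow> [p] \<cdot>\<^bsub>R\<^esub> y \<in> I (Suc n) \<Longrightarrow> y \<in> I n"
  using p_cancel I_carrier unfolding I_Suc by blast

lemma I_Suc_subset: "x \<in> I (Suc n) \<Longrightarrow> x \<in> I n"
proof -
  assume "x \<in> I (Suc n)"
  then obtain y where y: "y \<in> carrier R" "x = [(p ^ Suc n)] \<cdot>\<^bsub>R\<^esub> y" by (auto simp: I_iff simp del: power_Suc)
  then have "x = [(p ^ n)] \<cdot>\<^bsub>R\<^esub> ([p] \<cdot>\<^bsub>R\<^esub> y)"
    using R.nat_multiple_mult[OF y(1), of "p ^ n" p] by (simp add: mult.commute)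
  then show "x \<in> I n" using y(1) unfolding I_iff by blast
qed

lemma cls_eq_iff: "r \<in> carrier R \<Longrightarrow> s \<in> carrier R \<Longrightarrow> cls n r = cls n s \<longleftrightarrow> r \<ominus> s \<in> I n"
  unfolding cls_def using R.quotient_eq_iff_same_a_r_cos[OF ideal_I] by blast

lemma ring_Q: "ring (Q n)" by (rule I.quotient_is_ring)

lemma cls_hom: "cls n \<in> ring_hom R (Q n)"
  unfolding cls_def using I.rcos_ring_hom by simp

lemma carrier_Q: "carrier (Q n) = cls n ` carrier R"
  by (auto simp: FactRing_def A_RCOSETS_def' cls_def)

lemma cls_zero: "cls n \<zero> = \<zero>\<^bsub>Q n\<^esub>"
  using ring_hom_zero[OF cls_hom R.ring_axioms ring_Q] .

lemma cls_eq_zero_iff: "r \<in> carrier R \<Longrightarrow> cls n r = \<zero>\<^bsub>Q n\<^esub> \<longleftrightarrow> r \<in> I n"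
  unfolding cls_zero[symmetric] using cls_eq_iff[of r \<zero> n] by (simp add: a_minus_def)

lemma cls_transition:
  assumes "r \<in> carrier R"
  shows "I n <+>\<^bsub>R\<^esub> cls (Suc n) r = cls n r"
proof
  show "I n <+>\<^bsub>R\<^esub> cls (Suc n) r \<subseteq> cls n r"
  proof
    fix x assume "x \<in> I n <+>\<^bsub>R\<^esub> cls (Suc n) r"
    then obtain i j where ij: "i \<in> I n" "j \<in> I (Suc n)" "x = i \<oplus> (j \<oplus> r)"
      by (auto simp: set_add_def' cls_def a_r_coset_def')
    have "i \<in> carrier R" "j \<in> carrier R" by (rule I_carrier[OF ij(1)], rule I_carrier[OF ij(2)])
    then have "x = (i \<oplus> j) \<oplus> r" using assms by (simp add: ij(3) R.a_assoc)
    moreover have "i \<oplus> j \<in> I n" using ij I_Suc_subset I_add by blast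
    ultimately show "x \<in> cls n r" by (auto simp: cls_def a_r_coset_def')
  qed
  show "cls n r \<subseteq> I n <+>\<^bsub>R\<^esub> cls (Suc n) r"
  proof
    fix x assume "x \<in> cls n r"
    then obtain i where i: "i \<in> I n" "x = i \<oplus> r" by (auto simp: cls_def a_r_coset_def')
    then have "x = i \<oplus> (\<zero> \<oplus> r)" using assms by simp
    then show "x \<in> I n <+>\<^bsub>R\<^esub> cls (Suc n) r"
      using i(1) I_zero[of "Suc n"] unfolding set_add_def' cls_def a_r_coset_def' by blast
  qed
qed

text \<open>
  An element of the inverse limit is represented by a sequence in \<open>R\<close> whose \<open>n\<close>-th member matters modulo \<open>p\<^sup>n\<close>.
\<close>

definition coherent where
  "coherent s \<longleftrightarrow> (\<forall>n. s n \<in> carrier R \<and> s (Suc n) \<ominus> s n \<in> I n)"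

definition mk where "mk s = (\<lambda>n::nat. cls n (s n))"

lemma A_simps:
  "x \<oplus>\<^bsub>A\<^esub> y = (\<lambda>n. x n \<oplus>\<^bsub>Q n\<^esub> y n)" "x \<otimes>\<^bsub>A\<^esub> y = (\<lambda>n. x n \<otimes>\<^bsub>Q n\<^esub> y n)"
  "\<zero>\<^bsub>A\<^esub> = (\<lambda>n. \<zero>\<^bsub>Q n\<^esub>)" "\<one>\<^bsub>A\<^esub> = (\<lambda>n. \<one>\<^bsub>Q n\<^esub>)"
  by (simp_all add: padic_completion_def)

lemma carrier_A: "x \<in> carrier A \<longleftrightarrow> (\<exists>s. coherent s \<and> x = mk s)"
proof
  assume "x \<in> carrier A"
  then have x: "\<And>n. x n \<in> carrier (Q n)" "\<And>n. I n <+>\<^bsub>R\<^esub> x (Suc n) = x n"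
    by (auto simp: padic_completion_def inverse_limit_def Let_def)
  have "\<forall>n. \<exists>r. r \<in> carrier R \<and> x n = cls n r" using x(1) unfolding carrier_Q by blast
  then obtain s where s: "\<And>n. s n \<in> carrier R" "\<And>n. x n = cls n (s n)" by metis
  have "cls n (s (Suc n)) = cls n (s n)" for n
    using x(2)[of n] cls_transition[OF s(1), of n "Suc n"] s(2) by simp
  then have "coherent s" using s(1) by (simp add: coherent_def cls_eq_iff)
  moreover have "x = mk s" using s(2) by (auto simp: mk_def)
  ultimately show "\<exists>s. coherent s \<and> x = mk s" by blast
next
  assume "\<exists>s. coherent s \<and> x = mk s"
  then obtain s where s: "coherent s" "x = mk s" by blast
  then have sc: "s n \<in> carrier R" "cls n (s (Suc n)) = cls n (s n)" for n
    by (auto simp: coherent_def cls_eq_iff)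
  show "x \<in> carrier A"
    using cls_transition[OF sc(1)] sc(2)
    by (auto simp: padic_completion_def inverse_limit_def Let_def s(2) mk_def carrier_Q sc(1))
qed

lemma mk_closed: "coherent s \<Longrightarrow> mk s \<in> carrier A" by (auto simp: carrier_A)

lemma coherentD: "coherent s \<Longrightarrow> s n \<in> carrier R" "coherent s \<Longrightarrow> s (Suc n) \<ominus> s n \<in> I n"
  by (auto simp: coherent_def)

lemma coherentI:
  "(\<And>n. s n \<in> carrier R) \<Longrightarrow> (\<And>n. s (Suc n) \<ominus> s n \<in> I n) \<Longrightarrow> coherent s"
  by (auto simp: coherent_def)

lemma coherent_add: assumes "coherent s" "coherent t" shows "coherent (\<lambda>n. s n \<oplus> t n)"
  using assms by (intro coherentI) (simp_all add: coherentD R.add_diff_add I_add)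

lemma coherent_minus: assumes "coherent s" shows "coherent (\<lambda>n. \<ominus> s n)"
proof (rule coherentI)
  fix n
  have "(\<ominus> s (Suc n)) \<ominus> (\<ominus> s n) = \<ominus> (s (Suc n) \<ominus> s n)"
    using coherentD(1)[OF assms] by (simp add: a_minus_def R.minus_add)
  then show "(\<ominus> s (Suc n)) \<ominus> (\<ominus> s n) \<in> I n"
    using I_minus coherentD(2)[OF assms] by simp
qed (use coherentD(1)[OF assms] in simp)

lemma coherent_mult: assumes s: "coherent s" and t: "coherent t" shows "coherent (\<lambda>n. s n \<otimes> t n)"
proof (rule coherentI)
  fix n
  note c = coherentD(1)[OF s] coherentD(1)[OF t]
  have "s (Suc n) \<otimes> t (Suc n) \<ominus> s n \<otimes> t n
    = (s (Suc n) \<ominus> s n) \<otimes> t (Suc n) \<oplus> s n \<otimes> (t (Suc n) \<ominus> t n)"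
    using c[of "Suc n"] c[of n]
    by (simp add: a_minus_def R.l_distr R.r_distr R.l_minus R.r_minus R.a_assoc R.r_neg1)
  moreover have "(s (Suc n) \<ominus> s n) \<otimes> t (Suc n) \<in> I n"
    using I.I_r_closed coherentD(2)[OF s] c by blast
  moreover have "s n \<otimes> (t (Suc n) \<ominus> t n) \<in> I n"
    using I.I_l_closed coherentD(2)[OF t] c by blast
  ultimately show "s (Suc n) \<otimes> t (Suc n) \<ominus> s n \<otimes> t n \<in> I n"
    using I_add by simp
qed (use coherentD(1)[OF s] coherentD(1)[OF t] in simp)

lemma coherent_const: "r \<in> carrier R \<Longrightarrow> coherent (\<lambda>_. r)"
  by (rule coherentI) (simp_all add: R.diff_self I_zero)

lemma mk_add: "coherent s \<Longrightarrow> coherent t \<Longrightarrow> mk s \<oplus>\<^bsub>A\<^esub> mk t = mk (\<lambda>n. s n \<oplus> t n)"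
  by (simp add: A_simps mk_def ring_hom_add[OF cls_hom] coherentD)

lemma mk_mult: "coherent s \<Longrightarrow> coherent t \<Longrightarrow> mk s \<otimes>\<^bsub>A\<^esub> mk t = mk (\<lambda>n. s n \<otimes> t n)"
  by (simp add: A_simps mk_def ring_hom_mult[OF cls_hom] coherentD)

lemma mk_eqI:
  "coherent s \<Longrightarrow> coherent t \<Longrightarrow> (\<And>n. s n \<ominus> t n \<in> I n) \<Longrightarrow> mk s = mk t"
  unfolding mk_def by (rule ext) (simp add: cls_eq_iff coherentD)

lemma mk_eq_zero_iff: "coherent s \<Longrightarrow> mk s = \<zero>\<^bsub>A\<^esub> \<longleftrightarrow> (\<forall>n. s n \<in> I n)"
  by (simp add: mk_def A_simps fun_eq_iff cls_eq_zero_iff coherentD)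

lemma zero_A: "\<zero>\<^bsub>A\<^esub> = mk (\<lambda>_. \<zero>)" by (simp add: A_simps mk_def cls_zero)
lemma one_A: "\<one>\<^bsub>A\<^esub> = mk (\<lambda>_. \<one>)" by (simp add: A_simps mk_def ring_hom_one[OF cls_hom])

lemma A_component: "x \<in> carrier A \<Longrightarrow> x n \<in> carrier (Q n)"
  by (auto simp: padic_completion_def inverse_limit_def Let_def)

lemma ring_A: "ring A"
proof -
  have add: "x \<oplus>\<^bsub>A\<^esub> y \<in> carrier A" if "x \<in> carrier A" "y \<in> carrier A" for x y
  proof -
    obtain s t where "coherent s" "x = mk s" "coherent t" "y = mk t"
      using \<open>x \<in> carrier A\<close> \<open>y \<in> carrier A\<close> carrier_A by blast
    then show ?thesis by (simp only: mk_add coherent_add mk_closed)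
  qed
  have mult: "x \<otimes>\<^bsub>A\<^esub> y \<in> carrier A" if "x \<in> carrier A" "y \<in> carrier A" for x y
  proof -
    obtain s t where "coherent s" "x = mk s" "coherent t" "y = mk t"
      using \<open>x \<in> carrier A\<close> \<open>y \<in> carrier A\<close> carrier_A by blast
    then show ?thesis by (simp only: mk_mult coherent_mult mk_closed)
  qed
  have inv: "\<exists>y\<in>carrier A. y \<oplus>\<^bsub>A\<^esub> x = \<zero>\<^bsub>A\<^esub>" if x: "x \<in> carrier A" for x
  proof -
    obtain s where s: "coherent s" "x = mk s" using x carrier_A by blast
    have "mk (\<lambda>n. \<ominus> s n) \<oplus>\<^bsub>A\<^esub> x = \<zero>\<^bsub>A\<^esub>"
      using s coherent_minus[OF s(1)] by (simp add: mk_add zero_A R.l_neg coherentD)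
    then show ?thesis using mk_closed[OF coherent_minus[OF s(1)]] by blast
  qed
  have zero: "\<zero>\<^bsub>A\<^esub> \<in> carrier A" "\<one>\<^bsub>A\<^esub> \<in> carrier A"
    unfolding zero_A one_A by (intro mk_closed coherent_const; simp)+
  note c = A_component
  have Q: "ring (Q n)" for n by (rule ring_Q)
  have ag: "abelian_group (Q n)" for n by (rule ring.is_abelian_group[OF Q])
  show ?thesis
  proof (rule ringI)
    show "abelian_group A"
    proof (rule abelian_groupI)
      fix x y z assume xyz: "x \<in> carrier A" "y \<in> carrier A" "z \<in> carrier A"
      show "(x \<oplus>\<^bsub>A\<^esub> y) \<oplus>\<^bsub>A\<^esub> z = x \<oplus>\<^bsub>A\<^esub> (y \<oplus>\<^bsub>A\<^esub> z)"
        unfolding A_simps by (rule ext) (intro ring.ring_simprules(7)[OF Q] c xyz)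
    next
      fix x y assume xy: "x \<in> carrier A" "y \<in> carrier A"
      show "x \<oplus>\<^bsub>A\<^esub> y = y \<oplus>\<^bsub>A\<^esub> x"
        unfolding A_simps by (rule ext) (intro ring.ring_simprules(10)[OF Q] c xy)
    next
      fix x assume x: "x \<in> carrier A"
      show "\<zero>\<^bsub>A\<^esub> \<oplus>\<^bsub>A\<^esub> x = x"
        unfolding A_simps using ring.ring_simprules(8)[OF Q c[OF x]] by simp
    qed (use add zero inv in auto)
    show "monoid A"
    proof (rule monoidI)
      fix x y z assume xyz: "x \<in> carrier A" "y \<in> carrier A" "z \<in> carrier A"
      show "(x \<otimes>\<^bsub>A\<^esub> y) \<otimes>\<^bsub>A\<^esub> z = x \<otimes>\<^bsub>A\<^esub> (y \<otimes>\<^bsub>A\<^esub> z)"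
        unfolding A_simps by (rule ext) (intro ring.ring_simprules(11)[OF Q] c xyz)
    next
      fix x assume x: "x \<in> carrier A"
      show "\<one>\<^bsub>A\<^esub> \<otimes>\<^bsub>A\<^esub> x = x"
        unfolding A_simps using monoid.l_one[OF ring.is_monoid[OF Q] c[OF x]] by simp
      show "x \<otimes>\<^bsub>A\<^esub> \<one>\<^bsub>A\<^esub> = x"
        unfolding A_simps using monoid.r_one[OF ring.is_monoid[OF Q] c[OF x]] by simp
    qed (use mult zero in auto)
  next
    fix x y z assume xyz: "x \<in> carrier A" "y \<in> carrier A" "z \<in> carrier A"
    show "(x \<oplus>\<^bsub>A\<^esub> y) \<otimes>\<^bsub>A\<^esub> z = x \<otimes>\<^bsub>A\<^esub> z \<oplus>\<^bsub>A\<^esub> y \<otimes>\<^bsub>A\<^esub> z"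
      unfolding A_simps by (rule ext) (intro ringE(3)[OF Q] c xyz)
    show "z \<otimes>\<^bsub>A\<^esub> (x \<oplus>\<^bsub>A\<^esub> y) = z \<otimes>\<^bsub>A\<^esub> x \<oplus>\<^bsub>A\<^esub> z \<otimes>\<^bsub>A\<^esub> y"
      unfolding A_simps by (rule ext) (intro ringE(4)[OF Q] c xyz)
  qed
qed

sublocale A: ring A by (rule ring_A)

lemma mk_nat_multiple:
  assumes s: "coherent s"
  shows "coherent (\<lambda>n. [(k::nat)] \<cdot>\<^bsub>R\<^esub> s n)" "[k] \<cdot>\<^bsub>A\<^esub> mk s = mk (\<lambda>n. [k] \<cdot>\<^bsub>R\<^esub> s n)"
proof (induction k)
  case 0
  { case 1 show ?case using coherent_const[of \<zero>] by simp }
  { case 2 show ?case by (simp add: zero_A) }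
next
  case (Suc k)
  { case 1 show ?case using coherent_add[OF Suc(1) s] by simp }
  { case 2 show ?case using Suc mk_add[OF Suc(1) s] by simp }
qed

definition \<iota> where "\<iota> = completion_map p R"

lemma \<iota>_mk: "\<iota> r = mk (\<lambda>_. r)"
  by (simp add: \<iota>_def completion_map_def mk_def cls_def)

lemma \<iota>_closed: "r \<in> carrier R \<Longrightarrow> \<iota> r \<in> carrier A"
  by (simp add: \<iota>_mk mk_closed coherent_const)

lemma \<iota>_add: "r \<in> carrier R \<Longrightarrow> s \<in> carrier R \<Longrightarrow> \<iota> (r \<oplus> s) = \<iota> r \<oplus>\<^bsub>A\<^esub> \<iota> s"
  by (simp add: \<iota>_mk mk_add coherent_const)

lemma \<iota>_mult: "r \<in> carrier R \<Longrightarrow> s \<in> carrier R \<Longrightarrow> \<iota> (r \<otimes> s) = \<iota> r \<otimes>\<^bsub>A\<^esub> \<iota> s"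
  by (simp add: \<iota>_mk mk_mult coherent_const)

lemma \<iota>_one: "\<iota> \<one> = \<one>\<^bsub>A\<^esub>"
  by (simp add: \<iota>_mk one_A)

text \<open>
  If \<open>p s\<^sub>n \<in> p\<^sup>n R\<close> for all \<open>n\<close>, then \<open>s\<^bsub>n+1\<^esub> \<in> p\<^sup>n R\<close>, and \<open>s\<^sub>n\<close> is congruent to \<open>s\<^bsub>n+1\<^esub>\<close> modulo \<open>p\<^sup>n\<close>.
\<close>

lemma A_p_torsion_free:
  assumes "x \<in> carrier A" "[p] \<cdot>\<^bsub>A\<^esub> x = \<zero>\<^bsub>A\<^esub>"
  shows "x = \<zero>\<^bsub>A\<^esub>"
proof -
  obtain s where s: "coherent s" "x = mk s" using assms carrier_A by blast
  have "[p] \<cdot>\<^bsub>R\<^esub> s n \<in> I n" for n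
    using assms(2) s mk_nat_multiple[OF s(1), of p] by (simp add: mk_eq_zero_iff)
  then have "s (Suc n) \<in> I n" for n
    using I_p_cancel coherentD(1)[OF s(1)] by blast
  then have "s (Suc n) \<ominus> (s (Suc n) \<ominus> s n) \<in> I n" for n
    using I_add[OF _ I_minus[OF coherentD(2)[OF s(1)]]] by (simp add: a_minus_def)
  moreover have "s (Suc n) \<ominus> (s (Suc n) \<ominus> s n) = s n" for n
    using coherentD(1)[OF s(1)] by (simp add: a_minus_def R.minus_add R.a_assoc[symmetric] R.r_neg)
  ultimately show ?thesis using s by (simp add: mk_eq_zero_iff)
qed

text \<open>
  A power of \<open>p\<close> can be cancelled step by step, and a factor prime to \<open>p\<close> is invertible modulo each \<open>p\<^sup>n\<close>.
\<close>

lemma A_torsion_free: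
  assumes "x \<in> carrier A" "k > 0" "[(k::nat)] \<cdot>\<^bsub>A\<^esub> x = \<zero>\<^bsub>A\<^esub>"
  shows "x = \<zero>\<^bsub>A\<^esub>"
proof -
  obtain a m where am: "\<not> p dvd m" "k = m * p ^ a"
    using prime_power_canonical[OF prime_p assms(2)] by blast
  have pow: "y = \<zero>\<^bsub>A\<^esub>" if "y \<in> carrier A" "[(p ^ a)] \<cdot>\<^bsub>A\<^esub> y = \<zero>\<^bsub>A\<^esub>" for y
    using that
  proof (induction a)
    case (Suc a)
    then show ?case
      using A_p_torsion_free[of "[(p ^ a)] \<cdot>\<^bsub>A\<^esub> y"] A.nat_multiple_Suc_power[of y p a] by simp
  qed simp
  have "[(p ^ a)] \<cdot>\<^bsub>A\<^esub> ([m] \<cdot>\<^bsub>A\<^esub> x) = \<zero>\<^bsub>A\<^esub>"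
    using assms(1,3) A.nat_multiple_mult[of x "p ^ a" m] am(2) by (simp add: mult.commute)
  then have m: "[m] \<cdot>\<^bsub>A\<^esub> x = \<zero>\<^bsub>A\<^esub>" using pow assms(1) by simp
  obtain s where s: "coherent s" "x = mk s" using assms carrier_A by blast
  have "s n \<in> I n" for n
  proof -
    note sn = coherentD(1)[OF s(1), of n]
    have ms: "[m] \<cdot>\<^bsub>R\<^esub> s n \<in> I n"
      using m s mk_nat_multiple[OF s(1), of m] by (simp add: mk_eq_zero_iff)
    have "coprime m (p ^ n)"
      using prime_imp_coprime[OF prime_p am(1)] by (simp add: coprime_commute)
    moreover have "m \<noteq> 0" using assms(2) am(2) by auto
    ultimately obtain u v where uv: "m * u = p ^ n * v + 1"
      using coprime_bezout_strong[of m "p ^ n"] bezout_nat[of m "p ^ n"] by (auto simp: coprime_iff_gcd_eq_1)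
    have "[u] \<cdot>\<^bsub>R\<^esub> ([m] \<cdot>\<^bsub>R\<^esub> s n) = [(p ^ n)] \<cdot>\<^bsub>R\<^esub> ([v] \<cdot>\<^bsub>R\<^esub> s n) \<oplus> s n"
      using sn R.nat_multiple_mult[of "s n" u m] R.nat_multiple_mult[of "s n" "p ^ n" v] uv
      by (simp add: mult.commute)
    moreover have "[u] \<cdot>\<^bsub>R\<^esub> ([m] \<cdot>\<^bsub>R\<^esub> s n) \<in> I n"
      using ms by (induction u) (auto intro: I_add I_zero)
    moreover have "[(p ^ n)] \<cdot>\<^bsub>R\<^esub> ([v] \<cdot>\<^bsub>R\<^esub> s n) \<in> I n"
      using sn by (auto simp: I_iff)
    moreover have "s n = [u] \<cdot>\<^bsub>R\<^esub> ([m] \<cdot>\<^bsub>R\<^esub> s n) \<ominus> [(p ^ n)] \<cdot>\<^bsub>R\<^esub> ([v] \<cdot>\<^bsub>R\<^esub> s n)"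
      using calculation(1) R.add_diff_cancel_left sn by simp
    ultimately show "s n \<in> I n"
      using I_add I_minus unfolding a_minus_def by metis
  qed
  then show ?thesis using s by (simp add: mk_eq_zero_iff)
qed

lemma I_mono: "m \<le> n \<Longrightarrow> x \<in> I n \<Longrightarrow> x \<in> I m"
proof (induction n rule: nat_induct_at_least)
  case (Suc n)
  then show ?case using I_Suc_subset by blast
qed simp

lemma diff_chain:
  assumes "a \<in> carrier R" "b \<in> carrier R" "c \<in> carrier R"
  shows "(a \<ominus> b) \<oplus> (b \<ominus> c) = a \<ominus> c" "(a \<ominus> c) \<ominus> (b \<ominus> c) = a \<ominus> b"
proof -
  show *: "(a \<ominus> b) \<oplus> (b \<ominus> c) = a \<ominus> c"
    using assms by (simp add: a_minus_def R.a_assoc R.r_neg1)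
  show "(a \<ominus> c) \<ominus> (b \<ominus> c) = a \<ominus> b"
    unfolding *[symmetric] using assms by (simp add: R.add_diff_cancel)
qed

lemma coherent_shift: "coherent s \<Longrightarrow> coherent (\<lambda>n. s (Suc n))"
  by (rule coherentI) (simp_all add: coherentD I_Suc_subset[OF coherentD(2)] del: power_Suc)

lemma mk_shift: "coherent s \<Longrightarrow> mk (\<lambda>n. s (Suc n)) = mk s"
  by (intro mk_eqI coherent_shift) (simp_all add: coherentD)

text \<open>
  For a representing sequence \<open>s\<close>, all differences \<open>s\<^bsub>n+1\<^esub> - s\<^sub>1\<close> are divisible by \<open>p\<close>, and their quotients by \<open>p\<close> are
  again coherent.
\<close>

lemma A_dense:
  assumes "x \<in> carrier A"
  shows "\<exists>r\<in>carrier R. \<exists>y\<in>carrier A. x = \<iota> r \<oplus>\<^bsub>A\<^esub> [p] \<cdot>\<^bsub>A\<^esub> y"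
proof -
  obtain s where s: "coherent s" "x = mk s" using assms carrier_A by blast
  note sc = coherentD(1)[OF s(1)]
  have sub: "s (Suc n) \<ominus> s 1 \<in> I (Suc 0)" for n
  proof (induction n)
    case (Suc n)
    have "s (Suc (Suc n)) \<ominus> s (Suc n) \<in> I (Suc 0)"
      using coherentD(2)[OF s(1), of "Suc n"] I_mono[of "Suc 0" "Suc n"] by simp
    then show ?case
      using I_add[OF _ Suc, of "s (Suc (Suc n)) \<ominus> s (Suc n)"] diff_chain(1)[OF sc sc sc] by simp
  next
    case 0
    have "s (Suc 0) \<ominus> s 1 = \<zero>" by (simp add: R.diff_self sc)
    then show ?case using I_zero[of "Suc 0"] by (simp only:)
  qed
  have "\<forall>n. \<exists>y. y \<in> carrier R \<and> s (Suc n) \<ominus> s 1 = [p] \<cdot>\<^bsub>R\<^esub> y"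
  proof
    fix n
    show "\<exists>y. y \<in> carrier R \<and> s (Suc n) \<ominus> s 1 = [p] \<cdot>\<^bsub>R\<^esub> y"
      using sub[of n] I_carrier unfolding I_Suc by blast
  qed
  from choice[OF this] obtain s' where s': "\<And>n. s' n \<in> carrier R" "\<And>n. s (Suc n) \<ominus> s 1 = [p] \<cdot>\<^bsub>R\<^esub> s' n"
    by auto
  have coh: "coherent s'"
  proof (rule coherentI)
    fix n
    have "[p] \<cdot>\<^bsub>R\<^esub> (s' (Suc n) \<ominus> s' n) = (s (Suc (Suc n)) \<ominus> s 1) \<ominus> (s (Suc n) \<ominus> s 1)"
      unfolding s'(2)
      by (rule additive_diff[OF R.is_abelian_group R.is_abelian_group R.additive_nat_multiple s'(1) s'(1)])
    also have "\<dots> = s (Suc (Suc n)) \<ominus> s (Suc n)" by (rule diff_chain(2)[OF sc sc sc])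
    finally have "[p] \<cdot>\<^bsub>R\<^esub> (s' (Suc n) \<ominus> s' n) \<in> I (Suc n)"
      using coherentD(2)[OF s(1), of "Suc n"] by simp
    then show "s' (Suc n) \<ominus> s' n \<in> I n"
      using I_p_cancel s'(1) by simp
  qed (rule s')
  have "\<iota> (s 1) \<oplus>\<^bsub>A\<^esub> [p] \<cdot>\<^bsub>A\<^esub> mk s' = mk (\<lambda>n. s 1 \<oplus> [p] \<cdot>\<^bsub>R\<^esub> s' n)"
    unfolding \<iota>_mk mk_nat_multiple(2)[OF coh]
    by (rule mk_add[OF coherent_const[OF sc] mk_nat_multiple(1)[OF coh]])
  also have "(\<lambda>n. s 1 \<oplus> [p] \<cdot>\<^bsub>R\<^esub> s' n) = (\<lambda>n. s (Suc n))"
  proof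
    fix n
    have "s 1 \<oplus> (s (Suc n) \<ominus> s 1) = (s (Suc n) \<ominus> s 1) \<oplus> s 1"
      by (rule R.a_comm) (simp_all add: sc)
    then show "s 1 \<oplus> [p] \<cdot>\<^bsub>R\<^esub> s' n = s (Suc n)"
      unfolding s'(2)[symmetric] by (simp add: R.diff_add_cancel sc)
  qed
  also have "mk (\<lambda>n. s (Suc n)) = x" using mk_shift[OF s(1)] s(2) by simp
  finally have "x = \<iota> (s 1) \<oplus>\<^bsub>A\<^esub> [p] \<cdot>\<^bsub>A\<^esub> mk s'" by (rule sym)
  then show ?thesis using sc[of 1] mk_closed[OF coh] by blast
qed

lemma A_pow_component:
  assumes "x \<in> carrier A"
  shows "([(p ^ n)] \<cdot>\<^bsub>A\<^esub> x) n = \<zero>\<^bsub>Q n\<^esub>"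
proof -
  obtain s where s: "coherent s" "x = mk s" using assms carrier_A by blast
  have "[(p ^ n)] \<cdot>\<^bsub>R\<^esub> s n \<in> I n" using coherentD(1)[OF s(1)] by (auto simp: I_iff)
  then show ?thesis
    using mk_nat_multiple[OF s(1), of "p ^ n"] coherentD(1)[OF s(1), of n] cls_eq_zero_iff
    by (simp add: s(2) mk_def)
qed

lemma A_pure:
  assumes "r \<in> carrier R" "x \<in> carrier A" "\<iota> r = [(p ^ n)] \<cdot>\<^bsub>A\<^esub> x"
  shows "r \<in> I n"
  using A_pow_component[OF assms(2), of n] assms(3)[symmetric] assms(1) cls_eq_zero_iff
  by (simp add: \<iota>_mk mk_def)

lemma A_separated:
  assumes w: "\<And>n. w n \<in> carrier A" "\<And>n. w n = [p] \<cdot>\<^bsub>A\<^esub> w (Suc n)"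
  shows "w 0 = \<zero>\<^bsub>A\<^esub>"
proof -
  have "w 0 = [(p ^ n)] \<cdot>\<^bsub>A\<^esub> w n" for n
  proof (induction n)
    case (Suc n)
    have "[(p ^ Suc n)] \<cdot>\<^bsub>A\<^esub> w (Suc n) = [(p ^ n)] \<cdot>\<^bsub>A\<^esub> ([p] \<cdot>\<^bsub>A\<^esub> w (Suc n))"
      using A.nat_multiple_mult[OF w(1), of "p ^ n" p] by (simp add: mult.commute)
    then show ?case using Suc w(2)[of n] by simp
  qed (simp add: w(1))
  then have "w 0 n = \<zero>\<^bsub>Q n\<^esub>" for n
    using A_pow_component[OF w(1), of n n] by metis
  then show ?thesis by (simp add: A_simps fun_eq_iff)
qed

text \<open>
  If \<open>s i\<close> represents \<open>x\<^sub>i\<close>, then \<open>horner n m s\<close> represents \<open>\<Sum> p\<^sup>i x\<^bsub>m+i\<^esub>\<close> modulo \<open>p\<^sup>n\<close>: it suffices to know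
  \<open>x\<^bsub>m+i\<^esub>\<close> modulo \<open>p\<^bsup>n-i\<^esup>\<close>.
\<close>

fun horner :: "nat \<Rightarrow> nat \<Rightarrow> (nat \<Rightarrow> nat \<Rightarrow> 'r) \<Rightarrow> 'r" where
  "horner 0 m s = \<zero>"
| "horner (Suc n) m s = s m (Suc n) \<oplus> [p] \<cdot>\<^bsub>R\<^esub> horner n (Suc m) s"

lemma A_complete:
  assumes x: "\<And>m. x m \<in> carrier A"
  shows "\<exists>y. \<forall>m. y m \<in> carrier A \<and> y m = x m \<oplus>\<^bsub>A\<^esub> [p] \<cdot>\<^bsub>A\<^esub> y (Suc m)"
proof -
  have "\<forall>m. \<exists>s. coherent s \<and> x m = mk s" using x carrier_A by blast
  then obtain s where s: "\<And>m. coherent (s m)" "\<And>m. x m = mk (s m)" by metis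
  note sc = coherentD(1)[OF s(1)]
  have hc: "horner n m s \<in> carrier R" for n m
    by (induction n arbitrary: m) (simp_all add: sc)
  have hd: "horner (Suc n) m s \<ominus> horner n m s \<in> I n" for n m
  proof (induction n arbitrary: m)
    case 0
    have "horner (Suc 0) m s \<ominus> horner 0 m s \<in> carrier R" using hc by (intro R.minus_closed)
    then show ?case by (simp only: I_0)
  next
    case (Suc n)
    have "horner (Suc (Suc n)) m s \<ominus> horner (Suc n) m s
      = (s m (Suc (Suc n)) \<ominus> s m (Suc n)) \<oplus>
        ([p] \<cdot>\<^bsub>R\<^esub> horner (Suc n) (Suc m) s \<ominus> [p] \<cdot>\<^bsub>R\<^esub> horner n (Suc m) s)"
      unfolding horner.simps(2)[of "Suc n" m] horner.simps(2)[of n m]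
      by (rule R.add_diff_add) (simp_all add: sc hc del: horner.simps)
    moreover have "[p] \<cdot>\<^bsub>R\<^esub> horner (Suc n) (Suc m) s \<ominus> [p] \<cdot>\<^bsub>R\<^esub> horner n (Suc m) s \<in> I (Suc n)"
      using I_p[OF Suc] additive_diff[OF R.is_abelian_group R.is_abelian_group R.additive_nat_multiple hc hc] by metis
    ultimately show ?case using I_add coherentD(2)[OF s(1)] by (simp del: horner.simps power_Suc)
  qed
  have coh: "coherent (\<lambda>n. horner n m s)" for m
    by (rule coherentI) (simp_all add: hc hd del: horner.simps)
  have "mk (\<lambda>n. horner n m s) = x m \<oplus>\<^bsub>A\<^esub> [p] \<cdot>\<^bsub>A\<^esub> mk (\<lambda>n. horner n (Suc m) s)" for m
  proof -
    have "x m \<oplus>\<^bsub>A\<^esub> [p] \<cdot>\<^bsub>A\<^esub> mk (\<lambda>n. horner n (Suc m) s) = mk (\<lambda>n. s m n \<oplus> [p] \<cdot>\<^bsub>R\<^esub> horner n (Suc m) s)"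
      unfolding s(2) mk_nat_multiple(2)[OF coh]
      by (rule mk_add[OF s(1) mk_nat_multiple(1)[OF coh]])
    also have "\<dots> = mk (\<lambda>n. horner (Suc n) m s)"
    proof (rule mk_eqI[OF coherent_add[OF s(1) mk_nat_multiple(1)[OF coh]] coherent_shift[OF coh]])
      fix n
      have "(s m n \<oplus> [p] \<cdot>\<^bsub>R\<^esub> horner n (Suc m) s) \<ominus> horner (Suc n) m s = \<ominus> (s m (Suc n) \<ominus> s m n)"
        using sc[of m n] sc[of m "Suc n"] hc[of n "Suc m"]
        by (simp add: R.add_diff_add R.diff_self) (simp add: a_minus_def R.minus_add R.a_comm)
      then show "(s m n \<oplus> [p] \<cdot>\<^bsub>R\<^esub> horner n (Suc m) s) \<ominus> horner (Suc n) m s \<in> I n"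
        using I_minus coherentD(2)[OF s(1)] by simp
    qed
    finally show ?thesis using mk_shift[OF coh] by simp
  qed
  then show ?thesis using mk_closed[OF coh] by (intro exI[of _ "\<lambda>m. mk (\<lambda>n. horner n m s)"]) blast
qed

abbreviation CM where "CM \<equiv> completion_module p R"

lemma CM_simps:
  "carrier CM = carrier A" "add CM = add A" "ring.zero CM = ring.zero A"
  "r \<odot>\<^bsub>CM\<^esub> x = x \<otimes>\<^bsub>A\<^esub> \<iota> r"
  by (simp_all add: completion_module_def Let_def \<iota>_def)

lemma CM_multiple: "[(k::nat)] \<cdot>\<^bsub>CM\<^esub> x = [k] \<cdot>\<^bsub>A\<^esub> x"
  by (simp add: add_pow_def nat_pow_def CM_simps)

lemma right_module_CM: "right_module R CM"
proof -
  interpret CM: abelian_group CM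
    by (rule abelian_group_transfer[OF A.is_abelian_group]) (simp_all add: CM_simps)
  show ?thesis
    by unfold_locales
      (simp_all add: CM_simps \<iota>_closed \<iota>_add \<iota>_mult \<iota>_one A.r_distr A.l_distr A.m_assoc)
qed

end

section \<open>Completeness and exactness\<close>

text \<open>
  Here \<open>y\<^sub>m\<close> is the sum of the series \<open>\<Sum> p\<^sup>i x\<^bsub>m+i\<^esub>\<close>.  Asking for all the tails of the series at once makes it
  unnecessary to speak of limits.
\<close>

definition padic_complete :: "nat \<Rightarrow> ('a, 'x) ring_scheme \<Rightarrow> bool"
  where "padic_complete p T \<longleftrightarrow> (\<forall>x. (\<forall>m::nat. x m \<in> carrier T) \<longrightarrow>
    (\<exists>y. \<forall>m. y m \<in> carrier T \<and> y m = x m \<oplus>\<^bsub>T\<^esub> [p] \<cdot>\<^bsub>T\<^esub> y (Suc m)))"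

text \<open>
  In a torsion free group, the possible values of \<open>w 0\<close> are exactly the elements of \<open>\<Inter> p\<^sup>k T\<close>.
\<close>

definition padic_separated :: "nat \<Rightarrow> ('a, 'x) ring_scheme \<Rightarrow> bool"
  where "padic_separated p T \<longleftrightarrow> (\<forall>w. (\<forall>m::nat. w m \<in> carrier T) \<longrightarrow>
    (\<forall>m. w m = [p] \<cdot>\<^bsub>T\<^esub> w (Suc m)) \<longrightarrow> w 0 = \<zero>\<^bsub>T\<^esub>)"

text \<open>
  Iterating the step expands \<open>x\<close> formally as \<open>f (\<Sum> p\<^sup>i s\<^sub>i)\<close>.  Completeness of \<open>T\<close> provides the sum of the series,
  and the difference of the two sides is infinitely divisible by \<open>p\<close>, hence zero.
\<close>

lemma successive_approximation:
  assumes T: "abelian_group T" and T': "abelian_group T'" and f: "additive T T' f"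
    and comp: "padic_complete p T" and sep: "padic_separated p T'"
    and K: "K \<subseteq> carrier T'"
    and step: "\<And>x. x \<in> K \<Longrightarrow> \<exists>s\<in>carrier T. \<exists>x'\<in>K. x = f s \<oplus>\<^bsub>T'\<^esub> [p] \<cdot>\<^bsub>T'\<^esub> x'"
  shows "K \<subseteq> f ` carrier T"
proof
  interpret T: abelian_group T by fact
  interpret T': abelian_group T' by fact
  fix x assume x: "x \<in> K"
  have "\<forall>x\<in>K. \<exists>q. fst q \<in> carrier T \<and> snd q \<in> K \<and> x = f (fst q) \<oplus>\<^bsub>T'\<^esub> [p] \<cdot>\<^bsub>T'\<^esub> snd q"
    using step by fastforce
  from bchoice[OF this] obtain q where q: "\<And>x. x \<in> K \<Longrightarrow> fst (q x) \<in> carrier T"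
    "\<And>x. x \<in> K \<Longrightarrow> snd (q x) \<in> K" "\<And>x. x \<in> K \<Longrightarrow> x = f (fst (q x)) \<oplus>\<^bsub>T'\<^esub> [p] \<cdot>\<^bsub>T'\<^esub> snd (q x)"
    by auto
  define xs where "xs = (\<lambda>n::nat. ((\<lambda>x. snd (q x)) ^^ n) x)"
  have xs0: "xs 0 = x" and xsS: "xs (Suc n) = snd (q (xs n))" for n
    by (simp_all add: xs_def)
  have xsK: "xs n \<in> K" for n
    by (induction n) (simp_all add: xs0 xsS x q(2))
  then have xsT: "xs n \<in> carrier T'" for n using K by blast
  define s where "s = (\<lambda>n. fst (q (xs n)))"
  have s: "s n \<in> carrier T" for n by (simp add: s_def q(1) xsK)
  have xs: "xs n = f (s n) \<oplus>\<^bsub>T'\<^esub> [p] \<cdot>\<^bsub>T'\<^esub> xs (Suc n)" for n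
    using q(3)[OF xsK[of n]] by (simp add: s_def xsS)
  obtain y where y: "\<And>m. y m \<in> carrier T" "\<And>m. y m = s m \<oplus>\<^bsub>T\<^esub> [p] \<cdot>\<^bsub>T\<^esub> y (Suc m)"
    using comp s unfolding padic_complete_def by blast
  define w where "w = (\<lambda>n. xs n \<ominus>\<^bsub>T'\<^esub> f (y n))"
  note fc = additive_closed[OF f]
  have fy: "f (y n) = f (s n) \<oplus>\<^bsub>T'\<^esub> [p] \<cdot>\<^bsub>T'\<^esub> f (y (Suc n))" for n
    using arg_cong[OF y(2)[of n], of f] by (simp add: additive_add[OF f] s y(1) additive_nat_pow[OF T T' f])
  have "w n = [p] \<cdot>\<^bsub>T'\<^esub> w (Suc n)" for n
  proof -
    have "w n = (f (s n) \<oplus>\<^bsub>T'\<^esub> [p] \<cdot>\<^bsub>T'\<^esub> xs (Suc n)) \<ominus>\<^bsub>T'\<^esub> (f (s n) \<oplus>\<^bsub>T'\<^esub> [p] \<cdot>\<^bsub>T'\<^esub> f (y (Suc n)))"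
      unfolding w_def using xs[of n] fy[of n] by metis
    also have "\<dots> = [p] \<cdot>\<^bsub>T'\<^esub> xs (Suc n) \<ominus>\<^bsub>T'\<^esub> [p] \<cdot>\<^bsub>T'\<^esub> f (y (Suc n))"
      by (simp add: T'.add_diff_add T'.diff_self fc s y(1) xsT)
    also have "\<dots> = [p] \<cdot>\<^bsub>T'\<^esub> w (Suc n)"
      unfolding w_def by (rule additive_diff[OF T' T' T'.additive_nat_multiple, symmetric]) (simp_all add: fc y(1) xsT)
    finally show ?thesis .
  qed
  moreover have "w n \<in> carrier T'" for n by (simp add: w_def fc y(1) xsT)
  ultimately have "w 0 = \<zero>\<^bsub>T'\<^esub>" using sep unfolding padic_separated_def by blast
  then have "x = f (y 0)" using T'.diff_eq_zero[OF xsT fc[OF y(1)], of 0 0] by (simp add: w_def xs0)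
  then show "x \<in> f ` carrier T" using y(1) by blast
qed

text \<open>
  A resolution \<open>P\<close> of \<open>M\<close> together with its \<open>p\<close>-adic completion \<open>T\<close>, reduced to underlying abelian groups.
  Taken together, \<open>dense\<close> and \<open>pure\<close> say that \<open>P/p\<^sup>kP \<rightarrow> T/p\<^sup>kT\<close> is bijective.
\<close>

locale completed_resolution =
  fixes p :: nat and P :: "nat \<Rightarrow> ('r, 'a) module" and T :: "nat \<Rightarrow> ('s, 'b) module"
    and D :: "nat \<Rightarrow> 'a \<Rightarrow> 'a" and DT :: "nat \<Rightarrow> 'b \<Rightarrow> 'b" and \<iota> :: "nat \<Rightarrow> 'a \<Rightarrow> 'b"
    and M :: "('r, 'm) module" and \<epsilon> :: "'a \<Rightarrow> 'm"
  assumes P: "\<And>n. abelian_group (P n)" and T: "\<And>n. abelian_group (T n)" and M: "abelian_group M"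
    and D: "\<And>n. additive (P (Suc n)) (P n) (D n)"
    and DT: "\<And>n. additive (T (Suc n)) (T n) (DT n)"
    and \<iota>: "\<And>n. additive (P n) (T n) (\<iota> n)"
    and \<epsilon>: "additive (P 0) M \<epsilon>"
    and comm: "\<And>n x. x \<in> carrier (P (Suc n)) \<Longrightarrow> DT n (\<iota> (Suc n) x) = \<iota> n (D n x)"
    and tfP: "\<And>n x. x \<in> carrier (P n) \<Longrightarrow> [p] \<cdot>\<^bsub>P n\<^esub> x = \<zero>\<^bsub>P n\<^esub> \<Longrightarrow> x = \<zero>\<^bsub>P n\<^esub>"
    and tfT: "\<And>n x. x \<in> carrier (T n) \<Longrightarrow> [p] \<cdot>\<^bsub>T n\<^esub> x = \<zero>\<^bsub>T n\<^esub> \<Longrightarrow> x = \<zero>\<^bsub>T n\<^esub>"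
    and dense: "\<And>n t. t \<in> carrier (T n) \<Longrightarrow> \<exists>u\<in>carrier (P n). \<exists>t'\<in>carrier (T n). t = \<iota> n u \<oplus>\<^bsub>T n\<^esub> [p] \<cdot>\<^bsub>T n\<^esub> t'"
    and pure: "\<And>n u t k. u \<in> carrier (P n) \<Longrightarrow> t \<in> carrier (T n) \<Longrightarrow> \<iota> n u = [(p ^ k)] \<cdot>\<^bsub>T n\<^esub> t
        \<Longrightarrow> \<exists>v\<in>carrier (P n). u = [(p ^ k)] \<cdot>\<^bsub>P n\<^esub> v"
    and complete: "\<And>n. padic_complete p (T n)" and separated: "\<And>n. padic_separated p (T n)"
    and DD: "\<And>n x. x \<in> carrier (P (Suc (Suc n))) \<Longrightarrow> D n (D (Suc n) x) = \<zero>\<^bsub>P n\<^esub>"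
    and exact: "\<And>n x. x \<in> carrier (P (Suc n)) \<Longrightarrow> D n x = \<zero>\<^bsub>P n\<^esub> \<Longrightarrow> x \<in> D (Suc n) ` carrier (P (Suc (Suc n)))"
    and \<epsilon>_surj: "\<And>x. x \<in> carrier M \<Longrightarrow> x \<in> \<epsilon> ` carrier (P 0)"
    and \<epsilon>_D: "\<And>x. x \<in> carrier (P (Suc 0)) \<Longrightarrow> \<epsilon> (D 0 x) = \<zero>\<^bsub>M\<^esub>"
    and exact0: "\<And>x. x \<in> carrier (P 0) \<Longrightarrow> \<epsilon> x = \<zero>\<^bsub>M\<^esub> \<Longrightarrow> x \<in> D 0 ` carrier (P (Suc 0))"
begin

sublocale P: abelian_group "P n" for n by (rule P)
sublocale T: abelian_group "T n" for n by (rule T)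
sublocale M: abelian_group M by (rule M)

lemmas Dc = additive_closed[OF D] and DTc = additive_closed[OF DT] and \<iota>c = additive_closed[OF \<iota>]
  and \<epsilon>c = additive_closed[OF \<epsilon>]

lemma tfP_power:
  assumes "x \<in> carrier (P n)" "[(p ^ k)] \<cdot>\<^bsub>P n\<^esub> x = \<zero>\<^bsub>P n\<^esub>"
  shows "x = \<zero>\<^bsub>P n\<^esub>"
  using assms
proof (induction k)
  case (Suc k)
  then show ?case using tfP[of "[(p ^ k)] \<cdot>\<^bsub>P n\<^esub> x" n] P.nat_multiple_Suc_power[of x n p k] by simp
qed simp

lemma P_cancel:
  assumes "x \<in> carrier (P n)" "y \<in> carrier (P n)" "[(p ^ k)] \<cdot>\<^bsub>P n\<^esub> x = [(p ^ k)] \<cdot>\<^bsub>P n\<^esub> y"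
  shows "x = y"
proof -
  have "[(p ^ k)] \<cdot>\<^bsub>P n\<^esub> (x \<ominus>\<^bsub>P n\<^esub> y) = \<zero>\<^bsub>P n\<^esub>"
    using assms additive_diff[OF P P P.additive_nat_multiple assms(1,2)] by (simp add: P.diff_self)
  then show ?thesis using tfP_power[of "x \<ominus>\<^bsub>P n\<^esub> y" n k] assms P.diff_eq_zero[of x n y] by simp
qed

lemma dense_power:
  assumes t: "t \<in> carrier (T n)"
  shows "\<exists>u\<in>carrier (P n). \<exists>t'\<in>carrier (T n). t = \<iota> n u \<oplus>\<^bsub>T n\<^esub> [(p ^ k)] \<cdot>\<^bsub>T n\<^esub> t'"
proof (induction k)
  case 0
  have "t = \<iota> n \<zero>\<^bsub>P n\<^esub> \<oplus>\<^bsub>T n\<^esub> [(p ^ 0)] \<cdot>\<^bsub>T n\<^esub> t"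
    using t additive_zero[OF P T \<iota>] by simp
  then show ?case using t by blast
next
  case (Suc k)
  then obtain u t' where u: "u \<in> carrier (P n)" "t' \<in> carrier (T n)"
    "t = \<iota> n u \<oplus>\<^bsub>T n\<^esub> [(p ^ k)] \<cdot>\<^bsub>T n\<^esub> t'" by blast
  obtain v t'' where v: "v \<in> carrier (P n)" "t'' \<in> carrier (T n)"
    "t' = \<iota> n v \<oplus>\<^bsub>T n\<^esub> [p] \<cdot>\<^bsub>T n\<^esub> t''" using dense[OF u(2)] by blast
  have "[(p ^ k)] \<cdot>\<^bsub>T n\<^esub> t' = [(p ^ k)] \<cdot>\<^bsub>T n\<^esub> \<iota> n v \<oplus>\<^bsub>T n\<^esub> [(p ^ k)] \<cdot>\<^bsub>T n\<^esub> ([p] \<cdot>\<^bsub>T n\<^esub> t'')"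
    unfolding v(3) by (rule additive_add[OF T.additive_nat_multiple]) (simp_all add: v \<iota>c)
  also have "[(p ^ k)] \<cdot>\<^bsub>T n\<^esub> ([p] \<cdot>\<^bsub>T n\<^esub> t'') = [(p ^ Suc k)] \<cdot>\<^bsub>T n\<^esub> t''"
    using T.nat_multiple_mult[OF v(2), of "p ^ k" p] by (simp add: mult.commute)
  also have "[(p ^ k)] \<cdot>\<^bsub>T n\<^esub> \<iota> n v = \<iota> n ([(p ^ k)] \<cdot>\<^bsub>P n\<^esub> v)"
    by (rule additive_nat_pow[OF P T \<iota> v(1), symmetric])
  finally have "t = \<iota> n (u \<oplus>\<^bsub>P n\<^esub> [(p ^ k)] \<cdot>\<^bsub>P n\<^esub> v) \<oplus>\<^bsub>T n\<^esub> [(p ^ Suc k)] \<cdot>\<^bsub>T n\<^esub> t''"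
    using u v by (simp add: additive_add[OF \<iota>] T.a_assoc \<iota>c del: power_Suc)
  then show ?case using u v by blast
qed

text \<open>
  The square of the boundary vanishes on the image of \<open>P\<close>.  By density its values on \<open>T\<close> are therefore infinitely
  divisible by \<open>p\<close>.
\<close>

lemma DDT: "t \<in> carrier (T (Suc (Suc n))) \<Longrightarrow> DT n (DT (Suc n) t) = \<zero>\<^bsub>T n\<^esub>"
proof -
  assume t: "t \<in> carrier (T (Suc (Suc n)))"
  define w where "w = (\<lambda>t. DT n (DT (Suc n) t))"
  have w: "additive (T (Suc (Suc n))) (T n) w"
    unfolding w_def by (rule additive_compose[OF DT DT])
  have step: "\<exists>t'\<in>carrier (T (Suc (Suc n))). w t = [p] \<cdot>\<^bsub>T n\<^esub> w t'" if t: "t \<in> carrier (T (Suc (Suc n)))" for t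
  proof -
    obtain u t' where u: "u \<in> carrier (P (Suc (Suc n)))" "t' \<in> carrier (T (Suc (Suc n)))"
      "t = \<iota> (Suc (Suc n)) u \<oplus>\<^bsub>T (Suc (Suc n))\<^esub> [p] \<cdot>\<^bsub>T (Suc (Suc n))\<^esub> t'"
      using dense[OF t] by blast
    have "w (\<iota> (Suc (Suc n)) u) = \<zero>\<^bsub>T n\<^esub>"
      using u(1) additive_zero[OF P T \<iota>] by (simp add: w_def comm Dc DD)
    then have "w t = [p] \<cdot>\<^bsub>T n\<^esub> w t'"
      unfolding u(3) using u additive_closed[OF w] \<iota>c by (simp add: additive_add[OF w] additive_nat_pow[OF T T w])
    then show ?thesis using u by blast
  qed
  have "\<forall>t\<in>carrier (T (Suc (Suc n))). \<exists>t'. t' \<in> carrier (T (Suc (Suc n))) \<and> w t = [p] \<cdot>\<^bsub>T n\<^esub> w t'"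
    using step by blast
  from bchoice[OF this] obtain q where q: "\<And>t. t \<in> carrier (T (Suc (Suc n))) \<Longrightarrow> q t \<in> carrier (T (Suc (Suc n)))"
    "\<And>t. t \<in> carrier (T (Suc (Suc n))) \<Longrightarrow> w t = [p] \<cdot>\<^bsub>T n\<^esub> w (q t)" by auto
  have qc: "(q ^^ m) t \<in> carrier (T (Suc (Suc n)))" for m
    by (induction m) (simp_all add: t q(1))
  have "\<forall>m. w ((q ^^ m) t) \<in> carrier (T n)" by (intro allI additive_closed[OF w] qc)
  moreover have "\<forall>m. w ((q ^^ m) t) = [p] \<cdot>\<^bsub>T n\<^esub> w ((q ^^ Suc m) t)" using q(2)[OF qc] by simp
  ultimately have "w ((q ^^ 0) t) = \<zero>\<^bsub>T n\<^esub>"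
    using separated[of n, unfolded padic_separated_def, rule_format, of "\<lambda>m. w ((q ^^ m) t)"] by simp
  then show ?thesis by (simp add: w_def)
qed

text \<open>
  Successive approximation on the group of cycles: if a cycle has the form \<open>\<delta> s + p y\<close>, then \<open>p \<delta> y = 0\<close>, and \<open>y\<close> is
  a cycle because \<open>T\<close> is torsion free.
\<close>

lemma exactT_if:
  assumes step: "\<And>x. \<lbrakk>x \<in> carrier (T (Suc n)); DT n x = \<zero>\<^bsub>T n\<^esub>\<rbrakk> \<Longrightarrow>
      \<exists>s\<in>carrier (P (Suc (Suc n))). \<exists>y\<in>carrier (T (Suc n)). x = \<iota> (Suc n) (D (Suc n) s) \<oplus>\<^bsub>T (Suc n)\<^esub> [p] \<cdot>\<^bsub>T (Suc n)\<^esub> y"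
    and x: "x \<in> carrier (T (Suc n))" "DT n x = \<zero>\<^bsub>T n\<^esub>"
  shows "x \<in> DT (Suc n) ` carrier (T (Suc (Suc n)))"
proof -
  let ?K = "{x \<in> carrier (T (Suc n)). DT n x = \<zero>\<^bsub>T n\<^esub>}"
  have "?K \<subseteq> DT (Suc n) ` carrier (T (Suc (Suc n)))"
  proof (rule successive_approximation[OF T T DT complete separated])
    fix x assume "x \<in> ?K"
    then have x: "x \<in> carrier (T (Suc n))" "DT n x = \<zero>\<^bsub>T n\<^esub>" by auto
    obtain s y where s: "s \<in> carrier (P (Suc (Suc n)))" and y: "y \<in> carrier (T (Suc n))"
      and xy: "x = \<iota> (Suc n) (D (Suc n) s) \<oplus>\<^bsub>T (Suc n)\<^esub> [p] \<cdot>\<^bsub>T (Suc n)\<^esub> y"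
      using step[OF x] by blast
    let ?s = "\<iota> (Suc (Suc n)) s"
    have xs: "x = DT (Suc n) ?s \<oplus>\<^bsub>T (Suc n)\<^esub> [p] \<cdot>\<^bsub>T (Suc n)\<^esub> y" using xy s by (simp add: comm)
    have "DT n x = DT n (DT (Suc n) ?s) \<oplus>\<^bsub>T n\<^esub> [p] \<cdot>\<^bsub>T n\<^esub> DT n y"
      unfolding xs using y s by (simp add: additive_add[OF DT] DTc \<iota>c additive_nat_pow[OF T T DT])
    then have "[p] \<cdot>\<^bsub>T n\<^esub> DT n y = \<zero>\<^bsub>T n\<^esub>" using x(2) y s by (simp add: DDT \<iota>c DTc)
    then have "DT n y = \<zero>\<^bsub>T n\<^esub>" using tfT y DTc by blast
    then show "\<exists>s\<in>carrier (T (Suc (Suc n))). \<exists>x'\<in>?K. x = DT (Suc n) s \<oplus>\<^bsub>T (Suc n)\<^esub> [p] \<cdot>\<^bsub>T (Suc n)\<^esub> x'"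
      using xs y s \<iota>c by blast
  qed blast
  then show ?thesis using x by blast
qed

text \<open>
  For any approximation \<open>x = u + p\<^sup>k t\<close>, the boundary \<open>\<delta> u = - p\<^sup>k \<delta> t\<close> is divisible by \<open>p\<^sup>k\<close> in \<open>T\<close>, hence in \<open>P\<close> by
  purity.
\<close>

lemma cycle_approximation:
  assumes x: "x \<in> carrier (T (Suc n))" "DT n x = \<zero>\<^bsub>T n\<^esub>"
  shows "\<exists>u\<in>carrier (P (Suc n)). \<exists>t\<in>carrier (T (Suc n)). \<exists>v\<in>carrier (P n).
    x = \<iota> (Suc n) u \<oplus>\<^bsub>T (Suc n)\<^esub> [(p ^ k)] \<cdot>\<^bsub>T (Suc n)\<^esub> t \<and> D n u = [(p ^ k)] \<cdot>\<^bsub>P n\<^esub> v"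
proof -
  obtain u t where u: "u \<in> carrier (P (Suc n))" and t: "t \<in> carrier (T (Suc n))"
    and xu: "x = \<iota> (Suc n) u \<oplus>\<^bsub>T (Suc n)\<^esub> [(p ^ k)] \<cdot>\<^bsub>T (Suc n)\<^esub> t"
    using dense_power[OF x(1)] by blast
  have "DT n x = \<iota> n (D n u) \<oplus>\<^bsub>T n\<^esub> [(p ^ k)] \<cdot>\<^bsub>T n\<^esub> DT n t"
    unfolding xu using u t by (simp add: additive_add[OF DT] \<iota>c comm additive_nat_pow[OF T T DT])
  then have "\<iota> n (D n u) = \<ominus>\<^bsub>T n\<^esub> ([(p ^ k)] \<cdot>\<^bsub>T n\<^esub> DT n t)"
    using x(2) u t by (metis T.minus_equality DTc Dc T.add.nat_pow_closed \<iota>c)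
  also have "\<dots> = [(p ^ k)] \<cdot>\<^bsub>T n\<^esub> (\<ominus>\<^bsub>T n\<^esub> DT n t)"
    by (rule additive_uminus[OF T T T.additive_nat_multiple DTc[OF t], symmetric])
  finally obtain v where "v \<in> carrier (P n)" "D n u = [(p ^ k)] \<cdot>\<^bsub>P n\<^esub> v"
    using pure[of "D n u" n "\<ominus>\<^bsub>T n\<^esub> DT n t" k] u t DTc Dc by auto
  then show ?thesis using u t xu by blast
qed

text \<open>
  The element \<open>u - p w\<close> is a cycle of the resolution \<open>P\<close>, hence the boundary of some \<open>s\<close>.
\<close>

lemma boundary_mod_p:
  assumes u: "u \<in> carrier (P (Suc n))" and t: "t \<in> carrier (T (Suc n))" and w: "w \<in> carrier (P (Suc n))"
    and x: "x = \<iota> (Suc n) u \<oplus>\<^bsub>T (Suc n)\<^esub> [p] \<cdot>\<^bsub>T (Suc n)\<^esub> t"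
    and Du: "D n u = [p] \<cdot>\<^bsub>P n\<^esub> D n w"
  shows "\<exists>s\<in>carrier (P (Suc (Suc n))). \<exists>y\<in>carrier (T (Suc n)). x = \<iota> (Suc n) (D (Suc n) s) \<oplus>\<^bsub>T (Suc n)\<^esub> [p] \<cdot>\<^bsub>T (Suc n)\<^esub> y"
proof -
  let ?c = "u \<ominus>\<^bsub>P (Suc n)\<^esub> [p] \<cdot>\<^bsub>P (Suc n)\<^esub> w"
  have c: "?c \<in> carrier (P (Suc n))" using u w by simp
  have "D n ?c = \<zero>\<^bsub>P n\<^esub>"
    using u w by (simp add: additive_diff[OF P P D] additive_nat_pow[OF P P D] Du P.diff_self Dc)
  then obtain s where s: "s \<in> carrier (P (Suc (Suc n)))" "?c = D (Suc n) s"
    using exact[OF c] by blast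
  have "u = D (Suc n) s \<oplus>\<^bsub>P (Suc n)\<^esub> [p] \<cdot>\<^bsub>P (Suc n)\<^esub> w"
    using u w by (simp add: s(2)[symmetric] P.diff_add_cancel)
  then have "\<iota> (Suc n) u = \<iota> (Suc n) (D (Suc n) s) \<oplus>\<^bsub>T (Suc n)\<^esub> [p] \<cdot>\<^bsub>T (Suc n)\<^esub> \<iota> (Suc n) w"
    using w s(1) Dc by (simp add: additive_add[OF \<iota>] additive_nat_pow[OF P T \<iota>])
  then have "x = \<iota> (Suc n) (D (Suc n) s) \<oplus>\<^bsub>T (Suc n)\<^esub> [p] \<cdot>\<^bsub>T (Suc n)\<^esub> (\<iota> (Suc n) w \<oplus>\<^bsub>T (Suc n)\<^esub> t)"
    unfolding x using w t s(1) by (simp add: additive_add[OF T.additive_nat_multiple] T.a_assoc \<iota>c Dc)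
  then show ?thesis using s(1) w t \<iota>c T.a_closed by metis
qed

text \<open>
  If \<open>\<delta> u = p v\<close>, then \<open>p \<delta> v = 0\<close>.  So \<open>v\<close> is a cycle and, in positive degree, a boundary.
\<close>

lemma exactT_high:
  assumes x: "x \<in> carrier (T (Suc (Suc n)))" "DT (Suc n) x = \<zero>\<^bsub>T (Suc n)\<^esub>"
  shows "x \<in> DT (Suc (Suc n)) ` carrier (T (Suc (Suc (Suc n))))"
proof (rule exactT_if[OF _ x])
  fix x assume x: "x \<in> carrier (T (Suc (Suc n)))" "DT (Suc n) x = \<zero>\<^bsub>T (Suc n)\<^esub>"
  obtain u t v where u: "u \<in> carrier (P (Suc (Suc n)))" and t: "t \<in> carrier (T (Suc (Suc n)))"
    and v: "v \<in> carrier (P (Suc n))"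
    and xu: "x = \<iota> (Suc (Suc n)) u \<oplus>\<^bsub>T (Suc (Suc n))\<^esub> [p] \<cdot>\<^bsub>T (Suc (Suc n))\<^esub> t"
    and Du: "D (Suc n) u = [p] \<cdot>\<^bsub>P (Suc n)\<^esub> v"
    using cycle_approximation[OF x, of 1] by auto
  have "[p] \<cdot>\<^bsub>P n\<^esub> D n v = D n (D (Suc n) u)"
    unfolding Du by (rule additive_nat_pow[OF P P D v, symmetric])
  then have "D n v = \<zero>\<^bsub>P n\<^esub>" using tfP v u by (simp add: DD Dc)
  then obtain w where w: "w \<in> carrier (P (Suc (Suc n)))" "v = D (Suc n) w" using exact[OF v] by blast
  show "\<exists>s\<in>carrier (P (Suc (Suc (Suc n)))). \<exists>y\<in>carrier (T (Suc (Suc n))).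
      x = \<iota> (Suc (Suc n)) (D (Suc (Suc n)) s) \<oplus>\<^bsub>T (Suc (Suc n))\<^esub> [p] \<cdot>\<^bsub>T (Suc (Suc n))\<^esub> y"
    by (rule boundary_mod_p[OF u t w(1) xu]) (simp add: Du w(2))
qed

text \<open>
  Now \<open>v\<close> has degree 0, where a cycle is a boundary only if its image in \<open>M\<close> vanishes.  The approximations
  \<open>x = u\<^sub>k + p\<^sup>k t\<^sub>k\<close> with \<open>\<delta> u\<^sub>k = p\<^sup>k v\<^sub>k\<close> provide elements \<open>\<epsilon> v\<^sub>k\<close> of \<open>M\<close> that are killed by \<open>p\<^sup>k\<close>
  and satisfy \<open>p \<epsilon> v\<^bsub>k+1\<^esub> = \<epsilon> v\<^sub>k\<close>, to which the hypothesis on the inverse limit applies.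
\<close>

lemma exactT_1:
  assumes lim: "\<And>m. (\<And>k. m k \<in> carrier M) \<Longrightarrow> (\<And>k. [(p ^ k)] \<cdot>\<^bsub>M\<^esub> m k = \<zero>\<^bsub>M\<^esub>) \<Longrightarrow>
      (\<And>k. [p] \<cdot>\<^bsub>M\<^esub> m (Suc k) = m k) \<Longrightarrow> m 1 = \<zero>\<^bsub>M\<^esub>"
    and x: "x \<in> carrier (T (Suc 0))" "DT 0 x = \<zero>\<^bsub>T 0\<^esub>"
  shows "x \<in> DT (Suc 0) ` carrier (T (Suc (Suc 0)))"
proof (rule exactT_if[OF _ x])
  let ?P = "P (Suc 0)" and ?T = "T (Suc 0)"
  fix x assume x: "x \<in> carrier ?T" "DT 0 x = \<zero>\<^bsub>T 0\<^esub>"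
  have "\<forall>k. \<exists>q. fst q \<in> carrier ?P \<and> fst (snd q) \<in> carrier ?T \<and> snd (snd q) \<in> carrier (P 0) \<and>
      x = \<iota> (Suc 0) (fst q) \<oplus>\<^bsub>?T\<^esub> [(p ^ k)] \<cdot>\<^bsub>?T\<^esub> fst (snd q) \<and> D 0 (fst q) = [(p ^ k)] \<cdot>\<^bsub>P 0\<^esub> snd (snd q)"
    using cycle_approximation[OF x] by fastforce
  from choice[OF this] obtain q where q: "\<And>k. fst (q k) \<in> carrier ?P" "\<And>k. fst (snd (q k)) \<in> carrier ?T"
    "\<And>k. snd (snd (q k)) \<in> carrier (P 0)"
    "\<And>k. x = \<iota> (Suc 0) (fst (q k)) \<oplus>\<^bsub>?T\<^esub> [(p ^ k)] \<cdot>\<^bsub>?T\<^esub> fst (snd (q k))"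
    "\<And>k. D 0 (fst (q k)) = [(p ^ k)] \<cdot>\<^bsub>P 0\<^esub> snd (snd (q k))"
    by auto
  define u where "u k = fst (q k)" for k
  define t where "t k = fst (snd (q k))" for k
  define v where "v k = snd (snd (q k))" for k
  note q = q[folded u_def t_def v_def]
  have pk: "[(p ^ Suc k)] \<cdot>\<^bsub>T n\<^esub> y = [(p ^ k)] \<cdot>\<^bsub>T n\<^esub> ([p] \<cdot>\<^bsub>T n\<^esub> y)" if "y \<in> carrier (T n)" for y k n
    using T.nat_multiple_mult[OF that, of "p ^ k" p] by (simp add: mult.commute)
  have pkP: "[(p ^ Suc k)] \<cdot>\<^bsub>P n\<^esub> y = [(p ^ k)] \<cdot>\<^bsub>P n\<^esub> ([p] \<cdot>\<^bsub>P n\<^esub> y)" if "y \<in> carrier (P n)" for y k n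
    using P.nat_multiple_mult[OF that, of "p ^ k" p] by (simp add: mult.commute)
  \<comment> \<open>By purity \<open>u\<^bsub>k+1\<^esub> - u\<^sub>k = p\<^sup>k w\<close>; apply the boundary map and cancel \<open>p\<^sup>k\<close>.\<close>
  have rel: "\<exists>w\<in>carrier ?P. [p] \<cdot>\<^bsub>P 0\<^esub> v (Suc k) = v k \<oplus>\<^bsub>P 0\<^esub> D 0 w" for k
  proof -
    let ?d = "u (Suc k) \<ominus>\<^bsub>?P\<^esub> u k" and ?e = "t k \<ominus>\<^bsub>?T\<^esub> [p] \<cdot>\<^bsub>?T\<^esub> t (Suc k)"
    have d: "?d \<in> carrier ?P" "?e \<in> carrier ?T" using q by simp_all
    have eq: "\<iota> (Suc 0) (u (Suc k)) \<oplus>\<^bsub>?T\<^esub> [(p ^ k)] \<cdot>\<^bsub>?T\<^esub> ([p] \<cdot>\<^bsub>?T\<^esub> t (Suc k))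
        = \<iota> (Suc 0) (u k) \<oplus>\<^bsub>?T\<^esub> [(p ^ k)] \<cdot>\<^bsub>?T\<^esub> t k"
      using q(4)[of "Suc k"] q(4)[of k] pk[OF q(2)[of "Suc k"], of k] by simp
    have "\<iota> (Suc 0) ?d = \<iota> (Suc 0) (u (Suc k)) \<ominus>\<^bsub>?T\<^esub> \<iota> (Suc 0) (u k)"
      by (rule additive_diff[OF P T \<iota>]) (use q in auto)
    also have "\<dots> = [(p ^ k)] \<cdot>\<^bsub>?T\<^esub> t k \<ominus>\<^bsub>?T\<^esub> [(p ^ k)] \<cdot>\<^bsub>?T\<^esub> ([p] \<cdot>\<^bsub>?T\<^esub> t (Suc k))"
    proof -
      have swap: "a \<ominus>\<^bsub>?T\<^esub> b = c \<ominus>\<^bsub>?T\<^esub> e" if "a \<oplus>\<^bsub>?T\<^esub> e = b \<oplus>\<^bsub>?T\<^esub> c"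
        "a \<in> carrier ?T" "b \<in> carrier ?T" "c \<in> carrier ?T" "e \<in> carrier ?T" for a b c e
      proof -
        have "(a \<ominus>\<^bsub>?T\<^esub> b) \<ominus>\<^bsub>?T\<^esub> (c \<ominus>\<^bsub>?T\<^esub> e) = (a \<oplus>\<^bsub>?T\<^esub> e) \<ominus>\<^bsub>?T\<^esub> (b \<oplus>\<^bsub>?T\<^esub> c)"
          using that(2-) by (simp add: a_minus_def T.minus_add T.a_ac)
        then have "(a \<ominus>\<^bsub>?T\<^esub> b) \<ominus>\<^bsub>?T\<^esub> (c \<ominus>\<^bsub>?T\<^esub> e) = \<zero>\<^bsub>?T\<^esub>" using that by (simp add: T.diff_self)
        then show ?thesis using that T.diff_eq_zero by simp
      qed
      show ?thesis by (rule swap[OF eq]) (simp_all add: q \<iota>c)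
    qed
    also have "\<dots> = [(p ^ k)] \<cdot>\<^bsub>?T\<^esub> ?e"
      by (rule additive_diff[OF T T T.additive_nat_multiple, symmetric]) (simp_all add: q)
    finally obtain w where w: "w \<in> carrier ?P" "?d = [(p ^ k)] \<cdot>\<^bsub>?P\<^esub> w"
      using pure[OF d] by blast
    have "[(p ^ k)] \<cdot>\<^bsub>P 0\<^esub> ([p] \<cdot>\<^bsub>P 0\<^esub> v (Suc k)) = D 0 (u (Suc k))"
      using q(5)[of "Suc k"] pkP[OF q(3)[of "Suc k"], of k] by simp
    also have "u (Suc k) = u k \<oplus>\<^bsub>?P\<^esub> [(p ^ k)] \<cdot>\<^bsub>?P\<^esub> w"
      using q(1) w by (simp add: w(2)[symmetric] P.a_comm[of "u k"] P.diff_add_cancel)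
    also have "D 0 (u k \<oplus>\<^bsub>?P\<^esub> [(p ^ k)] \<cdot>\<^bsub>?P\<^esub> w) = [(p ^ k)] \<cdot>\<^bsub>P 0\<^esub> (v k \<oplus>\<^bsub>P 0\<^esub> D 0 w)"
      using q w by (simp add: additive_add[OF D] additive_nat_pow[OF P P D] additive_add[OF P.additive_nat_multiple] Dc)
    finally have "[p] \<cdot>\<^bsub>P 0\<^esub> v (Suc k) = v k \<oplus>\<^bsub>P 0\<^esub> D 0 w"
      by (rule P_cancel[rotated 2]) (simp_all add: q w Dc)
    then show ?thesis using w by blast
  qed
  have "\<epsilon> (v 1) = \<zero>\<^bsub>M\<^esub>"
  proof (rule lim[of "\<lambda>k. \<epsilon> (v k)"])
    fix k
    show "\<epsilon> (v k) \<in> carrier M" using q \<epsilon>c by blast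
    have "[(p ^ k)] \<cdot>\<^bsub>M\<^esub> \<epsilon> (v k) = \<epsilon> (D 0 (u k))"
      unfolding q(5) by (rule additive_nat_pow[OF P M \<epsilon> q(3), symmetric])
    then show "[(p ^ k)] \<cdot>\<^bsub>M\<^esub> \<epsilon> (v k) = \<zero>\<^bsub>M\<^esub>" using \<epsilon>_D[OF q(1)[of k]] by simp
    obtain w where w: "w \<in> carrier ?P" "[p] \<cdot>\<^bsub>P 0\<^esub> v (Suc k) = v k \<oplus>\<^bsub>P 0\<^esub> D 0 w" using rel by blast
    have "[p] \<cdot>\<^bsub>M\<^esub> \<epsilon> (v (Suc k)) = \<epsilon> (v k \<oplus>\<^bsub>P 0\<^esub> D 0 w)"
      unfolding w(2)[symmetric] by (rule additive_nat_pow[OF P M \<epsilon> q(3), symmetric])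
    then show "[p] \<cdot>\<^bsub>M\<^esub> \<epsilon> (v (Suc k)) = \<epsilon> (v k)"
      using w(1) q \<epsilon>_D by (simp add: additive_add[OF \<epsilon>] Dc \<epsilon>c)
  qed
  then obtain w where w: "w \<in> carrier ?P" "v 1 = D 0 w" using exact0[OF q(3)] by blast
  show "\<exists>s\<in>carrier (P (Suc (Suc 0))). \<exists>y\<in>carrier ?T. x = \<iota> (Suc 0) (D (Suc 0) s) \<oplus>\<^bsub>?T\<^esub> [p] \<cdot>\<^bsub>?T\<^esub> y"
    by (rule boundary_mod_p[OF q(1)[of 1] q(2)[of 1] w(1)]) (use q(4,5)[of 1] w(2) in simp_all)
qed

text \<open>
  Successive approximation on \<open>p\<^sup>k T\<^sub>0\<close>.  For \<open>u \<in> P\<^sub>0\<close> the hypothesis on \<open>M\<close> gives \<open>u' \<in> P\<^sub>0\<close> such that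
  \<open>p\<^sup>k u - p\<^bsup>k+1\<^esup> u'\<close> maps to zero in \<open>M\<close>, so \<open>p\<^sup>k u\<close> is a boundary up to \<open>p (p\<^sup>k u')\<close>.
\<close>

lemma multiple_boundary:
  assumes exp: "\<And>x. x \<in> carrier M \<Longrightarrow> \<exists>y\<in>carrier M. [(p ^ k)] \<cdot>\<^bsub>M\<^esub> x = [(p ^ Suc k)] \<cdot>\<^bsub>M\<^esub> y"
    and t: "t \<in> carrier (T 0)"
  shows "[(p ^ k)] \<cdot>\<^bsub>T 0\<^esub> t \<in> DT 0 ` carrier (T (Suc 0))"
proof -
  let ?q = "\<lambda>t. [(p ^ k)] \<cdot>\<^bsub>T 0\<^esub> t"
  have q: "?q ([p] \<cdot>\<^bsub>T 0\<^esub> t) = [p] \<cdot>\<^bsub>T 0\<^esub> ?q t" if "t \<in> carrier (T 0)" for t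
    using T.nat_multiple_mult[OF that, of "p ^ k" p] T.nat_multiple_mult[OF that, of p "p ^ k"] by (simp add: mult.commute)
  have "?q ` carrier (T 0) \<subseteq> DT 0 ` carrier (T (Suc 0))"
  proof (rule successive_approximation[OF T T DT complete separated])
    show "?q ` carrier (T 0) \<subseteq> carrier (T 0)" by auto
    fix x assume "x \<in> ?q ` carrier (T 0)"
    then obtain t where t: "t \<in> carrier (T 0)" "x = ?q t" by blast
    obtain u t' where u: "u \<in> carrier (P 0)" "t' \<in> carrier (T 0)" "t = \<iota> 0 u \<oplus>\<^bsub>T 0\<^esub> [p] \<cdot>\<^bsub>T 0\<^esub> t'"
      using dense[OF t(1)] by blast
    obtain m where m: "m \<in> carrier M" "[(p ^ k)] \<cdot>\<^bsub>M\<^esub> \<epsilon> u = [(p ^ Suc k)] \<cdot>\<^bsub>M\<^esub> m"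
      using exp[OF \<epsilon>c[OF u(1)]] by blast
    obtain u' where u': "u' \<in> carrier (P 0)" "m = \<epsilon> u'" using \<epsilon>_surj[OF m(1)] by blast
    let ?c = "[(p ^ k)] \<cdot>\<^bsub>P 0\<^esub> u \<ominus>\<^bsub>P 0\<^esub> [(p ^ Suc k)] \<cdot>\<^bsub>P 0\<^esub> u'"
    have "\<epsilon> ?c = \<zero>\<^bsub>M\<^esub>"
      using u(1) u' m(2) additive_diff[OF P M \<epsilon>, of "[(p ^ k)] \<cdot>\<^bsub>P 0\<^esub> u" "[(p ^ Suc k)] \<cdot>\<^bsub>P 0\<^esub> u'"]
      by (simp add: additive_nat_pow[OF P M \<epsilon>] M.diff_self \<epsilon>c del: power_Suc)
    then obtain w where w: "w \<in> carrier (P (Suc 0))" "?c = D 0 w"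
      using exact0[of ?c] u(1) u'(1) by auto
    have "[(p ^ k)] \<cdot>\<^bsub>P 0\<^esub> u = D 0 w \<oplus>\<^bsub>P 0\<^esub> [(p ^ Suc k)] \<cdot>\<^bsub>P 0\<^esub> u'"
      using u(1) u'(1) by (simp add: w(2)[symmetric] P.diff_add_cancel del: power_Suc)
    then have "?q (\<iota> 0 u) = DT 0 (\<iota> (Suc 0) w) \<oplus>\<^bsub>T 0\<^esub> [(p ^ Suc k)] \<cdot>\<^bsub>T 0\<^esub> \<iota> 0 u'"
      using u(1) u'(1) w(1)
      by (simp add: additive_nat_pow[OF P T \<iota>, symmetric] additive_add[OF \<iota>] comm Dc del: power_Suc)
    also have "[(p ^ Suc k)] \<cdot>\<^bsub>T 0\<^esub> \<iota> 0 u' = [p] \<cdot>\<^bsub>T 0\<^esub> ?q (\<iota> 0 u')"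
      using u'(1) by (intro T.nat_multiple_Suc_power) (simp add: \<iota>c)
    finally have "x = DT 0 (\<iota> (Suc 0) w) \<oplus>\<^bsub>T 0\<^esub> [p] \<cdot>\<^bsub>T 0\<^esub> ?q (\<iota> 0 u' \<oplus>\<^bsub>T 0\<^esub> t')"
      unfolding t(2) u(3) using u u'(1) w(1)
      by (simp add: additive_add[OF T.additive_nat_multiple] \<iota>c DTc q T.a_assoc)
    then show "\<exists>s\<in>carrier (T (Suc 0)). \<exists>x'\<in>?q ` carrier (T 0). x = DT 0 s \<oplus>\<^bsub>T 0\<^esub> [p] \<cdot>\<^bsub>T 0\<^esub> x'"
      using w(1) u(2) u'(1) \<iota>c T.a_closed by blast
  qed
  then show ?thesis using t by blast
qed

end

section \<open>The completion of a finitely generated projective module\<close>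

lemma nat_multiple_transfer:
  assumes "add M = add A" "ring.zero M = ring.zero A"
  shows "[(k::nat)] \<cdot>\<^bsub>M\<^esub> x = [k] \<cdot>\<^bsub>A\<^esub> x"
  by (simp add: add_pow_def nat_pow_def assms)

lemma finsum_transfer:
  assumes "carrier M = carrier A" "add M = add A" "ring.zero M = ring.zero A"
  shows "finsum M f J = finsum A f J"
  by (simp add: finsum_def finprod_def assms)

lemma dual_basis_torsion_free:
  assumes P: "left_module R P" and J: "finite J" and db: "dual_basis R P J b \<phi>"
    and tf: "\<And>r. r \<in> carrier R \<Longrightarrow> [(k::nat)] \<cdot>\<^bsub>R\<^esub> r = \<zero>\<^bsub>R\<^esub> \<Longrightarrow> r = \<zero>\<^bsub>R\<^esub>"
    and x: "x \<in> carrier P" "[k] \<cdot>\<^bsub>P\<^esub> x = \<zero>\<^bsub>P\<^esub>"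
  shows "x = \<zero>\<^bsub>P\<^esub>"
proof -
  interpret P: left_module R P by fact
  note db' = dual_basisD[OF db]
  have "\<phi> j x = \<zero>\<^bsub>R\<^esub>" if j: "j \<in> J" for j
  proof (rule tf)
    show "\<phi> j x \<in> carrier R" by (rule db'(6)[OF j x(1)])
    show "[k] \<cdot>\<^bsub>R\<^esub> \<phi> j x = \<zero>\<^bsub>R\<^esub>"
      using additive_nat_pow[OF P.M.abelian_group_axioms P.R.is_abelian_group db'(2)[OF j] x(1), of k]
        additive_zero[OF P.M.abelian_group_axioms P.R.is_abelian_group db'(2)[OF j]] x(2) by simp
  qed
  then have e: "{j \<in> J. \<phi> j x \<noteq> \<zero>\<^bsub>R\<^esub>} = {}" by blast
  have "(\<Oplus>\<^bsub>P\<^esub>j\<in>{}. \<phi> j x \<odot>\<^bsub>P\<^esub> b j) = x" using db'(5)[OF x(1)] by (simp only: e)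
  then show ?thesis by simp
qed

context tensor_pair
begin

lemma tensor_torsion_free:
  assumes J: "finite J" and db: "dual_basis R B J b \<phi>"
    and tf: "\<And>a. a \<in> carrier A \<Longrightarrow> [(k::nat)] \<cdot>\<^bsub>A\<^esub> a = \<zero>\<^bsub>A\<^esub> \<Longrightarrow> a = \<zero>\<^bsub>A\<^esub>"
    and t: "t \<in> carrier T" "[k] \<cdot>\<^bsub>T\<^esub> t = \<zero>\<^bsub>T\<^esub>"
  shows "t = \<zero>\<^bsub>T\<^esub>"
proof (rule tensor_coordinates_zero[OF J db t(1)])
  fix j assume j: "j \<in> J"
  note c = tensor_coordinate(1)[OF dual_basisD(2,3)[OF db j]]
  show "tensor_coordinate R A B (\<phi> j) t = \<zero>\<^bsub>A\<^esub>"
  proof (rule tf)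
    show "tensor_coordinate R A B (\<phi> j) t \<in> carrier A" by (rule additive_closed[OF c t(1)])
    show "[k] \<cdot>\<^bsub>A\<^esub> tensor_coordinate R A B (\<phi> j) t = \<zero>\<^bsub>A\<^esub>"
      using additive_nat_pow[OF T.abelian_group_axioms A.M.abelian_group_axioms c t(1), of k]
        additive_zero[OF T.abelian_group_axioms A.M.abelian_group_axioms c] t(2) by simp
  qed
qed

end

locale padic_module = padic_ring R p + P: left_module R P
  for R :: "'r ring" (structure) and p and P :: "('r, 'a) module" +
  fixes J :: "'j set" and b :: "'j \<Rightarrow> 'a" and \<phi> :: "'j \<Rightarrow> 'a \<Rightarrow> 'r"
  assumes finite_J: "finite J" and db: "dual_basis R P J b \<phi>"
begin

sublocale TP: tensor_pair R CM P
  using right_module_CM P.left_module_axioms by (simp add: tensor_pair_def)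

abbreviation "T \<equiv> TP.T"
abbreviation "tens \<equiv> TP.tens"
abbreviation "coord j \<equiv> tensor_coordinate R CM P (\<phi> j)"

definition \<iota>P :: "'a \<Rightarrow> ((nat \<Rightarrow> 'r set) \<times> 'a \<Rightarrow>\<^sub>0 int) set"
  where "\<iota>P x = tens \<one>\<^bsub>A\<^esub> x"

lemmas db' = dual_basisD[OF db]

lemma coord:
  assumes "j \<in> J"
  shows "additive T CM (coord j)"
    and "\<And>a x. a \<in> carrier A \<Longrightarrow> x \<in> carrier P \<Longrightarrow> coord j (tens a x) = a \<otimes>\<^bsub>A\<^esub> \<iota> (\<phi> j x)"
  using TP.tensor_coordinate[OF db'(2,3)[OF assms]] by (simp_all add: CM_simps)

lemma coord_closed: "j \<in> J \<Longrightarrow> t \<in> carrier T \<Longrightarrow> coord j t \<in> carrier A"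
  using additive_closed[OF coord(1)] by (simp add: CM_simps)

lemma tens_closed: "a \<in> carrier A \<Longrightarrow> x \<in> carrier P \<Longrightarrow> tens a x \<in> carrier T"
  using TP.tens_closed by (simp add: CM_simps)

lemma additive_\<iota>P: "additive P T \<iota>P"
  unfolding \<iota>P_def by (rule TP.additive_tens_right) (simp add: CM_simps)

lemma \<iota>P_closed: "x \<in> carrier P \<Longrightarrow> \<iota>P x \<in> carrier T"
  by (rule additive_closed[OF additive_\<iota>P])

lemma \<iota>P_smult: "r \<in> carrier R \<Longrightarrow> x \<in> carrier P \<Longrightarrow> \<iota>P (r \<odot>\<^bsub>P\<^esub> x) = tens (\<iota> r) x"
  unfolding \<iota>P_def using TP.tens_balanced[of r "\<one>\<^bsub>A\<^esub>" x] by (simp add: CM_simps \<iota>_closed)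

lemma P_torsion_free: "x \<in> carrier P \<Longrightarrow> [p] \<cdot>\<^bsub>P\<^esub> x = \<zero>\<^bsub>P\<^esub> \<Longrightarrow> x = \<zero>\<^bsub>P\<^esub>"
  by (rule dual_basis_torsion_free[OF P.left_module_axioms finite_J db torsion_free])

lemma T_torsion_free: "t \<in> carrier T \<Longrightarrow> k > 0 \<Longrightarrow> [(k::nat)] \<cdot>\<^bsub>T\<^esub> t = \<zero>\<^bsub>T\<^esub> \<Longrightarrow> t = \<zero>\<^bsub>T\<^esub>"
  by (rule TP.tensor_torsion_free[OF finite_J db])
    (auto simp: CM_simps CM_multiple intro: A_torsion_free)

lemma T_dense:
  assumes "t \<in> carrier T"
  shows "\<exists>u\<in>carrier P. \<exists>t'\<in>carrier T. t = \<iota>P u \<oplus>\<^bsub>T\<^esub> [p] \<cdot>\<^bsub>T\<^esub> t'"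
  using assms
proof (induction rule: TP.tensor_induct)
  case (tens a x)
  then have a: "a \<in> carrier A" and x: "x \<in> carrier P" by (simp_all add: CM_simps)
  obtain r y where ry: "r \<in> carrier R" "y \<in> carrier A" "a = \<iota> r \<oplus>\<^bsub>A\<^esub> [p] \<cdot>\<^bsub>A\<^esub> y"
    using A_dense[OF a] by blast
  have "tens a x = tens (\<iota> r) x \<oplus>\<^bsub>T\<^esub> tens ([p] \<cdot>\<^bsub>A\<^esub> y) x"
    using ry x TP.tens_add_left[of "\<iota> r" "[p] \<cdot>\<^bsub>A\<^esub> y" x] by (simp add: CM_simps \<iota>_closed)
  also have "tens ([p] \<cdot>\<^bsub>A\<^esub> y) x = [p] \<cdot>\<^bsub>T\<^esub> tens y x"
    using additive_nat_pow[OF TP.A.M.abelian_group_axioms TP.T.abelian_group_axioms TP.additive_tens_left[OF x], of y p] ry(2)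
    by (simp add: CM_simps CM_multiple)
  also have "tens (\<iota> r) x = \<iota>P (r \<odot>\<^bsub>P\<^esub> x)" using \<iota>P_smult ry x by simp
  finally show ?case using ry x tens_closed P.smult_closed by blast
next
  case (add s t)
  obtain u s' where u: "u \<in> carrier P" "s' \<in> carrier T" "s = \<iota>P u \<oplus>\<^bsub>T\<^esub> [p] \<cdot>\<^bsub>T\<^esub> s'"
    using add by blast
  obtain v t' where v: "v \<in> carrier P" "t' \<in> carrier T" "t = \<iota>P v \<oplus>\<^bsub>T\<^esub> [p] \<cdot>\<^bsub>T\<^esub> t'"
    using add by blast
  have "s \<oplus>\<^bsub>T\<^esub> t = \<iota>P (u \<oplus>\<^bsub>P\<^esub> v) \<oplus>\<^bsub>T\<^esub> [p] \<cdot>\<^bsub>T\<^esub> (s' \<oplus>\<^bsub>T\<^esub> t')"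
    unfolding u(3) v(3) using u(1,2) v(1,2)
    by (simp add: additive_add[OF additive_\<iota>P] additive_add[OF TP.T.additive_nat_multiple] \<iota>P_closed TP.T.a_ac)
  then show ?case using u v P.M.a_closed TP.T.a_closed by blast
qed

text \<open>
  The coordinates of \<open>u\<close> are divisible by \<open>p\<^sup>k\<close> in the completed ring, hence in \<open>R\<close>.
\<close>

lemma T_pure:
  assumes u: "u \<in> carrier P" and t: "t \<in> carrier T" and ut: "\<iota>P u = [(p ^ k)] \<cdot>\<^bsub>T\<^esub> t"
  shows "\<exists>v\<in>carrier P. u = [(p ^ k)] \<cdot>\<^bsub>P\<^esub> v"
proof -
  have "\<exists>s. s \<in> carrier R \<and> \<phi> j u = [(p ^ k)] \<cdot>\<^bsub>R\<^esub> s" if j: "j \<in> J" for j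
  proof -
    have "\<iota> (\<phi> j u) = coord j (\<iota>P u)"
      unfolding \<iota>P_def using coord(2)[OF j _ u] \<iota>_closed[OF db'(6)[OF j u]] by simp
    also have "\<dots> = [(p ^ k)] \<cdot>\<^bsub>A\<^esub> coord j t"
      unfolding ut using additive_nat_pow[OF TP.T.abelian_group_axioms TP.A.M.abelian_group_axioms coord(1)[OF j] t]
      by (simp add: CM_multiple)
    finally have "\<phi> j u \<in> I k" by (rule A_pure[OF db'(6)[OF j u] coord_closed[OF j t]])
    then show ?thesis unfolding I_iff by blast
  qed
  then have "\<forall>j\<in>J. \<exists>s. s \<in> carrier R \<and> \<phi> j u = [(p ^ k)] \<cdot>\<^bsub>R\<^esub> s" by blast
  from bchoice[OF this] obtain s where s: "\<And>j. j \<in> J \<Longrightarrow> s j \<in> carrier R"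
    "\<And>j. j \<in> J \<Longrightarrow> \<phi> j u = [(p ^ k)] \<cdot>\<^bsub>R\<^esub> s j" by auto
  have cl: "(\<lambda>j. s j \<odot>\<^bsub>P\<^esub> b j) \<in> J \<rightarrow> carrier P"
    by (intro funcsetI P.smult_closed s db'(1))
  have "u = (\<Oplus>\<^bsub>P\<^esub>j\<in>J. \<phi> j u \<odot>\<^bsub>P\<^esub> b j)"
    by (rule dual_basis_expand[OF P.left_module_axioms db finite_J u, symmetric])
  also have "\<dots> = (\<Oplus>\<^bsub>P\<^esub>j\<in>J. [(p ^ k)] \<cdot>\<^bsub>P\<^esub> (s j \<odot>\<^bsub>P\<^esub> b j))"
  proof (rule P.M.finsum_cong'[OF refl])
    show "(\<lambda>j. [(p ^ k)] \<cdot>\<^bsub>P\<^esub> (s j \<odot>\<^bsub>P\<^esub> b j)) \<in> J \<rightarrow> carrier P" using cl by auto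
    show "\<phi> j u \<odot>\<^bsub>P\<^esub> b j = [(p ^ k)] \<cdot>\<^bsub>P\<^esub> (s j \<odot>\<^bsub>P\<^esub> b j)" if "j \<in> J" for j
      unfolding s(2)[OF that]
      by (rule additive_nat_pow[OF R.is_abelian_group P.M.abelian_group_axioms P.additive_smult_left[OF db'(1)[OF that]] s(1)[OF that]])
  qed
  also have "\<dots> = [(p ^ k)] \<cdot>\<^bsub>P\<^esub> (\<Oplus>\<^bsub>P\<^esub>j\<in>J. s j \<odot>\<^bsub>P\<^esub> b j)"
    by (rule additive_finsum[OF P.M.abelian_group_axioms P.M.abelian_group_axioms P.M.additive_nat_multiple cl, symmetric])
  finally show ?thesis using P.M.finsum_closed[OF cl] by blast
qed

lemma T_separated: "padic_separated p T"
  unfolding padic_separated_def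
proof (intro allI impI)
  fix w assume w: "\<forall>m::nat. w m \<in> carrier T" "\<forall>m. w m = [p] \<cdot>\<^bsub>T\<^esub> w (Suc m)"
  show "w 0 = \<zero>\<^bsub>T\<^esub>"
  proof (rule TP.tensor_coordinates_zero[OF finite_J db])
    fix j assume j: "j \<in> J"
    have wj: "coord j (w m) = [p] \<cdot>\<^bsub>A\<^esub> coord j (w (Suc m))" for m
      using arg_cong[OF w(2)[rule_format, of m], of "coord j"] w(1)
        additive_nat_pow[OF TP.T.abelian_group_axioms TP.A.M.abelian_group_axioms coord(1)[OF j], of "w (Suc m)" p]
      by (simp add: CM_multiple)
    have "coord j (w 0) = \<zero>\<^bsub>A\<^esub>"
      by (rule A_separated[of "\<lambda>m. coord j (w m)", OF coord_closed[OF j w(1)[rule_format]] wj])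
    then show "coord j (w 0) = \<zero>\<^bsub>CM\<^esub>" by (simp add: CM_simps)
  qed (use w in blast)
qed

text \<open>
  The series is summed in each coordinate separately.
\<close>

lemma T_complete: "padic_complete p T"
  unfolding padic_complete_def
proof (intro allI impI)
  fix x assume x: "\<forall>m::nat. x m \<in> carrier T"
  have "\<exists>y. \<forall>m. y m \<in> carrier A \<and> y m = coord j (x m) \<oplus>\<^bsub>A\<^esub> [p] \<cdot>\<^bsub>A\<^esub> y (Suc m)" if j: "j \<in> J" for j
    by (rule A_complete) (use x coord_closed[OF j] in blast)
  then have "\<forall>j\<in>J. \<exists>y. \<forall>m. y m \<in> carrier A \<and> y m = coord j (x m) \<oplus>\<^bsub>A\<^esub> [p] \<cdot>\<^bsub>A\<^esub> y (Suc m)" by blast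
  from bchoice[OF this] obtain y where y0: "\<forall>j\<in>J. \<forall>m. y j m \<in> carrier A \<and>
      y j m = coord j (x m) \<oplus>\<^bsub>A\<^esub> [p] \<cdot>\<^bsub>A\<^esub> y j (Suc m)" by (rule exE)
  have y: "y j m \<in> carrier A" "y j m = coord j (x m) \<oplus>\<^bsub>A\<^esub> [p] \<cdot>\<^bsub>A\<^esub> y j (Suc m)" if "j \<in> J" for j m
    using y0[rule_format, OF that, of m] by (rule conjunct1, rule conjunct2)
  define z where "z m = (\<Oplus>\<^bsub>T\<^esub>j\<in>J. tens (y j m) (b j))" for m
  have ycl: "(\<lambda>j. tens (y j m) (b j)) \<in> J \<rightarrow> carrier T" for m
    by (intro funcsetI tens_closed y(1) db'(1))
  have xcl: "(\<lambda>j. tens (coord j (x m)) (b j)) \<in> J \<rightarrow> carrier T" for m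
    using x by (intro funcsetI tens_closed coord_closed db'(1)) auto
  have pcl: "(\<lambda>j. [p] \<cdot>\<^bsub>T\<^esub> tens (y j m) (b j)) \<in> J \<rightarrow> carrier T" for m
    using ycl by auto
  have z: "z m \<in> carrier T" for m unfolding z_def by (rule TP.T.finsum_closed[OF ycl])
  moreover have "z m = x m \<oplus>\<^bsub>T\<^esub> [p] \<cdot>\<^bsub>T\<^esub> z (Suc m)" for m
  proof -
    have "tens (y j m) (b j) = tens (coord j (x m)) (b j) \<oplus>\<^bsub>T\<^esub> [p] \<cdot>\<^bsub>T\<^esub> tens (y j (Suc m)) (b j)" if j: "j \<in> J" for j
    proof -
      have "tens (y j m) (b j) = tens (coord j (x m) \<oplus>\<^bsub>A\<^esub> [p] \<cdot>\<^bsub>A\<^esub> y j (Suc m)) (b j)"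
        using y(2)[OF j, of m] by simp
      also have "\<dots> = tens (coord j (x m)) (b j) \<oplus>\<^bsub>T\<^esub> tens ([p] \<cdot>\<^bsub>A\<^esub> y j (Suc m)) (b j)"
        using TP.tens_add_left[of "coord j (x m)" "[p] \<cdot>\<^bsub>A\<^esub> y j (Suc m)" "b j"] x y(1)[OF j] coord_closed[OF j] db'(1)[OF j]
        by (simp add: CM_simps)
      also have "tens ([p] \<cdot>\<^bsub>A\<^esub> y j (Suc m)) (b j) = [p] \<cdot>\<^bsub>T\<^esub> tens (y j (Suc m)) (b j)"
        using additive_nat_pow[OF TP.A.M.abelian_group_axioms TP.T.abelian_group_axioms TP.additive_tens_left[OF db'(1)[OF j]], of "y j (Suc m)" p]
          y(1)[OF j] by (simp add: CM_simps CM_multiple)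
      finally show ?thesis .
    qed
    note eq = this
    have "z m = (\<Oplus>\<^bsub>T\<^esub>j\<in>J. tens (coord j (x m)) (b j) \<oplus>\<^bsub>T\<^esub> [p] \<cdot>\<^bsub>T\<^esub> tens (y j (Suc m)) (b j))"
      unfolding z_def
    proof (rule TP.T.finsum_cong'[OF refl _ eq])
      show "(\<lambda>j. tens (coord j (x m)) (b j) \<oplus>\<^bsub>T\<^esub> [p] \<cdot>\<^bsub>T\<^esub> tens (y j (Suc m)) (b j)) \<in> J \<rightarrow> carrier T"
        by (intro funcsetI TP.T.a_closed funcset_mem[OF xcl] funcset_mem[OF pcl])
    qed
    also have "\<dots> = (\<Oplus>\<^bsub>T\<^esub>j\<in>J. tens (coord j (x m)) (b j)) \<oplus>\<^bsub>T\<^esub> (\<Oplus>\<^bsub>T\<^esub>j\<in>J. [p] \<cdot>\<^bsub>T\<^esub> tens (y j (Suc m)) (b j))"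
      by (rule TP.T.finsum_addf[OF xcl pcl])
    also have "(\<Oplus>\<^bsub>T\<^esub>j\<in>J. tens (coord j (x m)) (b j)) = x m"
      by (rule TP.tensor_expand[OF finite_J db x[rule_format]])
    also have "(\<Oplus>\<^bsub>T\<^esub>j\<in>J. [p] \<cdot>\<^bsub>T\<^esub> tens (y j (Suc m)) (b j)) = [p] \<cdot>\<^bsub>T\<^esub> z (Suc m)"
      unfolding z_def
      by (rule additive_finsum[OF TP.T.abelian_group_axioms TP.T.abelian_group_axioms TP.T.additive_nat_multiple ycl, symmetric])
    finally show ?thesis .
  qed
  ultimately show "\<exists>y. \<forall>m. y m \<in> carrier T \<and> y m = x m \<oplus>\<^bsub>T\<^esub> [p] \<cdot>\<^bsub>T\<^esub> y (Suc m)" by blast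
qed

text \<open>
  The completion of \<open>P\<close> as a left module over the completed ring.
\<close>

definition TA :: "(nat \<Rightarrow> 'r set, ((nat \<Rightarrow> 'r set) \<times> 'a \<Rightarrow>\<^sub>0 int) set) module"
  where "TA = module_of (carrier T) (add T) (ring.zero T) (\<lambda>a. tensor_map R CM P (\<lambda>x. a \<otimes>\<^bsub>A\<^esub> x) (\<lambda>x. x))"

lemma TA_simps:
  "carrier TA = carrier T" "add TA = add T" "ring.zero TA = ring.zero T"
  "a \<odot>\<^bsub>TA\<^esub> t = tensor_map R CM P (\<lambda>x. a \<otimes>\<^bsub>A\<^esub> x) (\<lambda>x. x) t"
  by (simp_all add: TA_def)

lemma TA_smult:
  assumes "a \<in> carrier A"
  shows "additive T T (\<lambda>t. a \<odot>\<^bsub>TA\<^esub> t)"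
    and "\<And>c x. c \<in> carrier A \<Longrightarrow> x \<in> carrier P \<Longrightarrow> a \<odot>\<^bsub>TA\<^esub> tens c x = tens (a \<otimes>\<^bsub>A\<^esub> c) x"
proof -
  have f: "additive CM CM (\<lambda>x. a \<otimes>\<^bsub>A\<^esub> x)"
    by (rule additiveI) (simp_all add: CM_simps assms A.r_distr)
  have f': "a \<otimes>\<^bsub>A\<^esub> (r \<odot>\<^bsub>CM\<^esub> x) = r \<odot>\<^bsub>CM\<^esub> (a \<otimes>\<^bsub>A\<^esub> x)" if "r \<in> carrier R" "x \<in> carrier CM" for r x
    using that assms by (simp add: CM_simps A.m_assoc \<iota>_closed)
  have id: "(\<lambda>x. x) \<in> module_homs R P P" by (auto simp: module_homs_def)
  note tm = tensor_map_additive[where f = "\<lambda>x. a \<otimes>\<^bsub>A\<^esub> x" and g = "\<lambda>x. x", OF TP.tensor_pair_axioms TP.tensor_pair_axioms f f' id]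
  show "additive T T (\<lambda>t. a \<odot>\<^bsub>TA\<^esub> t)" using tm(1) by (simp add: TA_simps)
  show "\<And>c x. c \<in> carrier A \<Longrightarrow> x \<in> carrier P \<Longrightarrow> a \<odot>\<^bsub>TA\<^esub> tens c x = tens (a \<otimes>\<^bsub>A\<^esub> c) x"
    using tm(2) by (simp add: TA_simps CM_simps)
qed

lemma left_module_TA: "left_module A TA"
proof -
  interpret TA: abelian_group TA
    by (rule abelian_group_transfer[OF TP.T.abelian_group_axioms]) (simp_all add: TA_simps)
  have ind: "Q t" if "t \<in> carrier TA" "\<And>a x. a \<in> carrier A \<Longrightarrow> x \<in> carrier P \<Longrightarrow> Q (tens a x)"
    "\<And>s t. \<lbrakk>s \<in> carrier T; t \<in> carrier T; Q s; Q t\<rbrakk> \<Longrightarrow> Q (s \<oplus>\<^bsub>T\<^esub> t)" for Q t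
    using that by (intro TP.tensor_induct[of t Q]) (simp_all add: TA_simps CM_simps)
  note sa = TA_smult(1) and st = TA_smult(2)
  note sc = additive_closed[OF sa] and sadd = additive_add[OF sa]
  show ?thesis
  proof unfold_locales
    fix r s x assume r: "r \<in> carrier A" and s: "s \<in> carrier A" and x: "x \<in> carrier TA"
    show "(r \<oplus>\<^bsub>A\<^esub> s) \<odot>\<^bsub>TA\<^esub> x = r \<odot>\<^bsub>TA\<^esub> x \<oplus>\<^bsub>TA\<^esub> s \<odot>\<^bsub>TA\<^esub> x"
      using x
    proof (rule ind)
      fix a x assume "a \<in> carrier A" "x \<in> carrier P"
      then show "(r \<oplus>\<^bsub>A\<^esub> s) \<odot>\<^bsub>TA\<^esub> tens a x = r \<odot>\<^bsub>TA\<^esub> tens a x \<oplus>\<^bsub>TA\<^esub> s \<odot>\<^bsub>TA\<^esub> tens a x"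
        using r s TP.tens_add_left[of "r \<otimes>\<^bsub>A\<^esub> a" "s \<otimes>\<^bsub>A\<^esub> a" x]
        by (simp add: st TA_simps(2) A.l_distr CM_simps)
    next
      fix u t assume u: "u \<in> carrier T" "t \<in> carrier T"
        and eq: "(r \<oplus>\<^bsub>A\<^esub> s) \<odot>\<^bsub>TA\<^esub> u = r \<odot>\<^bsub>TA\<^esub> u \<oplus>\<^bsub>TA\<^esub> s \<odot>\<^bsub>TA\<^esub> u"
          "(r \<oplus>\<^bsub>A\<^esub> s) \<odot>\<^bsub>TA\<^esub> t = r \<odot>\<^bsub>TA\<^esub> t \<oplus>\<^bsub>TA\<^esub> s \<odot>\<^bsub>TA\<^esub> t"
      have "(r \<oplus>\<^bsub>A\<^esub> s) \<odot>\<^bsub>TA\<^esub> (u \<oplus>\<^bsub>T\<^esub> t) = (r \<oplus>\<^bsub>A\<^esub> s) \<odot>\<^bsub>TA\<^esub> u \<oplus>\<^bsub>T\<^esub> (r \<oplus>\<^bsub>A\<^esub> s) \<odot>\<^bsub>TA\<^esub> t"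
        using r s u by (intro sadd) auto
      also have "\<dots> = (r \<odot>\<^bsub>TA\<^esub> u \<oplus>\<^bsub>T\<^esub> r \<odot>\<^bsub>TA\<^esub> t) \<oplus>\<^bsub>T\<^esub> (s \<odot>\<^bsub>TA\<^esub> u \<oplus>\<^bsub>T\<^esub> s \<odot>\<^bsub>TA\<^esub> t)"
        using r s u by (simp add: eq[unfolded TA_simps(2)] sc TP.T.a_ac)
      also have "\<dots> = r \<odot>\<^bsub>TA\<^esub> (u \<oplus>\<^bsub>T\<^esub> t) \<oplus>\<^bsub>TA\<^esub> s \<odot>\<^bsub>TA\<^esub> (u \<oplus>\<^bsub>T\<^esub> t)"
        using r s u by (simp only: sadd TA_simps(2))
      finally show "(r \<oplus>\<^bsub>A\<^esub> s) \<odot>\<^bsub>TA\<^esub> (u \<oplus>\<^bsub>T\<^esub> t) = r \<odot>\<^bsub>TA\<^esub> (u \<oplus>\<^bsub>T\<^esub> t) \<oplus>\<^bsub>TA\<^esub> s \<odot>\<^bsub>TA\<^esub> (u \<oplus>\<^bsub>T\<^esub> t)" .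
    qed
    show "(r \<otimes>\<^bsub>A\<^esub> s) \<odot>\<^bsub>TA\<^esub> x = r \<odot>\<^bsub>TA\<^esub> (s \<odot>\<^bsub>TA\<^esub> x)"
      using x
    proof (rule ind)
      fix a x assume "a \<in> carrier A" "x \<in> carrier P"
      then show "(r \<otimes>\<^bsub>A\<^esub> s) \<odot>\<^bsub>TA\<^esub> tens a x = r \<odot>\<^bsub>TA\<^esub> (s \<odot>\<^bsub>TA\<^esub> tens a x)"
        using r s by (simp add: st A.m_assoc)
    next
      fix u t assume "u \<in> carrier T" "t \<in> carrier T"
        "(r \<otimes>\<^bsub>A\<^esub> s) \<odot>\<^bsub>TA\<^esub> u = r \<odot>\<^bsub>TA\<^esub> (s \<odot>\<^bsub>TA\<^esub> u)" "(r \<otimes>\<^bsub>A\<^esub> s) \<odot>\<^bsub>TA\<^esub> t = r \<odot>\<^bsub>TA\<^esub> (s \<odot>\<^bsub>TA\<^esub> t)"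
      then show "(r \<otimes>\<^bsub>A\<^esub> s) \<odot>\<^bsub>TA\<^esub> (u \<oplus>\<^bsub>T\<^esub> t) = r \<odot>\<^bsub>TA\<^esub> (s \<odot>\<^bsub>TA\<^esub> (u \<oplus>\<^bsub>T\<^esub> t))"
        using r s by (simp add: sadd sc)
    qed
  next
    fix r x y assume "r \<in> carrier A" "x \<in> carrier TA" "y \<in> carrier TA"
    then show "r \<odot>\<^bsub>TA\<^esub> (x \<oplus>\<^bsub>TA\<^esub> y) = r \<odot>\<^bsub>TA\<^esub> x \<oplus>\<^bsub>TA\<^esub> r \<odot>\<^bsub>TA\<^esub> y"
      by (simp add: TA_simps(1-3) sadd)
  next
    fix r x assume "r \<in> carrier A" "x \<in> carrier TA"
    then show "r \<odot>\<^bsub>TA\<^esub> x \<in> carrier TA" by (simp add: TA_simps(1-3) sc)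
  next
    fix x assume "x \<in> carrier TA"
    then show "\<one>\<^bsub>A\<^esub> \<odot>\<^bsub>TA\<^esub> x = x"
      by (rule ind) (simp_all add: st sadd)
  qed
qed

text \<open>
  Extension of scalars: the completion of a finitely generated projective module is projective over the completed
  ring, with the same functionals.
\<close>

lemma dual_basis_TA: "dual_basis A TA J (\<lambda>j. \<iota>P (b j)) coord"
proof (rule dual_basis_finiteI[OF left_module_TA finite_J])
  show "(\<lambda>j. \<iota>P (b j)) \<in> J \<rightarrow> carrier TA" using \<iota>P_closed db'(1) by (auto simp: TA_simps)
next
  fix j assume j: "j \<in> J"
  note c = additive_add[OF coord(1)[OF j]]
  show add: "additive TA A (coord j)"
    using c by (intro additiveI) (simp_all add: TA_simps CM_simps coord_closed j)
  fix r x assume r: "r \<in> carrier A" and x: "x \<in> carrier TA"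
  then have "x \<in> carrier T" by (simp add: TA_simps)
  then show "coord j (r \<odot>\<^bsub>TA\<^esub> x) = r \<otimes>\<^bsub>A\<^esub> coord j x"
  proof (induction rule: TP.tensor_induct)
    case (tens a x)
    then show ?case
      using r by (simp add: CM_simps TA_smult(2) coord(2)[OF j] A.m_assoc \<iota>_closed db'(6)[OF j])
  next
    case (add s t)
    then show ?case
      using r additive_closed[OF TA_smult(1)]
      by (simp add: additive_add[OF TA_smult(1)] c CM_simps A.r_distr coord_closed[OF j])
  qed
next
  fix x assume "x \<in> carrier TA"
  then have x: "x \<in> carrier T" by (simp add: TA_simps)
  have "(\<Oplus>\<^bsub>TA\<^esub>j\<in>J. coord j x \<odot>\<^bsub>TA\<^esub> \<iota>P (b j)) = (\<Oplus>\<^bsub>T\<^esub>j\<in>J. coord j x \<odot>\<^bsub>TA\<^esub> \<iota>P (b j))"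
    by (rule finsum_transfer) (simp_all add: TA_simps)
  also have "\<dots> = (\<Oplus>\<^bsub>T\<^esub>j\<in>J. tens (coord j x) (b j))"
    unfolding \<iota>P_def using coord_closed[OF _ x] db'(1)
    by (intro TP.T.finsum_cong') (auto simp: TA_smult(2) tens_closed)
  also have "\<dots> = x" by (rule TP.tensor_expand[OF finite_J db x])
  finally show "(\<Oplus>\<^bsub>TA\<^esub>j\<in>J. coord j x \<odot>\<^bsub>TA\<^esub> \<iota>P (b j)) = x" .
qed

end

section \<open>Inverting integers in the completion\<close>

lemma rat_common_denominator:
  fixes q :: rat
  obtains d :: nat where "d > 0" "\<And>N. d dvd N \<Longrightarrow> \<exists>i::int. of_nat N * q = of_int i"
proof -
  obtain a b where q: "q = Fract a b" "b > 0" by (cases q) auto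
  have qb: "q = of_int a / of_int b" using q by (simp add: Fract_of_int_quotient)
  show thesis
  proof
    show "nat b > 0" using q by simp
    fix N assume "nat b dvd N"
    then obtain k where "N = nat b * k" by blast
    then have "(of_nat N :: rat) * q = of_int (int k * a)"
      using q(2) by (simp add: qb)
    then show "\<exists>i::int. of_nat N * q = of_int i" by blast
  qed
qed

lemma ring_Z: "ring \<Z>"
  using int_is_cring cring.axioms(1) by blast

lemma rat_module_simps:
  "carrier rat_module = UNIV" "add rat_module = (+)" "ring.zero rat_module = 0"
  "k \<odot>\<^bsub>rat_module\<^esub> q = of_int k * q"
  by (simp_all add: rat_module_def)

lemma left_module_rat_module: "left_module \<Z> rat_module"
proof -
  interpret Z: ring \<Z> by (rule ring_Z)
  interpret Q: abelian_group rat_module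
  proof (rule abelian_groupI)
    fix x show "\<exists>y\<in>carrier rat_module. y \<oplus>\<^bsub>rat_module\<^esub> x = \<zero>\<^bsub>rat_module\<^esub>"
      by (intro bexI[of _ "- x"]) (simp_all add: rat_module_simps)
  qed (simp_all add: rat_module_simps)
  show ?thesis
    by unfold_locales (simp_all add: rat_module_simps distrib_left distrib_right)
qed

lemma int_module_simps:
  "carrier (int_module_of A) = carrier A" "add (int_module_of A) = add A"
  "ring.zero (int_module_of A) = ring.zero A" "k \<odot>\<^bsub>int_module_of A\<^esub> x = [k] \<cdot>\<^bsub>A\<^esub> x"
  by (simp_all add: int_module_of_def)

lemma right_module_int_module:
  assumes "abelian_group A"
  shows "right_module \<Z> (int_module_of A)"
proof -
  interpret A: abelian_group A by fact
  interpret Z: ring \<Z> by (rule ring_Z)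
  interpret I: abelian_group "int_module_of A"
    by (rule abelian_group_transfer[OF assms]) (simp_all add: int_module_simps)
  show ?thesis
    by unfold_locales
      (simp_all add: int_module_simps A.add.int_pow_mult A.add.int_pow_distrib A.add.int_pow_pow mult.commute)
qed

text \<open>
  The tensor product of \<open>A\<close> with the rational numbers, seen as a group of fractions \<open>a/m\<close>.
\<close>

locale rationalization = base: abelian_group A for A :: "('r, 'a) module"
begin

sublocale tensor_pair \<Z> "int_module_of A" rat_module
  using right_module_int_module[OF base.abelian_group_axioms] left_module_rat_module
  by (simp add: tensor_pair_def)

abbreviation "over a m \<equiv> tens a (1 / rat_of_nat m)"

lemma frac_closed: "a \<in> carrier A \<Longrightarrow> over a m \<in> carrier T"
  by (rule tens_closed) (simp_all add: int_module_simps rat_module_simps)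

lemma frac_add: "a \<in> carrier A \<Longrightarrow> b \<in> carrier A \<Longrightarrow> over (a \<oplus>\<^bsub>A\<^esub> b) m = over a m \<oplus>\<^bsub>T\<^esub> over b m"
  using tens_add_left[of a b "1 / rat_of_nat m"] by (simp add: int_module_simps rat_module_simps)

lemma frac_multiple:
  assumes a: "a \<in> carrier A"
  shows "tens a (of_int k / rat_of_nat m) = over ([(k::int)] \<cdot>\<^bsub>A\<^esub> a) m"
  using tens_balanced[of k a "1 / rat_of_nat m"] a
  by (simp add: int_module_simps rat_module_simps)

lemma frac_cancel:
  assumes a: "a \<in> carrier A" and n: "n > 0"
  shows "over ([(n::nat)] \<cdot>\<^bsub>A\<^esub> a) (m * n) = over a m"
  using frac_multiple[OF a, of "int n" "m * n"] n
  by (simp add: add_pow_int_ge)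

lemma frac_exhaust:
  assumes "t \<in> carrier T"
  shows "\<exists>a m. a \<in> carrier A \<and> m > 0 \<and> t = over a m"
  using assms
proof (induction rule: tensor_induct)
  case (tens a q)
  then have a: "a \<in> carrier A" by (simp add: int_module_simps)
  obtain u v where q: "q = Fract u v" "v > 0" by (cases q) auto
  then have "q = of_int u / rat_of_nat (nat v)" by (simp add: Fract_of_int_quotient)
  then have "tens a q = over ([u] \<cdot>\<^bsub>A\<^esub> a) (nat v)" using frac_multiple[OF a] by simp
  then show ?case using a q by (intro exI[of _ "[u] \<cdot>\<^bsub>A\<^esub> a"] exI[of _ "nat v"]) simp
next
  case (add s t)
  then obtain a m b n where ab: "a \<in> carrier A" "m > 0" "s = over a m" "b \<in> carrier A" "n > 0" "t = over b n"
    by blast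
  have "s \<oplus>\<^bsub>T\<^esub> t = over ([n] \<cdot>\<^bsub>A\<^esub> a) (m * n) \<oplus>\<^bsub>T\<^esub> over ([m] \<cdot>\<^bsub>A\<^esub> b) (m * n)"
    using ab frac_cancel[of a n m] frac_cancel[of b m n] by (simp add: mult.commute)
  also have "\<dots> = over ([n] \<cdot>\<^bsub>A\<^esub> a \<oplus>\<^bsub>A\<^esub> [m] \<cdot>\<^bsub>A\<^esub> b) (m * n)"
    using ab by (intro frac_add[symmetric]) simp_all
  finally show ?case using ab by (intro exI[of _ "[n] \<cdot>\<^bsub>A\<^esub> a \<oplus>\<^bsub>A\<^esub> [m] \<cdot>\<^bsub>A\<^esub> b"] exI[of _ "m * n"]) simp
qed

text \<open>
  For a natural number \<open>N\<close> let \<open>h\<^sub>N\<close> be the homomorphism from the free abelian group on the pairs \<open>(c, q)\<close> to \<open>A\<close>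
  with \<open>h\<^sub>N (c, q) = \<lfloor>N q\<rfloor> c\<close>.  A defining relation of the tensor product is killed by \<open>h\<^sub>N\<close> whenever \<open>N\<close> is
  divisible by a suitable \<open>N\<^sub>0 > 0\<close>, because then the floors involved are exact.  The elements with this property form a
  subgroup, so it holds for \<open>(a, 1/m)\<close> if \<open>a/m = 0\<close>, and \<open>N = N\<^sub>0 m\<close> yields \<open>N\<^sub>0 a = 0\<close>.
\<close>

lemma frac_eq_zero:
  assumes tf: "\<And>a k. a \<in> carrier A \<Longrightarrow> k > 0 \<Longrightarrow> [(k::nat)] \<cdot>\<^bsub>A\<^esub> a = \<zero>\<^bsub>A\<^esub> \<Longrightarrow> a = \<zero>\<^bsub>A\<^esub>"
    and a: "a \<in> carrier A" and m: "m > 0" and z: "over a m = \<zero>\<^bsub>T\<^esub>"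
  shows "a = \<zero>\<^bsub>A\<^esub>"
proof -
  let ?f = "\<lambda>N x. [\<lfloor>of_nat N * snd x\<rfloor>] \<cdot>\<^bsub>A\<^esub> fst x"
  have "\<exists>h. h \<in> hom F (add_monoid A) \<and> (\<forall>x. x \<in> carrier (int_module_of A) \<times> carrier rat_module \<longrightarrow> h (frag_of x) = ?f N x)" for N :: nat
  proof -
    have "?f N ` (carrier (int_module_of A) \<times> carrier rat_module) \<subseteq> carrier (add_monoid A)"
      by (auto simp: int_module_simps)
    from comm_group.free_Abelian_group_universal[OF base.a_comm_group this] show ?thesis by blast
  qed
  then have "\<forall>N. \<exists>h. h \<in> hom F (add_monoid A) \<and> (\<forall>x. x \<in> carrier (int_module_of A) \<times> carrier rat_module \<longrightarrow> h (frag_of x) = ?f N x)"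
    by (rule allI)
  from choice[OF this] obtain h where h0: "\<forall>N. h N \<in> hom F (add_monoid A) \<and>
      (\<forall>x. x \<in> carrier (int_module_of A) \<times> carrier rat_module \<longrightarrow> h N (frag_of x) = ?f N x)" by (rule exE)
  have h: "h N \<in> hom F (add_monoid A)" for N using h0 by blast
  have hf: "h N (frag_of x) = ?f N x" if "x \<in> carrier (int_module_of A) \<times> carrier rat_module" for N x
    using h0 that by blast
  have hom: "group_hom F (add_monoid A) (h N)" for N
    using h base.a_group F.group_axioms by (simp add: group_hom_def group_hom_axioms_def)
  have hd: "h N (x - y) = h N x \<ominus>\<^bsub>A\<^esub> h N y" if "x \<in> carrier F" "y \<in> carrier F" for x y N
  proof -
    interpret group_hom F "add_monoid A" "h N" by (rule hom)
    show ?thesis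
      using hom_mult[of x "- y"] hom_inv[of y] that F.inv_closed[of y]
      by (simp add: a_minus_def a_inv_def)
  qed
  have hc: "h N x \<in> carrier A" if "x \<in> carrier F" for x N
    using h[of N] that by (auto simp: hom_def)
  have of2: "frag_of x - frag_of y \<in> carrier F" if "frag_of x \<in> carrier F" "frag_of y \<in> carrier F" for x y
    using that keys_diff[of "frag_of x" "frag_of y"] by (auto simp: keys_frag_of)
  define good where "good = {x \<in> carrier F. \<exists>N0>0. \<forall>N. N0 dvd N \<longrightarrow> h N x = \<zero>\<^bsub>A\<^esub>}"
  have goodI: "x \<in> good" if "x \<in> carrier F" "N0 > 0" "\<And>N. N0 dvd N \<Longrightarrow> h N x = \<zero>\<^bsub>A\<^esub>" for x N0
    using that by (auto simp: good_def)
  have "subgroup good F"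
  proof (rule F.subgroupI)
    show "good \<subseteq> carrier F" by (auto simp: good_def)
    have "0 \<in> good"
    proof (rule goodI[of 0 1])
      show "h N 0 = \<zero>\<^bsub>A\<^esub>" for N using group_hom.hom_one[OF hom, of N] by simp
    qed simp_all
    then show "good \<noteq> {}" by blast
  next
    fix x assume x: "x \<in> good"
    then obtain N0 where N0: "N0 > 0" "\<And>N. N0 dvd N \<Longrightarrow> h N x = \<zero>\<^bsub>A\<^esub>" and xF: "x \<in> carrier F"
      by (auto simp: good_def)
    show "inv\<^bsub>F\<^esub> x \<in> good"
    proof (rule goodI[OF F.inv_closed[OF xF] N0(1)])
      show "h N (inv\<^bsub>F\<^esub> x) = \<zero>\<^bsub>A\<^esub>" if "N0 dvd N" for N
        using group_hom.hom_inv[OF hom xF, of N] N0(2)[OF that]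
        using base.add.inv_one by (simp add: a_inv_def)
    qed
  next
    fix x y assume x: "x \<in> good" and y: "y \<in> good"
    then obtain N0 N1 where N: "N0 > 0" "\<And>N. N0 dvd N \<Longrightarrow> h N x = \<zero>\<^bsub>A\<^esub>"
      "N1 > 0" "\<And>N. N1 dvd N \<Longrightarrow> h N y = \<zero>\<^bsub>A\<^esub>" and xF: "x \<in> carrier F" and yF: "y \<in> carrier F"
      by (auto simp: good_def)
    show "x \<otimes>\<^bsub>F\<^esub> y \<in> good"
    proof (rule goodI[OF F.m_closed[OF xF yF], of "N0 * N1"])
      show "h N (x \<otimes>\<^bsub>F\<^esub> y) = \<zero>\<^bsub>A\<^esub>" if "N0 * N1 dvd N" for N
        using group_hom.hom_mult[OF hom xF yF, of N] N(2)[OF dvd_mult_left[OF that]] N(4)[OF dvd_mult_right[OF that]]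
        by simp
    qed (use N in simp)
  qed
  moreover have "relators \<subseteq> good"
  proof
    fix x assume xr: "x \<in> relators"
    then have xF: "x \<in> carrier F" using relators_subset by (rule subsetD[rotated])
    have fo: "frag_of (c, q) \<in> carrier F" if "c \<in> carrier A" for c q
      using that by (simp add: int_module_simps rat_module_simps)
    have hfo: "h N (frag_of (c, q)) = [\<lfloor>of_nat N * q\<rfloor>] \<cdot>\<^bsub>A\<^esub> c" if "c \<in> carrier A" for c q N
      using hf[of "(c, q)" N] that by (simp add: int_module_simps rat_module_simps)
    have h3: "h N (frag_of (c, q) - frag_of (c', q') - frag_of (c'', q'')) =
        [\<lfloor>of_nat N * q\<rfloor>] \<cdot>\<^bsub>A\<^esub> c \<ominus>\<^bsub>A\<^esub> [\<lfloor>of_nat N * q'\<rfloor>] \<cdot>\<^bsub>A\<^esub> c' \<ominus>\<^bsub>A\<^esub> [\<lfloor>of_nat N * q''\<rfloor>] \<cdot>\<^bsub>A\<^esub> c''"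
      if "c \<in> carrier A" "c' \<in> carrier A" "c'' \<in> carrier A" for c c' c'' q q' q'' N
      using hd[OF of2[OF fo[OF that(1)] fo[OF that(2)]] fo[OF that(3)]] hd[OF fo[OF that(1)] fo[OF that(2)]]
      by (simp only: hfo that)
    have cancel: "u \<oplus>\<^bsub>A\<^esub> v \<ominus>\<^bsub>A\<^esub> u \<ominus>\<^bsub>A\<^esub> v = \<zero>\<^bsub>A\<^esub>" if "u \<in> carrier A" "v \<in> carrier A" for u v
      using that by (simp add: base.add_diff_cancel_left base.diff_self)
    consider (left) c c' q where "c \<in> carrier A" "c' \<in> carrier A"
        "x = frag_of (c \<oplus>\<^bsub>A\<^esub> c', q) - frag_of (c, q) - frag_of (c', q)"
      | (right) c q q' where "c \<in> carrier A" "x = frag_of (c, q + q') - frag_of (c, q) - frag_of (c, q')"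
      | (bal) k c q where "c \<in> carrier A" "x = frag_of ([(k::int)] \<cdot>\<^bsub>A\<^esub> c, q) - frag_of (c, of_int k * q)"
      using xr unfolding relators_def by (auto simp: int_module_simps rat_module_simps)
    then show "x \<in> good"
    proof cases
      case left
      show ?thesis
      proof (rule goodI[OF xF, of 1])
        show "h N x = \<zero>\<^bsub>A\<^esub>" for N
          using left by (simp add: h3 base.add.int_pow_distrib cancel)
      qed simp
    next
      case right
      obtain d where d: "d > 0" "\<And>N. d dvd N \<Longrightarrow> \<exists>i::int. of_nat N * q = of_int i"
        using rat_common_denominator[of q] by metis
      show ?thesis
      proof (rule goodI[OF xF d(1)])
        fix N assume "d dvd N"
        then obtain i :: int where i: "of_nat N * q = of_int i" using d(2) by blast
        have "\<lfloor>of_nat N * (q + q')\<rfloor> = i + \<lfloor>of_nat N * q'\<rfloor>" "\<lfloor>of_nat N * q\<rfloor> = i"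
          by (simp_all add: distrib_left i)
        then show "h N x = \<zero>\<^bsub>A\<^esub>"
          using right by (simp add: h3 base.add.int_pow_mult cancel)
      qed
    next
      case bal
      obtain d where d: "d > 0" "\<And>N. d dvd N \<Longrightarrow> \<exists>i::int. of_nat N * q = of_int i"
        using rat_common_denominator[of q] by metis
      show ?thesis
      proof (rule goodI[OF xF d(1)])
        fix N assume "d dvd N"
        then obtain i :: int where i: "of_nat N * q = of_int i" using d(2) by blast
        have "of_nat N * (of_int k * q) = of_int (k * i)" using i by (simp add: mult.left_commute)
        then have fl: "\<lfloor>of_nat N * (of_int k * q)\<rfloor> = k * i" "\<lfloor>of_nat N * q\<rfloor> = i"
          using i by (simp_all only: floor_of_int)
        have "h N x = [i] \<cdot>\<^bsub>A\<^esub> ([k] \<cdot>\<^bsub>A\<^esub> c) \<ominus>\<^bsub>A\<^esub> [(k * i)] \<cdot>\<^bsub>A\<^esub> c"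
          unfolding bal(2) using hd[OF fo fo] bal(1) by (simp only: hfo fl base.add.int_pow_closed)
        then show "h N x = \<zero>\<^bsub>A\<^esub>"
          using bal(1) by (simp add: base.add.int_pow_pow base.diff_self)
      qed
    qed
  qed
  ultimately have Kgood: "K \<subseteq> good"
    unfolding tensor_relations_eq by (intro F.generate_subgroup_incl)
  have aF: "frag_of (a, 1 / rat_of_nat m) \<in> carrier F"
    using a by (simp add: int_module_simps rat_module_simps)
  have "K #>\<^bsub>F\<^esub> frag_of (a, 1 / rat_of_nat m) = K"
    using z by (simp add: pure_tensor_def additive_tensor_simps tensor_def)
  then have "frag_of (a, 1 / rat_of_nat m) \<in> good"
    using F.rcos_self[OF aF subgroup_relations] Kgood by auto
  then obtain N0 where N0: "N0 > 0" "\<And>N. N0 dvd N \<Longrightarrow> h N (frag_of (a, 1 / rat_of_nat m)) = \<zero>\<^bsub>A\<^esub>"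
    by (auto simp: good_def)
  have "h (N0 * m) (frag_of (a, 1 / rat_of_nat m)) = [(int N0)] \<cdot>\<^bsub>A\<^esub> a"
    using hf[of "(a, 1 / rat_of_nat m)" "N0 * m"] a m by (simp add: int_module_simps rat_module_simps)
  then have "[N0] \<cdot>\<^bsub>A\<^esub> a = \<zero>\<^bsub>A\<^esub>" using N0(2)[of "N0 * m"] by (simp add: add_pow_int_ge)
  then show ?thesis using tf[OF a N0(1)] by blast
qed

end

context padic_ring
begin

interpretation CMa: right_module R CM by (rule right_module_CM)

lemma abelian_CM: "abelian_group CM"
  by (rule CMa.M.abelian_group_axioms)

sublocale rat: rationalization CM
  using CMa.M.abelian_group_axioms by (simp add: rationalization_def)

text \<open>
  For the group ring of \<open>G\<close> this is \<open>c\<^sub>0(G)\<close>.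
\<close>

definition C0 :: "('r, ((nat \<Rightarrow> 'r set) \<times> rat \<Rightarrow>\<^sub>0 int) set) module"
  where "C0 = (let T = tensor \<Z> (int_module_of CM) rat_module in
    module_of (carrier T) (monoid.mult T) (one T)
      (\<lambda>r. tensor_map \<Z> (int_module_of CM) rat_module (\<lambda>x. r \<odot>\<^bsub>CM\<^esub> x) id))"

lemma C0_simps:
  "carrier C0 = carrier rat.T" "add C0 = add rat.T" "ring.zero C0 = ring.zero rat.T"
  "r \<odot>\<^bsub>C0\<^esub> t = tensor_map \<Z> (int_module_of CM) rat_module (\<lambda>x. r \<odot>\<^bsub>CM\<^esub> x) id t"
  by (simp_all add: C0_def Let_def additive_tensor_simps)

lemma C0_smult:
  assumes r: "r \<in> carrier R"
  shows "additive rat.T rat.T (\<lambda>t. r \<odot>\<^bsub>C0\<^esub> t)"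
    and "\<And>a q. a \<in> carrier A \<Longrightarrow> r \<odot>\<^bsub>C0\<^esub> rat.tens a q = rat.tens (r \<odot>\<^bsub>CM\<^esub> a) q"
proof -
  have add: "additive CM CM (\<lambda>x. r \<odot>\<^bsub>CM\<^esub> x)"
    by (rule additiveI) (simp_all add: CMa.smult_closed CMa.smult_r_distr r)
  then have f: "additive (int_module_of CM) (int_module_of CM) (\<lambda>x. r \<odot>\<^bsub>CM\<^esub> x)"
    by (simp add: additive_def hom_def int_module_simps)
  have f': "r \<odot>\<^bsub>CM\<^esub> (k \<odot>\<^bsub>int_module_of CM\<^esub> x) = k \<odot>\<^bsub>int_module_of CM\<^esub> (r \<odot>\<^bsub>CM\<^esub> x)"
    if "k \<in> carrier \<Z>" "x \<in> carrier (int_module_of CM)" for k x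
    using additive_int_pow[OF CMa.M.abelian_group_axioms CMa.M.abelian_group_axioms add] that
    by (simp add: int_module_simps)
  have id: "id \<in> module_homs \<Z> rat_module rat_module" by (simp add: module_homs_def)
  note tm = tensor_map_additive[where f = "\<lambda>x. r \<odot>\<^bsub>CM\<^esub> x", OF rat.tensor_pair_axioms rat.tensor_pair_axioms f f' id]
  show "additive rat.T rat.T (\<lambda>t. r \<odot>\<^bsub>C0\<^esub> t)" using tm(1) by (simp add: C0_simps)
  show "\<And>a q. a \<in> carrier A \<Longrightarrow> r \<odot>\<^bsub>C0\<^esub> rat.tens a q = rat.tens (r \<odot>\<^bsub>CM\<^esub> a) q"
    using tm(2) by (simp add: C0_simps int_module_simps rat_module_simps CM_simps)
qed

lemma right_module_C0: "right_module R C0"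
proof -
  interpret C0: abelian_group C0
    by (rule abelian_group_transfer[OF rat.T.abelian_group_axioms]) (simp_all add: C0_simps)
  note sa = C0_smult(1) and st = C0_smult(2)
  note sc = additive_closed[OF sa] and sadd = additive_add[OF sa]
  have ind: "S t" if "t \<in> carrier C0" "\<And>a q. a \<in> carrier A \<Longrightarrow> S (rat.tens a q)"
    "\<And>s t. \<lbrakk>s \<in> carrier rat.T; t \<in> carrier rat.T; S s; S t\<rbrakk> \<Longrightarrow> S (s \<oplus>\<^bsub>rat.T\<^esub> t)" for S t
    using that by (intro rat.tensor_induct[of t S]) (simp_all add: C0_simps int_module_simps CM_simps)
  have tl: "rat.tens (a \<oplus>\<^bsub>CM\<^esub> a') q = rat.tens a q \<oplus>\<^bsub>rat.T\<^esub> rat.tens a' q"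
    if "a \<in> carrier CM" "a' \<in> carrier CM" for a a' q
    using rat.tens_add_left[of a a' q] that by (simp add: int_module_simps rat_module_simps)
  note cmc = CMa.smult_closed[unfolded CM_simps(1)]
  show ?thesis
  proof unfold_locales
    fix r s x assume r: "r \<in> carrier R" and s: "s \<in> carrier R" and x: "x \<in> carrier C0"
    show "(r \<oplus> s) \<odot>\<^bsub>C0\<^esub> x = r \<odot>\<^bsub>C0\<^esub> x \<oplus>\<^bsub>C0\<^esub> s \<odot>\<^bsub>C0\<^esub> x"
      using x
    proof (rule ind)
      fix a q assume "a \<in> carrier A"
      then show "(r \<oplus> s) \<odot>\<^bsub>C0\<^esub> rat.tens a q = r \<odot>\<^bsub>C0\<^esub> rat.tens a q \<oplus>\<^bsub>C0\<^esub> s \<odot>\<^bsub>C0\<^esub> rat.tens a q"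
        using r s by (simp add: st C0_simps(2) CMa.smult_l_distr tl cmc CM_simps(1))
    next
      fix u t assume u: "u \<in> carrier rat.T" "t \<in> carrier rat.T"
        and eq: "(r \<oplus> s) \<odot>\<^bsub>C0\<^esub> u = r \<odot>\<^bsub>C0\<^esub> u \<oplus>\<^bsub>C0\<^esub> s \<odot>\<^bsub>C0\<^esub> u"
          "(r \<oplus> s) \<odot>\<^bsub>C0\<^esub> t = r \<odot>\<^bsub>C0\<^esub> t \<oplus>\<^bsub>C0\<^esub> s \<odot>\<^bsub>C0\<^esub> t"
      have "(r \<oplus> s) \<odot>\<^bsub>C0\<^esub> (u \<oplus>\<^bsub>rat.T\<^esub> t) = (r \<oplus> s) \<odot>\<^bsub>C0\<^esub> u \<oplus>\<^bsub>rat.T\<^esub> (r \<oplus> s) \<odot>\<^bsub>C0\<^esub> t"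
        using r s u by (intro sadd) auto
      also have "\<dots> = (r \<odot>\<^bsub>C0\<^esub> u \<oplus>\<^bsub>rat.T\<^esub> r \<odot>\<^bsub>C0\<^esub> t) \<oplus>\<^bsub>rat.T\<^esub> (s \<odot>\<^bsub>C0\<^esub> u \<oplus>\<^bsub>rat.T\<^esub> s \<odot>\<^bsub>C0\<^esub> t)"
        using r s u by (simp add: eq[unfolded C0_simps(2)] sc rat.T.a_ac)
      also have "\<dots> = r \<odot>\<^bsub>C0\<^esub> (u \<oplus>\<^bsub>rat.T\<^esub> t) \<oplus>\<^bsub>C0\<^esub> s \<odot>\<^bsub>C0\<^esub> (u \<oplus>\<^bsub>rat.T\<^esub> t)"
        using r s u by (simp only: sadd C0_simps(2))
      finally show "(r \<oplus> s) \<odot>\<^bsub>C0\<^esub> (u \<oplus>\<^bsub>rat.T\<^esub> t) = r \<odot>\<^bsub>C0\<^esub> (u \<oplus>\<^bsub>rat.T\<^esub> t) \<oplus>\<^bsub>C0\<^esub> s \<odot>\<^bsub>C0\<^esub> (u \<oplus>\<^bsub>rat.T\<^esub> t)" .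
    qed
    show "(r \<otimes> s) \<odot>\<^bsub>C0\<^esub> x = s \<odot>\<^bsub>C0\<^esub> (r \<odot>\<^bsub>C0\<^esub> x)"
      using x
    proof (rule ind)
      fix a q assume "a \<in> carrier A"
      then show "(r \<otimes> s) \<odot>\<^bsub>C0\<^esub> rat.tens a q = s \<odot>\<^bsub>C0\<^esub> (r \<odot>\<^bsub>C0\<^esub> rat.tens a q)"
        using r s by (simp add: st cmc CMa.smult_assoc CM_simps(1))
    next
      fix u t assume "u \<in> carrier rat.T" "t \<in> carrier rat.T"
        "(r \<otimes> s) \<odot>\<^bsub>C0\<^esub> u = s \<odot>\<^bsub>C0\<^esub> (r \<odot>\<^bsub>C0\<^esub> u)" "(r \<otimes> s) \<odot>\<^bsub>C0\<^esub> t = s \<odot>\<^bsub>C0\<^esub> (r \<odot>\<^bsub>C0\<^esub> t)"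
      then show "(r \<otimes> s) \<odot>\<^bsub>C0\<^esub> (u \<oplus>\<^bsub>rat.T\<^esub> t) = s \<odot>\<^bsub>C0\<^esub> (r \<odot>\<^bsub>C0\<^esub> (u \<oplus>\<^bsub>rat.T\<^esub> t))"
        using r s by (simp add: sadd sc)
    qed
  next
    fix r x y assume "r \<in> carrier R" "x \<in> carrier C0" "y \<in> carrier C0"
    then show "r \<odot>\<^bsub>C0\<^esub> (x \<oplus>\<^bsub>C0\<^esub> y) = r \<odot>\<^bsub>C0\<^esub> x \<oplus>\<^bsub>C0\<^esub> r \<odot>\<^bsub>C0\<^esub> y"
      by (simp add: C0_simps(1-3) sadd)
  next
    fix r x assume "r \<in> carrier R" "x \<in> carrier C0"
    then show "r \<odot>\<^bsub>C0\<^esub> x \<in> carrier C0" by (simp add: C0_simps(1-3) sc)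
  next
    fix x assume "x \<in> carrier C0"
    then show "\<one> \<odot>\<^bsub>C0\<^esub> x = x"
      by (rule ind) (simp_all add: st sadd CMa.smult_one CM_simps(1))
  qed
qed

lemma frac_hom:
  "additive CM C0 (\<lambda>a. rat.over a m)"
  "\<And>r a. r \<in> carrier R \<Longrightarrow> a \<in> carrier CM \<Longrightarrow> rat.over (r \<odot>\<^bsub>CM\<^esub> a) m = r \<odot>\<^bsub>C0\<^esub> rat.over a m"
proof -
  show "additive CM C0 (\<lambda>a. rat.over a m)"
    by (rule additiveI) (simp_all add: C0_simps rat.frac_closed rat.frac_add)
qed (simp add: C0_smult(2) CM_simps(1))

end

context padic_module
begin

sublocale TC: tensor_pair R C0 P
  using right_module_C0 P.left_module_axioms by (simp add: tensor_pair_def)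

text \<open>
  The map \<open>t \<mapsto> t/m\<close> from the completion of \<open>P\<close> to \<open>c\<^sub>0 \<otimes> P\<close>.
\<close>

definition \<theta> where "\<theta> m = tensor_map R C0 P (\<lambda>a. rat.over a m) (\<lambda>x. x)"

lemma \<theta>:
  "additive T TC.T (\<theta> m)"
  "\<And>a x. a \<in> carrier A \<Longrightarrow> x \<in> carrier P \<Longrightarrow> \<theta> m (tens a x) = TC.tens (rat.over a m) x"
proof -
  have id: "(\<lambda>x. x) \<in> module_homs R P P" by (auto simp: module_homs_def)
  note tm = tensor_map_additive[where f = "\<lambda>a. rat.over a m" and g = "\<lambda>x. x",
      OF TP.tensor_pair_axioms TC.tensor_pair_axioms frac_hom id]
  show "additive T TC.T (\<theta> m)" using tm(1) by (simp add: \<theta>_def)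
  show "\<And>a x. a \<in> carrier A \<Longrightarrow> x \<in> carrier P \<Longrightarrow> \<theta> m (tens a x) = TC.tens (rat.over a m) x"
    using tm(2) by (simp add: \<theta>_def CM_simps)
qed

lemma \<theta>_closed: "t \<in> carrier T \<Longrightarrow> \<theta> m t \<in> carrier TC.T"
  by (rule additive_closed[OF \<theta>(1)])

lemma \<theta>_cancel:
  assumes t: "t \<in> carrier T" and n: "n > 0"
  shows "\<theta> (m * n) ([(n::nat)] \<cdot>\<^bsub>T\<^esub> t) = \<theta> m t"
proof (rule TP.additive_eqI[OF _ \<theta>(1) _ t])
  show "additive T TC.T (\<lambda>t. \<theta> (m * n) ([n] \<cdot>\<^bsub>T\<^esub> t))"
    by (rule additive_compose[OF TP.T.additive_nat_multiple \<theta>(1)])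
  fix a x assume "a \<in> carrier CM" and x: "x \<in> carrier P"
  then have a: "a \<in> carrier A" "a \<in> carrier CM" by (simp_all add: CM_simps)
  have "[n] \<cdot>\<^bsub>T\<^esub> tens a x = tens ([n] \<cdot>\<^bsub>CM\<^esub> a) x"
    by (rule additive_nat_pow[OF abelian_CM TP.T.abelian_group_axioms TP.additive_tens_left[OF x] a(2), symmetric])
  then show "\<theta> (m * n) ([n] \<cdot>\<^bsub>T\<^esub> tens a x) = \<theta> m (tens a x)"
    using a x rat.frac_cancel[OF a(2) n, of m] by (simp add: \<theta>(2) CM_multiple)
qed

lemma \<theta>_exhaust:
  assumes "t \<in> carrier TC.T"
  shows "\<exists>s m. s \<in> carrier T \<and> m > 0 \<and> t = \<theta> m s"
  using assms
proof (induction rule: TC.tensor_induct)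
  case (tens c x)
  then obtain a m where a: "a \<in> carrier CM" "m > 0" "c = rat.over a m"
    using rat.frac_exhaust[of c] by (auto simp: C0_simps)
  then have "TC.tens c x = \<theta> m (tens a x)" using \<theta>(2)[of a x m] tens by (simp add: CM_simps)
  moreover have "tens a x \<in> carrier T" using a tens tens_closed[of a x] by (simp add: CM_simps)
  ultimately show ?case using a(2) by (intro exI[of _ "tens a x"] exI[of _ m]) simp
next
  case (add s t)
  then obtain u m v n where uv: "u \<in> carrier T" "m > 0" "s = \<theta> m u" "v \<in> carrier T" "n > 0" "t = \<theta> n v"
    by blast
  have "s \<oplus>\<^bsub>TC.T\<^esub> t = \<theta> (m * n) ([n] \<cdot>\<^bsub>T\<^esub> u) \<oplus>\<^bsub>TC.T\<^esub> \<theta> (m * n) ([m] \<cdot>\<^bsub>T\<^esub> v)"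
    using uv \<theta>_cancel[of u n m] \<theta>_cancel[of v m n] by (simp add: mult.commute)
  also have "\<dots> = \<theta> (m * n) ([n] \<cdot>\<^bsub>T\<^esub> u \<oplus>\<^bsub>T\<^esub> [m] \<cdot>\<^bsub>T\<^esub> v)"
    using uv by (simp add: additive_add[OF \<theta>(1)])
  finally show ?case using uv by (intro exI[of _ "[n] \<cdot>\<^bsub>T\<^esub> u \<oplus>\<^bsub>T\<^esub> [m] \<cdot>\<^bsub>T\<^esub> v"] exI[of _ "m * n"]) simp
qed

text \<open>
  The coordinates of \<open>t/m\<close> are those of \<open>t\<close> divided by \<open>m\<close>, and the completed ring is torsion free.
\<close>

lemma \<theta>_eq_zero:
  assumes t: "t \<in> carrier T" and m: "m > 0" and z: "\<theta> m t = \<zero>\<^bsub>TC.T\<^esub>"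
  shows "t = \<zero>\<^bsub>T\<^esub>"
proof (rule TP.tensor_coordinates_zero[OF finite_J db t])
  fix j assume j: "j \<in> J"
  let ?c = "tensor_coordinate R C0 P (\<phi> j)"
  note c = TC.tensor_coordinate[OF db'(2,3)[OF j]]
  have "?c (\<theta> m t) = rat.over (coord j t) m"
  proof (rule TP.additive_eqI[OF _ _ _ t])
    show "additive T C0 (\<lambda>t. ?c (\<theta> m t))" by (rule additive_compose[OF \<theta>(1) c(1)])
    show "additive T C0 (\<lambda>t. rat.over (coord j t) m)"
      by (rule additive_compose[OF coord(1)[OF j] frac_hom(1)])
    fix a x assume "a \<in> carrier CM" and x: "x \<in> carrier P"
    then have a: "a \<in> carrier A" "a \<in> carrier CM" by (simp_all add: CM_simps)
    have "coord j (tens a x) = \<phi> j x \<odot>\<^bsub>CM\<^esub> a" by (rule TP.tensor_coordinate(2)[OF db'(2,3)[OF j] a(2) x])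
    moreover have "rat.over a m \<in> carrier C0" using rat.frac_closed[OF a(2)] by (simp add: C0_simps)
    ultimately show "?c (\<theta> m (tens a x)) = rat.over (coord j (tens a x)) m"
      using a x c(2)[of "rat.over a m" x] frac_hom(2)[OF db'(6)[OF j x] a(2)] by (simp add: \<theta>(2))
  qed
  moreover have "?c (\<theta> m t) = \<zero>\<^bsub>C0\<^esub>"
    unfolding z by (rule additive_zero[OF TC.T.abelian_group_axioms TC.A.M.abelian_group_axioms c(1)])
  ultimately have "rat.over (coord j t) m = \<zero>\<^bsub>rat.T\<^esub>" by (simp add: C0_simps)
  then have "coord j t = \<zero>\<^bsub>CM\<^esub>"
    using coord_closed[OF j t] m
    by (intro rat.frac_eq_zero[of "coord j t" m]) (auto simp: CM_simps CM_multiple intro: A_torsion_free)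
  then show "coord j t = \<zero>\<^bsub>CM\<^esub>" .
qed

end

section \<open>Finitely generated abelian groups\<close>

context comm_group
begin

lemma generate_insert_form:
  assumes a: "a \<in> carrier G" and S: "S \<subseteq> carrier G" and x: "x \<in> generate G (insert a S)"
  shows "\<exists>(k::int). \<exists>g\<in>generate G S. x = a [^] k \<otimes> g"
proof -
  have sub: "subgroup (generate G S) G" by (rule generate_is_subgroup[OF S])
  note gc = subgroup.mem_carrier[OF sub]
  let ?K = "{x. \<exists>(k::int). \<exists>g\<in>generate G S. x = a [^] k \<otimes> g}"
  have "subgroup ?K G"
  proof (rule subgroupI)
    show "?K \<subseteq> carrier G" using a gc by auto
    have "a [^] (0::int) \<otimes> \<one> \<in> ?K" using generate.one by blast
    then show "?K \<noteq> {}" by blast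
  next
    fix x assume "x \<in> ?K"
    then obtain k :: int and g where kg: "g \<in> generate G S" "x = a [^] k \<otimes> g" by blast
    have "inv x = a [^] (- k) \<otimes> inv g"
      using kg a gc by (simp add: inv_mult int_pow_neg)
    then show "inv x \<in> ?K" using subgroup.m_inv_closed[OF sub kg(1)] by blast
  next
    fix x y assume "x \<in> ?K" "y \<in> ?K"
    then obtain k l :: int and g h where kg: "g \<in> generate G S" "x = a [^] k \<otimes> g"
      "h \<in> generate G S" "y = a [^] l \<otimes> h" by blast
    have "x \<otimes> y = a [^] (k + l) \<otimes> (g \<otimes> h)"
      using kg a gc by (simp add: int_pow_mult m_ac)
    then show "x \<otimes> y \<in> ?K" using subgroup.m_closed[OF sub kg(1,3)] by blast
  qed
  moreover have "insert a S \<subseteq> ?K"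
  proof -
    have "a = a [^] (1::int) \<otimes> \<one>" using a by simp
    then have "a \<in> ?K" using generate.one by blast
    moreover have "s \<in> ?K" if "s \<in> S" for s
    proof -
      have "s = a [^] (0::int) \<otimes> s" using that S by auto
      then show ?thesis using generate.incl[OF that] by blast
    qed
    ultimately show ?thesis by blast
  qed
  ultimately show ?thesis using generate_subgroup_incl[of "insert a S" ?K] x by blast
qed

lemma finite_generate_bounded_exponent:
  assumes "finite S" "S \<subseteq> carrier G" "(d::nat) > 0" "\<And>x. x \<in> generate G S \<Longrightarrow> x [^] d = \<one>"
  shows "finite (generate G S)"
  using assms
proof (induction S rule: finite_induct)
  case empty
  have "generate G {} = {\<one>}" by (rule generate_empty)
  then show ?case by simp
next
  case (insert a S)
  have sub: "generate G S \<subseteq> generate G (insert a S)" by (rule mono_generate) blast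
  have a: "a \<in> carrier G" using insert by simp
  have ad: "a [^] d = \<one>" by (rule insert.prems(3)[OF generate.incl]) simp
  have "generate G (insert a S) \<subseteq> (\<lambda>(k, g). a [^] k \<otimes> g) ` ({0..<int d} \<times> generate G S)"
  proof
    fix x assume "x \<in> generate G (insert a S)"
    then obtain k :: int and g where kg: "g \<in> generate G S" "x = a [^] k \<otimes> g"
      using generate_insert_form[OF a] insert by blast
    have "a [^] k = a [^] (int d * (k div int d) + k mod int d)" by simp
    also have "\<dots> = (a [^] int d) [^] (k div int d) \<otimes> a [^] (k mod int d)"
      using a by (simp only: int_pow_mult int_pow_pow)
    also have "a [^] int d = \<one>" using ad by (simp add: int_pow_int)
    finally have "a [^] k = a [^] (k mod int d)" using a by simp
    then show "x \<in> (\<lambda>(k, g). a [^] k \<otimes> g) ` ({0..<int d} \<times> generate G S)"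
      using kg insert.prems(2) by (intro image_eqI[of _ _ "(k mod int d, g)"]) auto
  qed
  moreover have "finite (generate G S)" using insert sub by blast
  ultimately show ?case by (meson finite_SigmaI finite_atLeastLessThan_int finite_imageI finite_subset)
qed

text \<open>
  Induction on the number of generators.  The exponents with which the new generator \<open>a\<close> occurs in \<open>Z\<close> are the
  multiples of a number \<open>e\<close>, and an element of \<open>Z\<close> realising \<open>e\<close> is added to generators of \<open>Z \<inter> \<langle>S\<rangle>\<close>.
\<close>

lemma finitely_generated_subgroup:
  assumes "finite S" "S \<subseteq> carrier G" "subgroup Z G" "Z \<subseteq> generate G S"
  shows "\<exists>S'. finite S' \<and> S' \<subseteq> Z \<and> Z \<subseteq> generate G S'"
  using assms
proof (induction S arbitrary: Z rule: finite_induct)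
  case empty
  then have "Z \<subseteq> generate G {}" by simp
  then show ?case by blast
next
  case (insert a S)
  have a: "a \<in> carrier G" and S: "S \<subseteq> carrier G" using insert by auto
  note Z = insert.prems(2)
  have sub: "subgroup (generate G S) G" by (rule generate_is_subgroup[OF S])
  note gc = subgroup.mem_carrier[OF sub]
  define Z' where "Z' = Z \<inter> generate G S"
  have Z': "subgroup Z' G" unfolding Z'_def by (rule subgroups_Inter_pair[OF Z sub])
  then obtain S' where S': "finite S'" "S' \<subseteq> Z'" "Z' \<subseteq> generate G S'"
    using insert.IH[OF S Z'] unfolding Z'_def by blast
  define I where "I = {k::int. \<exists>g\<in>generate G S. a [^] k \<otimes> g \<in> Z}"
  have form: "\<exists>k\<in>I. \<exists>g\<in>generate G S. z = a [^] k \<otimes> g" if "z \<in> Z" for z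
    using generate_insert_form[OF a S, of z] insert.prems(3) that unfolding I_def by blast
  show ?case
  proof (cases "\<exists>k\<in>I. k > 0")
    case True
    define e where "e = (LEAST n::nat. n > 0 \<and> int n \<in> I)"
    have "\<exists>n::nat. n > 0 \<and> int n \<in> I" using True by (metis zero_less_imp_eq_int)
    then have e: "e > 0" "int e \<in> I" unfolding e_def by (metis (mono_tags, lifting) LeastI)+
    have least: "\<not> (0 < n \<and> int n \<in> I)" if "n < e" for n
      using not_less_Least[of n "\<lambda>n. n > 0 \<and> int n \<in> I"] that unfolding e_def by blast
    obtain g0 where g0: "g0 \<in> generate G S" "a [^] int e \<otimes> g0 \<in> Z" using e(2) unfolding I_def by blast
    define z0 where "z0 = a [^] int e \<otimes> g0"
    have z0: "z0 \<in> Z" using g0 by (simp add: z0_def)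
    have z0c: "z0 \<in> carrier G" by (rule subgroup.mem_carrier[OF Z z0])
    have "Z \<subseteq> generate G (insert z0 S')"
    proof
      fix z assume z: "z \<in> Z"
      obtain k :: int and g where kg: "g \<in> generate G S" "z = a [^] k \<otimes> g" using form[OF z] by blast
      define q r where "q = k div int e" and "r = k mod int e"
      have k: "k = int e * q + r" by (simp add: q_def r_def)
      have r: "0 \<le> r" "r < int e" using e(1) by (simp_all add: r_def)
      define y where "y = z \<otimes> z0 [^] (- q)"
      have zq: "z0 [^] (- q) \<in> Z" by (rule subgroup_int_pow_closed[OF Z z0])
      have yZ: "y \<in> Z" unfolding y_def by (rule subgroup.m_closed[OF Z z zq])
      have gq: "g0 [^] (- q) \<in> generate G S" by (rule subgroup_int_pow_closed[OF sub g0(1)])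
      have "y = (a [^] k \<otimes> g) \<otimes> (a [^] (int e * (- q)) \<otimes> g0 [^] (- q))"
        using a gc[OF g0(1)] by (simp add: y_def kg(2) z0_def int_pow_distrib int_pow_pow)
      also have "\<dots> = (a [^] k \<otimes> a [^] (int e * (- q))) \<otimes> (g \<otimes> g0 [^] (- q))"
        using a gc[OF g0(1)] gc[OF kg(1)] by (simp add: m_ac)
      also have "a [^] k \<otimes> a [^] (int e * (- q)) = a [^] r"
        using a by (simp add: int_pow_mult[symmetric] k)
      finally have y: "y = a [^] r \<otimes> (g \<otimes> g0 [^] (- q))" .
      have gg: "g \<otimes> g0 [^] (- q) \<in> generate G S" by (rule subgroup.m_closed[OF sub kg(1) gq])
      then have "r \<in> I" using y yZ unfolding I_def by blast
      then have "r = 0" using least[of "nat r"] r by (cases "r = 0") (auto simp: nat_less_iff)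
      then have "y \<in> Z'" using y yZ gg gc[OF gg] by (simp add: Z'_def)
      then have yg: "y \<in> generate G (insert z0 S')"
        using S'(3) mono_generate[of S' "insert z0 S'"] by blast
      have ins: "insert z0 S' \<subseteq> carrier G"
        using z0c S'(2) subgroup.subset[OF Z'] by blast
      have "z0 [^] q \<in> generate G (insert z0 S')"
        by (rule subgroup_int_pow_closed[OF generate_is_subgroup[OF ins]]) (rule generate.incl, simp)
      then have "y \<otimes> z0 [^] q \<in> generate G (insert z0 S')"
        by (rule generate.eng[OF yg])
      moreover have "y \<otimes> z0 [^] q = z"
      proof -
        have "y \<otimes> z0 [^] q = z \<otimes> (z0 [^] (- q) \<otimes> z0 [^] q)"
          using subgroup.mem_carrier[OF Z z] z0c by (simp add: y_def m_assoc)
        also have "z0 [^] (- q) \<otimes> z0 [^] q = \<one>"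
          using z0c by (simp add: int_pow_mult[symmetric])
        finally show ?thesis using subgroup.mem_carrier[OF Z z] by simp
      qed
      ultimately show "z \<in> generate G (insert z0 S')" by simp
    qed
    then show ?thesis
      using S' z0 by (intro exI[of _ "insert z0 S'"]) (auto simp: Z'_def)
  next
    case False
    have k0: "k = 0" if kI: "k \<in> I" for k
    proof (rule ccontr)
      assume "k \<noteq> 0"
      then have "k < 0" using False that by force
      obtain g where g: "g \<in> generate G S" "a [^] k \<otimes> g \<in> Z" using kI unfolding I_def by blast
      have "inv (a [^] k \<otimes> g) = a [^] (- k) \<otimes> inv g"
        using a gc[OF g(1)] by (simp add: inv_mult int_pow_neg)
      then have "a [^] (- k) \<otimes> inv g \<in> Z" using subgroup.m_inv_closed[OF Z g(2)] by simp
      then have "- k \<in> I" using subgroup.m_inv_closed[OF sub g(1)] unfolding I_def by blast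
      then show False using False \<open>k < 0\<close> by auto
    qed
    have "Z \<subseteq> Z'"
    proof
      fix z assume z: "z \<in> Z"
      then obtain k :: int and g where kg: "k \<in> I" "g \<in> generate G S" "z = a [^] k \<otimes> g" using form by blast
      have "k = 0" by (rule k0[OF kg(1)])
      then have "z = g" using gc[OF kg(2)] by (simp add: kg(3))
      then show "z \<in> Z'" using kg z by (simp add: Z'_def)
    qed
    then show ?thesis using S' unfolding Z'_def by blast
  qed
qed

text \<open>
  Induction on the number of generators.  For a new generator \<open>a\<close> write \<open>a\<^bsup>p^n\<^esup> = y\<^bsup>p^(n+1)\<^esup>\<close> with
  \<open>y = a\<^sup>k g\<close> and \<open>g \<in> \<langle>S\<rangle>\<close>.  Then \<open>a\<^sup>E \<in> \<langle>S\<rangle>\<close> for \<open>E = p\<^sup>n (1 - p k)\<close>, so the whole group has exponent \<open>E\<close>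
  modulo \<open>\<langle>S\<rangle>\<close>.  Since \<open>1 - p k\<close> is prime to \<open>p\<close>, the divisibility property passes to \<open>\<langle>S\<rangle>\<close>.
\<close>

lemma bounded_exponent_of_divisible:
  fixes p n :: nat
  assumes p: "Factorial_Ring.prime p" and "finite S" "S \<subseteq> carrier G"
    and "\<And>N x. x \<in> generate G S \<Longrightarrow> \<exists>y\<in>generate G S. x [^] (int p ^ n) = y [^] (int p ^ N)"
  shows "\<exists>d::int. d \<noteq> 0 \<and> (\<forall>x\<in>generate G S. x [^] d = \<one>)"
  using assms(2-)
proof (induction S rule: finite_induct)
  case empty
  have "generate G {} = {\<one>}" by (rule generate_empty)
  then show ?case by (intro exI[of _ 1]) simp
next
  case (insert a S)
  let ?H = "generate G (insert a S)" and ?H' = "generate G S"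
  have a: "a \<in> carrier G" and S: "S \<subseteq> carrier G" using insert by auto
  have sub': "subgroup ?H' G" by (rule generate_is_subgroup[OF S])
  have sub: "subgroup ?H G" by (rule generate_is_subgroup[OF insert.prems(1)])
  note gc' = subgroup.mem_carrier[OF sub'] and gc = subgroup.mem_carrier[OF sub]
  have HH: "?H' \<subseteq> ?H" by (rule mono_generate) blast
  obtain y where y: "y \<in> ?H" "a [^] (int p ^ n) = y [^] (int p ^ Suc n)"
    using insert.prems(2)[of a "Suc n"] generate.incl[of a "insert a S"] by blast
  obtain k g where kg: "g \<in> ?H'" "y = a [^] (k::int) \<otimes> g"
    using generate_insert_form[OF a S y(1)] by blast
  define E1 where "E1 = 1 - int p * k"
  define E where "E = int p ^ n * E1"
  have cop: "coprime E1 (int p ^ N)" for N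
  proof -
    have "coprime (int p) E1"
      unfolding E1_def by (metis coprime_1_right coprime_iff_gcd_eq_1 diff_add_cancel gcd_add_mult mult.commute uminus_add_conv_diff add.commute diff_conv_add_uminus mult_minus_right)
    then show ?thesis by (simp add: coprime_commute)
  qed
  have "E1 \<noteq> 0"
  proof
    assume "E1 = 0"
    then have "int p dvd 1" by (metis E1_def dvd_triv_left eq_iff_diff_eq_0)
    then show False using p prime_gt_1_nat[of p] by simp
  qed
  then have E0: "E \<noteq> 0" using p prime_gt_0_nat[of p] by (simp add: E_def)
  have aE: "a [^] E \<in> ?H'"
  proof -
    have "y [^] (int p ^ Suc n) = a [^] (k * int p ^ Suc n) \<otimes> g [^] (int p ^ Suc n)"
      using a gc'[OF kg(1)] by (simp add: kg(2) int_pow_distrib int_pow_pow)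
    then have "a [^] (int p ^ n) \<otimes> a [^] (- (k * int p ^ Suc n)) = g [^] (int p ^ Suc n)"
      using a gc'[OF kg(1)] y(2) by (simp add: int_pow_neg m_ac)
    moreover have "a [^] (int p ^ n) \<otimes> a [^] (- (k * int p ^ Suc n)) = a [^] E"
      using a by (simp add: int_pow_mult[symmetric] E_def E1_def algebra_simps)
    ultimately show ?thesis using subgroup_int_pow_closed[OF sub' kg(1)] by metis
  qed
  have xE: "x [^] E \<in> ?H'" if x: "x \<in> ?H" for x
  proof -
    obtain l h where lh: "h \<in> ?H'" "x = a [^] (l::int) \<otimes> h"
      using generate_insert_form[OF a S x] by blast
    have "x [^] E = (a [^] E) [^] l \<otimes> h [^] E"
      using a gc'[OF lh(1)] by (simp add: lh(2) int_pow_distrib int_pow_pow mult.commute)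
    then show ?thesis
      using subgroup.m_closed[OF sub' subgroup_int_pow_closed[OF sub' aE] subgroup_int_pow_closed[OF sub' lh(1)]] by simp
  qed
  have "\<exists>z\<in>?H'. x [^] (int p ^ n) = z [^] (int p ^ N)" if x: "x \<in> ?H'" for x N
  proof -
    have xc: "x \<in> carrier G" by (rule gc'[OF x])
    obtain y where y: "y \<in> ?H" "x [^] (int p ^ n) = y [^] (int p ^ (n + N))"
      using insert.prems(2)[of x "n + N"] x HH by blast
    have yc: "y \<in> carrier G" by (rule gc[OF y(1)])
    obtain u v where uv: "u * E1 + v * int p ^ N = 1"
      using cop[of N] by (metis bezout_int coprime_iff_gcd_eq_1)
    \<comment> \<open>By Bezout, \<open>x\<^bsup>p^n\<^esup> = (y\<^bsup>p^(n+N)\<^esup>)\<^bsup>u (1 - p k)\<^esup> x\<^bsup>p^n v p^N\<^esup>\<close>, which is a \<open>p\<^sup>N\<close>-th power in \<open>\<langle>S\<rangle>\<close>.\<close>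
    define z where "z = (y [^] E) [^] u \<otimes> x [^] (int p ^ n * v)"
    have zH: "z \<in> ?H'" unfolding z_def
      by (rule subgroup.m_closed[OF sub' subgroup_int_pow_closed[OF sub' xE[OF y(1)]] subgroup_int_pow_closed[OF sub' x]])
    have "x [^] (int p ^ n) = x [^] (int p ^ n * (u * E1 + v * int p ^ N))" by (simp add: uv)
    also have "\<dots> = (x [^] (int p ^ n)) [^] (u * E1) \<otimes> x [^] (int p ^ n * v * int p ^ N)"
      using xc by (simp only: int_pow_mult[symmetric] int_pow_pow distrib_left mult.assoc)
    also have "(x [^] (int p ^ n)) [^] (u * E1) = y [^] (E * u * int p ^ N)"
      unfolding y(2) using yc by (simp add: int_pow_pow E_def power_add mult_ac)
    also have "y [^] (E * u * int p ^ N) \<otimes> x [^] (int p ^ n * v * int p ^ N) = z [^] (int p ^ N)"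
      using xc yc by (simp add: z_def int_pow_distrib int_pow_pow)
    finally show ?thesis using zH by blast
  qed
  then obtain d where d: "d \<noteq> 0" "\<And>x. x \<in> ?H' \<Longrightarrow> x [^] (d::int) = \<one>"
    using insert.IH[OF S] by blast
  have "x [^] (E * d) = \<one>" if "x \<in> ?H" for x
    using d(2)[OF xE[OF that]] gc[OF that] by (simp add: int_pow_pow)
  then show ?case using d(1) E0 by (intro exI[of _ "E * d"]) simp
qed

text \<open>
  The group is finitely generated of bounded exponent, hence finite.  Let its order be \<open>m p\<^sup>a\<close> with \<open>m\<close> prime to
  \<open>p\<close>.  If \<open>x\<close> is \<open>p\<close>-primary, \<open>x\<^bsup>p^n\<^esup> = y\<^bsup>p^a\<^esup>\<close> is killed both by \<open>m\<close> and by a power of \<open>p\<close>.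
\<close>

theorem finite_of_divisible:
  fixes p n :: nat
  assumes p: "Factorial_Ring.prime p" and S: "finite S" "S \<subseteq> carrier G" and gen: "generate G S = carrier G"
    and div: "\<And>N x. x \<in> carrier G \<Longrightarrow> \<exists>y\<in>carrier G. x [^] (p ^ n) = y [^] (p ^ N)"
  shows "finite (carrier G)"
    and "\<And>x k. x \<in> carrier G \<Longrightarrow> x [^] (p ^ k) = \<one> \<Longrightarrow> x [^] (p ^ n) = \<one>"
proof -
  have ip: "x [^] (int p ^ k) = x [^] (p ^ k)" for x k
    by (metis int_pow_int of_nat_power)
  have "\<exists>d::int. d \<noteq> 0 \<and> (\<forall>x\<in>generate G S. x [^] d = \<one>)"
    by (rule bounded_exponent_of_divisible[OF p S, of n]) (use div in \<open>simp add: gen ip\<close>)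
  then obtain d :: int where d: "d \<noteq> 0" "\<And>x. x \<in> carrier G \<Longrightarrow> x [^] d = \<one>" by (auto simp: gen)
  have "x [^] (nat \<bar>d\<bar>) = \<one>" if "x \<in> carrier G" for x
  proof (cases "d > 0")
    case True
    then show ?thesis using d(2)[OF that] by (metis abs_of_pos int_nat_eq int_pow_int less_imp_le)
  next
    case False
    have "x [^] (- d) = \<one>" using d(2)[OF that] that by (simp add: int_pow_neg)
    moreover have "int (nat \<bar>d\<bar>) = - d" using False by simp
    ultimately show ?thesis by (metis int_pow_int)
  qed
  then have fin: "finite (generate G S)"
    by (intro finite_generate_bounded_exponent[OF S, of "nat \<bar>d\<bar>"]) (use d(1) gen in auto)
  then show finG: "finite (carrier G)" by (simp add: gen)
  fix x k assume x: "x \<in> carrier G" "x [^] (p ^ k) = \<one>"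
  have "card (carrier G) > 0" using finG one_closed card_gt_0_iff by blast
  then obtain a m where am: "\<not> p dvd m" "card (carrier G) = m * p ^ a"
    using prime_power_canonical[OF p] by blast
  obtain y where y: "y \<in> carrier G" "x [^] (p ^ n) = y [^] (p ^ a)" using div[OF x(1)] by blast
  let ?z = "x [^] (p ^ n)"
  have zc: "?z \<in> carrier G" using x by simp
  have "?z [^] m = y [^] card (carrier G)" unfolding y(2) am(2) using y(1) by (simp add: nat_pow_pow mult.commute)
  then have zm: "?z [^] m = \<one>" using power_order_eq_one[OF finG y(1)] by simp
  have "?z [^] (p ^ k) = (x [^] (p ^ k)) [^] (p ^ n)" using x(1) by (simp add: nat_pow_pow mult.commute)
  then have zp: "?z [^] (p ^ k) = \<one>" using x(2) by simp
  have "coprime m (p ^ k)" using prime_imp_coprime[OF p am(1)] by (simp add: coprime_commute)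
  then have "gcd (int m) (int (p ^ k)) = 1" unfolding gcd_int_int_eq coprime_iff_gcd_eq_1 by simp
  then obtain u v where uv: "u * int m + v * int (p ^ k) = 1" using bezout_int[of "int m" "int (p ^ k)"] by auto
  have "?z = ?z [^] (u * int m + v * int (p ^ k))" unfolding uv using zc by (simp only: int_pow_1)
  also have "\<dots> = (?z [^] int m) [^] u \<otimes> (?z [^] int (p ^ k)) [^] v"
    using zc by (simp only: int_pow_mult int_pow_pow mult.commute)
  also have "\<dots> = \<one>" unfolding int_pow_int zm zp by (simp add: int_pow_one)
  finally show "?z = \<one>" .
qed

end

section \<open>The syzygy resolution\<close>

lemma module_homs_cong:
  assumes "f \<in> module_homs R M N" "\<And>x. x \<in> carrier M \<Longrightarrow> g x = f x"
    and "\<And>x y. x \<in> carrier M \<Longrightarrow> y \<in> carrier M \<Longrightarrow> x \<oplus>\<^bsub>M\<^esub> y \<in> carrier M"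
    and "\<And>r x. r \<in> carrier R \<Longrightarrow> x \<in> carrier M \<Longrightarrow> r \<odot>\<^bsub>M\<^esub> x \<in> carrier M"
  shows "g \<in> module_homs R M N"
proof (intro module_homsI additiveI)
  note f = module_homsD[OF assms(1)]
  show "g x \<in> carrier N" if "x \<in> carrier M" for x using f(2) assms(2) that by simp
  show "g (x \<oplus>\<^bsub>M\<^esub> y) = g x \<oplus>\<^bsub>N\<^esub> g y" if "x \<in> carrier M" "y \<in> carrier M" for x y
    using additive_add[OF f(1)] assms(2,3) that by simp
  show "g (r \<odot>\<^bsub>M\<^esub> x) = r \<odot>\<^bsub>N\<^esub> g x" if "r \<in> carrier R" "x \<in> carrier M" for r x
    using f(3) assms(2,4) that by simp
qed

lemma unit_vector_closed:
  fixes R :: "'r ring"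
  assumes "ring R" "x \<in> X"
  shows "unit_vector R x \<in> carrier (free_module R X)"
proof -
  interpret ring R by fact
  show ?thesis using assms(2) by (auto simp: unit_vector_def free_module_simps)
qed

lemma linear_extension_hom:
  fixes R :: "'r ring"
  assumes R: "ring R" and N: "left_module R N" and \<phi>: "\<phi> \<in> X \<rightarrow> carrier N"
  shows "linear_extension R N \<phi> \<in> module_homs R (free_module R X) N"
    and "\<And>x. x \<in> X \<Longrightarrow> linear_extension R N \<phi> (unit_vector R x) = \<phi> x"
proof -
  interpret R: ring R by fact
  interpret N: left_module R N by fact
  interpret F: left_module R "free_module R X" by (rule left_module_free_module[OF R])
  have eq: "linear_extension R N \<phi> v = (\<Oplus>\<^bsub>N\<^esub>x\<in>{x \<in> X. v x \<noteq> \<zero>\<^bsub>R\<^esub>}. v x \<odot>\<^bsub>N\<^esub> \<phi> x)"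
    if "v \<in> carrier (free_module R X)" for v
  proof -
    have "{x. v x \<noteq> \<zero>\<^bsub>R\<^esub>} = {x \<in> X. v x \<noteq> \<zero>\<^bsub>R\<^esub>}" using that by (auto simp: free_module_simps)
    then show ?thesis by (simp add: linear_extension_def)
  qed
  show "linear_extension R N \<phi> \<in> module_homs R (free_module R X) N"
    by (rule module_homs_cong[OF dual_basis_hom[OF F.left_module_axioms N dual_basis_free_module[OF R] \<phi>] eq])
      (simp_all add: F.smult_closed)
  fix x assume x: "x \<in> X"
  have "linear_extension R N \<phi> (unit_vector R x) = (\<Oplus>\<^bsub>N\<^esub>y\<in>{y. unit_vector R x y \<noteq> \<zero>\<^bsub>R\<^esub>}. unit_vector R x y \<odot>\<^bsub>N\<^esub> \<phi> y)"
    by (simp add: linear_extension_def)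
  also have "\<dots> = (\<Oplus>\<^bsub>N\<^esub>y\<in>{x}. unit_vector R x y \<odot>\<^bsub>N\<^esub> \<phi> y)"
  proof (rule N.add.finprod_mono_neutral_cong_left)
    have \<phi>x: "\<phi> x \<in> carrier N" using x \<phi> by blast
    then show "(\<lambda>y. unit_vector R x y \<odot>\<^bsub>N\<^esub> \<phi> y) \<in> {x} \<rightarrow> carrier N"
      by (auto simp: unit_vector_def N.smult_one)
    fix y assume "y \<in> {x} - {y. unit_vector R x y \<noteq> \<zero>\<^bsub>R\<^esub>}"
    then have "y = x" "unit_vector R x y = \<zero>\<^bsub>R\<^esub>" by blast+
    then show "unit_vector R x y \<odot>\<^bsub>N\<^esub> \<phi> y = \<zero>\<^bsub>N\<^esub>"
      using N.smult_zero_left[OF \<phi>x] by simp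
  qed (auto simp: unit_vector_def)
  also have "\<dots> = \<phi> x"
  proof -
    have "\<phi> x \<in> carrier N" using x \<phi> by blast
    then show ?thesis by (subst N.M.finsum_insert) (auto simp: unit_vector_def N.smult_one)
  qed
  finally show "linear_extension R N \<phi> (unit_vector R x) = \<phi> x" .
qed

lemma free_module_hom_zero:
  fixes R :: "'r ring"
  assumes R: "ring R" and N: "left_module R N" and f: "f \<in> module_homs R (free_module R X) N"
    and z: "\<And>x. x \<in> X \<Longrightarrow> f (unit_vector R x) = \<zero>\<^bsub>N\<^esub>" and v: "v \<in> carrier (free_module R X)"
  shows "f v = \<zero>\<^bsub>N\<^esub>"
proof -
  interpret N: left_module R N by fact
  note db = dual_basis_free_module[OF R, of X]
  let ?S = "{x \<in> X. v x \<noteq> \<zero>\<^bsub>R\<^esub>}"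
  have "f v = f (\<Oplus>\<^bsub>free_module R X\<^esub>x\<in>?S. v x \<odot>\<^bsub>free_module R X\<^esub> unit_vector R x)"
    using dual_basisD(5)[OF db v] by simp
  also have "\<dots> = (\<Oplus>\<^bsub>N\<^esub>x\<in>?S. v x \<odot>\<^bsub>N\<^esub> f (unit_vector R x))"
    by (rule hom_dual_sum[OF left_module_free_module[OF R] N f db v]) (auto intro: dual_basisD(1)[OF db])
  also have "\<dots> = (\<Oplus>\<^bsub>N\<^esub>x\<in>?S. \<zero>\<^bsub>N\<^esub>)"
    by (rule N.add.finprod_cong'[OF refl]) (use v in \<open>auto simp: z free_module_simps N.smult_zero_right\<close>)
  finally show ?thesis by (simp add: N.M.finsum_zero)
qed

lemma formal_combination_simps:
  "formal_combination R [] = (\<lambda>_. \<zero>\<^bsub>R\<^esub>)"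
  "formal_combination R ((r, x) # l) = (formal_combination R l)(x := r \<oplus>\<^bsub>R\<^esub> formal_combination R l x)"
  by (simp_all add: formal_combination_def)

lemma formal_combination_closed:
  fixes R :: "'r ring"
  assumes R: "ring R" and "set l \<subseteq> carrier R \<times> X"
  shows "formal_combination R l \<in> carrier (free_module R X)"
  using assms(2)
proof (induction l)
  case Nil
  interpret ring R by fact
  show ?case by (simp add: formal_combination_simps free_module_simps)
next
  case (Cons a l)
  interpret ring R by fact
  obtain r x where a: "a = (r, x)" by (cases a)
  let ?f = "formal_combination R l"
  have f: "?f \<in> carrier (free_module R X)" using Cons by simp
  have "{y. (?f(x := r \<oplus>\<^bsub>R\<^esub> ?f x)) y \<noteq> \<zero>\<^bsub>R\<^esub>} \<subseteq> insert x {y. ?f y \<noteq> \<zero>\<^bsub>R\<^esub>}" by auto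
  then have fin: "finite {y. (?f(x := r \<oplus>\<^bsub>R\<^esub> ?f x)) y \<noteq> \<zero>\<^bsub>R\<^esub>}"
    by (rule finite_subset) (use f in \<open>simp add: free_module_simps\<close>)
  show ?case
    unfolding a formal_combination_simps free_module_simps
  proof (intro CollectI conjI allI)
    show "(?f(x := r \<oplus>\<^bsub>R\<^esub> ?f x)) y \<in> carrier R" for y
      using f Cons.prems a by (auto simp: free_module_simps)
    show "{y. (?f(x := r \<oplus>\<^bsub>R\<^esub> ?f x)) y \<noteq> \<zero>\<^bsub>R\<^esub>} \<subseteq> X"
      using f Cons.prems a by (auto simp: free_module_simps)
  qed (rule fin)
qed

lemma formal_combination_exhaust:
  fixes R :: "'r ring"
  assumes R: "ring R" and f: "f \<in> carrier (free_module R X)"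
  shows "\<exists>l. set l \<subseteq> carrier R \<times> X \<and> formal_combination R l = f"
proof -
  interpret ring R by fact
  have fc: "f x \<in> carrier R" for x using f by (simp add: free_module_simps)
  have "finite {x. f x \<noteq> \<zero>\<^bsub>R\<^esub>}" using f by (simp add: free_module_simps)
  then obtain xs where xs: "set xs = {x. f x \<noteq> \<zero>\<^bsub>R\<^esub>}" "distinct xs"
    using finite_distinct_list by blast
  have "formal_combination R (map (\<lambda>x. (f x, x)) ys) = (\<lambda>y. if y \<in> set ys then f y else \<zero>\<^bsub>R\<^esub>)"
    if "distinct ys" for ys
    using that by (induction ys) (auto simp: formal_combination_simps fc fun_eq_iff)
  then have "formal_combination R (map (\<lambda>x. (f x, x)) xs) = f"
    using xs by (auto simp: fun_eq_iff)
  moreover have "set (map (\<lambda>x. (f x, x)) xs) \<subseteq> carrier R \<times> X"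
    using xs f by (auto simp: free_module_simps)
  ultimately show ?thesis by blast
qed

text \<open>
  The resolution is exact by construction: the basis in degree \<open>n + 1\<close> consists of all formal combinations that
  represent cycles of degree \<open>n\<close>.
\<close>

locale syzygies = M: left_module R M for R :: "'r ring" and M :: "('r, 'm) module"
begin

abbreviation "SF n \<equiv> free_module R (syzygy_basis R M n)"
abbreviation "bd \<equiv> syzygy_boundary R"
abbreviation "aug \<equiv> syzygy_augmentation R M"

lemmas ring_R = M.R.ring_axioms

lemma left_module_SF: "left_module R (SF n)"
  by (rule left_module_free_module[OF ring_R])

lemma aug_hom: "aug \<in> module_homs R (SF 0) M"
  and aug_unit: "m \<in> carrier M \<Longrightarrow> aug (unit_vector R (Gen m)) = m"
proof -
  have \<phi>: "(\<lambda>x. case x of Gen m \<Rightarrow> m | Rel l \<Rightarrow> \<zero>\<^bsub>M\<^esub>) \<in> syzygy_basis R M 0 \<rightarrow> carrier M" by auto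
  note le = linear_extension_hom[OF ring_R M.left_module_axioms \<phi>]
  show "aug \<in> module_homs R (SF 0) M" using le(1) by (simp add: syzygy_augmentation_def)
  show "aug (unit_vector R (Gen m)) = m" if "m \<in> carrier M"
    using le(2)[of "Gen m"] that by (simp add: syzygy_augmentation_def)
qed

lemma boundary_hom: "bd \<in> module_homs R (SF (Suc n)) (SF n)"
  and boundary_unit: "Rel l \<in> syzygy_basis R M (Suc n) \<Longrightarrow> bd (unit_vector R (Rel l)) = formal_combination R l"
proof -
  let ?\<phi> = "\<lambda>x. case x of Gen m \<Rightarrow> (\<lambda>_. \<zero>\<^bsub>R\<^esub>) | Rel l \<Rightarrow> formal_combination R l"
  let ?U = "free_module R UNIV"
  interpret U: left_module R ?U by (rule left_module_free_module[OF ring_R])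
  have \<phi>n: "?\<phi> x \<in> carrier (SF n)" if "x \<in> syzygy_basis R M (Suc n)" for x
    using that by (auto intro: formal_combination_closed[OF ring_R])
  have sub: "carrier (SF n) \<subseteq> carrier ?U" by (auto simp: free_module_simps)
  have \<phi>: "?\<phi> \<in> syzygy_basis R M (Suc n) \<rightarrow> carrier ?U" using \<phi>n sub by blast
  note le = linear_extension_hom[OF ring_R U.left_module_axioms \<phi>]
  have hom: "bd \<in> module_homs R (SF (Suc n)) ?U" using le(1) by (simp add: syzygy_boundary_def)
  note h = module_homsD[OF hom]
  have img: "bd v \<in> carrier (SF n)" if v: "v \<in> carrier (SF (Suc n))" for v
  proof -
    have vr: "v x \<in> carrier R" for x using v by (simp add: free_module_simps)
    have vb: "x \<in> syzygy_basis R M (Suc n)" if "v x \<noteq> \<zero>\<^bsub>R\<^esub>" for x using v that unfolding free_module_simps by blast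
    have "(bd v) y = \<zero>\<^bsub>R\<^esub>" if y: "y \<notin> syzygy_basis R M n" for y
    proof -
      have cl: "(\<lambda>x. v x \<odot>\<^bsub>?U\<^esub> ?\<phi> x) \<in> {x. v x \<noteq> \<zero>\<^bsub>R\<^esub>} \<rightarrow> carrier ?U"
        using vb \<phi> by (intro funcsetI U.smult_closed vr) blast
      have "(bd v) y = (\<Oplus>\<^bsub>R\<^esub>x\<in>{x. v x \<noteq> \<zero>\<^bsub>R\<^esub>}. (v x \<odot>\<^bsub>?U\<^esub> ?\<phi> x) y)"
        unfolding syzygy_boundary_def linear_extension_def
        by (rule additive_finsum[OF U.M.abelian_group_axioms M.R.is_abelian_group additive_eval cl])
      also have "\<dots> = (\<Oplus>\<^bsub>R\<^esub>x\<in>{x. v x \<noteq> \<zero>\<^bsub>R\<^esub>}. \<zero>\<^bsub>R\<^esub>)"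
      proof (rule M.R.finsum_cong'[OF refl])
        fix x assume "x \<in> {x. v x \<noteq> \<zero>\<^bsub>R\<^esub>}"
        then have "?\<phi> x \<in> carrier (SF n)" using vb \<phi>n by blast
        then have "?\<phi> x y = \<zero>\<^bsub>R\<^esub>" using y by (auto simp: free_module_simps)
        then show "(v x \<odot>\<^bsub>?U\<^esub> ?\<phi> x) y = \<zero>\<^bsub>R\<^esub>" by (simp add: free_module_simps vr)
      qed simp
      finally show ?thesis by (simp add: M.R.finsum_zero)
    qed
    then show ?thesis using h(2)[OF v] by (auto simp: free_module_simps)
  qed
  show "bd \<in> module_homs R (SF (Suc n)) (SF n)"
    using img hom by (auto simp: module_homs_def free_module_simps(2-4))
  show "bd (unit_vector R (Rel l)) = formal_combination R l" if "Rel l \<in> syzygy_basis R M (Suc n)"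
    using le(2)[OF that] by (simp add: syzygy_boundary_def)
qed

lemma aug_surj: "m \<in> carrier M \<Longrightarrow> m \<in> aug ` carrier (SF 0)"
  using aug_unit[of m] unit_vector_closed[OF ring_R, of "Gen m" "syzygy_basis R M 0"] by force

lemma aug_boundary: "v \<in> carrier (SF (Suc 0)) \<Longrightarrow> aug (bd v) = \<zero>\<^bsub>M\<^esub>"
proof (rule free_module_hom_zero[OF ring_R M.left_module_axioms module_homs_compose[OF boundary_hom aug_hom]])
  fix x assume "x \<in> syzygy_basis R M (Suc 0)"
  then obtain l where l: "x = Rel l" "Rel l \<in> syzygy_basis R M (Suc 0)" "aug (formal_combination R l) = \<zero>\<^bsub>M\<^esub>" by auto
  show "aug (bd (unit_vector R x)) = \<zero>\<^bsub>M\<^esub>" unfolding l(1) boundary_unit[OF l(2)] by (rule l(3))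
qed

lemma boundary_boundary: "v \<in> carrier (SF (Suc (Suc n))) \<Longrightarrow> bd (bd v) = \<zero>\<^bsub>SF n\<^esub>"
proof (rule free_module_hom_zero[OF ring_R left_module_SF module_homs_compose[OF boundary_hom boundary_hom]])
  fix x assume "x \<in> syzygy_basis R M (Suc (Suc n))"
  then obtain l where l: "x = Rel l" "Rel l \<in> syzygy_basis R M (Suc (Suc n))"
    "bd (formal_combination R l) = (\<lambda>_. \<zero>\<^bsub>R\<^esub>)" by auto
  show "bd (bd (unit_vector R x)) = \<zero>\<^bsub>SF n\<^esub>"
    unfolding l(1) boundary_unit[OF l(2)] free_module_simps by (rule l(3))
qed

lemma exact_aug:
  assumes v: "v \<in> carrier (SF 0)" "aug v = \<zero>\<^bsub>M\<^esub>"
  shows "v \<in> bd ` carrier (SF (Suc 0))"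
proof -
  obtain l where l: "set l \<subseteq> carrier R \<times> syzygy_basis R M 0" "formal_combination R l = v"
    using formal_combination_exhaust[OF ring_R v(1)] by blast
  then have b: "Rel l \<in> syzygy_basis R M (Suc 0)" using v(2) by simp
  show ?thesis
    by (rule image_eqI[OF _ unit_vector_closed[OF ring_R b]]) (simp only: boundary_unit[OF b] l(2))
qed

lemma exact_boundary:
  assumes v: "v \<in> carrier (SF (Suc n))" "bd v = \<zero>\<^bsub>SF n\<^esub>"
  shows "v \<in> bd ` carrier (SF (Suc (Suc n)))"
proof -
  obtain l where l: "set l \<subseteq> carrier R \<times> syzygy_basis R M (Suc n)" "formal_combination R l = v"
    using formal_combination_exhaust[OF ring_R v(1)] by blast
  have "bd (formal_combination R l) = (\<lambda>_. \<zero>\<^bsub>R\<^esub>)" using v(2) by (simp only: l(2) free_module_simps)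
  then have b: "Rel l \<in> syzygy_basis R M (Suc (Suc n))"
    unfolding syzygy_basis.simps(2)[of R M "Suc n"] using l(1) by simp
  show ?thesis
    by (rule image_eqI[OF _ unit_vector_closed[OF ring_R b]]) (simp only: boundary_unit[OF b] l(2))
qed

end

section \<open>Homology\<close>

locale group_complex =
  fixes C :: "nat \<Rightarrow> 'a monoid" and \<delta> :: "nat \<Rightarrow> 'a \<Rightarrow> 'a"
  assumes C: "\<And>n. comm_group (C n)"
    and \<delta>: "\<And>n. \<delta> (Suc n) \<in> hom (C (Suc n)) (C n)"
    and \<delta>\<delta>: "\<And>n x. x \<in> carrier (C (Suc (Suc n))) \<Longrightarrow> \<delta> (Suc n) (\<delta> (Suc (Suc n)) x) = \<one>\<^bsub>C n\<^esub>"
begin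

abbreviation "Z n \<equiv> C n\<lparr>carrier := cycles C \<delta> n\<rparr>"
abbreviation "B n \<equiv> \<delta> (Suc n) ` carrier (C (Suc n))"

lemma hom: "group_hom (C (Suc n)) (C n) (\<delta> (Suc n))"
  using C \<delta> by (simp add: group_hom_def group_hom_axioms_def comm_group.axioms(2))

lemma subgroup_cycles: "subgroup (cycles C \<delta> n) (C n)"
proof (cases n)
  case 0
  then show ?thesis using group.subgroup_self[OF comm_group.axioms(2)[OF C]] by (simp add: cycles_def)
next
  case (Suc m)
  then show ?thesis using group_hom.subgroup_kernel[OF hom] by (simp add: cycles_def)
qed

lemma boundary_cycle: "x \<in> B n \<Longrightarrow> x \<in> cycles C \<delta> n"
proof (cases n)
  case 0
  then show "x \<in> B n \<Longrightarrow> x \<in> cycles C \<delta> n" using hom_in_carrier[OF \<delta>] by (auto simp: cycles_def)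
next
  case (Suc m)
  then show "x \<in> B n \<Longrightarrow> x \<in> cycles C \<delta> n"
    using hom_in_carrier[OF \<delta>] \<delta>\<delta> by (auto simp: cycles_def kernel_def)
qed

lemma comm_group_cycles: "comm_group (Z n)"
proof (rule group.group_comm_groupI)
  interpret Cn: comm_group "C n" by (rule C)
  show "group (Z n)" by (rule Cn.subgroup_imp_group[OF subgroup_cycles])
  show "x \<otimes>\<^bsub>Z n\<^esub> y = y \<otimes>\<^bsub>Z n\<^esub> x" if "x \<in> carrier (Z n)" "y \<in> carrier (Z n)" for x y
    using that subgroup.mem_carrier[OF subgroup_cycles] by (simp add: Cn.m_comm)
qed

lemma subgroup_boundaries: "subgroup (B n) (Z n)"
proof -
  have "subgroup (B n) (C n)" by (rule group_hom.img_is_subgroup[OF hom])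
  then show ?thesis
    using group.subgroup_incl[OF comm_group.axioms(2)[OF C] _ subgroup_cycles] boundary_cycle by blast
qed

lemma normal_boundaries: "B n \<lhd> Z n"
  by (rule comm_group.subgroup_imp_normal[OF comm_group_cycles subgroup_boundaries])

lemma comm_group_homology: "comm_group (homology C \<delta> n)"
  unfolding homology_def by (rule comm_group.abelian_FactGroup[OF comm_group_cycles subgroup_boundaries])

lemma coset_hom: "(\<lambda>z. B n #>\<^bsub>Z n\<^esub> z) \<in> hom (Z n) (homology C \<delta> n)"
  unfolding homology_def by (rule normal.r_coset_hom_Mod[OF normal_boundaries])

lemma homology_exhaust:
  assumes "x \<in> carrier (homology C \<delta> n)"
  obtains z where "z \<in> cycles C \<delta> n" "x = B n #>\<^bsub>Z n\<^esub> z"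
  using assms unfolding homology_def carrier_FactGroup by auto

text \<open>
  The cycles form a finitely generated group, and for the homology classes the last hypothesis says that \<open>p\<^sup>k\<close> times
  a class is \<open>p\<^sup>N\<close> times another one.
\<close>

lemma homology_finite_of_divisible:
  fixes p k :: nat
  assumes p: "Factorial_Ring.prime p" and S: "finite S" "S \<subseteq> carrier (C n)" "carrier (C n) \<subseteq> generate (C n) S"
    and div: "\<And>N z. z \<in> cycles C \<delta> n \<Longrightarrow> \<exists>w\<in>carrier (C (Suc n)). \<exists>c\<in>cycles C \<delta> n.
      z [^]\<^bsub>C n\<^esub> (p ^ k) = \<delta> (Suc n) w \<otimes>\<^bsub>C n\<^esub> c [^]\<^bsub>C n\<^esub> (p ^ N)"
  shows "finite (carrier (homology C \<delta> n))"
    and "\<And>x i. x \<in> carrier (homology C \<delta> n) \<Longrightarrow> x [^]\<^bsub>homology C \<delta> n\<^esub> (p ^ i) = \<one>\<^bsub>homology C \<delta> n\<^esub>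
      \<Longrightarrow> x [^]\<^bsub>homology C \<delta> n\<^esub> (p ^ k) = \<one>\<^bsub>homology C \<delta> n\<^esub>"
proof -
  let ?H = "homology C \<delta> n"
  interpret Cn: comm_group "C n" by (rule C)
  interpret H: comm_group ?H by (rule comm_group_homology)
  interpret Zn: comm_group "Z n" by (rule comm_group_cycles)
  interpret q: group_hom "Z n" ?H "\<lambda>z. B n #>\<^bsub>Z n\<^esub> z"
    using coset_hom by (simp add: group_hom_def group_hom_axioms_def)
  have "cycles C \<delta> n \<subseteq> generate (C n) S"
    using S(3) subgroup.subset[OF subgroup_cycles] by blast
  then obtain S' where S': "finite S'" "S' \<subseteq> cycles C \<delta> n" "cycles C \<delta> n \<subseteq> generate (C n) S'"
    using Cn.finitely_generated_subgroup[OF S(1,2) subgroup_cycles] by blast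
  let ?S = "(\<lambda>z. B n #>\<^bsub>Z n\<^esub> z) ` S'"
  have gen: "generate ?H ?S = carrier ?H"
  proof -
    have "generate (Z n) S' = generate (C n) S'"
      by (rule Cn.generate_consistent[OF S'(2) subgroup_cycles])
    moreover have "generate (Z n) S' \<subseteq> carrier (Z n)" using S'(2) by (intro Zn.generate_incl) simp
    ultimately have "generate (Z n) S' = carrier (Z n)" using S'(3) by auto
    then have "generate ?H ?S = (\<lambda>z. B n #>\<^bsub>Z n\<^esub> z) ` carrier (Z n)"
      using q.generate_img[of S'] S'(2) by simp
    then show ?thesis by (simp add: homology_def carrier_FactGroup)
  qed
  have fin: "finite ?S" and sub: "?S \<subseteq> carrier ?H" using S'(1,2) q.hom_closed by auto
  have pow: "(B n #>\<^bsub>Z n\<^esub> z) [^]\<^bsub>?H\<^esub> (i::nat) = B n #>\<^bsub>Z n\<^esub> (z [^]\<^bsub>C n\<^esub> i)" if "z \<in> cycles C \<delta> n" for z i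
    using q.hom_nat_pow[of z i] that by (simp add: nat_pow_def)
  have "\<exists>y\<in>carrier ?H. x [^]\<^bsub>?H\<^esub> (p ^ k) = y [^]\<^bsub>?H\<^esub> (p ^ N)" if x: "x \<in> carrier ?H" for N x
  proof -
    obtain z where z: "z \<in> cycles C \<delta> n" "x = B n #>\<^bsub>Z n\<^esub> z" using homology_exhaust[OF x] by blast
    obtain w c where wc: "w \<in> carrier (C (Suc n))" "c \<in> cycles C \<delta> n"
      "z [^]\<^bsub>C n\<^esub> (p ^ k) = \<delta> (Suc n) w \<otimes>\<^bsub>C n\<^esub> c [^]\<^bsub>C n\<^esub> (p ^ N)" using div[OF z(1)] by blast
    have b: "\<delta> (Suc n) w \<in> B n" using wc(1) by blast
    have cp: "c [^]\<^bsub>C n\<^esub> (p ^ N) \<in> cycles C \<delta> n"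
      using Zn.nat_pow_closed[of c "p ^ N"] wc(2) by (simp add: nat_pow_def)
    have "B n #>\<^bsub>Z n\<^esub> (\<delta> (Suc n) w \<otimes>\<^bsub>Z n\<^esub> c [^]\<^bsub>C n\<^esub> (p ^ N))
        = (B n #>\<^bsub>Z n\<^esub> \<delta> (Suc n) w) \<otimes>\<^bsub>?H\<^esub> (B n #>\<^bsub>Z n\<^esub> c [^]\<^bsub>C n\<^esub> (p ^ N))"
      using q.hom_mult[of "\<delta> (Suc n) w" "c [^]\<^bsub>C n\<^esub> (p ^ N)"] boundary_cycle[OF b] cp by simp
    also have "B n #>\<^bsub>Z n\<^esub> \<delta> (Suc n) w = \<one>\<^bsub>?H\<^esub>"
      using Zn.coset_join2[OF _ subgroup_boundaries b] boundary_cycle[OF b] by (simp add: homology_def)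
    finally have e: "B n #>\<^bsub>Z n\<^esub> (\<delta> (Suc n) w \<otimes>\<^bsub>Z n\<^esub> c [^]\<^bsub>C n\<^esub> (p ^ N))
        = \<one>\<^bsub>?H\<^esub> \<otimes>\<^bsub>?H\<^esub> (B n #>\<^bsub>Z n\<^esub> c [^]\<^bsub>C n\<^esub> (p ^ N))" .
    have "x [^]\<^bsub>?H\<^esub> (p ^ k) = B n #>\<^bsub>Z n\<^esub> (\<delta> (Suc n) w \<otimes>\<^bsub>Z n\<^esub> c [^]\<^bsub>C n\<^esub> (p ^ N))"
      unfolding z(2) pow[OF z(1)] wc(3) by simp
    also have "\<dots> = B n #>\<^bsub>Z n\<^esub> c [^]\<^bsub>C n\<^esub> (p ^ N)"
      unfolding e by (rule H.l_one[OF q.hom_closed]) (simp add: cp)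
    also have "\<dots> = (B n #>\<^bsub>Z n\<^esub> c) [^]\<^bsub>?H\<^esub> (p ^ N)" by (rule pow[OF wc(2), symmetric])
    finally have xy: "x [^]\<^bsub>?H\<^esub> (p ^ k) = (B n #>\<^bsub>Z n\<^esub> c) [^]\<^bsub>?H\<^esub> (p ^ N)" .
    have "B n #>\<^bsub>Z n\<^esub> c \<in> carrier ?H" by (rule q.hom_closed) (simp add: wc(2))
    then show ?thesis using xy by (rule bexI[rotated])
  qed
  note fd = H.finite_of_divisible[OF p fin sub gen this]
  show "finite (carrier ?H)" by (rule fd(1))
  show "\<And>x i. x \<in> carrier ?H \<Longrightarrow> x [^]\<^bsub>?H\<^esub> (p ^ i) = \<one>\<^bsub>?H\<^esub> \<Longrightarrow> x [^]\<^bsub>?H\<^esub> (p ^ k) = \<one>\<^bsub>?H\<^esub>"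
    by (rule fd(2))
qed

end

text \<open>
  Composing \<open>g\<close> on the cycles with the projection to the homology of \<open>C'\<close> gives a map whose kernel consists of
  the boundaries of \<open>C\<close>.
\<close>

lemma homology_injection:
  assumes CC: "group_complex C \<delta>" and CC': "group_complex C' \<delta>'"
    and g: "\<And>n. g n \<in> hom (C n) (C' n)"
    and comm: "\<And>n x. x \<in> carrier (C (Suc n)) \<Longrightarrow> g n (\<delta> (Suc n) x) = \<delta>' (Suc n) (g (Suc n) x)"
    and inj: "\<And>z. z \<in> cycles C \<delta> n \<Longrightarrow> g n z \<in> \<delta>' (Suc n) ` carrier (C' (Suc n)) \<Longrightarrow> z \<in> \<delta> (Suc n) ` carrier (C (Suc n))"
  shows "\<exists>f\<in>hom (homology C \<delta> n) (homology C' \<delta>' n). inj_on f (carrier (homology C \<delta> n))"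
proof -
  interpret C: group_complex C \<delta> by fact
  interpret C': group_complex C' \<delta>' by fact
  interpret Z: comm_group "C.Z n" by (rule C.comm_group_cycles)
  interpret Z': comm_group "C'.Z n" by (rule C'.comm_group_cycles)
  interpret H': comm_group "homology C' \<delta>' n" by (rule C'.comm_group_homology)
  have gz: "g n z \<in> cycles C' \<delta>' n" if z: "z \<in> cycles C \<delta> n" for z
  proof (cases n)
    case 0
    then show ?thesis using z hom_in_carrier[OF g] by (simp add: cycles_def)
  next
    case (Suc m)
    interpret gm: group_hom "C m" "C' m" "g m"
      using C.C C'.C g by (simp add: group_hom_def group_hom_axioms_def comm_group.axioms(2))
    have zc: "z \<in> carrier (C (Suc m))" "\<delta> (Suc m) z = \<one>\<^bsub>C m\<^esub>" using z Suc by (simp_all add: cycles_def kernel_def)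
    then have "\<delta>' (Suc m) (g (Suc m) z) = \<one>\<^bsub>C' m\<^esub>" using comm[OF zc(1)] by simp
    then show ?thesis using hom_in_carrier[OF g zc(1)] Suc by (simp add: cycles_def kernel_def)
  qed
  have gZ: "g n \<in> hom (C.Z n) (C'.Z n)"
    by (rule homI) (simp_all add: gz hom_mult[OF g] subgroup.mem_carrier[OF C.subgroup_cycles])
  let ?q = "\<lambda>z. C'.B n #>\<^bsub>C'.Z n\<^esub> g n z"
  have q: "?q \<in> hom (C.Z n) (homology C' \<delta>' n)"
    using hom_compose[OF gZ C'.coset_hom] by (simp add: comp_def)
  interpret q: group_hom "C.Z n" "homology C' \<delta>' n" ?q
    using q by (simp add: group_hom_def group_hom_axioms_def)
  have "kernel (C.Z n) (homology C' \<delta>' n) ?q = C.B n"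
  proof
    show "kernel (C.Z n) (homology C' \<delta>' n) ?q \<subseteq> C.B n"
    proof
      fix z assume z: "z \<in> kernel (C.Z n) (homology C' \<delta>' n) ?q"
      then have zc: "z \<in> cycles C \<delta> n" and "?q z = C'.B n" by (simp_all add: kernel_def homology_def)
      then have "g n z \<in> C'.B n"
        using Z'.rcos_self[OF _ C'.subgroup_boundaries, of "g n z"] gz[OF zc] by simp
      then show "z \<in> C.B n" by (rule inj[OF zc])
    qed
    show "C.B n \<subseteq> kernel (C.Z n) (homology C' \<delta>' n) ?q"
    proof
      fix z assume z: "z \<in> C.B n"
      then obtain x where x: "x \<in> carrier (C (Suc n))" "z = \<delta> (Suc n) x" by blast
      have "g n z \<in> C'.B n" using comm[OF x(1)] hom_in_carrier[OF g x(1)] x(2) by simp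
      then have "?q z = C'.B n"
        using Z'.coset_join2[OF _ C'.subgroup_boundaries] C'.boundary_cycle by simp
      then show "z \<in> kernel (C.Z n) (homology C' \<delta>' n) ?q"
        using C.boundary_cycle[OF z] by (simp add: kernel_def homology_def)
    qed
  qed
  then show ?thesis
    using q.FactGroup_hom q.FactGroup_inj_on by (auto simp: homology_def)
qed

declare syzygy_basis.simps [simp del]

section \<open>Tensoring a complex with a right module\<close>

lemma additive_tensor_hom_iff:
  "additive (additive_tensor R A B) (additive_tensor R' A' B') f \<longleftrightarrow> f \<in> hom (tensor R A B) (tensor R' A' B')"
  by (simp add: additive_def hom_def additive_tensor_simps)

lemma additive_tensor_multiple:
  "[(k::nat)] \<cdot>\<^bsub>additive_tensor R A B\<^esub> x = x [^]\<^bsub>tensor R A B\<^esub> k"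
  by (simp add: add_pow_def nat_pow_def additive_tensor_simps)

abbreviation map_right :: "'r ring \<Rightarrow> ('r, 'b) module \<Rightarrow> ('r, 'a2) module \<Rightarrow> ('a1 \<Rightarrow> 'a2)
    \<Rightarrow> ('b \<times> 'a1 \<Rightarrow>\<^sub>0 int) set \<Rightarrow> ('b \<times> 'a2 \<Rightarrow>\<^sub>0 int) set"
  where "map_right R B Y f \<equiv> tensor_map R B Y id f"

lemma map_right:
  assumes B: "right_module R B" and X: "left_module R X" and Y: "left_module R Y" and f: "f \<in> module_homs R X Y"
  shows "additive (additive_tensor R B X) (additive_tensor R B Y) (map_right R B Y f)"
    and "\<And>a x. a \<in> carrier B \<Longrightarrow> x \<in> carrier X \<Longrightarrow> map_right R B Y f (pure_tensor R B X a x) = pure_tensor R B Y a (f x)"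
  using tensor_map_additive[of R B X B Y id f] assms
  by (simp_all add: tensor_pair_def additive_def hom_def)

locale module_complex = R: ring R for R :: "'r ring" +
  fixes X :: "nat \<Rightarrow> ('r, 'a) module" and DX :: "nat \<Rightarrow> 'a \<Rightarrow> 'a"
  assumes X: "\<And>n. left_module R (X n)"
    and DX: "\<And>n. DX n \<in> module_homs R (X (Suc n)) (X n)"
    and DDX: "\<And>n x. x \<in> carrier (X (Suc (Suc n))) \<Longrightarrow> DX n (DX (Suc n) x) = \<zero>\<^bsub>X n\<^esub>"
begin

lemma tensor_pair_X: "right_module R B \<Longrightarrow> tensor_pair R B (X n)"
  using X by (simp add: tensor_pair_def)

lemma map_right_DD:
  assumes B: "right_module R B" and t: "t \<in> carrier (additive_tensor R B (X (Suc (Suc n))))"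
  shows "map_right R B (X n) (DX n) (map_right R B (X (Suc n)) (DX (Suc n)) t) = \<zero>\<^bsub>additive_tensor R B (X n)\<^esub>"
proof -
  interpret B2: tensor_pair R B "X (Suc (Suc n))" by (rule tensor_pair_X[OF B])
  interpret B0: tensor_pair R B "X n" by (rule tensor_pair_X[OF B])
  note m1 = map_right[OF B X X DX] 
  show ?thesis
  proof (rule B2.additive_eqI[OF additive_compose[OF m1(1) m1(1)] _ _ t])
    show "additive B2.T B0.T (\<lambda>_. \<zero>\<^bsub>B0.T\<^esub>)" by (rule additiveI) simp_all
    fix a x assume a: "a \<in> carrier B" and x: "x \<in> carrier (X (Suc (Suc n)))"
    have "pure_tensor R B (X n) a \<zero>\<^bsub>X n\<^esub> = \<zero>\<^bsub>B0.T\<^esub>"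
      by (rule additive_zero[OF B0.B.M.abelian_group_axioms B0.T.abelian_group_axioms B0.additive_tens_right[OF a]])
    then show "map_right R B (X n) (DX n) (map_right R B (X (Suc n)) (DX (Suc n)) (B2.tens a x)) = \<zero>\<^bsub>B0.T\<^esub>"
      using a x module_homsD(2)[OF DX] by (simp add: m1(2) DDX)
  qed
qed

lemma group_complex_tensor:
  assumes B: "right_module R B"
  shows "group_complex (\<lambda>n. tensor R B (X n)) (\<lambda>i. map_right R B (X (i - 1)) (DX (i - 1)))"
proof (rule group_complex.intro)
  show "comm_group (tensor R B (X n))" for n
    by (rule tensor_pair.tensor_comm_group[OF tensor_pair_X[OF B]])
  show "map_right R B (X (Suc n - 1)) (DX (Suc n - 1)) \<in> hom (tensor R B (X (Suc n))) (tensor R B (X n))" for n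
    using map_right(1)[OF B X X DX] by (simp add: additive_tensor_hom_iff)
  show "map_right R B (X (Suc n - 1)) (DX (Suc n - 1)) (map_right R B (X (Suc (Suc n) - 1)) (DX (Suc (Suc n) - 1)) x)
      = \<one>\<^bsub>tensor R B (X n)\<^esub>" if "x \<in> carrier (tensor R B (X (Suc (Suc n))))" for n x
    using map_right_DD[OF B, of x n] that by (simp add: additive_tensor_simps)
qed

end

lemma (in syzygies) module_complex_SF: "module_complex R SF (\<lambda>_. bd)"
  using boundary_hom boundary_boundary left_module_SF ring_R
  by (simp add: module_complex_def module_complex_axioms_def)

locale projective_resolution = module_complex R X DX + M: left_module R M
  for R :: "'r ring" and X :: "nat \<Rightarrow> ('r, 'a) module" and DX :: "nat \<Rightarrow> 'a \<Rightarrow> 'a"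
    and M :: "('r, 'm) module" +
  fixes \<epsilon> :: "'a \<Rightarrow> 'm" and J :: "nat \<Rightarrow> 'j set" and b :: "nat \<Rightarrow> 'j \<Rightarrow> 'a" and \<phi> :: "nat \<Rightarrow> 'j \<Rightarrow> 'a \<Rightarrow> 'r"
  assumes db: "\<And>n. dual_basis R (X n) (J n) (b n) (\<phi> n)"
    and \<epsilon>: "\<epsilon> \<in> module_homs R (X 0) M"
    and exact: "\<And>n x. x \<in> carrier (X (Suc n)) \<Longrightarrow> DX n x = \<zero>\<^bsub>X n\<^esub> \<Longrightarrow> x \<in> DX (Suc n) ` carrier (X (Suc (Suc n)))"
    and \<epsilon>_surj: "\<And>x. x \<in> carrier M \<Longrightarrow> x \<in> \<epsilon> ` carrier (X 0)"
    and \<epsilon>_D: "\<And>x. x \<in> carrier (X (Suc 0)) \<Longrightarrow> \<epsilon> (DX 0 x) = \<zero>\<^bsub>M\<^esub>"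
    and exact0: "\<And>x. x \<in> carrier (X 0) \<Longrightarrow> \<epsilon> x = \<zero>\<^bsub>M\<^esub> \<Longrightarrow> x \<in> DX 0 ` carrier (X (Suc 0))"
begin

text \<open>
  Let \<open>g\<close> be a lift of the identity of \<open>M\<close> from the syzygy resolution to \<open>X\<close>, and \<open>f\<close> one in the opposite direction.
  Then \<open>f g\<close> is homotopic to the identity.  This survives tensoring with \<open>B\<close> and makes the map induced by \<open>g\<close> on
  homology injective.
\<close>

lemma Tor_injection:
  fixes B :: "('r, 'b) module" and k :: nat
  assumes B: "right_module R B"
  shows "\<exists>f\<in>hom (Tor R B M k) (homology (\<lambda>n. tensor R B (X n)) (\<lambda>i. map_right R B (X (i - 1)) (DX (i - 1))) k).
    inj_on f (carrier (Tor R B M k))"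
proof -
  interpret S: syzygies R M using M.left_module_axioms by (simp add: syzygies_def)
  interpret SC: module_complex R S.SF "\<lambda>_. S.bd" by (rule S.module_complex_SF)
  note dbS = dual_basis_free_module[OF S.ring_R]
  have "\<exists>g. (\<forall>n. g n \<in> module_homs R (S.SF n) (X n)) \<and> (\<forall>x\<in>carrier (S.SF 0). \<epsilon> (g 0 x) = S.aug x) \<and>
      (\<forall>n. \<forall>x\<in>carrier (S.SF (Suc n)). DX n (g (Suc n) x) = g n (S.bd x))"
  proof (rule chain_map_lift[OF S.left_module_SF X M.left_module_axioms S.boundary_hom DX S.aug_hom \<epsilon>
          S.boundary_boundary S.aug_boundary dbS _ exact0 exact])
    show "S.aug ` carrier (S.SF 0) \<subseteq> \<epsilon> ` carrier (X 0)"
      using \<epsilon>_surj module_homsD(2)[OF S.aug_hom] by blast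
  next
    fix k assume k: "\<And>n. k n \<in> module_homs R (S.SF n) (X n)"
      "\<And>x. x \<in> carrier (S.SF 0) \<Longrightarrow> \<epsilon> (k 0 x) = S.aug x"
      "\<And>n x. x \<in> carrier (S.SF (Suc n)) \<Longrightarrow> DX n (k (Suc n) x) = k n (S.bd x)"
    show "\<exists>g. (\<forall>n. g n \<in> module_homs R (S.SF n) (X n)) \<and> (\<forall>x\<in>carrier (S.SF 0). \<epsilon> (g 0 x) = S.aug x) \<and>
      (\<forall>n. \<forall>x\<in>carrier (S.SF (Suc n)). DX n (g (Suc n) x) = g n (S.bd x))"
      by (rule exI[of _ k]) (simp add: k)
  qed
  then obtain g where g: "\<And>n. g n \<in> module_homs R (S.SF n) (X n)"
    and g0: "\<And>x. x \<in> carrier (S.SF 0) \<Longrightarrow> \<epsilon> (g 0 x) = S.aug x"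
    and gD: "\<And>n x. x \<in> carrier (S.SF (Suc n)) \<Longrightarrow> DX n (g (Suc n) x) = g n (S.bd x)"
    by blast
  have "\<exists>f. (\<forall>n. f n \<in> module_homs R (X n) (S.SF n)) \<and> (\<forall>x\<in>carrier (X 0). S.aug (f 0 x) = \<epsilon> x) \<and>
      (\<forall>n. \<forall>x\<in>carrier (X (Suc n)). S.bd (f (Suc n) x) = f n (DX n x))"
  proof (rule chain_map_lift[OF X S.left_module_SF M.left_module_axioms DX S.boundary_hom \<epsilon> S.aug_hom
          DDX \<epsilon>_D db _ S.exact_aug S.exact_boundary])
    show "\<epsilon> ` carrier (X 0) \<subseteq> S.aug ` carrier (S.SF 0)"
      using S.aug_surj module_homsD(2)[OF \<epsilon>] by blast
  next
    fix k assume k: "\<And>n. k n \<in> module_homs R (X n) (S.SF n)"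
      "\<And>x. x \<in> carrier (X 0) \<Longrightarrow> S.aug (k 0 x) = \<epsilon> x"
      "\<And>n x. x \<in> carrier (X (Suc n)) \<Longrightarrow> S.bd (k (Suc n) x) = k n (DX n x)"
    show "\<exists>f. (\<forall>n. f n \<in> module_homs R (X n) (S.SF n)) \<and> (\<forall>x\<in>carrier (X 0). S.aug (f 0 x) = \<epsilon> x) \<and>
      (\<forall>n. \<forall>x\<in>carrier (X (Suc n)). S.bd (f (Suc n) x) = f n (DX n x))"
      by (rule exI[of _ k]) (simp add: k)
  qed
  then obtain f where f: "\<And>n. f n \<in> module_homs R (X n) (S.SF n)"
    and f0: "\<And>x. x \<in> carrier (X 0) \<Longrightarrow> S.aug (f 0 x) = \<epsilon> x"
    and fD: "\<And>n x. x \<in> carrier (X (Suc n)) \<Longrightarrow> S.bd (f (Suc n) x) = f n (DX n x)"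
    by blast
  note g' = module_homsD[OF g] and f' = module_homsD[OF f] and bd' = module_homsD[OF S.boundary_hom]
  have fg: "(\<lambda>v. f n (g n v)) \<in> module_homs R (S.SF n) (S.SF n)" for n
    by (rule module_homs_compose[OF g f])
  have idh: "(\<lambda>v. v) \<in> module_homs R (S.SF n) (S.SF n)" for n by (auto simp: module_homs_def)
  define e where "e n v = f n (g n v) \<ominus>\<^bsub>S.SF n\<^esub> v" for n v
  have e: "e n \<in> module_homs R (S.SF n) (S.SF n)" for n
    unfolding e_def by (rule module_homs_diff[OF S.left_module_SF S.left_module_SF fg idh])
  interpret SF: left_module R "S.SF n" for n by (rule S.left_module_SF)
  have eD: "S.bd (e (Suc n) v) = e n (S.bd v)" if v: "v \<in> carrier (S.SF (Suc n))" for n v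
    unfolding e_def using v g'(2) f'(2) bd'(2)
    by (simp add: additive_diff[OF SF.M.abelian_group_axioms SF.M.abelian_group_axioms bd'(1)] fD gD)
  have e0: "e 0 ` carrier (S.SF 0) \<subseteq> S.bd ` carrier (S.SF (Suc 0))"
  proof
    fix y assume "y \<in> e 0 ` carrier (S.SF 0)"
    then obtain v where v: "v \<in> carrier (S.SF 0)" "y = e 0 v" by blast
    have "S.aug y = \<zero>\<^bsub>M\<^esub>"
      unfolding v(2) e_def using v(1) g'(2) f'(2) module_homsD(2)[OF S.aug_hom]
      by (simp add: additive_diff[OF SF.M.abelian_group_axioms M.M.abelian_group_axioms module_homsD(1)[OF S.aug_hom]] f0 g0 M.diff_self)
    then show "y \<in> S.bd ` carrier (S.SF (Suc 0))"
      using S.exact_aug module_homsD(2)[OF e] v by blast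
  qed
  have "\<exists>h. (\<forall>n. h n \<in> module_homs R (S.SF n) (S.SF (Suc n))) \<and> (\<forall>x\<in>carrier (S.SF 0). S.bd (h 0 x) = e 0 x) \<and>
      (\<forall>n. \<forall>x\<in>carrier (S.SF (Suc n)). S.bd (h (Suc n) x) \<oplus>\<^bsub>S.SF (Suc n)\<^esub> h n (S.bd x) = e (Suc n) x)"
  proof (rule null_homotopy[OF S.left_module_SF S.left_module_SF S.boundary_hom S.boundary_hom
          S.boundary_boundary dbS e eD e0 S.exact_boundary])
    fix k assume k: "\<And>n. k n \<in> module_homs R (S.SF n) (S.SF (Suc n))"
      "\<And>x. x \<in> carrier (S.SF 0) \<Longrightarrow> S.bd (k 0 x) = e 0 x"
      "\<And>n x. x \<in> carrier (S.SF (Suc n)) \<Longrightarrow> S.bd (k (Suc n) x) \<oplus>\<^bsub>S.SF (Suc n)\<^esub> k n (S.bd x) = e (Suc n) x"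
    show "\<exists>h. (\<forall>n. h n \<in> module_homs R (S.SF n) (S.SF (Suc n))) \<and> (\<forall>x\<in>carrier (S.SF 0). S.bd (h 0 x) = e 0 x) \<and>
      (\<forall>n. \<forall>x\<in>carrier (S.SF (Suc n)). S.bd (h (Suc n) x) \<oplus>\<^bsub>S.SF (Suc n)\<^esub> h n (S.bd x) = e (Suc n) x)"
      by (rule exI[of _ k]) (simp add: k)
  qed
  then obtain h where h: "\<And>n. h n \<in> module_homs R (S.SF n) (S.SF (Suc n))"
    and h0: "\<And>x. x \<in> carrier (S.SF 0) \<Longrightarrow> S.bd (h 0 x) = e 0 x"
    and hS: "\<And>n x. x \<in> carrier (S.SF (Suc n)) \<Longrightarrow> S.bd (h (Suc n) x) \<oplus>\<^bsub>S.SF (Suc n)\<^esub> h n (S.bd x) = e (Suc n) x"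
    by blast
  note h' = module_homsD[OF h]
  have fg0: "f 0 (g 0 v) = v \<oplus>\<^bsub>S.SF 0\<^esub> S.bd (h 0 v)" if v: "v \<in> carrier (S.SF 0)" for v
    unfolding h0[OF v] e_def using v g'(2) f'(2)
    by (subst SF.M.a_comm) (simp_all add: SF.M.diff_add_cancel)
  have fgS: "f (Suc n) (g (Suc n) v) = v \<oplus>\<^bsub>S.SF (Suc n)\<^esub> (S.bd (h (Suc n) v) \<oplus>\<^bsub>S.SF (Suc n)\<^esub> h n (S.bd v))"
    if v: "v \<in> carrier (S.SF (Suc n))" for v n
    unfolding hS[OF v] e_def using v g'(2) f'(2)
    by (subst SF.M.a_comm) (simp_all add: SF.M.diff_add_cancel)
  let ?T = "\<lambda>n. additive_tensor R B (S.SF n)" and ?T' = "\<lambda>n. additive_tensor R B (X n)"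
  interpret T: tensor_pair R B "S.SF n" for n by (rule SC.tensor_pair_X[OF B])
  interpret T': tensor_pair R B "X n" for n by (rule tensor_pair_X[OF B])
  let ?g = "\<lambda>n. map_right R B (X n) (g n)" and ?f = "\<lambda>n. map_right R B (S.SF n) (f n)"
    and ?h = "\<lambda>n. map_right R B (S.SF (Suc n)) (h n)" and ?d = "\<lambda>n. map_right R B (S.SF n) S.bd"
    and ?d' = "\<lambda>n. map_right R B (X n) (DX n)"
  note mg = map_right[OF B S.left_module_SF X g] and mf = map_right[OF B X S.left_module_SF f]
    and mh = map_right[OF B S.left_module_SF S.left_module_SF h]
    and md = map_right[OF B S.left_module_SF S.left_module_SF S.boundary_hom]
    and md' = map_right[OF B X X DX]
  have gd: "?d' n (?g (Suc n) t) = ?g n (?d n t)" if t: "t \<in> carrier (?T (Suc n))" for n t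
    by (rule T.additive_eqI[OF additive_compose[OF mg(1) md'(1)] additive_compose[OF md(1) mg(1)] _ t])
      (simp add: mg(2) md(2) md'(2) g'(2) bd'(2) gD)
  have fd: "?d n (?f (Suc n) t) = ?f n (?d' n t)" if t: "t \<in> carrier (?T' (Suc n))" for n t
    by (rule T'.additive_eqI[OF additive_compose[OF mf(1) md(1)] additive_compose[OF md'(1) mf(1)] _ t])
      (simp add: mf(2) md(2) md'(2) f'(2) module_homsD(2)[OF DX] fD)
  have add_sum: "additive (?T n) (?T n) (\<lambda>t. u t \<oplus>\<^bsub>?T n\<^esub> v t)"
    if "additive (?T n) (?T n) u" "additive (?T n) (?T n) v" for u v n
    by (rule additiveI)
      (simp_all add: additive_closed[OF that(1)] additive_closed[OF that(2)] additive_add[OF that(1)] additive_add[OF that(2)] T.T.a_ac)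
  have hom0: "?f 0 (?g 0 t) = t \<oplus>\<^bsub>?T 0\<^esub> ?d 0 (?h 0 t)" if t: "t \<in> carrier (?T 0)" for t
    by (rule T.additive_eqI[OF additive_compose[OF mg(1) mf(1)] add_sum[OF additive_id additive_compose[OF mh(1) md(1)]] _ t])
      (simp add: mg(2) mf(2) mh(2) md(2) g'(2) f'(2) h'(2) bd'(2) fg0 T.tens_add_right)
  have homS: "?f (Suc n) (?g (Suc n) t) = t \<oplus>\<^bsub>?T (Suc n)\<^esub> (?d (Suc n) (?h (Suc n) t) \<oplus>\<^bsub>?T (Suc n)\<^esub> ?h n (?d n t))"
    if t: "t \<in> carrier (?T (Suc n))" for n t
    by (rule T.additive_eqI[OF additive_compose[OF mg(1) mf(1)]
          add_sum[OF additive_id add_sum[OF additive_compose[OF mh(1) md(1)] additive_compose[OF md(1) mh(1)]]] _ t])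
      (simp add: mg(2) mf(2) mh(2) md(2) g'(2) f'(2) h'(2) bd'(2) fgS T.tens_add_right)
  have cyc: "?f n (?g n t) = t \<oplus>\<^bsub>?T n\<^esub> ?d n (?h n t)"
    if t: "t \<in> carrier (?T n)" and z: "\<And>m. n = Suc m \<Longrightarrow> ?d m t = \<zero>\<^bsub>?T m\<^esub>" for n t
  proof (cases n)
    case 0
    then show ?thesis using hom0 t by simp
  next
    case (Suc m)
    have "?h m (?d m t) = \<zero>\<^bsub>?T (Suc m)\<^esub>"
      unfolding z[OF Suc] by (rule additive_zero[OF T.T.abelian_group_axioms T.T.abelian_group_axioms mh(1)])
    then show ?thesis
      using homS[of t m] t Suc additive_closed[OF additive_compose[OF mh(1) md(1)], of t "Suc m"] by simp
  qed
  have inj: "z \<in> map_right R B (S.SF (Suc k - 1)) S.bd ` carrier (tensor R B (S.SF (Suc k)))"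
    if z: "z \<in> cycles (\<lambda>n. tensor R B (S.SF n)) (\<lambda>n. map_right R B (S.SF (n - 1)) S.bd) k"
      and gz: "?g k z \<in> map_right R B (X (Suc k - 1)) (DX (Suc k - 1)) ` carrier (tensor R B (X (Suc k)))" for z
  proof -
    have zT: "z \<in> carrier (?T k)"
      using z by (auto simp: cycles_def kernel_def additive_tensor_simps split: if_splits)
    have zd: "?d m z = \<zero>\<^bsub>?T m\<^esub>" if "k = Suc m" for m
      using z that by (simp add: cycles_def kernel_def additive_tensor_simps)
    obtain w where w: "w \<in> carrier (?T' (Suc k))" "?g k z = ?d' k w"
      using gz by (auto simp: additive_tensor_simps)
    have hz: "?h k z \<in> carrier (?T (Suc k))" by (rule additive_closed[OF mh(1) zT])
    have fw: "?f (Suc k) w \<in> carrier (?T (Suc k))" by (rule additive_closed[OF mf(1) w(1)])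
    have "z \<oplus>\<^bsub>?T k\<^esub> ?d k (?h k z) = ?d k (?f (Suc k) w)"
      using cyc[OF zT zd] fd[OF w(1)] w(2) by simp
    then have "z = ?d k (?f (Suc k) w) \<ominus>\<^bsub>?T k\<^esub> ?d k (?h k z)"
      using T.T.add_diff_cancel[of z k "?d k (?h k z)"] zT additive_closed[OF md(1) hz] by simp
    also have "\<dots> = ?d k (?f (Suc k) w \<ominus>\<^bsub>?T (Suc k)\<^esub> ?h k z)"
      by (rule additive_diff[OF T.T.abelian_group_axioms T.T.abelian_group_axioms md(1) fw hz, symmetric])
    finally have "z \<in> ?d k ` carrier (?T (Suc k))" using fw hz T.T.minus_closed by blast
    then show "z \<in> map_right R B (S.SF (Suc k - 1)) S.bd ` carrier (tensor R B (S.SF (Suc k)))"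
      by (simp add: additive_tensor_simps)
  qed
  have ghom: "?g n \<in> hom (tensor R B (S.SF n)) (tensor R B (X n))" for n
    using mg(1) by (simp add: additive_tensor_hom_iff)
  have gcomm: "?g n (map_right R B (S.SF (Suc n - 1)) S.bd x) = map_right R B (X (Suc n - 1)) (DX (Suc n - 1)) (?g (Suc n) x)"
    if "x \<in> carrier (tensor R B (S.SF (Suc n)))" for n x
    using gd[of x n] that by (simp add: additive_tensor_simps)
  let ?C = "\<lambda>n. tensor R B (S.SF n)" and ?\<delta> = "\<lambda>i. map_right R B (S.SF (i - 1)) S.bd"
  let ?C' = "\<lambda>n. tensor R B (X n)" and ?\<delta>' = "\<lambda>i. map_right R B (X (i - 1)) (DX (i - 1))"
  have T: "Tor R B M k = homology ?C ?\<delta> k" by (simp only: Tor_def)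
  have "\<exists>f\<in>hom (homology ?C ?\<delta> k) (homology ?C' ?\<delta>' k). inj_on f (carrier (homology ?C ?\<delta> k))"
  proof (rule homology_injection)
    show "group_complex ?C ?\<delta>" by (rule SC.group_complex_tensor[OF B])
    show "group_complex ?C' ?\<delta>'" by (rule group_complex_tensor[OF B])
    show "?g n \<in> hom (?C n) (?C' n)" for n by (rule ghom)
    show "?g n (?\<delta> (Suc n) x) = ?\<delta>' (Suc n) (?g (Suc n) x)" if "x \<in> carrier (?C (Suc n))" for n x
      by (rule gcomm[OF that])
    show "z \<in> ?\<delta> (Suc k) ` carrier (?C (Suc k))"
      if "z \<in> cycles ?C ?\<delta> k" "?g k z \<in> ?\<delta>' (Suc k) ` carrier (?C' (Suc k))" for z
      by (rule inj[OF that])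
  qed
  then show ?thesis unfolding T .
qed

end

section \<open>Resolutions of p-adically expansive modules\<close>

lemma trivial_module_int_multiple:
  "[(k::int)] \<cdot>\<^bsub>(trivial_module :: ('g \<Rightarrow>\<^sub>0 int, int) module)\<^esub> x = k * x"
proof -
  let ?Z = "trivial_module :: ('g \<Rightarrow>\<^sub>0 int, int) module"
  interpret M: abelian_group ?Z
  proof (rule abelian_groupI)
    fix x :: int
    show "\<exists>y\<in>carrier ?Z. y \<oplus>\<^bsub>?Z\<^esub> x = \<zero>\<^bsub>?Z\<^esub>"
      by (intro bexI[of _ "- x"]) simp_all
  qed auto
  have "\<ominus>\<^bsub>?Z\<^esub> y = - y" for y
    using M.minus_equality[of "- y" y] by simp
  then show ?thesis
    by (cases "k \<ge> 0") (simp_all add: add_pow_int_ge add_pow_int_lt trivial_module_nat_multiple)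
qed

lemma additive_tensor_int_multiple:
  "[(k::int)] \<cdot>\<^bsub>additive_tensor R A B\<^esub> x = x [^]\<^bsub>tensor R A B\<^esub> k"
  by (simp add: add_pow_def int_pow_def nat_pow_def m_inv_def Let_def additive_tensor_simps)

locale expansive_resolution = projective_resolution "group_ring G" X DX M \<epsilon> J b \<phi>
  for G :: "('g, 'x) monoid_scheme" and X :: "nat \<Rightarrow> ('g \<Rightarrow>\<^sub>0 int, 'a) module" and DX
    and M :: "('g \<Rightarrow>\<^sub>0 int, 'm) module" and \<epsilon> and J :: "nat \<Rightarrow> 'j set" and b \<phi> +
  fixes p n0 :: nat
  assumes G: "group G" and prime_p: "Factorial_Ring.prime p"
    and finite_J: "\<And>n. finite (J n)"
    and exponent: "\<And>x. x \<in> carrier M \<Longrightarrow> \<exists>y\<in>carrier M. [(p ^ n0)] \<cdot>\<^bsub>M\<^esub> x = [(p ^ Suc n0)] \<cdot>\<^bsub>M\<^esub> y"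
    and limit: "\<And>m. (\<And>k. m k \<in> carrier M) \<Longrightarrow> (\<And>k. [(p ^ k)] \<cdot>\<^bsub>M\<^esub> m k = \<zero>\<^bsub>M\<^esub>) \<Longrightarrow>
      (\<And>k. [p] \<cdot>\<^bsub>M\<^esub> m (Suc k) = m k) \<Longrightarrow> m 1 = \<zero>\<^bsub>M\<^esub>"
begin

abbreviation "\<R> \<equiv> group_ring G"

lemma p_pos: "p > 0" using prime_p prime_gt_0_nat by blast

sublocale PR: padic_ring \<R> p
proof -
  interpret ring \<R> by (rule ring_group_ring[OF G])
  show "padic_ring \<R> p"
    by unfold_locales (rule prime_p, rule group_ring_torsion_free[OF p_pos])
qed

sublocale XM: padic_module \<R> p "X n" "J n" "b n" "\<phi> n" for n
  using PR.padic_ring_axioms X finite_J db by (simp add: padic_module_def padic_module_axioms_def)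

abbreviation "T n \<equiv> additive_tensor \<R> PR.CM (X n)"
abbreviation "DT n \<equiv> map_right \<R> PR.CM (X n) (DX n)"
abbreviation "iot n \<equiv> padic_module.\<iota>P \<R> p (X n)"
abbreviation "TA n \<equiv> padic_module.TA \<R> p (X n)"

lemmas DX' = module_homsD[OF DX] and \<epsilon>' = module_homsD[OF \<epsilon>]
lemmas DT = map_right[OF PR.right_module_CM X X DX]

lemma DT_iot: "x \<in> carrier (X (Suc n)) \<Longrightarrow> DT n (iot (Suc n) x) = iot n (DX n x)"
  by (simp add: XM.\<iota>P_def DT(2) PR.CM_simps)

sublocale CR: completed_resolution p X T DX DT iot M \<epsilon>
proof (rule completed_resolution.intro)
  show "abelian_group (X n)" for n by (rule XM.P.M.abelian_group_axioms)
  show "abelian_group (T n)" for n by (rule XM.TP.T.abelian_group_axioms)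
  show "abelian_group M" by (rule M.M.abelian_group_axioms)
  show "additive (X (Suc n)) (X n) (DX n)" for n by (rule DX')
  show "additive (T (Suc n)) (T n) (DT n)" for n by (rule DT(1))
  show "additive (X n) (T n) (iot n)" for n by (rule XM.additive_\<iota>P)
  show "additive (X 0) M \<epsilon>" by (rule \<epsilon>')
  show "DT n (iot (Suc n) x) = iot n (DX n x)" if "x \<in> carrier (X (Suc n))" for n x
    by (rule DT_iot[OF that])
  show "x = \<zero>\<^bsub>X n\<^esub>" if "x \<in> carrier (X n)" "[p] \<cdot>\<^bsub>X n\<^esub> x = \<zero>\<^bsub>X n\<^esub>" for n x
    by (rule XM.P_torsion_free[OF that])
  show "x = \<zero>\<^bsub>T n\<^esub>" if "x \<in> carrier (T n)" "[p] \<cdot>\<^bsub>T n\<^esub> x = \<zero>\<^bsub>T n\<^esub>" for n x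
    by (rule XM.T_torsion_free[OF that(1) p_pos that(2)])
  show "\<exists>u\<in>carrier (X n). \<exists>t'\<in>carrier (T n). t = iot n u \<oplus>\<^bsub>T n\<^esub> [p] \<cdot>\<^bsub>T n\<^esub> t'"
    if "t \<in> carrier (T n)" for n t
    by (rule XM.T_dense[OF that])
  show "\<exists>v\<in>carrier (X n). u = [(p ^ k)] \<cdot>\<^bsub>X n\<^esub> v"
    if "u \<in> carrier (X n)" "t \<in> carrier (T n)" "iot n u = [(p ^ k)] \<cdot>\<^bsub>T n\<^esub> t" for n u t k
    by (rule XM.T_pure[OF that])
  show "padic_complete p (T n)" for n by (rule XM.T_complete)
  show "padic_separated p (T n)" for n by (rule XM.T_separated)
qed (fact DDX exact \<epsilon>_surj \<epsilon>_D exact0)+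

lemma exact_T:
  assumes "x \<in> carrier (T (Suc n))" "DT n x = \<zero>\<^bsub>T n\<^esub>"
  shows "x \<in> DT (Suc n) ` carrier (T (Suc (Suc n)))"
proof (cases n)
  case 0
  have "x \<in> DT (Suc 0) ` carrier (T (Suc (Suc 0)))"
  proof (rule CR.exactT_1)
    fix m assume m: "\<And>k. m k \<in> carrier M" "\<And>k. [(p ^ k)] \<cdot>\<^bsub>M\<^esub> m k = \<zero>\<^bsub>M\<^esub>" "\<And>k. [p] \<cdot>\<^bsub>M\<^esub> m (Suc k) = m k"
    then show "m 1 = \<zero>\<^bsub>M\<^esub>" by (rule limit)
  qed (use assms 0 in simp_all)
  then show ?thesis using 0 by simp
next
  case (Suc k)
  then show ?thesis using CR.exactT_high assms by simp
qed

text \<open>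
  For \<open>n0 = 0\<close> this is surjectivity in degree 0.
\<close>

lemma bottom_T: "t \<in> carrier (T 0) \<Longrightarrow> [(p ^ n0)] \<cdot>\<^bsub>T 0\<^esub> t \<in> DT 0 ` carrier (T (Suc 0))"
  by (rule CR.multiple_boundary[OF exponent])

subsection \<open>Inverting p\<close>

abbreviation "TC n \<equiv> additive_tensor \<R> PR.C0 (X n)"
abbreviation "DC n \<equiv> map_right \<R> PR.C0 (X n) (DX n)"
abbreviation "th n \<equiv> padic_module.\<theta> \<R> p (X n)"

lemmas DC = map_right[OF PR.right_module_C0 X X DX]

lemma DC_\<theta>:
  assumes "t \<in> carrier (T (Suc n))"
  shows "DC n (th (Suc n) m t) = th n m (DT n t)"
proof (rule XM.TP.additive_eqI[OF additive_compose[OF XM.\<theta>(1) DC(1)] additive_compose[OF DT(1) XM.\<theta>(1)] _ assms])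
  fix a x assume a: "a \<in> carrier PR.CM" and x: "x \<in> carrier (X (Suc n))"
  have a': "a \<in> carrier PR.A" using a by (simp add: PR.CM_simps)
  have "PR.rat.over a m \<in> carrier PR.C0" using PR.rat.frac_closed[OF a] by (simp add: PR.C0_simps)
  then show "DC n (th (Suc n) m (pure_tensor \<R> PR.CM (X (Suc n)) a x))
      = th n m (DT n (pure_tensor \<R> PR.CM (X (Suc n)) a x))"
    using a a' x DX'(2)[OF x] by (simp add: XM.\<theta>(2) DT(2) DC(2))
qed

lemma exact_C:
  assumes x: "x \<in> carrier (TC (Suc n))" "DC n x = \<zero>\<^bsub>TC n\<^esub>"
  shows "x \<in> DC (Suc n) ` carrier (TC (Suc (Suc n)))"
proof -
  obtain t m where t: "t \<in> carrier (T (Suc n))" "m > 0" "x = th (Suc n) m t"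
    using XM.\<theta>_exhaust[OF x(1)] by blast
  have "th n m (DT n t) = \<zero>\<^bsub>TC n\<^esub>" using x(2) DC_\<theta>[OF t(1), of m] t(3) by simp
  then have "DT n t = \<zero>\<^bsub>T n\<^esub>" by (rule XM.\<theta>_eq_zero[OF CR.DTc[OF t(1)] t(2)])
  then obtain s where s: "s \<in> carrier (T (Suc (Suc n)))" "t = DT (Suc n) s" using exact_T t(1) by blast
  have "x = DC (Suc n) (th (Suc (Suc n)) m s)" using t(3) s DC_\<theta>[OF s(1), of m] by simp
  then show ?thesis using XM.\<theta>_closed[OF s(1)] by blast
qed

lemma bottom_C:
  assumes x: "x \<in> carrier (TC 0)"
  shows "x \<in> DC 0 ` carrier (TC (Suc 0))"
proof -
  obtain t m where t: "t \<in> carrier (T 0)" "m > 0" "x = th 0 m t"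
    using XM.\<theta>_exhaust[OF x] by blast
  obtain s where s: "s \<in> carrier (T (Suc 0))" "[(p ^ n0)] \<cdot>\<^bsub>T 0\<^esub> t = DT 0 s" using bottom_T[OF t(1)] by blast
  have pk: "p ^ n0 > 0" using p_pos by simp
  \<comment> \<open>Enlarge the fraction \<open>t/m\<close> by \<open>p\<^bsup>n0\<^esup>\<close>.\<close>
  have "x = th 0 (m * p ^ n0) (DT 0 s)" using XM.\<theta>_cancel[OF t(1) pk, of m] t(3) s(2) by simp
  then have "x = DC 0 (th (Suc 0) (m * p ^ n0) s)" using DC_\<theta>[OF s(1)] by simp
  then show ?thesis using XM.\<theta>_closed[OF s(1)] by blast
qed

subsection \<open>A contracting homotopy up to a power of p\<close>

lemma DT_hom: "DT n \<in> module_homs PR.A (TA (Suc n)) (TA n)"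
proof (rule module_homsI)
  show "additive (TA (Suc n)) (TA n) (DT n)"
    using DT(1)[of n] by (simp add: additive_def hom_def XM.TA_simps(1,2))
  fix r t assume r: "r \<in> carrier PR.A" and "t \<in> carrier (TA (Suc n))"
  then have t: "t \<in> carrier (T (Suc n))" by (simp add: XM.TA_simps)
  show "DT n (r \<odot>\<^bsub>TA (Suc n)\<^esub> t) = r \<odot>\<^bsub>TA n\<^esub> DT n t"
  proof (rule XM.TP.additive_eqI[OF additive_compose[OF XM.TA_smult(1)[OF r] DT(1)] additive_compose[OF DT(1) XM.TA_smult(1)[OF r]] _ t])
    fix a x assume "a \<in> carrier PR.CM" and x: "x \<in> carrier (X (Suc n))"
    then have "a \<in> carrier PR.A" by (simp add: PR.CM_simps)
    then show "DT n (r \<odot>\<^bsub>TA (Suc n)\<^esub> pure_tensor \<R> PR.CM (X (Suc n)) a x)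
        = r \<odot>\<^bsub>TA n\<^esub> DT n (pure_tensor \<R> PR.CM (X (Suc n)) a x)"
      using r x DX'(2)[OF x] by (simp add: XM.TA_smult(2) DT(2) PR.CM_simps(1))
  qed
qed

lemma TA_multiple: "[(k::nat)] \<cdot>\<^bsub>TA n\<^esub> t = [k] \<cdot>\<^bsub>T n\<^esub> t"
  by (rule nat_multiple_transfer) (simp_all add: XM.TA_simps)

text \<open>
  The completed modules are projective over the completed ring, so multiplication by \<open>p\<^bsup>n0\<^esup>\<close>, which induces zero on
  the homology of their complex, is null homotopic.
\<close>

lemma homotopy:
  "\<exists>h. (\<forall>n. h n \<in> module_homs PR.A (TA n) (TA (Suc n))) \<and>
    (\<forall>t\<in>carrier (T 0). DT 0 (h 0 t) = [(p ^ n0)] \<cdot>\<^bsub>T 0\<^esub> t) \<and>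
    (\<forall>n. \<forall>t\<in>carrier (T (Suc n)). DT (Suc n) (h (Suc n) t) \<oplus>\<^bsub>T (Suc n)\<^esub> h n (DT n t) = [(p ^ n0)] \<cdot>\<^bsub>T (Suc n)\<^esub> t)"
proof (rule null_homotopy[where X = TA and Y = TA and DX = DT and DY = DT and e = "\<lambda>n t. [(p ^ n0)] \<cdot>\<^bsub>TA n\<^esub> t"])
  show "left_module PR.A (TA n)" for n by (rule XM.left_module_TA)
  then show "left_module PR.A (TA n)" for n .
  show "DT n \<in> module_homs PR.A (TA (Suc n)) (TA n)" for n by (rule DT_hom)
  then show "DT n \<in> module_homs PR.A (TA (Suc n)) (TA n)" for n .
  show "DT n (DT (Suc n) t) = \<zero>\<^bsub>TA n\<^esub>" if "t \<in> carrier (TA (Suc (Suc n)))" for n t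
    using CR.DDT that by (simp add: XM.TA_simps(1,3))
  show "dual_basis PR.A (TA n) (J n) (\<lambda>j. iot n (b n j)) (\<lambda>j. tensor_coordinate \<R> PR.CM (X n) (\<phi> n j))" for n
    by (rule XM.dual_basis_TA)
  show "(\<lambda>t. [(p ^ n0)] \<cdot>\<^bsub>TA n\<^esub> t) \<in> module_homs PR.A (TA n) (TA n)" for n
    by (rule nat_multiple_hom[OF XM.left_module_TA])
  show "DT n ([(p ^ n0)] \<cdot>\<^bsub>TA (Suc n)\<^esub> t) = [(p ^ n0)] \<cdot>\<^bsub>TA n\<^esub> DT n t" if "t \<in> carrier (TA (Suc n))" for n t
    using additive_nat_pow[OF CR.T CR.T DT(1)] that by (simp add: XM.TA_simps(1) TA_multiple)
  show "(\<lambda>t. [(p ^ n0)] \<cdot>\<^bsub>TA 0\<^esub> t) ` carrier (TA 0) \<subseteq> DT 0 ` carrier (TA (Suc 0))"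
    using bottom_T by (auto simp: XM.TA_simps(1) TA_multiple)
  show "t \<in> DT (Suc n) ` carrier (TA (Suc (Suc n)))" if "t \<in> carrier (TA (Suc n))" "DT n t = \<zero>\<^bsub>TA n\<^esub>" for n t
    using exact_T that by (simp add: XM.TA_simps(1,3))
next
  fix h assume h: "\<And>n. h n \<in> module_homs PR.A (TA n) (TA (Suc n))"
    "\<And>t. t \<in> carrier (TA 0) \<Longrightarrow> DT 0 (h 0 t) = [(p ^ n0)] \<cdot>\<^bsub>TA 0\<^esub> t"
    "\<And>n t. t \<in> carrier (TA (Suc n)) \<Longrightarrow> DT (Suc n) (h (Suc n) t) \<oplus>\<^bsub>TA (Suc n)\<^esub> h n (DT n t) = [(p ^ n0)] \<cdot>\<^bsub>TA (Suc n)\<^esub> t"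
  show "\<exists>h. (\<forall>n. h n \<in> module_homs PR.A (TA n) (TA (Suc n))) \<and>
    (\<forall>t\<in>carrier (T 0). DT 0 (h 0 t) = [(p ^ n0)] \<cdot>\<^bsub>T 0\<^esub> t) \<and>
    (\<forall>n. \<forall>t\<in>carrier (T (Suc n)). DT (Suc n) (h (Suc n) t) \<oplus>\<^bsub>T (Suc n)\<^esub> h n (DT n t) = [(p ^ n0)] \<cdot>\<^bsub>T (Suc n)\<^esub> t)"
    by (rule exI[of _ h]) (simp add: h(1) h(2,3)[unfolded XM.TA_simps(1,2) TA_multiple])
qed

subsection \<open>Coinvariants\<close>

abbreviation triv :: "('g \<Rightarrow>\<^sub>0 int, int) module" where "triv \<equiv> trivial_module"

lemma right_triv: "right_module \<R> triv"
  by (rule right_module_trivial_module[OF G])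

abbreviation "ZT n \<equiv> additive_tensor \<R> triv (X n)"
abbreviation "DZ n \<equiv> map_right \<R> triv (X n) (DX n)"
abbreviation "cl n x \<equiv> pure_tensor \<R> triv (X n) 1 x"

sublocale ZX: tensor_pair \<R> triv "X n" for n
  by (rule tensor_pair_X[OF right_triv])

lemmas DZ = map_right[OF right_triv X X DX]

lemma additive_cl: "additive (X n) (ZT n) (cl n)"
  by (rule ZX.additive_tens_right) simp

lemmas cl_closed = additive_closed[OF additive_cl]

lemma DZ_cl: "x \<in> carrier (X (Suc n)) \<Longrightarrow> DZ n (cl (Suc n) x) = cl n (DX n x)"
  by (rule DZ(2)) simp_all

lemma cl_smult_zero:
  assumes "s \<in> carrier \<R>" "augmentation s = 0" "x \<in> carrier (X n)"
  shows "cl n (s \<odot>\<^bsub>X n\<^esub> x) = \<zero>\<^bsub>ZT n\<^esub>"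
proof -
  have "cl n (s \<odot>\<^bsub>X n\<^esub> x) = pure_tensor \<R> triv (X n) 0 x"
    using ZX.tens_balanced[of s 1 x n] assms by simp
  then show ?thesis
    using additive_zero[OF ZX.A.M.abelian_group_axioms ZX.T.abelian_group_axioms ZX.additive_tens_left[OF assms(3)]] by simp
qed

text \<open>
  By balancedness \<open>k \<otimes> x = 1 \<otimes> k x\<close>.
\<close>

lemma cl_exhaust:
  assumes "z \<in> carrier (ZT n)"
  shows "\<exists>x\<in>carrier (X n). z = cl n x"
  using assms
proof (induction rule: ZX.tensor_induct)
  case (tens k x)
  define r where "r = frag_cmul k (frag_of \<one>\<^bsub>G\<^esub>)"
  have r: "r \<in> carrier \<R>" using group.is_monoid[OF G] monoid.one_closed by (auto simp: r_def)
  have "augmentation r = k" by (simp add: r_def augmentation_eq frag_extend_cmul)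
  then have "pure_tensor \<R> triv (X n) k x = cl n (r \<odot>\<^bsub>X n\<^esub> x)"
    using ZX.tens_balanced[of r 1 x n] r tens by simp
  then show ?case using XM.P.smult_closed[OF r tens(2)] by blast
next
  case (add s t)
  then obtain x y where xy: "x \<in> carrier (X n)" "s = cl n x" "y \<in> carrier (X n)" "t = cl n y" by blast
  then have "s \<oplus>\<^bsub>ZT n\<^esub> t = cl n (x \<oplus>\<^bsub>X n\<^esub> y)" by (simp add: additive_add[OF additive_cl])
  then show ?case using xy XM.P.M.a_closed by blast
qed

text \<open>
  The augmentations of the coordinates of \<open>v\<close> are the coordinates of \<open>1 \<otimes> v\<close>.
\<close>

lemma cl_zero_augmentation:
  assumes v: "v \<in> carrier (X n)" "cl n v = \<zero>\<^bsub>ZT n\<^esub>" and j: "j \<in> J n"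
  shows "augmentation (\<phi> n j v) = 0"
proof -
  note c = ZX.tensor_coordinate[OF dual_basisD(2,3)[OF db j]]
  have "tensor_coordinate \<R> triv (X n) (\<phi> n j) (cl n v) = \<phi> n j v \<odot>\<^bsub>triv\<^esub> 1"
    by (rule c(2)) (simp_all add: v)
  moreover have "tensor_coordinate \<R> triv (X n) (\<phi> n j) (cl n v) = 0"
    unfolding v(2) using additive_zero[OF ZX.T.abelian_group_axioms ZX.A.M.abelian_group_axioms c(1)] by simp
  ultimately show ?thesis by simp
qed

lemma iot_smult:
  assumes "s \<in> carrier \<R>" "x \<in> carrier (X n)"
  shows "iot n (s \<odot>\<^bsub>X n\<^esub> x) = PR.\<iota> s \<odot>\<^bsub>TA n\<^esub> iot n x"
  using XM.\<iota>P_smult[OF assms] XM.TA_smult(2)[OF PR.\<iota>_closed[OF assms(1)] PR.A.one_closed assms(2)]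
    PR.\<iota>_closed[OF assms(1)] by (simp add: XM.\<iota>P_def)

text \<open>
  Write \<open>v = \<Sum> s\<^sub>j b\<^sub>j\<close> and approximate \<open>h b\<^sub>j\<close> modulo \<open>p\<^sup>N\<close> by \<open>y\<^sub>j \<in> X\<^sub>n\<close>.  Then \<open>h v\<close> is approximated by
  \<open>e = \<Sum> s\<^sub>j y\<^sub>j\<close>, and the \<open>s\<^sub>j\<close> have augmentation zero.
\<close>

lemma hom_augmentation_zero:
  assumes h: "h \<in> module_homs PR.A (TA m) (TA n)" and v: "v \<in> carrier (X m)" "cl m v = \<zero>\<^bsub>ZT m\<^esub>"
  shows "\<exists>e\<in>carrier (X n). \<exists>t\<in>carrier (T n). h (iot m v) = iot n e \<oplus>\<^bsub>T n\<^esub> [(p ^ N)] \<cdot>\<^bsub>T n\<^esub> t \<and> cl n e = \<zero>\<^bsub>ZT n\<^esub>"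
proof -
  have h': "additive (T m) (T n) h" "\<And>r t. r \<in> carrier PR.A \<Longrightarrow> t \<in> carrier (T m) \<Longrightarrow> h (r \<odot>\<^bsub>TA m\<^esub> t) = r \<odot>\<^bsub>TA n\<^esub> h t"
    using module_homsD(1,3)[OF h] by (simp_all add: additive_def hom_def XM.TA_simps(1,2))
  note d = dual_basisD[OF db[of m]]
  let ?w = "\<lambda>j. \<phi> m j v \<odot>\<^bsub>X m\<^esub> b m j"
  have w: "?w j \<in> carrier (X m)" if "j \<in> J m" for j
    by (intro XM.P.smult_closed d(1) d(6) that v(1))
  have "\<exists>e\<in>carrier (X n). \<exists>t\<in>carrier (T n).
      h (iot m (\<Oplus>\<^bsub>X m\<^esub>j\<in>K. ?w j)) = iot n e \<oplus>\<^bsub>T n\<^esub> [(p ^ N)] \<cdot>\<^bsub>T n\<^esub> t \<and> cl n e = \<zero>\<^bsub>ZT n\<^esub>"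
    if "finite K" "K \<subseteq> J m" for K
    using that
  proof (induction K rule: finite_induct)
    case empty
    have "h (iot m \<zero>\<^bsub>X m\<^esub>) = iot n \<zero>\<^bsub>X n\<^esub> \<oplus>\<^bsub>T n\<^esub> [(p ^ N)] \<cdot>\<^bsub>T n\<^esub> \<zero>\<^bsub>T n\<^esub>"
      using additive_zero[OF CR.P CR.T CR.\<iota>] additive_zero[OF CR.T CR.T h'(1)] by simp
    moreover have "cl n \<zero>\<^bsub>X n\<^esub> = \<zero>\<^bsub>ZT n\<^esub>"
      by (rule additive_zero[OF CR.P ZX.T.abelian_group_axioms additive_cl])
    ultimately show ?case by (intro bexI[of _ "\<zero>\<^bsub>X n\<^esub>"] bexI[of _ "\<zero>\<^bsub>T n\<^esub>"]) simp_all
  next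
    case (insert j K)
    then have j: "j \<in> J m" and K: "K \<subseteq> J m" by auto
    obtain e t where e: "e \<in> carrier (X n)" and t: "t \<in> carrier (T n)"
      and IH: "h (iot m (\<Oplus>\<^bsub>X m\<^esub>j\<in>K. ?w j)) = iot n e \<oplus>\<^bsub>T n\<^esub> [(p ^ N)] \<cdot>\<^bsub>T n\<^esub> t" "cl n e = \<zero>\<^bsub>ZT n\<^esub>"
      using insert.IH[OF K] by blast
    let ?s = "\<phi> m j v"
    have s: "?s \<in> carrier \<R>" by (rule d(6)[OF j v(1)])
    have \<iota>s: "PR.\<iota> ?s \<in> carrier PR.A" by (rule PR.\<iota>_closed[OF s])
    have bj: "b m j \<in> carrier (X m)" by (rule d(1)[OF j])
    have hb: "h (iot m (b m j)) \<in> carrier (T n)" by (rule additive_closed[OF h'(1) CR.\<iota>c[OF bj]])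
    obtain y u where y: "y \<in> carrier (X n)" and u: "u \<in> carrier (T n)"
      and yu: "h (iot m (b m j)) = iot n y \<oplus>\<^bsub>T n\<^esub> [(p ^ N)] \<cdot>\<^bsub>T n\<^esub> u"
      using CR.dense_power[OF hb] by blast
    note sa = XM.TA_smult(1)[OF \<iota>s, of n]
    let ?su = "PR.\<iota> ?s \<odot>\<^bsub>TA n\<^esub> u"
    have su: "?su \<in> carrier (T n)" by (rule additive_closed[OF sa u])
    have sy: "?s \<odot>\<^bsub>X n\<^esub> y \<in> carrier (X n)" by (rule XM.P.smult_closed[OF s y])
    have "h (iot m (?w j)) = PR.\<iota> ?s \<odot>\<^bsub>TA n\<^esub> h (iot m (b m j))"
      unfolding iot_smult[OF s bj] by (rule h'(2)[OF \<iota>s CR.\<iota>c[OF bj]])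
    also have "\<dots> = iot n (?s \<odot>\<^bsub>X n\<^esub> y) \<oplus>\<^bsub>T n\<^esub> [(p ^ N)] \<cdot>\<^bsub>T n\<^esub> ?su"
      unfolding yu iot_smult[OF s y] using CR.\<iota>c[OF y] u
      by (simp add: additive_add[OF sa] additive_nat_pow[OF CR.T CR.T sa])
    finally have hw: "h (iot m (?w j)) = iot n (?s \<odot>\<^bsub>X n\<^esub> y) \<oplus>\<^bsub>T n\<^esub> [(p ^ N)] \<cdot>\<^bsub>T n\<^esub> ?su" .
    have wK: "?w \<in> K \<rightarrow> carrier (X m)" using w K by blast
    have sumK: "(\<Oplus>\<^bsub>X m\<^esub>j\<in>K. ?w j) \<in> carrier (X m)" by (rule XM.P.M.finsum_closed[OF wK])
    have "(\<Oplus>\<^bsub>X m\<^esub>j\<in>insert j K. ?w j) = ?w j \<oplus>\<^bsub>X m\<^esub> (\<Oplus>\<^bsub>X m\<^esub>j\<in>K. ?w j)"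
      by (rule XM.P.M.finsum_insert[OF insert(1,2) wK w[OF j]])
    then have "h (iot m (\<Oplus>\<^bsub>X m\<^esub>j\<in>insert j K. ?w j)) = h (iot m (?w j)) \<oplus>\<^bsub>T n\<^esub> h (iot m (\<Oplus>\<^bsub>X m\<^esub>j\<in>K. ?w j))"
      using w[OF j] sumK CR.\<iota>c by (simp add: additive_add[OF CR.\<iota>] additive_add[OF h'(1)])
    also have "\<dots> = iot n (?s \<odot>\<^bsub>X n\<^esub> y \<oplus>\<^bsub>X n\<^esub> e) \<oplus>\<^bsub>T n\<^esub> [(p ^ N)] \<cdot>\<^bsub>T n\<^esub> (?su \<oplus>\<^bsub>T n\<^esub> t)"
      unfolding hw IH(1) using sy e su t CR.\<iota>c[OF sy] CR.\<iota>c[OF e]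
      by (simp add: additive_add[OF CR.\<iota>] additive_add[OF XM.TP.T.additive_nat_multiple] XM.TP.T.a_ac)
    finally have 1: "h (iot m (\<Oplus>\<^bsub>X m\<^esub>j\<in>insert j K. ?w j))
        = iot n (?s \<odot>\<^bsub>X n\<^esub> y \<oplus>\<^bsub>X n\<^esub> e) \<oplus>\<^bsub>T n\<^esub> [(p ^ N)] \<cdot>\<^bsub>T n\<^esub> (?su \<oplus>\<^bsub>T n\<^esub> t)" .
    have 2: "cl n (?s \<odot>\<^bsub>X n\<^esub> y \<oplus>\<^bsub>X n\<^esub> e) = \<zero>\<^bsub>ZT n\<^esub>"
      using sy e IH(2) cl_smult_zero[OF s cl_zero_augmentation[OF v j] y]
      by (simp add: additive_add[OF additive_cl])
    show ?case
      using 1 2 by (intro bexI[of _ "?s \<odot>\<^bsub>X n\<^esub> y \<oplus>\<^bsub>X n\<^esub> e"] bexI[of _ "?su \<oplus>\<^bsub>T n\<^esub> t"]) (simp_all add: sy e su t)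
  qed
  from this[OF finite_J subset_refl]
  show ?thesis using dual_basis_expand[OF X db finite_J v(1)] by simp
qed

text \<open>
  In the equation \<open>p\<^bsup>n0\<^esup> u = \<delta> h u + h \<delta> u\<close>, the element \<open>h u\<close> is replaced by an approximation \<open>w\<close> modulo \<open>p\<^sup>N\<close>, and
  the term \<open>h \<delta> u\<close> by the element \<open>e\<close> of the previous lemma.  The error is divisible by \<open>p\<^sup>N\<close> in the completion, hence
  in \<open>X\<^sub>n\<close>.
\<close>

lemma cycle_multiple:
  assumes u: "u \<in> carrier (X n)" and cyc: "\<And>m. n = Suc m \<Longrightarrow> cl m (DX m u) = \<zero>\<^bsub>ZT m\<^esub>"
  shows "\<exists>w\<in>carrier (X (Suc n)). \<exists>e\<in>carrier (X n). \<exists>c\<in>carrier (X n).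
    [(p ^ n0)] \<cdot>\<^bsub>X n\<^esub> u = (DX n w \<oplus>\<^bsub>X n\<^esub> e) \<oplus>\<^bsub>X n\<^esub> [(p ^ N)] \<cdot>\<^bsub>X n\<^esub> c \<and> cl n e = \<zero>\<^bsub>ZT n\<^esub>"
proof -
  obtain h where h: "\<And>n. h n \<in> module_homs PR.A (TA n) (TA (Suc n))"
    and h0: "\<And>t. t \<in> carrier (T 0) \<Longrightarrow> DT 0 (h 0 t) = [(p ^ n0)] \<cdot>\<^bsub>T 0\<^esub> t"
    and hS: "\<And>n t. t \<in> carrier (T (Suc n)) \<Longrightarrow> DT (Suc n) (h (Suc n) t) \<oplus>\<^bsub>T (Suc n)\<^esub> h n (DT n t) = [(p ^ n0)] \<cdot>\<^bsub>T (Suc n)\<^esub> t"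
    using homotopy by blast
  have iu: "iot n u \<in> carrier (T n)" by (rule CR.\<iota>c[OF u])
  have hu: "h n (iot n u) \<in> carrier (T (Suc n))"
    using module_homsD(2)[OF h] iu by (simp add: XM.TA_simps(1))
  have "\<exists>e\<in>carrier (X n). \<exists>t\<in>carrier (T n).
      [(p ^ n0)] \<cdot>\<^bsub>T n\<^esub> iot n u = DT n (h n (iot n u)) \<oplus>\<^bsub>T n\<^esub> (iot n e \<oplus>\<^bsub>T n\<^esub> [(p ^ N)] \<cdot>\<^bsub>T n\<^esub> t) \<and> cl n e = \<zero>\<^bsub>ZT n\<^esub>"
  proof (cases n)
    case 0
    have "iot n \<zero>\<^bsub>X n\<^esub> = \<zero>\<^bsub>T n\<^esub>" by (rule additive_zero[OF CR.P CR.T CR.\<iota>])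
    moreover have "cl n \<zero>\<^bsub>X n\<^esub> = \<zero>\<^bsub>ZT n\<^esub>" by (rule additive_zero[OF CR.P ZX.T.abelian_group_axioms additive_cl])
    ultimately show ?thesis
      using h0 iu 0 by (intro bexI[of _ "\<zero>\<^bsub>X n\<^esub>"] bexI[of _ "\<zero>\<^bsub>T n\<^esub>"]) simp_all
  next
    case (Suc m)
    have Du: "DX m u \<in> carrier (X m)" using DX'(2) u Suc by simp
    obtain e t where et: "e \<in> carrier (X n)" "t \<in> carrier (T n)"
      "h m (iot m (DX m u)) = iot n e \<oplus>\<^bsub>T n\<^esub> [(p ^ N)] \<cdot>\<^bsub>T n\<^esub> t" "cl n e = \<zero>\<^bsub>ZT n\<^esub>"
      using hom_augmentation_zero[OF h Du cyc[OF Suc], of N] Suc by blast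
    have "[(p ^ n0)] \<cdot>\<^bsub>T n\<^esub> iot n u = DT n (h n (iot n u)) \<oplus>\<^bsub>T n\<^esub> h m (iot m (DX m u))"
      using hS[of "iot n u" m] iu DT_iot[of u m] u Suc by simp
    then show ?thesis using et by auto
  qed
  then obtain e t where e: "e \<in> carrier (X n)" and t: "t \<in> carrier (T n)" and ce: "cl n e = \<zero>\<^bsub>ZT n\<^esub>"
    and eq: "[(p ^ n0)] \<cdot>\<^bsub>T n\<^esub> iot n u = DT n (h n (iot n u)) \<oplus>\<^bsub>T n\<^esub> (iot n e \<oplus>\<^bsub>T n\<^esub> [(p ^ N)] \<cdot>\<^bsub>T n\<^esub> t)"
    by blast
  obtain w t' where w: "w \<in> carrier (X (Suc n))" and t': "t' \<in> carrier (T (Suc n))"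
    and wt: "h n (iot n u) = iot (Suc n) w \<oplus>\<^bsub>T (Suc n)\<^esub> [(p ^ N)] \<cdot>\<^bsub>T (Suc n)\<^esub> t'"
    using CR.dense_power[OF hu] by blast
  have Dw: "DX n w \<in> carrier (X n)" by (rule DX'(2)[OF w])
  have Dh: "DT n (h n (iot n u)) = iot n (DX n w) \<oplus>\<^bsub>T n\<^esub> [(p ^ N)] \<cdot>\<^bsub>T n\<^esub> DT n t'"
    unfolding wt using w t' by (simp add: additive_add[OF DT(1)] CR.\<iota>c DT_iot additive_nat_pow[OF CR.T CR.T DT(1)])
  let ?c = "[(p ^ n0)] \<cdot>\<^bsub>X n\<^esub> u \<ominus>\<^bsub>X n\<^esub> (DX n w \<oplus>\<^bsub>X n\<^esub> e)"
  have eq': "iot n ([(p ^ n0)] \<cdot>\<^bsub>X n\<^esub> u) = iot n (DX n w \<oplus>\<^bsub>X n\<^esub> e) \<oplus>\<^bsub>T n\<^esub> [(p ^ N)] \<cdot>\<^bsub>T n\<^esub> (DT n t' \<oplus>\<^bsub>T n\<^esub> t)"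
    using eq unfolding Dh using u e t t' Dw CR.DTc[OF t'] CR.\<iota>c[OF Dw] CR.\<iota>c[OF e]
    by (simp add: additive_nat_pow[OF CR.P CR.T CR.\<iota>] additive_add[OF CR.\<iota>] additive_add[OF XM.TP.T.additive_nat_multiple] XM.TP.T.a_ac)
  have "iot n ?c = iot n ([(p ^ n0)] \<cdot>\<^bsub>X n\<^esub> u) \<ominus>\<^bsub>T n\<^esub> iot n (DX n w \<oplus>\<^bsub>X n\<^esub> e)"
    by (rule additive_diff[OF CR.P CR.T CR.\<iota>]) (simp_all add: u Dw e)
  also have "\<dots> = [(p ^ N)] \<cdot>\<^bsub>T n\<^esub> (DT n t' \<oplus>\<^bsub>T n\<^esub> t)"
    unfolding eq' by (rule XM.TP.T.add_diff_cancel_left) (simp_all add: CR.\<iota>c Dw e t CR.DTc[OF t'])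
  finally have "iot n ?c = [(p ^ N)] \<cdot>\<^bsub>T n\<^esub> (DT n t' \<oplus>\<^bsub>T n\<^esub> t)" .
  then obtain c where c: "c \<in> carrier (X n)" "?c = [(p ^ N)] \<cdot>\<^bsub>X n\<^esub> c"
    using XM.T_pure[of ?c n "DT n t' \<oplus>\<^bsub>T n\<^esub> t" N] u Dw e t CR.DTc[OF t'] by auto
  have "[(p ^ n0)] \<cdot>\<^bsub>X n\<^esub> u = ?c \<oplus>\<^bsub>X n\<^esub> (DX n w \<oplus>\<^bsub>X n\<^esub> e)"
    by (rule XM.P.M.diff_add_cancel[symmetric]) (simp_all add: u Dw e)
  then have "[(p ^ n0)] \<cdot>\<^bsub>X n\<^esub> u = (DX n w \<oplus>\<^bsub>X n\<^esub> e) \<oplus>\<^bsub>X n\<^esub> [(p ^ N)] \<cdot>\<^bsub>X n\<^esub> c"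
    unfolding c(2) using c(1) Dw e by (simp add: XM.P.M.a_comm)
  then show ?thesis using w e c(1) ce by blast
qed

lemma ZT_torsion_free: "z \<in> carrier (ZT n) \<Longrightarrow> [(p ^ N)] \<cdot>\<^bsub>ZT n\<^esub> z = \<zero>\<^bsub>ZT n\<^esub> \<Longrightarrow> z = \<zero>\<^bsub>ZT n\<^esub>"
  by (rule ZX.tensor_torsion_free[OF finite_J db]) (use p_pos in \<open>auto simp: trivial_module_nat_multiple\<close>)

abbreviation "HC \<equiv> \<lambda>n. tensor \<R> triv (X n)"
abbreviation "HD \<equiv> \<lambda>i. map_right \<R> triv (X (i - 1)) (DX (i - 1))"

sublocale HX: group_complex HC HD
  by (rule group_complex_tensor[OF right_triv])

text \<open>
  The previous equation is projected to \<open>\<int> \<otimes> X\<^sub>n\<close>, where \<open>e\<close> disappears.  The image of \<open>c\<close> is a cycle since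
  \<open>p\<^sup>N\<close> times its boundary vanishes and the group is torsion free.
\<close>

lemma cycles_divisible:
  assumes z: "z \<in> cycles HC HD n"
  shows "\<exists>w\<in>carrier (HC (Suc n)). \<exists>c\<in>cycles HC HD n.
    z [^]\<^bsub>HC n\<^esub> (p ^ n0) = HD (Suc n) w \<otimes>\<^bsub>HC n\<^esub> c [^]\<^bsub>HC n\<^esub> (p ^ N)"
proof -
  have zc: "z \<in> carrier (ZT n)"
    using subgroup.mem_carrier[OF HX.subgroup_cycles z] by (simp add: additive_tensor_simps)
  have zd: "DZ m z = \<zero>\<^bsub>ZT m\<^esub>" if "n = Suc m" for m
    using z that by (simp add: cycles_def kernel_def additive_tensor_simps)
  obtain u where u: "u \<in> carrier (X n)" "z = cl n u" using cl_exhaust[OF zc] by blast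
  have cyc: "cl m (DX m u) = \<zero>\<^bsub>ZT m\<^esub>" if "n = Suc m" for m
    using zd[OF that] DZ_cl[of u m] u that by simp
  obtain w e c where w: "w \<in> carrier (X (Suc n))" and e: "e \<in> carrier (X n)" and c: "c \<in> carrier (X n)"
    and eq: "[(p ^ n0)] \<cdot>\<^bsub>X n\<^esub> u = (DX n w \<oplus>\<^bsub>X n\<^esub> e) \<oplus>\<^bsub>X n\<^esub> [(p ^ N)] \<cdot>\<^bsub>X n\<^esub> c"
    and ce: "cl n e = \<zero>\<^bsub>ZT n\<^esub>"
    using cycle_multiple[OF u(1) cyc, of N] by blast
  have Dw: "DX n w \<in> carrier (X n)" by (rule DX'(2)[OF w])
  note ab = CR.P ZX.T.abelian_group_axioms
  have main: "[(p ^ n0)] \<cdot>\<^bsub>ZT n\<^esub> z = DZ n (cl (Suc n) w) \<oplus>\<^bsub>ZT n\<^esub> [(p ^ N)] \<cdot>\<^bsub>ZT n\<^esub> cl n c"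
    using arg_cong[OF eq, of "cl n"] u e c Dw w cl_closed[OF Dw]
    by (simp add: additive_nat_pow[OF ab additive_cl] additive_add[OF additive_cl] ce DZ_cl)
  have "cl n c \<in> cycles HC HD n"
  proof (cases n)
    case 0
    then show ?thesis using cl_closed[OF c] by (simp add: cycles_def additive_tensor_simps)
  next
    case (Suc m)
    have zn: "[(p ^ n0)] \<cdot>\<^bsub>ZT m\<^esub> DZ m z = \<zero>\<^bsub>ZT m\<^esub>" using zd[OF Suc] by simp
    have cm: "cl n c \<in> carrier (ZT (Suc m))" "DZ n (cl (Suc n) w) \<in> carrier (ZT (Suc m))" "z \<in> carrier (ZT (Suc m))"
      using cl_closed[OF c] cl_closed[OF Dw] DZ_cl[OF w] zc Suc by simp_all
    have "DZ m ([(p ^ n0)] \<cdot>\<^bsub>ZT n\<^esub> z) = DZ m (DZ n (cl (Suc n) w)) \<oplus>\<^bsub>ZT m\<^esub> [(p ^ N)] \<cdot>\<^bsub>ZT m\<^esub> DZ m (cl n c)"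
      unfolding main using cm Suc
      by (simp add: additive_add[OF DZ(1)] additive_nat_pow[OF ZX.T.abelian_group_axioms ZX.T.abelian_group_axioms DZ(1)])
    moreover have "DZ m (DZ n (cl (Suc n) w)) = \<zero>\<^bsub>ZT m\<^esub>"
      using map_right_DD[OF right_triv, of "cl (Suc n) w" m] cl_closed[OF w] Suc by simp
    moreover have "DZ m ([(p ^ n0)] \<cdot>\<^bsub>ZT n\<^esub> z) = \<zero>\<^bsub>ZT m\<^esub>"
      using additive_nat_pow[OF ZX.T.abelian_group_axioms ZX.T.abelian_group_axioms DZ(1) cm(3)] zn Suc by simp
    ultimately have "[(p ^ N)] \<cdot>\<^bsub>ZT m\<^esub> DZ m (cl n c) = \<zero>\<^bsub>ZT m\<^esub>"
      using additive_closed[OF DZ(1) cm(1)] by simp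
    then have "DZ m (cl n c) = \<zero>\<^bsub>ZT m\<^esub>" by (rule ZT_torsion_free[OF additive_closed[OF DZ(1) cm(1)]])
    then show ?thesis using cm(1) Suc by (simp add: cycles_def kernel_def additive_tensor_simps)
  qed
  moreover have "z [^]\<^bsub>HC n\<^esub> (p ^ n0) = HD (Suc n) (cl (Suc n) w) \<otimes>\<^bsub>HC n\<^esub> cl n c [^]\<^bsub>HC n\<^esub> (p ^ N)"
    using main by (simp add: additive_tensor_multiple additive_tensor_simps)
  moreover have "cl (Suc n) w \<in> carrier (HC (Suc n))" using cl_closed[OF w] by (simp add: additive_tensor_simps)
  ultimately show ?thesis by blast
qed

text \<open>
  In the coordinates of \<open>t\<close>, which are integers \<open>k\<^sub>j\<close>, one has \<open>t = \<Sum> k\<^sub>j (1 \<otimes> b\<^sub>j)\<close>.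
\<close>

lemma HC_generated: "carrier (HC n) \<subseteq> generate (HC n) ((\<lambda>j. cl n (b n j)) ` J n)"
proof
  fix t assume "t \<in> carrier (HC n)"
  then have t: "t \<in> carrier (ZT n)" by (simp add: additive_tensor_simps)
  interpret C: comm_group "HC n" by (rule HX.C)
  let ?S = "(\<lambda>j. cl n (b n j)) ` J n"
  let ?t = "\<lambda>j. pure_tensor \<R> triv (X n) (tensor_coordinate \<R> triv (X n) (\<phi> n j) t) (b n j)"
  note d = dual_basisD[OF db[of n]]
  have S: "?S \<subseteq> carrier (HC n)" using cl_closed[OF d(1)] by (auto simp: additive_tensor_simps)
  have sub: "subgroup (generate (HC n) ?S) (HC n)" by (rule C.generate_is_subgroup[OF S])
  have tj: "?t j \<in> carrier (ZT n)" if "j \<in> J n" for j by (rule ZX.tens_closed) (simp_all add: d(1)[OF that])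
  have gen: "?t j \<in> generate (HC n) ?S" if j: "j \<in> J n" for j
  proof -
    let ?k = "tensor_coordinate \<R> triv (X n) (\<phi> n j) t"
    have "?t j = [?k] \<cdot>\<^bsub>ZT n\<^esub> cl n (b n j)"
      using additive_int_pow[OF ZX.A.M.abelian_group_axioms ZX.T.abelian_group_axioms ZX.additive_tens_left[OF d(1)[OF j]], of 1 ?k]
      by (simp add: trivial_module_int_multiple)
    also have "\<dots> = cl n (b n j) [^]\<^bsub>HC n\<^esub> ?k" by (rule additive_tensor_int_multiple)
    finally show ?thesis
      using C.subgroup_int_pow_closed[OF sub, of "cl n (b n j)" ?k] generate.incl[of "cl n (b n j)" ?S] j by auto
  qed
  have "(\<Oplus>\<^bsub>ZT n\<^esub>j\<in>K. ?t j) \<in> generate (HC n) ?S" if "finite K" "K \<subseteq> J n" for K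
    using that
  proof (induction K rule: finite_induct)
    case empty
    then show ?case using subgroup.one_closed[OF sub] by (simp add: additive_tensor_simps)
  next
    case (insert j K)
    then have "(\<Oplus>\<^bsub>ZT n\<^esub>j\<in>insert j K. ?t j) = ?t j \<oplus>\<^bsub>ZT n\<^esub> (\<Oplus>\<^bsub>ZT n\<^esub>j\<in>K. ?t j)"
      using tj by (intro ZX.T.finsum_insert) auto
    then show ?case
      using subgroup.m_closed[OF sub gen[of j]] insert by (simp add: additive_tensor_simps)
  qed
  from this[OF finite_J subset_refl] show "t \<in> generate (HC n) ?S"
    using ZX.tensor_expand[OF finite_J db t] by simp
qed

theorem homology_finite:
  "finite (carrier (homology HC HD n))"
  "\<And>x i. x \<in> carrier (homology HC HD n) \<Longrightarrow> x [^]\<^bsub>homology HC HD n\<^esub> (p ^ i) = \<one>\<^bsub>homology HC HD n\<^esub>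
      \<Longrightarrow> x [^]\<^bsub>homology HC HD n\<^esub> (p ^ n0) = \<one>\<^bsub>homology HC HD n\<^esub>"
proof -
  have S: "finite ((\<lambda>j. cl n (b n j)) ` J n)" "(\<lambda>j. cl n (b n j)) ` J n \<subseteq> carrier (HC n)"
    using finite_J cl_closed[OF dual_basisD(1)[OF db]] by (auto simp: additive_tensor_simps)
  note hf = HX.homology_finite_of_divisible[OF prime_p S HC_generated cycles_divisible]
  show "finite (carrier (homology HC HD n))" by (rule hf(1))
  show "\<And>x i. x \<in> carrier (homology HC HD n) \<Longrightarrow> x [^]\<^bsub>homology HC HD n\<^esub> (p ^ i) = \<one>\<^bsub>homology HC HD n\<^esub>
      \<Longrightarrow> x [^]\<^bsub>homology HC HD n\<^esub> (p ^ n0) = \<one>\<^bsub>homology HC HD n\<^esub>" by (rule hf(2))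
qed

end

section \<open>Finite resolutions over a subgroup\<close>

lemma (in group_complex) homology_trivial:
  assumes "carrier (C n) = {\<one>\<^bsub>C n\<^esub>}"
  shows "carrier (homology C \<delta> n) = {\<one>\<^bsub>homology C \<delta> n\<^esub>}"
proof -
  interpret H: comm_group "homology C \<delta> n" by (rule comm_group_homology)
  have "x = \<one>\<^bsub>homology C \<delta> n\<^esub>" if x: "x \<in> carrier (homology C \<delta> n)" for x
  proof -
    obtain z where z: "z \<in> cycles C \<delta> n" "x = B n #>\<^bsub>Z n\<^esub> z" using homology_exhaust[OF x] .
    then have "z = \<one>\<^bsub>Z n\<^esub>" using subgroup.mem_carrier[OF subgroup_cycles] assms by auto
    then show ?thesis
      using hom_one[OF coset_hom[of n] comm_group.axioms(2)[OF comm_group_cycles] H.is_group] z(2) by simp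
  qed
  then show ?thesis using H.one_closed by blast
qed

lemma (in tensor_pair) tensor_trivial:
  assumes db: "dual_basis R B {} b \<phi>"
  shows "carrier (tensor R A B) = {\<one>\<^bsub>tensor R A B\<^esub>}"
proof -
  have "t = \<zero>\<^bsub>T\<^esub>" if "t \<in> carrier T" for t using tensor_expand[OF _ db that] by simp
  then have "carrier T = {\<zero>\<^bsub>T\<^esub>}" using T.zero_closed by blast
  then show ?thesis by (simp add: additive_tensor_simps)
qed

text \<open>
  An exact complex without end gives a finite exact sequence if it vanishes in degree \<open>d + 1\<close>: injectivity in
  degree \<open>d\<close> is exactness there.
\<close>

lemma (in projective_resolution) exact_sequence_tensor:
  fixes B :: "('r, 'b) module" and d :: nat
  assumes B: "right_module R B" and J: "J (Suc d) = {}"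
    and bottom: "\<And>t. t \<in> carrier (additive_tensor R B (X 0)) \<Longrightarrow>
      t \<in> map_right R B (X 0) (DX 0) ` carrier (additive_tensor R B (X (Suc 0)))"
    and high: "\<And>n t. t \<in> carrier (additive_tensor R B (X (Suc n))) \<Longrightarrow>
      map_right R B (X n) (DX n) t = \<zero>\<^bsub>additive_tensor R B (X n)\<^esub> \<Longrightarrow>
      t \<in> map_right R B (X (Suc n)) (DX (Suc n)) ` carrier (additive_tensor R B (X (Suc (Suc n))))"
  shows "exact_sequence d (\<lambda>n. tensor R B (X n)) (\<lambda>i. map_right R B (X (i - 1)) (DX (i - 1)))"
    (is "exact_sequence d ?C ?\<delta>")
proof -
  interpret C: group_complex ?C ?\<delta> by (rule group_complex_tensor[OF B])
  have cycles: "cycles ?C ?\<delta> n = C.B n" for n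
  proof
    show "cycles ?C ?\<delta> n \<subseteq> C.B n"
    proof (cases n)
      case 0
      then show ?thesis using bottom by (auto simp: cycles_def additive_tensor_simps)
    next
      case (Suc m)
      then show ?thesis using high[of _ m] by (auto simp: cycles_def kernel_def additive_tensor_simps)
    qed
  qed (rule subsetI, rule C.boundary_cycle)
  interpret D: comm_group "?C d" by (rule C.C)
  have "tensor_pair R B (X (Suc d))" by (rule tensor_pair_X[OF B])
  then have "carrier (?C (Suc d)) = {\<one>\<^bsub>?C (Suc d)\<^esub>}"
    by (rule tensor_pair.tensor_trivial) (use db[of "Suc d"] J in simp)
  moreover have "?\<delta> (Suc d) \<one>\<^bsub>?C (Suc d)\<^esub> = \<one>\<^bsub>?C d\<^esub>"
    by (rule hom_one[OF C.\<delta>]) (rule comm_group.axioms(2)[OF C.C])+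
  ultimately have top: "C.B d = {\<one>\<^bsub>?C d\<^esub>}" by simp
  have "?\<delta> i \<in> hom (?C i) (?C (i - 1))" if "i \<in> {1..d}" for i
    using C.\<delta>[of "i - 1"] that by simp
  then show ?thesis using cycles top unfolding exact_sequence_def by auto
qed

lemma exact_sequence_cong:
  assumes "\<And>i. i \<le> d \<Longrightarrow> C i = C' i" and "\<And>i. i \<in> {1..d} \<Longrightarrow> \<delta> i = \<delta>' i"
  shows "exact_sequence d C \<delta> \<longleftrightarrow> exact_sequence d C' \<delta>'"
proof -
  have "cycles C \<delta> i = cycles C' \<delta>' i" if "i \<le> d" for i
    using that assms(1)[of i] assms(1)[of "i - 1"] assms(2)[of i] by (cases i) (simp_all add: cycles_def)
  moreover have "\<delta> i \<in> hom (C i) (C (i - 1)) \<longleftrightarrow> \<delta>' i \<in> hom (C' i) (C' (i - 1))" if "i \<in> {1..d}" for i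
  proof -
    have "C (i - 1) = C' (i - 1)" by (rule assms(1)) (use that in auto)
    then show ?thesis using that assms(1)[of i] assms(2)[of i] by simp
  qed
  moreover have "(if i < d then \<delta> (Suc i) ` carrier (C (Suc i)) else {\<one>\<^bsub>C i\<^esub>})
      = (if i < d then \<delta>' (Suc i) ` carrier (C' (Suc i)) else {\<one>\<^bsub>C' i\<^esub>})" if "i \<le> d" for i
    using that assms(1)[of i] assms(1)[of "Suc i"] assms(2)[of "Suc i"] by (cases "i < d") auto
  ultimately show ?thesis unfolding exact_sequence_def by simp
qed

lemma finite_p_part_of_injection:
  assumes H: "group H" and K: "group K" and f: "f \<in> hom H K" and inj: "inj_on f (carrier H)"
    and fin: "finite (carrier K)"
    and p_part: "\<And>x i. x \<in> carrier K \<Longrightarrow> x [^]\<^bsub>K\<^esub> (p ^ i) = \<one>\<^bsub>K\<^esub> \<Longrightarrow> x [^]\<^bsub>K\<^esub> (p ^ n0) = \<one>\<^bsub>K\<^esub>"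
  shows "finite (carrier H)"
    and "\<And>x i. x \<in> carrier H \<Longrightarrow> x [^]\<^bsub>H\<^esub> ((p::nat) ^ i) = \<one>\<^bsub>H\<^esub> \<Longrightarrow> x [^]\<^bsub>H\<^esub> (p ^ n0) = \<one>\<^bsub>H\<^esub>"
proof -
  interpret f: group_hom H K f using H K f by (simp add: group_hom_def group_hom_axioms_def)
  show "finite (carrier H)" by (rule inj_on_finite[OF inj image_subsetI fin]) (rule f.hom_closed)
  fix x and i :: nat
  assume x: "x \<in> carrier H" and xp: "x [^]\<^bsub>H\<^esub> (p ^ i) = \<one>\<^bsub>H\<^esub>"
  have "f x [^]\<^bsub>K\<^esub> (p ^ i) = f (x [^]\<^bsub>H\<^esub> (p ^ i))" using x by (simp add: f.hom_nat_pow)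
  then have "f x [^]\<^bsub>K\<^esub> (p ^ n0) = \<one>\<^bsub>K\<^esub>" using p_part[OF f.hom_closed[OF x]] xp by simp
  then have "f (x [^]\<^bsub>H\<^esub> (p ^ n0)) = f \<one>\<^bsub>H\<^esub>" using x by (simp add: f.hom_nat_pow)
  then show "x [^]\<^bsub>H\<^esub> (p ^ n0) = \<one>\<^bsub>H\<^esub>" using inj_onD[OF inj] x by blast
qed

definition zero_module :: "('r, 'a) module"
  where "zero_module = module_of {undefined} (\<lambda>_ _. undefined) undefined (\<lambda>_ _. undefined)"

lemma zero_module_simps [simp]:
  defines "Z \<equiv> zero_module :: ('r, 'a) module"
  shows "carrier Z = {\<zero>\<^bsub>Z\<^esub>}" "x \<oplus>\<^bsub>Z\<^esub> y = \<zero>\<^bsub>Z\<^esub>" "r \<odot>\<^bsub>Z\<^esub> x = \<zero>\<^bsub>Z\<^esub>"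
  by (simp_all add: Z_def zero_module_def module_of_simps)

lemma left_module_zero_module:
  assumes "ring R"
  shows "left_module R (zero_module :: ('r, 'a) module)"
proof -
  have "abelian_group (zero_module :: ('r, 'a) module)" by (rule abelian_groupI) simp_all
  then show ?thesis using assms by (simp add: left_module_def left_module_axioms_def)
qed

lemma dual_basis_zero_module:
  assumes "ring R"
  shows "dual_basis R (zero_module :: ('r, 'a) module) {} b \<phi>"
proof -
  interpret left_module R "zero_module :: ('r, 'a) module" by (rule left_module_zero_module[OF assms])
  show ?thesis by (simp add: dual_basis_def)
qed

text \<open>
  A resolution of length \<open>d\<close> is continued by zero modules.  The boundary map is indexed by the degree of its target, in
  contrast to \<open>\<delta>\<close>, which is indexed by the degree of its source.
\<close>

context
  fixes d :: nat and P :: "nat \<Rightarrow> ('r, 'a) module" and \<delta> :: "nat \<Rightarrow> 'a \<Rightarrow> 'a"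
begin

definition extended_module :: "nat \<Rightarrow> ('r, 'a) module"
  where "extended_module n = (if n \<le> d then P n else zero_module)"

definition extended_boundary :: "nat \<Rightarrow> 'a \<Rightarrow> 'a"
  where "extended_boundary n = (if Suc n \<le> d then \<delta> (Suc n) else (\<lambda>_. \<zero>\<^bsub>extended_module n\<^esub>))"

lemma projective_resolution_extended:
  assumes R: "ring R" and res: "finite_resolution R d P \<delta> \<epsilon> M"
    and db: "\<And>n. n \<le> d \<Longrightarrow> dual_basis R (P n) (J n) (b n) (\<phi> n)" and J: "\<And>n. n > d \<Longrightarrow> J n = {}"
  shows "projective_resolution R extended_module extended_boundary M \<epsilon> J b \<phi>"
proof -
  note X_def = extended_module_def and DX_def = extended_boundary_def
  have M: "left_module R M" and P: "\<And>i. i \<le> d \<Longrightarrow> left_module R (P i)"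
    and \<epsilon>: "\<epsilon> \<in> module_homs R (P 0) M" "\<epsilon> ` carrier (P 0) = carrier M"
    and \<delta>': "\<forall>i\<in>{1..d}. \<delta> i \<in> module_homs R (P i) (P (i - 1))"
    using res unfolding finite_resolution_def by simp_all
  have \<delta>: "\<delta> (Suc i) \<in> module_homs R (P (Suc i)) (P i)" if "Suc i \<le> d" for i
    using bspec[OF \<delta>', of "Suc i"] that by simp
  have ker: "{x \<in> carrier (P i). if i = 0 then \<epsilon> x = \<zero>\<^bsub>M\<^esub> else \<delta> i x = \<zero>\<^bsub>P (i - 1)\<^esub>}
      = (if i < d then \<delta> (Suc i) ` carrier (P (Suc i)) else {\<zero>\<^bsub>P i\<^esub>})" if "i \<le> d" for i
    using res that unfolding finite_resolution_def by blast
  have X: "left_module R (extended_module n)" for n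
    unfolding X_def by (cases "n \<le> d") (simp_all add: P left_module_zero_module[OF R])
  have ab: "abelian_group (extended_module n)" for n using X[of n] by (simp add: left_module_def)
  have zero: "\<zero>\<^bsub>extended_module n\<^esub> \<in> carrier (extended_module n)" for n
    using abelian_group.axioms(1)[OF ab] by (rule abelian_monoid.zero_closed)
  have image: "extended_boundary n ` carrier (extended_module (Suc n))
      = (if n < d then \<delta> (Suc n) ` carrier (P (Suc n)) else {\<zero>\<^bsub>extended_module n\<^esub>})" for n
    by (auto simp: X_def DX_def)
  have X_0: "extended_module 0 = P 0" by (simp add: X_def)
  have ker0: "{x \<in> carrier (extended_module 0). \<epsilon> x = \<zero>\<^bsub>M\<^esub>} = extended_boundary 0 ` carrier (extended_module (Suc 0))"
    unfolding image X_0 using ker[of 0] by simp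
  have kerS: "{x \<in> carrier (extended_module (Suc n)). extended_boundary n x = \<zero>\<^bsub>extended_module n\<^esub>}
      = extended_boundary (Suc n) ` carrier (extended_module (Suc (Suc n)))" for n
  proof (cases "Suc n \<le> d")
    case True
    then show ?thesis unfolding image using ker[OF True] by (simp add: X_def DX_def)
  next
    case False
    then have "extended_module (Suc n) = zero_module" "extended_boundary n = (\<lambda>_. \<zero>\<^bsub>extended_module n\<^esub>)"
      by (simp_all add: X_def DX_def)
    then show ?thesis unfolding image using False by simp
  qed
  have DX: "extended_boundary n \<in> module_homs R (extended_module (Suc n)) (extended_module n)" for n
  proof (cases "Suc n \<le> d")
    case True
    then show ?thesis using \<delta>[OF True] by (simp add: X_def DX_def)
  next
    case False
    interpret left_module R "extended_module n" by (rule X)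
    have "r \<odot>\<^bsub>extended_module n\<^esub> \<zero>\<^bsub>extended_module n\<^esub> = \<zero>\<^bsub>extended_module n\<^esub>" if "r \<in> carrier R" for r
    proof -
      have "r \<odot>\<^bsub>extended_module n\<^esub> \<zero>\<^bsub>extended_module n\<^esub> \<oplus>\<^bsub>extended_module n\<^esub> r \<odot>\<^bsub>extended_module n\<^esub> \<zero>\<^bsub>extended_module n\<^esub>
          = r \<odot>\<^bsub>extended_module n\<^esub> \<zero>\<^bsub>extended_module n\<^esub>"
        using smult_r_distr[OF that M.zero_closed M.zero_closed] by simp
      then show ?thesis using smult_closed[OF that M.zero_closed] M.add.r_cancel_one' by metis
    qed
    then show ?thesis using False by (simp add: module_homs_def DX_def)
  qed
  show ?thesis
  proof (intro projective_resolution.intro module_complex.intro module_complex_axioms.intro projective_resolution_axioms.intro)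
    show "dual_basis R (extended_module n) (J n) (b n) (\<phi> n)" for n
      using db[of n] J[of n] by (cases "n \<le> d") (simp_all add: X_def dual_basis_zero_module[OF R])
    show "\<epsilon> \<in> module_homs R (extended_module 0) M" using \<epsilon>(1) by (simp add: X_def)
    show "x \<in> \<epsilon> ` carrier (extended_module 0)" if "x \<in> carrier M" for x
      using \<epsilon>(2) that by (simp add: X_def)
  qed (use X DX R M ker0 kerS in blast)+
qed

lemma exact_sequence_extended:
  "exact_sequence d (\<lambda>n. tensor R B (extended_module n)) (\<lambda>i. map_right R B (extended_module (i - 1)) (extended_boundary (i - 1)))
    \<longleftrightarrow> exact_sequence d (\<lambda>i. tensor R B (P i)) (\<lambda>i. map_right R B (P (i - 1)) (\<delta> i))"
  by (rule exact_sequence_cong) (auto simp: extended_module_def extended_boundary_def)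

end

lemma dual_bases_restrict:
  fixes G :: "('g, 'x) monoid_scheme" and P :: "nat \<Rightarrow> ('g \<Rightarrow>\<^sub>0 int, 'a) module"
  assumes G: "group G" and D: "subgroup D G" and fin: "finite (rcosets\<^bsub>G\<^esub> D)"
    and P: "\<And>i. i \<le> d \<Longrightarrow> left_module (group_ring G) (P i)"
    and proj: "\<And>i. i \<le> d \<Longrightarrow> finitely_generated (group_ring G) (P i) \<and> projective (group_ring G) (P i)"
  shows "\<exists>(J :: nat \<Rightarrow> ('a \<times> 'g) set) b \<phi>. \<forall>i. finite (J i) \<and>
    (i \<le> d \<longrightarrow> dual_basis (group_ring (G\<lparr>carrier := D\<rparr>)) (P i) (J i) (b i) (\<phi> i)) \<and> (i > d \<longrightarrow> J i = {})"
proof -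
  have "\<exists>q :: ('a \<times> 'g) set \<times> ('a \<times> 'g \<Rightarrow> 'a) \<times> ('a \<times> 'g \<Rightarrow> 'a \<Rightarrow> 'g \<Rightarrow>\<^sub>0 int). finite (fst q) \<and>
    (i \<le> d \<longrightarrow> dual_basis (group_ring (G\<lparr>carrier := D\<rparr>)) (P i) (fst q) (fst (snd q)) (snd (snd q))) \<and> (i > d \<longrightarrow> fst q = {})" for i
  proof (cases "i \<le> d")
    case True
    obtain J :: "'a set" and b \<phi> where J: "finite J" "dual_basis (group_ring G) (P i) J b \<phi>"
      using fg_projective_dual_basis[OF P[OF True]] proj[OF True] by blast
    obtain J' :: "('a \<times> 'g) set" and b' \<phi>' where "finite J'" "dual_basis (group_ring (G\<lparr>carrier := D\<rparr>)) (P i) J' b' \<phi>'"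
      using dual_basis_restrict[OF G D fin P[OF True] J] by blast
    then show ?thesis using True by (intro exI[of _ "(J', b', \<phi>')"]) simp
  next
    case False
    then show ?thesis by (intro exI[of _ "({}, undefined)"]) simp
  qed
  then obtain q where q: "\<And>i. finite (fst (q i)) \<and>
    (i \<le> d \<longrightarrow> dual_basis (group_ring (G\<lparr>carrier := D\<rparr>)) (P i) (fst (q i)) (fst (snd (q i))) (snd (snd (q i)))) \<and>
    (i > d \<longrightarrow> fst (q i) = ({} :: ('a \<times> 'g) set))" by metis
  show ?thesis
    using q by (intro exI[of _ "\<lambda>i. fst (q i)"] exI[of _ "\<lambda>i. fst (snd (q i))"] exI[of _ "\<lambda>i. snd (snd (q i))"]) blast
qed

lemma finite_resolution_restrict:
  assumes G: "group G" and D: "subgroup D G" and res: "finite_resolution (group_ring G) d P \<delta> \<epsilon> M"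
  shows "finite_resolution (group_ring (G\<lparr>carrier := D\<rparr>)) d P \<delta> \<epsilon> M"
  unfolding finite_resolution_def
proof (intro conjI)
  note res' = res[unfolded finite_resolution_def]
  show "left_module (group_ring (G\<lparr>carrier := D\<rparr>)) M"
    by (rule left_module_restrict[OF G D res'[THEN conjunct1]])
  show "\<forall>i\<le>d. left_module (group_ring (G\<lparr>carrier := D\<rparr>)) (P i)"
    using res'[THEN conjunct2, THEN conjunct1] left_module_restrict[OF G D] by blast
  show "\<epsilon> \<in> module_homs (group_ring (G\<lparr>carrier := D\<rparr>)) (P 0) M"
    by (rule module_homs_restrict[OF D res'[THEN conjunct2, THEN conjunct2, THEN conjunct1]])
  show "\<forall>i\<in>{1..d}. \<delta> i \<in> module_homs (group_ring (G\<lparr>carrier := D\<rparr>)) (P i) (P (i - 1))"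
    using res'[THEN conjunct2, THEN conjunct2, THEN conjunct2, THEN conjunct1] module_homs_restrict[OF D] by blast
qed (rule res[unfolded finite_resolution_def, THEN conjunct2, THEN conjunct2, THEN conjunct2, THEN conjunct2, THEN conjunct1]
    res[unfolded finite_resolution_def, THEN conjunct2, THEN conjunct2, THEN conjunct2, THEN conjunct2, THEN conjunct2])+

section \<open>Homology and exactness for expansive modules\<close>

context expansive_resolution
begin

text \<open>
  All properties are read off from the complex \<open>\<int> \<otimes> X\<close>, into whose homology the group homology embeds.
\<close>

lemma group_homology_finite:
  shows "comm_group (group_homology G M i)"
    and "finite (carrier (group_homology G M i))"
    and "\<And>x k. x \<in> carrier (group_homology G M i) \<Longrightarrow> x [^]\<^bsub>group_homology G M i\<^esub> (p ^ k) = \<one>\<^bsub>group_homology G M i\<^esub>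
      \<Longrightarrow> x [^]\<^bsub>group_homology G M i\<^esub> (p ^ n0) = \<one>\<^bsub>group_homology G M i\<^esub>"
    and "J i = {} \<Longrightarrow> carrier (group_homology G M i) = {\<one>\<^bsub>group_homology G M i\<^esub>}"
proof -
  let ?H = "group_homology G M i"
  interpret S: syzygies \<R> M using M.left_module_axioms by (simp add: syzygies_def)
  have "group_complex (\<lambda>n. tensor \<R> triv (S.SF n)) (\<lambda>i. map_right \<R> triv (S.SF (i - 1)) S.bd)"
    using module_complex.group_complex_tensor[OF S.module_complex_SF right_triv] .
  then show comm: "comm_group ?H"
    unfolding group_homology_def Tor_def by (rule group_complex.comm_group_homology)
  obtain f where f: "f \<in> hom ?H (homology HC HD i)" "inj_on f (carrier ?H)"
    using Tor_injection[OF right_triv, of i] unfolding group_homology_def by blast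
  note groups = comm_group.axioms(2)[OF comm] comm_group.axioms(2)[OF HX.comm_group_homology]
  show "finite (carrier ?H)"
    by (rule finite_p_part_of_injection(1)[OF groups f homology_finite])
  show "\<And>x k. x \<in> carrier ?H \<Longrightarrow> x [^]\<^bsub>?H\<^esub> (p ^ k) = \<one>\<^bsub>?H\<^esub> \<Longrightarrow> x [^]\<^bsub>?H\<^esub> (p ^ n0) = \<one>\<^bsub>?H\<^esub>"
    by (rule finite_p_part_of_injection(2)[OF groups f homology_finite])
  interpret H: comm_group ?H by (rule comm)
  show "carrier ?H = {\<one>\<^bsub>?H\<^esub>}" if J: "J i = {}"
  proof -
    have "carrier (HC i) = {\<one>\<^bsub>HC i\<^esub>}" by (rule ZX.tensor_trivial) (use db[of i] J in simp)
    then have triv: "carrier (homology HC HD i) = {\<one>\<^bsub>homology HC HD i\<^esub>}" by (rule HX.homology_trivial)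
    have "x = \<one>\<^bsub>?H\<^esub>" if x: "x \<in> carrier ?H" for x
      using hom_in_carrier[OF f(1) x] hom_in_carrier[OF f(1) H.one_closed] triv inj_onD[OF f(2) _ x H.one_closed] by simp
    then show ?thesis using H.one_closed by blast
  qed
qed

lemma exact_sequence_completion:
  assumes "n0 = 0" "J (Suc d) = {}"
  shows "exact_sequence d (\<lambda>n. tensor \<R> (completion_module p \<R>) (X n))
    (\<lambda>i. map_right \<R> (completion_module p \<R>) (X (i - 1)) (DX (i - 1)))"
proof (rule exact_sequence_tensor[OF PR.right_module_CM assms(2) _ exact_T])
  show "t \<in> DT 0 ` carrier (T (Suc 0))" if "t \<in> carrier (T 0)" for t
    using bottom_T[OF that] that assms(1) by (simp add: add_pow_def nat_pow_def)
qed

lemma exact_sequence_c0: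
  assumes "J (Suc d) = {}"
  shows "exact_sequence d (\<lambda>n. tensor \<R> (c0_module p G) (X n))
    (\<lambda>i. map_right \<R> (c0_module p G) (X (i - 1)) (DX (i - 1)))"
proof -
  have "PR.C0 = c0_module p G" by (simp add: PR.C0_def c0_module_def Let_def)
  then show ?thesis
    using exact_sequence_tensor[OF PR.right_module_C0 assms bottom_C exact_C] by simp
qed

end

theorem theorem3p1:
  fixes p n0 d :: nat
    and G :: "('g, 'x) monoid_scheme"
    and D :: "'g set"
    and \<Delta> :: "('g, 'x) monoid_scheme"
    and M :: "('g \<Rightarrow>\<^sub>0 int, 'm) module"
    and P :: "nat \<Rightarrow> ('g \<Rightarrow>\<^sub>0 int, 'a) module"
    and \<delta> :: "nat \<Rightarrow> 'a \<Rightarrow> 'a"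
    and \<epsilon> :: "'a \<Rightarrow> 'm"
  assumes "Factorial_Ring.prime p"
    and "group G"
    and "D \<lhd> G"
    and "\<Delta> = G\<lparr>carrier := D\<rparr>"
    and "finite (rcosets\<^bsub>G\<^esub> D)"
    and "padically_expansive_of_exponent p G M n0"
    and "finite_resolution (group_ring G) d P \<delta> \<epsilon> M"
    and "\<And>i. i \<le> d \<Longrightarrow> finitely_generated (group_ring G) (P i) \<and> projective (group_ring G) (P i)"
    and "inverse_limit (\<lambda>i. torsion M (p ^ i)) (\<lambda>i x. [p] \<cdot>\<^bsub>M\<^esub> x) = {\<lambda>i. \<zero>\<^bsub>M\<^esub>}"
  shows "(\<forall>i. comm_group (group_homology \<Delta> M i) \<and> finite (carrier (group_homology \<Delta> M i)) \<and>
            (\<forall>x\<in>carrier (group_homology \<Delta> M i).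
               (\<exists>k. x [^]\<^bsub>group_homology \<Delta> M i\<^esub> (p ^ k) = \<one>\<^bsub>group_homology \<Delta> M i\<^esub>) \<longrightarrow>
               x [^]\<^bsub>group_homology \<Delta> M i\<^esub> (p ^ n0) = \<one>\<^bsub>group_homology \<Delta> M i\<^esub>)) \<and>
         (\<forall>i>d. carrier (group_homology \<Delta> M i) = {\<one>\<^bsub>group_homology \<Delta> M i\<^esub>}) \<and>
         exact_sequence d
           (\<lambda>i. tensor (group_ring \<Delta>) (c0_module p \<Delta>) (P i))
           (\<lambda>i. tensor_map (group_ring \<Delta>) (c0_module p \<Delta>) (P (i - 1)) id (\<delta> i)) \<and>
         (n0 = 0 \<longrightarrow>
           exact_sequence d
             (\<lambda>i. tensor (group_ring \<Delta>) (completion_module p (group_ring \<Delta>)) (P i))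
             (\<lambda>i. tensor_map (group_ring \<Delta>) (completion_module p (group_ring \<Delta>)) (P (i - 1))
                    id (\<delta> i)))"
proof -
  note G = assms(2) and \<Delta> = assms(4) and expansive = assms(6)[unfolded padically_expansive_of_exponent_def]
  have D: "subgroup D G" using assms(3) by (rule normal_imp_subgroup)
  have group_\<Delta>: "group \<Delta>" unfolding \<Delta> by (rule group.subgroup_imp_group[OF G D])
  have P: "left_module (group_ring G) (P i)" if "i \<le> d" for i
    using assms(7) that unfolding finite_resolution_def by blast
  have res: "finite_resolution (group_ring \<Delta>) d P \<delta> \<epsilon> M"
    unfolding \<Delta> by (rule finite_resolution_restrict[OF G D assms(7)])
  have "\<exists>(J :: nat \<Rightarrow> ('a \<times> 'g) set) b \<phi>. \<forall>i. finite (J i) \<and>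
      (i \<le> d \<longrightarrow> dual_basis (group_ring \<Delta>) (P i) (J i) (b i) (\<phi> i)) \<and> (i > d \<longrightarrow> J i = {})"
    unfolding \<Delta> by (rule dual_bases_restrict[OF G D assms(5) P assms(8)]) assumption+
  then obtain J :: "nat \<Rightarrow> ('a \<times> 'g) set" and b \<phi> where "\<forall>i. finite (J i) \<and>
      (i \<le> d \<longrightarrow> dual_basis (group_ring \<Delta>) (P i) (J i) (b i) (\<phi> i)) \<and> (i > d \<longrightarrow> J i = {})"
    by (elim exE) (rule that)
  then have J: "finite (J i)" "i \<le> d \<Longrightarrow> dual_basis (group_ring \<Delta>) (P i) (J i) (b i) (\<phi> i)" "i > d \<Longrightarrow> J i = {}" for i
    by simp_all
  have resolution: "projective_resolution (group_ring \<Delta>) (extended_module d P) (extended_boundary d P \<delta>) M \<epsilon> J b \<phi>"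
    by (rule projective_resolution_extended[OF ring_group_ring[OF group_\<Delta>] res J(2,3)])
  have exponent: "\<exists>y\<in>carrier M. [(p ^ n0)] \<cdot>\<^bsub>M\<^esub> x = [(p ^ Suc n0)] \<cdot>\<^bsub>M\<^esub> y" if x: "x \<in> carrier M" for x
  proof -
    have "multiples M (p ^ Suc n0) = multiples M (p ^ n0)" using expansive le_SucI[OF order_refl] by blast
    moreover have "[(p ^ n0)] \<cdot>\<^bsub>M\<^esub> x \<in> multiples M (p ^ n0)" using x unfolding multiples_def by (rule imageI)
    ultimately have "[(p ^ n0)] \<cdot>\<^bsub>M\<^esub> x \<in> multiples M (p ^ Suc n0)" by (simp only:)
    then show ?thesis unfolding multiples_def by blast
  qed
  have limit: "m 1 = \<zero>\<^bsub>M\<^esub>" if m: "\<And>k. m k \<in> carrier M" "\<And>k. [(p ^ k)] \<cdot>\<^bsub>M\<^esub> m k = \<zero>\<^bsub>M\<^esub>"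
    "\<And>k. [p] \<cdot>\<^bsub>M\<^esub> m (Suc k) = m k" for m
  proof -
    have "m \<in> inverse_limit (\<lambda>i. torsion M (p ^ i)) (\<lambda>i x. [p] \<cdot>\<^bsub>M\<^esub> x)"
      using m by (simp add: inverse_limit_def torsion_def)
    then show ?thesis using assms(9) by simp
  qed
  interpret E: expansive_resolution \<Delta> "extended_module d P" "extended_boundary d P \<delta>" M \<epsilon> J b \<phi> p n0
    using resolution group_\<Delta> assms(1) J(1) exponent limit
    by (simp add: expansive_resolution_def expansive_resolution_axioms_def)
  note homology = E.group_homology_finite
  have c0: "exact_sequence d (\<lambda>i. tensor (group_ring \<Delta>) (c0_module p \<Delta>) (P i))
      (\<lambda>i. tensor_map (group_ring \<Delta>) (c0_module p \<Delta>) (P (i - 1)) id (\<delta> i))"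
    by (rule exact_sequence_extended[THEN iffD1]) (rule E.exact_sequence_c0, simp add: J(3))
  have completed: "exact_sequence d (\<lambda>i. tensor (group_ring \<Delta>) (completion_module p (group_ring \<Delta>)) (P i))
      (\<lambda>i. tensor_map (group_ring \<Delta>) (completion_module p (group_ring \<Delta>)) (P (i - 1)) id (\<delta> i))" if "n0 = 0"
    by (rule exact_sequence_extended[THEN iffD1]) (rule E.exact_sequence_completion[OF that], simp add: J(3))
  show ?thesis
    using homology c0 completed J(3) by blast
qed

end
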